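(* Let $p\in(2,6)$, $\beta=\frac{p-2}{6-p}$, and $N\ge 3$ an integer. For $\ell>0$ let $\mathcal{G}_\ell$ be the metric graph made up of $N$ half-lines and one terminal edge of length $\ell$, all emanating from the same vertex $v$. Then there exists $C^*>0$, depending only on $N$ and $p$, such that for every $\mu>0$ and $\ell>0$: $$\inf_{w\in H^1_\mu(\mathcal{G}_\ell)}E(w,\mathcal{G}_\ell)\ \text{is attained}\iff \mu^\beta\ell\ge C^*.$$
   Context: A metric graph is a connected graph with finitely many edges, each identified with a bounded interval $[0,\ell_e]$ or a half-line $[0,+\infty)$, glued at vertices, with the shortest-path distance. $H^1(\mathcal{G})$ consists of real continuous functions on $\mathcal{G}$ which are $H^1$ on each edge with finite $H^1$ norm. $E(u,\mathcal{G})=\frac12\int_{\mathcal{G}}|u'|^2dx-\frac1p\int_{\mathcal{G}}|u|^pdx$, $H^1_\mu(\mathcal{G})=\{u\in H^1(\mathcal{G}):\|u\|^2_{L^2(\mathcal{G})}=\mu\}$. A terminal edge is a bounded edge one of whose endpoints has degree one. *)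

theory Defs
  imports "HOL-Analysis.Analysis"
begin

definition weak_deriv_on :: "real set \<Rightarrow> (real \<Rightarrow> real) \<Rightarrow> (real \<Rightarrow> real) \<Rightarrow> bool" where
  "weak_deriv_on I u g \<longleftrightarrow> g \<in> borel_measurable lborel \<and>
     (\<forall>x\<in>I. \<forall>y\<in>I. x \<le> y \<longrightarrow>
        set_integrable lborel {x..y} g \<and> u y - u x = (LINT t:{x..y}|lborel. g t))"

definition H1_on :: "real set \<Rightarrow> (real \<Rightarrow> real) \<Rightarrow> bool" where
  "H1_on I u \<longleftrightarrow> continuous_on I u \<and> set_integrable lborel I (\<lambda>x. (u x)^2) \<and>
     (\<exists>g. weak_deriv_on I u g \<and> set_integrable lborel I (\<lambda>x. (g x)^2))"

text \<open>The chosen weak derivative (unique a.e., so integrals of it are well defined).\<close>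
definition wderiv :: "real set \<Rightarrow> (real \<Rightarrow> real) \<Rightarrow> real \<Rightarrow> real" where
  "wderiv I u = (SOME g. weak_deriv_on I u g \<and> set_integrable lborel I (\<lambda>x. (g x)^2))"

text \<open>Star graph G_l: edges 0..N-1 are half-lines [0,\<infinity>), edge N is the terminal edge [0,l];
  all edges are attached at the common vertex v, which is the point 0 on every edge.
  A function on the graph is u :: nat \<Rightarrow> real \<Rightarrow> real, u i being its restriction to edge i.\<close>
definition edge_dom :: "nat \<Rightarrow> real \<Rightarrow> nat \<Rightarrow> real set" where
  "edge_dom N l i = (if i < N then {0..} else {0..l})"

definition H1_graph :: "nat \<Rightarrow> real \<Rightarrow> (nat \<Rightarrow> real \<Rightarrow> real) \<Rightarrow> bool" where
  "H1_graph N l u \<longleftrightarrow> (\<forall>i\<le>N. H1_on (edge_dom N l i) (u i)) \<and> (\<forall>i\<le>N. u i 0 = u 0 0)"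

definition mass :: "nat \<Rightarrow> real \<Rightarrow> (nat \<Rightarrow> real \<Rightarrow> real) \<Rightarrow> real" where
  "mass N l u = (\<Sum>i\<le>N. LINT x:edge_dom N l i|lborel. (u i x)^2)"

definition H1_mass :: "nat \<Rightarrow> real \<Rightarrow> real \<Rightarrow> (nat \<Rightarrow> real \<Rightarrow> real) set" where
  "H1_mass N l \<mu> = {u. H1_graph N l u \<and> mass N l u = \<mu>}"

definition energy :: "real \<Rightarrow> nat \<Rightarrow> real \<Rightarrow> (nat \<Rightarrow> real \<Rightarrow> real) \<Rightarrow> real" where
  "energy p N l u =
     1/2 * (\<Sum>i\<le>N. LINT x:edge_dom N l i|lborel. (wderiv (edge_dom N l i) (u i) x)^2)
   - 1/p * (\<Sum>i\<le>N. LINT x:edge_dom N l i|lborel. \<bar>u i x\<bar> powr p)"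

end

(* Among functions of given mass on a half-line or a line, the soliton level ee is sharp by calibration: with
   c the multiplier of the soliton, |u'| sqrt(2 W(u)) <= u'^2 / 2 + W(u) for W(s) = c s^2 - s^p / p, so a function
   whose levels are all covered twice costs at least a full soliton. On N >= 3 half-lines every level below the
   vertex value is covered three times, and a competitor of energy at most ee must take its maximum on the
   terminal edge. Hence the infimum is attained iff some competitor of unit mass has energy at most ee: below ee,
   minimising sequences lose no mass along the half-lines. This condition fails for short edges, holds for long
   ones, and is closed in the length. It also persists when the edge is lengthened slightly: a piece of length
   delta is inserted either as a plateau at the maximum or, near the vertex, as a steep ramp replacing N >= 3
   short pieces of the half-lines, and the first order effect on E + c * mass is negative. Scaling reduces
   arbitrary mass to mass one. *)
theory Submission
  imports Defs "HOL-Real_Asymp.Real_Asymp" "HOL-Complex_Analysis.Great_Picard"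
begin

text \<open>The obstacle is the dependence on the length: two lengths are never compared directly,
  so persistence is read off at a minimiser, to first order only, and becomes global by combination
  with closedness. Surgery does not keep the mass fixed. The mass is repaired by changing the
  amplitude, and the price is the product of the change of mass with the Nehari functional
  \<open>ne\<close>. The constant \<open>c\<close> in the action is therefore chosen to make
  \<open>ne\<close> vanish at the minimiser: the repair is then of second order, and no
  Euler-Lagrange equation has to be derived. The same device hides the mass of the solitons. The
  level \<open>ee\<close> is an infimum over the heights \<open>M\<close> of \<open>f0 M\<close>:
  calibration gives the bound from below at each height, and a soliton of height \<open>M\<close>,
  on which \<open>ne\<close> vanishes, has energy at most \<open>f0 M\<close> once brought to mass
  one. So neither its mass nor the best height is computed. All functionals involved are linear in
  three integrals, hence competitors are handled through these triples. Weak compactness in L2 is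
  replaced by averaging: midpoints of nearly minimal norm converge strongly and give the limit its
  weak derivative.\<close>

section \<open>Set integrals on the line\<close>

lemma set_integral_split_at:
  fixes f :: "real \<Rightarrow> real"
  assumes "set_integrable lborel (A \<union> B) f"
    "A \<in> sets borel" "B \<in> sets borel" "A \<subseteq> {..b}" "B \<subseteq> {b..}"
  shows "(LINT x:A \<union> B|lborel. f x) = (LINT x:A|lborel. f x) + (LINT x:B|lborel. f x)"
proof (rule set_integral_Un_AE)
  show "AE x in lborel. \<not> (x \<in> A \<and> x \<in> B)"
    using AE_lborel_singleton[of b] by eventually_elim (use assms in force)
  show "set_integrable lborel A f" "set_integrable lborel B f"
    using assms by (auto intro: set_integrable_subset[OF assms(1)])
qed (use assms in auto)

lemma set_integral_Icc_split:
  fixes f :: "real \<Rightarrow> real"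
  assumes "a \<le> b" "b \<le> c" "set_integrable lborel {a..c} f"
  shows "(LINT x:{a..c}|lborel. f x) = (LINT x:{a..b}|lborel. f x) + (LINT x:{b..c}|lborel. f x)"
proof -
  have "{a..c} = {a..b} \<union> {b..c}" using assms by auto
  then show ?thesis using set_integral_split_at[of "{a..b}" "{b..c}" f b] assms by auto
qed

lemma set_integral_Ici_split:
  fixes f :: "real \<Rightarrow> real"
  assumes "a \<le> b" "set_integrable lborel {a..} f"
  shows "(LINT x:{a..}|lborel. f x) = (LINT x:{a..b}|lborel. f x) + (LINT x:{b..}|lborel. f x)"
proof -
  have "{a..} = {a..b} \<union> {b..}" using assms by auto
  then show ?thesis using set_integral_split_at[of "{a..b}" "{b..}" f b] assms by auto
qed

lemma set_integral_point [simp]: "(LINT x:{a}|lborel. f x) = (0::real)" for a :: real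
  unfolding set_lebesgue_integral_def
  by (rule integral_eq_zero_AE, use AE_lborel_singleton[of a] in eventually_elim) auto

lemma set_integrable_sq_bound:
  fixes f g :: "real \<Rightarrow> real"
  assumes "set_integrable M A (\<lambda>x. f x ^ 2)" "set_integrable M A (\<lambda>x. g x ^ 2)"
    "set_borel_measurable M A (\<lambda>x. f x * g x)"
  shows "set_integrable M A (\<lambda>x. f x * g x)"
proof (rule set_integrable_bound)
  show "set_integrable M A (\<lambda>x. f x ^ 2 + g x ^ 2)" using assms by (intro set_integral_add)
  have "\<bar>f x * g x\<bar> \<le> f x ^ 2 + g x ^ 2" for x
    using sum_squares_bound[of "\<bar>f x\<bar>" "\<bar>g x\<bar>"] abs_ge_zero[of "f x * g x"]
    unfolding abs_mult power2_abs by linarith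
  then show "AE x in M. x \<in> A \<longrightarrow> norm (f x * g x) \<le> norm (f x ^ 2 + g x ^ 2)"
    by (intro AE_I2) auto
qed (use assms in auto)

lemma set_integral_nonneg_real:
  fixes f :: "'a \<Rightarrow> real"
  assumes "\<And>x. x \<in> A \<Longrightarrow> 0 \<le> f x"
  shows "0 \<le> (LINT x:A|M. f x)"
  unfolding set_lebesgue_integral_def by (rule integral_nonneg_AE) (auto simp: assms indicator_def)

lemma set_integral_subset_mono:
  fixes f :: "'a \<Rightarrow> real"
  assumes "set_integrable M B f" "A \<in> sets M" "A \<subseteq> B" "\<And>x. x \<in> B \<Longrightarrow> 0 \<le> f x"
  shows "(LINT x:A|M. f x) \<le> (LINT x:B|M. f x)"
  unfolding set_lebesgue_integral_def
proof (rule integral_mono)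
  show "integrable M (\<lambda>x. indicat_real A x *\<^sub>R f x)"
    using set_integrable_subset[OF assms(1-3)] by (simp add: set_integrable_def)
qed (use assms in \<open>auto simp: set_integrable_def indicator_def\<close>)

text \<open>Intervals generate the Borel sets, so by induction over Borel sets the truncation
  \<open>f\<close> of \<open>d\<close> to \<open>{a..b}\<close> has integral zero over each of them
  and therefore vanishes almost everywhere.\<close>

lemma AE_zero_if_Icc_integrals_zero:
  fixes d :: "real \<Rightarrow> real"
  assumes "set_integrable lborel {a..b} d"
    and zero: "\<And>x y. a \<le> x \<Longrightarrow> x \<le> y \<Longrightarrow> y \<le> b \<Longrightarrow> (LINT t:{x..y}|lborel. d t) = 0"
  shows "AE x in lborel. x \<in> {a..b} \<longrightarrow> d x = 0"
proof (cases "a \<le> b")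
  case True
  define f where "f \<equiv> \<lambda>x. indicat_real {a..b} x * d x"
  have int: "integrable lborel f" using assms(1) by (simp add: f_def set_integrable_def)
  have intA: "set_integrable lborel A f" if "A \<in> sets lborel" for A
    using integrable_mult_indicator[OF that int] by (simp add: set_integrable_def)
  have base: "(LINT t:{x..y}|lborel. f t) = 0" for x y
  proof -
    have "(LINT t:{x..y}|lborel. f t) = (LINT t:{max a x..min b y}|lborel. d t)"
      unfolding set_lebesgue_integral_def f_def
      by (rule Bochner_Integration.integral_cong) (auto simp: indicator_def)
    also have "\<dots> = 0"
    proof (cases "max a x \<le> min b y")
      case True then show ?thesis by (intro zero) auto
    qed (simp add: set_lebesgue_integral_def)
    finally show ?thesis .
  qed
  have tot: "(LINT t|lborel. f t) = 0"
    using zero[of a b] True by (simp add: f_def set_lebesgue_integral_def)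
  have all: "(LINT t:A|lborel. f t) = 0" if "A \<in> sets borel" for A
    using that
  proof (induction rule: borel_set_induct)
    case (compl A)
    have "(LINT t:A \<union> (-A)|lborel. f t) = (LINT t:A|lborel. f t) + (LINT t:-A|lborel. f t)"
      by (rule set_integral_Un) (use compl intA in auto)
    then show ?case using compl tot by (simp add: set_lebesgue_integral_def)
  next
    case (union F)
    have "(LINT t:(\<Union>i. F i)|lborel. f t) = (\<Sum>i. LINT t:F i|lborel. f t)"
      by (rule lebesgue_integral_countable_add) (use union intA in \<open>auto simp: disjoint_family_on_def\<close>)
    then show ?case using union by simp
  next
    case empty
    then show ?case by (simp add: set_lebesgue_integral_def)
  qed (rule base)
  have "AE x in lborel. f x = 0" by (rule sigma_finite_measure.density_zero[OF sigma_finite_lborel int]) (use all in auto)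
  then show ?thesis by eventually_elim (auto simp: f_def)
qed auto

section \<open>Weak derivatives: uniqueness, chain rule, absolute value\<close>

lemma weak_deriv_onD:
  assumes "weak_deriv_on I u g"
  shows "g \<in> borel_measurable borel"
    and "x \<in> I \<Longrightarrow> y \<in> I \<Longrightarrow> x \<le> y \<Longrightarrow> set_integrable lborel {x..y} g"
    and "x \<in> I \<Longrightarrow> y \<in> I \<Longrightarrow> x \<le> y \<Longrightarrow> u y - u x = (LINT t:{x..y}|lborel. g t)"
proof -
  show "g \<in> borel_measurable borel"
    using assms[unfolded weak_deriv_on_def, THEN conjunct1] by simp
  note * = assms[unfolded weak_deriv_on_def, THEN conjunct2, rule_format]
  show "x \<in> I \<Longrightarrow> y \<in> I \<Longrightarrow> x \<le> y \<Longrightarrow> set_integrable lborel {x..y} g"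
    by (rule *[THEN conjunct1])
  show "x \<in> I \<Longrightarrow> y \<in> I \<Longrightarrow> x \<le> y \<Longrightarrow> u y - u x = (LINT t:{x..y}|lborel. g t)"
    by (rule *[THEN conjunct2])
qed

definition ray :: "real set \<Rightarrow> bool" where
  "ray I \<longleftrightarrow> (\<exists>a b. a \<le> b \<and> I = {a..b}) \<or> (\<exists>a. I = {a..})"

lemma ray_Icc [simp]: "a \<le> b \<Longrightarrow> ray {a..b}" and ray_Ici [simp]: "ray {a..}"
  by (auto simp: ray_def)

lemma ray_sets [measurable]: "ray I \<Longrightarrow> I \<in> sets borel"
  by (auto simp: ray_def)

lemma ray_Icc_subset: "ray I \<Longrightarrow> x \<in> I \<Longrightarrow> y \<in> I \<Longrightarrow> {x..y} \<subseteq> I"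
  by (auto simp: ray_def)

text \<open>\<open>wderiv\<close> picks a derivative by choice; this uniqueness is what allows the
  energy to be computed from any other weak derivative. A half-line is exhausted by countably many
  compact intervals.\<close>

lemma weak_deriv_AE_unique:
  assumes "ray I" "weak_deriv_on I u g1" "weak_deriv_on I u g2"
  shows "AE x in lborel. x \<in> I \<longrightarrow> g1 x = g2 x"
proof -
  have Icc: "AE x in lborel. x \<in> {a..b} \<longrightarrow> g1 x = g2 x" if "{a..b} \<subseteq> I" "a \<le> b" for a b
  proof -
    have i: "set_integrable lborel {x..y} g1" "set_integrable lborel {x..y} g2"
      "u y - u x = (LINT t:{x..y}|lborel. g1 t)" "u y - u x = (LINT t:{x..y}|lborel. g2 t)"
      if "a \<le> x" "x \<le> y" "y \<le> b" for x y
      by (rule weak_deriv_onD[OF assms(2)] weak_deriv_onD[OF assms(3)]; use that \<open>{a..b} \<subseteq> I\<close> in auto)+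
    have "AE x in lborel. x \<in> {a..b} \<longrightarrow> g1 x - g2 x = 0"
    proof (rule AE_zero_if_Icc_integrals_zero)
      show "set_integrable lborel {a..b} (\<lambda>x. g1 x - g2 x)" using i that by (intro set_integral_diff) auto
      show "(LINT t:{x..y}|lborel. g1 t - g2 t) = 0" if "a \<le> x" "x \<le> y" "y \<le> b" for x y
        using i[OF that] by (subst set_integral_diff) auto
    qed
    then show ?thesis by eventually_elim auto
  qed
  from assms(1) consider (b) a b where "a \<le> b" "I = {a..b}" | (i) a where "I = {a..}" by (auto simp: ray_def)
  then show ?thesis
  proof cases
    case b then show ?thesis using Icc by auto
  next
    case (i a)
    have "AE x in lborel. \<forall>n::nat. x \<in> {a..a + n} \<longrightarrow> g1 x = g2 x"
      by (subst AE_all_countable) (use i Icc in auto)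
    then show ?thesis
    proof eventually_elim
      case (elim x)
      obtain n :: nat where "x - a \<le> n" using real_arch_simple by blast
      then show ?case using elim[rule_format, of n] i by auto
    qed
  qed
qed

lemma set_borel_measurable_cont_mult:
  fixes f g :: "real \<Rightarrow> real"
  assumes "continuous_on A f" "A \<in> sets borel" "g \<in> borel_measurable lborel"
  shows "set_borel_measurable lborel A (\<lambda>x. f x * g x)"
proof -
  have [measurable]: "(\<lambda>x. indicator A x *\<^sub>R f x) \<in> borel_measurable borel"
    using borel_measurable_continuous_on_indicator[OF assms(2,1)] by simp
  have "(\<lambda>x. (indicator A x *\<^sub>R f x) * g x) \<in> borel_measurable lborel"
    using assms(3) by measurable
  then show ?thesis by (simp add: set_borel_measurable_def mult.assoc)
qed

lemma set_borel_measurable_lborel: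
  fixes g :: "real \<Rightarrow> real"
  assumes "A \<in> sets borel" "g \<in> borel_measurable lborel"
  shows "set_borel_measurable lborel A g"
  using set_borel_measurable_cont_mult[of A "\<lambda>_. 1" g] assms by simp

lemma set_borel_measurable_continuous_on:
  fixes f :: "real \<Rightarrow> real"
  assumes "A \<in> sets borel" "continuous_on A f"
  shows "set_borel_measurable lborel A f"
  using set_borel_measurable_cont_mult[of A f "\<lambda>_. 1"] assms by simp

text \<open>The defect \<open>D\<close> of the formula is additive over adjacent intervals, and near
  every point the mean value theorem together with continuity of \<open>\<psi> (u x)\<close> bounds
  it by \<open>e\<close> times the integral of \<open>\<bar>g\<bar>\<close>. Bisection makes this
  bound global, and \<open>e\<close> is arbitrary. Derivatives are taken within \<open>J\<close>, so
  that the range of \<open>u\<close> may contain an endpoint of \<open>J\<close>; the calibration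
  needs this at the levels 0 and \<open>M\<close>.\<close>

lemma weak_chain_rule_Icc:
  fixes u g \<Psi> \<psi> :: "real \<Rightarrow> real"
  assumes "a \<le> b" and u: "continuous_on {a..b} u" and g: "g \<in> borel_measurable lborel"
    and gi: "set_integrable lborel {a..b} g"
    and inc: "\<And>x y. a \<le> x \<Longrightarrow> x \<le> y \<Longrightarrow> y \<le> b \<Longrightarrow> u y - u x = (LINT t:{x..y}|lborel. g t)"
    and uJ: "\<And>x. x \<in> {a..b} \<Longrightarrow> u x \<in> J" and J: "is_interval J"
    and \<Psi>: "\<And>s. s \<in> J \<Longrightarrow> (\<Psi> has_real_derivative \<psi> s) (at s within J)"
    and \<psi>: "continuous_on J \<psi>"
  shows "set_integrable lborel {a..b} (\<lambda>x. \<psi> (u x) * g x)"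
    and "\<Psi> (u b) - \<Psi> (u a) = (LINT x:{a..b}|lborel. \<psi> (u x) * g x)"
proof -
  have cont: "continuous_on {a..b} (\<lambda>x. \<psi> (u x))"
    by (rule continuous_on_compose2[OF \<psi> u]) (use uJ in auto)
  have "bounded ((\<lambda>x. \<psi> (u x)) ` {a..b})"
    by (rule compact_imp_bounded[OF compact_continuous_image[OF cont compact_Icc]])
  then obtain K where "\<forall>y\<in>(\<lambda>x. \<psi> (u x)) ` {a..b}. norm y \<le> K" unfolding bounded_iff ..
  then have K: "\<bar>\<psi> (u x)\<bar> \<le> K" if "x \<in> {a..b}" for x using that by auto
  show int: "set_integrable lborel {a..b} (\<lambda>x. \<psi> (u x) * g x)"
  proof (rule set_integrable_bound[where f = "\<lambda>x. K * g x"])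
    have "norm (\<psi> (u x) * g x) \<le> norm (K * g x)" if "x \<in> {a..b}" for x
      using K[OF that] by (auto simp: abs_mult intro!: mult_right_mono)
    then show "AE x in lborel. x \<in> {a..b} \<longrightarrow> norm (\<psi> (u x) * g x) \<le> norm (K * g x)" by simp
    show "set_borel_measurable lborel {a..b} (\<lambda>x. \<psi> (u x) * g x)"
      by (rule set_borel_measurable_cont_mult) (use cont g in auto)
  qed (use gi in auto)
  define D where "D \<equiv> \<lambda>x y. \<Psi> (u y) - \<Psi> (u x) - (LINT t:{x..y}|lborel. \<psi> (u t) * g t)"
  have sub: "set_integrable lborel {x..y} f"
    if "set_integrable lborel {a..b} f" "a \<le> x" "y \<le> b" for x y and f :: "real \<Rightarrow> real"
    using that by (auto intro: set_integrable_subset)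
  have key: "\<bar>D a b\<bar> \<le> e * (LINT t:{a..b}|lborel. \<bar>g t\<bar>)" if "e > 0" for e
  proof -
    define P where "P x y \<longleftrightarrow> (a \<le> x \<longrightarrow> y \<le> b \<longrightarrow> \<bar>D x y\<bar> \<le> e * (LINT t:{x..y}|lborel. \<bar>g t\<bar>))" for x y
    have "P a b"
    \<comment> \<open>\<open>P\<close> passes from two adjacent intervals to their union and holds
      on short intervals around any point, which is exactly what bisection requires.\<close>
    proof (rule Bolzano[of a b P, OF \<open>a \<le> b\<close>])
      fix x y z assume 1: "P x y" "P y z" "x \<le> y" "y \<le> z"
      show "P x z" unfolding P_def
      proof (intro impI)
        assume "a \<le> x" "z \<le> b"
        have "D x z = D x y + D y z" unfolding D_def
          using set_integral_Icc_split[of x y z "\<lambda>t. \<psi> (u t) * g t"] sub[OF int \<open>a \<le> x\<close> \<open>z \<le> b\<close>] 1 by simp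
        moreover have "(LINT t:{x..z}|lborel. \<bar>g t\<bar>) = (LINT t:{x..y}|lborel. \<bar>g t\<bar>) + (LINT t:{y..z}|lborel. \<bar>g t\<bar>)"
          by (rule set_integral_Icc_split) (use 1 sub[OF set_integrable_abs[OF gi] \<open>a \<le> x\<close> \<open>z \<le> b\<close>] in auto)
        ultimately show "\<bar>D x z\<bar> \<le> e * (LINT t:{x..z}|lborel. \<bar>g t\<bar>)"
          using 1 \<open>a \<le> x\<close> \<open>z \<le> b\<close> by (auto simp: algebra_simps P_def)
      qed
    next
      fix c assume 2: "a \<le> c" "c \<le> b"
      have "\<forall>e>0. \<exists>d>0. \<forall>t\<in>{a..b}. dist t c < d \<longrightarrow> dist (\<psi> (u t)) (\<psi> (u c)) < e"
        using cont 2 unfolding continuous_on_iff by auto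
      from this[rule_format, of "e / 2"] \<open>e > 0\<close>
      obtain d where d: "d > 0" "\<And>t. t \<in> {a..b} \<Longrightarrow> \<bar>t - c\<bar> < d \<Longrightarrow> \<bar>\<psi> (u t) - \<psi> (u c)\<bar> < e / 2"
        by (auto simp: dist_real_def)
      have "\<bar>D x y\<bar> \<le> e * (LINT t:{x..y}|lborel. \<bar>g t\<bar>)"
        if xy: "x \<le> c" "c \<le> y" "y - x < d" "a \<le> x" "y \<le> b" for x y
      proof -
        \<comment> \<open>The mean value theorem acts on the range of \<open>u\<close>; the
          intermediate value theorem pulls its point back to some \<open>\<xi>\<close> in the
          interval.\<close>
        have "\<exists>\<xi>\<in>{x..y}. \<Psi> (u y) - \<Psi> (u x) = \<psi> (u \<xi>) * (u y - u x)"
        proof -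
          have mv: "\<exists>z. v \<le> z \<and> z \<le> w \<and> \<Psi> w - \<Psi> v = \<psi> z * (w - v)"
            if "v < w" "v \<in> J" "w \<in> J" for v w
          proof -
            have "{v..w} \<subseteq> J" using mem_is_interval_1_I[OF J that(2,3)] by (intro subsetI) simp
            have d: "(\<Psi> has_derivative (*) (\<psi> z)) (at z within {v..w})" if "v \<le> z \<and> z \<le> w" for z
            proof -
              have "z \<in> J" using that \<open>{v..w} \<subseteq> J\<close> by auto
              from \<Psi>[OF this] show ?thesis unfolding has_field_derivative_def
                by (rule has_derivative_subset) fact
            qed
            from mvt_simple[OF \<open>v < w\<close> d] obtain z where "z \<in> {v<..<w}" "\<Psi> w - \<Psi> v = \<psi> z * (w - v)" by auto
            then show ?thesis by (intro exI[of _ z]) auto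
          qed
          have img: "\<exists>\<xi>\<in>{x..y}. u \<xi> = z" if "min (u x) (u y) \<le> z" "z \<le> max (u x) (u y)" for z
          proof -
            have "continuous_on {x..y} u" using continuous_on_subset[OF u] xy by auto
            moreover have "x \<le> y" using xy by simp
            ultimately show ?thesis
            proof (cases "u x \<le> u y")
              case True
              then show ?thesis using IVT'[of u x z y] that \<open>x \<le> y\<close> \<open>continuous_on {x..y} u\<close> by auto
            next
              case False
              then show ?thesis using IVT2'[of u y z x] that \<open>x \<le> y\<close> \<open>continuous_on {x..y} u\<close> by auto
            qed
          qed
          have J': "u x \<in> J" "u y \<in> J" by (rule uJ; use xy in simp)+
          consider "u x < u y" | "u y < u x" | "u x = u y" by linarith
          then show ?thesis
          proof cases
            case 1
            from mv[OF this J'] obtain z where z: "u x \<le> z" "z \<le> u y" "\<Psi> (u y) - \<Psi> (u x) = \<psi> z * (u y - u x)"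
              by blast
            have "\<exists>\<xi>\<in>{x..y}. u \<xi> = z" by (rule img) (use z in simp_all)
            with z(3) show ?thesis by blast
          next
            case 2
            from mv[OF this J'(2,1)] obtain z where z: "u y \<le> z" "z \<le> u x" "\<Psi> (u x) - \<Psi> (u y) = \<psi> z * (u x - u y)"
              by blast
            have "\<exists>\<xi>\<in>{x..y}. u \<xi> = z" by (rule img) (use z in simp_all)
            moreover have "\<Psi> (u y) - \<Psi> (u x) = \<psi> z * (u y - u x)" using z(3) by (simp add: algebra_simps)
            ultimately show ?thesis by blast
          next
            case 3 then show ?thesis by (intro bexI[of _ x]) (use xy in simp_all)
          qed
        qed
        then obtain \<xi> where \<xi>: "\<xi> \<in> {x..y}" "\<Psi> (u y) - \<Psi> (u x) = \<psi> (u \<xi>) * (u y - u x)" by auto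
        have i1: "set_integrable lborel {x..y} (\<lambda>t. \<psi> (u \<xi>) * g t)" using sub[OF gi] xy by auto
        have i2: "set_integrable lborel {x..y} (\<lambda>t. \<psi> (u t) * g t)" using sub[OF int] xy by auto
        have "D x y = (LINT t:{x..y}|lborel. \<psi> (u \<xi>) * g t) - (LINT t:{x..y}|lborel. \<psi> (u t) * g t)"
          unfolding D_def \<xi> using inc[of x y] xy by simp
        also have "\<dots> = (LINT t:{x..y}|lborel. (\<psi> (u \<xi>) - \<psi> (u t)) * g t)"
          by (subst set_integral_diff(2)[OF i1 i2, symmetric]) (simp add: algebra_simps)
        finally have D: "D x y = (LINT t:{x..y}|lborel. (\<psi> (u \<xi>) - \<psi> (u t)) * g t)" .
        have i3: "set_integrable lborel {x..y} (\<lambda>t. (\<psi> (u \<xi>) - \<psi> (u t)) * g t)"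
          using set_integral_diff(1)[OF i1 i2] by (simp add: algebra_simps)
        have b: "\<bar>(\<psi> (u \<xi>) - \<psi> (u t)) * g t\<bar> \<le> e * \<bar>g t\<bar>" if "t \<in> {x..y}" for t
        proof -
          have "\<bar>\<psi> (u \<xi>) - \<psi> (u t)\<bar> \<le> e"
          proof -
            have "\<bar>\<xi> - c\<bar> < d" "\<bar>t - c\<bar> < d" "\<xi> \<in> {a..b}" "t \<in> {a..b}" using xy \<xi>(1) that by auto
            from d(2)[OF this(3,1)] d(2)[OF this(4,2)] show ?thesis by linarith
          qed
          then show ?thesis unfolding abs_mult by (rule mult_right_mono) simp
        qed
        have "\<bar>D x y\<bar> \<le> (LINT t:{x..y}|lborel. \<bar>(\<psi> (u \<xi>) - \<psi> (u t)) * g t\<bar>)"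
          unfolding D set_lebesgue_integral_def
          by (rule order_trans[OF integral_abs_bound]) (simp add: abs_mult)
        also have "\<dots> \<le> (LINT t:{x..y}|lborel. e * \<bar>g t\<bar>)"
          by (rule set_integral_mono) (use i3 sub[OF gi] xy b in \<open>auto intro!: set_integrable_abs\<close>)
        finally show ?thesis by simp
      qed
      then show "\<exists>d>0. \<forall>x y. x \<le> c \<and> c \<le> y \<and> y - x < d \<longrightarrow> P x y"
        using d(1) by (intro exI[of _ d]) (auto simp: P_def)
    qed
    then show ?thesis by (simp add: P_def)
  qed
  have "D a b = 0"
  proof (rule ccontr)
    assume "D a b \<noteq> 0"
    \<comment> \<open>Dividing by \<open>2 * (G + 1)\<close> instead of \<open>2 * G\<close> covers
      the case that \<open>g\<close> vanishes almost everywhere.\<close>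
    define G where "G = (LINT t:{a..b}|lborel. \<bar>g t\<bar>)"
    have "G \<ge> 0" unfolding G_def by (rule set_integral_nonneg_real) auto
    then have "\<bar>D a b\<bar> \<le> \<bar>D a b\<bar> / (2 * (G + 1)) * G"
      using key[of "\<bar>D a b\<bar> / (2 * (G + 1))"] \<open>D a b \<noteq> 0\<close> by (auto simp: G_def)
    also have "\<dots> \<le> \<bar>D a b\<bar> / 2" using \<open>G \<ge> 0\<close> by (simp add: field_simps mult_left_mono)
    finally show False using \<open>D a b \<noteq> 0\<close> by simp
  qed
  then show "\<Psi> (u b) - \<Psi> (u a) = (LINT x:{a..b}|lborel. \<psi> (u x) * g x)" by (simp add: D_def)
qed

lemma weak_chain_rule:
  fixes u g \<Psi> \<psi> :: "real \<Rightarrow> real"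
  assumes "ray I" "continuous_on I u" "weak_deriv_on I u g" "x \<in> I" "y \<in> I" "x \<le> y"
    and "\<And>t. t \<in> {x..y} \<Longrightarrow> u t \<in> J" and "is_interval J"
    and "\<And>s. s \<in> J \<Longrightarrow> (\<Psi> has_real_derivative \<psi> s) (at s within J)"
    and "continuous_on J \<psi>"
  shows "set_integrable lborel {x..y} (\<lambda>x. \<psi> (u x) * g x)"
    and "\<Psi> (u y) - \<Psi> (u x) = (LINT t:{x..y}|lborel. \<psi> (u t) * g t)"
proof -
  note s = ray_Icc_subset[OF assms(1,4,5)]
  have inc: "u w - u v = (LINT t:{v..w}|lborel. g t)" if "x \<le> v" "v \<le> w" "w \<le> y" for v w
    by (rule weak_deriv_onD(3)[OF assms(3)]) (use s that in auto)
  have g: "g \<in> borel_measurable lborel" "set_integrable lborel {x..y} g"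
    using weak_deriv_onD(1,2)[OF assms(3)] assms(4-6) by auto
  show "set_integrable lborel {x..y} (\<lambda>x. \<psi> (u x) * g x)"
    by (rule weak_chain_rule_Icc(1)[OF \<open>x \<le> y\<close> continuous_on_subset[OF assms(2) s] g inc assms(7-10)])
  show "\<Psi> (u y) - \<Psi> (u x) = (LINT t:{x..y}|lborel. \<psi> (u t) * g t)"
    by (rule weak_chain_rule_Icc(2)[OF \<open>x \<le> y\<close> continuous_on_subset[OF assms(2) s] g inc assms(7-10)])
qed

text \<open>The absolute value is smoothed to \<open>sqrt (s\<^sup>2 + e n)\<close>, whose
  derivative is bounded by 1 and tends to \<open>sgn s\<close>; dominated convergence passes to the
  limit in the chain rule. The indicator inside \<open>sgn\<close> makes the derivative measurable
  on the whole line, since \<open>u\<close> is controlled on \<open>I\<close> only.\<close>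

lemma weak_deriv_abs:
  assumes I: "ray I" and u: "continuous_on I u" and g: "weak_deriv_on I u g"
  shows "weak_deriv_on I (\<lambda>x. \<bar>u x\<bar>) (\<lambda>x. sgn (indicator I x * u x) * g x)"
proof -
  have [measurable]: "I \<in> sets borel" by (rule ray_sets[OF I])
  have [measurable]: "g \<in> borel_measurable borel" by (rule weak_deriv_onD(1)[OF g])
  have [measurable]: "(\<lambda>x. indicator I x * u x) \<in> borel_measurable borel"
    using borel_measurable_continuous_on_indicator[of I u] u \<open>I \<in> sets borel\<close> unfolding real_scaleR_def by blast
  have *: "set_integrable lborel {x..y} (\<lambda>x. sgn (indicator I x * u x) * g x) \<and>
      \<bar>u y\<bar> - \<bar>u x\<bar> = (LINT t:{x..y}|lborel. sgn (indicator I t * u t) * g t)"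
    if xy: "x \<in> I" "y \<in> I" "x \<le> y" for x y
  proof -
    define e where "e n = inverse (real (Suc n))" for n
    have e: "e n > 0" for n unfolding e_def by simp
    have e0: "e \<longlonglongrightarrow> 0" unfolding e_def by (rule LIMSEQ_inverse_real_of_nat)
    have s: "{x..y} \<subseteq> I" by (rule ray_Icc_subset[OF I xy(1,2)])
    have gi: "set_integrable lborel {x..y} g" by (rule weak_deriv_onD(2)[OF g xy])
    have pos: "s\<^sup>2 + e n > 0" for s n using e[of n] by (simp add: add_nonneg_pos)
    have der: "((\<lambda>s. sqrt (s\<^sup>2 + e n)) has_real_derivative (s / sqrt (s\<^sup>2 + e n))) (at s within UNIV)" for s n
      using pos[of s n] by (auto intro!: derivative_eq_intros simp: inverse_eq_divide)
    have cder: "continuous_on UNIV (\<lambda>s. s / sqrt (s\<^sup>2 + e n))" for n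
      by (intro continuous_intros ballI) (use pos in \<open>simp add: less_imp_neq[THEN not_sym]\<close>)
    have ch: "set_integrable lborel {x..y} (\<lambda>t. u t / sqrt ((u t)\<^sup>2 + e n) * g t)"
      "sqrt ((u y)\<^sup>2 + e n) - sqrt ((u x)\<^sup>2 + e n) = (LINT t:{x..y}|lborel. u t / sqrt ((u t)\<^sup>2 + e n) * g t)" for n
      by (rule weak_chain_rule[OF I u g xy _ is_interval_univ der cder], simp)+
    have lim: "(\<lambda>n. s / sqrt (s\<^sup>2 + e n)) \<longlonglongrightarrow> sgn s" for s :: real
    proof (cases "s = 0")
      case False
      have "(\<lambda>n. s / sqrt (s\<^sup>2 + e n)) \<longlonglongrightarrow> s / sqrt (s\<^sup>2 + 0)"
        by (intro tendsto_intros e0) (use False in auto)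
      then show ?thesis by (simp add: sgn_if abs_if split: if_splits)
    qed simp
    have "integrable lborel (\<lambda>t. indicator {x..y} t *\<^sub>R (sgn (indicator I t * u t) * g t)) \<and>
      (\<lambda>n. LINT t|lborel. indicator {x..y} t *\<^sub>R (u t / sqrt ((u t)\<^sup>2 + e n) * g t)) \<longlonglongrightarrow>
      (LINT t|lborel. indicator {x..y} t *\<^sub>R (sgn (indicator I t * u t) * g t))"
    proof (intro conjI)
      have b1: "norm (indicat_real {x..y} t *\<^sub>R (sgn (indicat_real I t * u t) * g t)) \<le> norm (indicat_real {x..y} t *\<^sub>R g t)" for t
        by (auto simp: indicator_def sgn_if)
      show "integrable lborel (\<lambda>t. indicator {x..y} t *\<^sub>R (sgn (indicator I t * u t) * g t))"
        by (rule Bochner_Integration.integrable_bound[OF gi[unfolded set_integrable_def]]) (use b1 in auto)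
      show "(\<lambda>n. LINT t|lborel. indicator {x..y} t *\<^sub>R (u t / sqrt ((u t)\<^sup>2 + e n) * g t)) \<longlonglongrightarrow>
        (LINT t|lborel. indicator {x..y} t *\<^sub>R (sgn (indicator I t * u t) * g t))"
      proof (rule integral_dominated_convergence[where w = "\<lambda>t. indicator {x..y} t *\<^sub>R \<bar>g t\<bar>"])
        show "(\<lambda>t. indicator {x..y} t *\<^sub>R (u t / sqrt ((u t)\<^sup>2 + e n) * g t)) \<in> borel_measurable lborel" for n
          using ch(1)[of n] unfolding set_integrable_def by (rule borel_measurable_integrable)
        show "integrable lborel (\<lambda>t. indicator {x..y} t *\<^sub>R \<bar>g t\<bar>)"
          using set_integrable_abs[OF gi] by (simp add: set_integrable_def)
        show "AE t in lborel. (\<lambda>n. indicator {x..y} t *\<^sub>R (u t / sqrt ((u t)\<^sup>2 + e n) * g t))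
            \<longlonglongrightarrow> indicator {x..y} t *\<^sub>R (sgn (indicator I t * u t) * g t)"
          using s by (intro AE_I2) (auto simp: indicator_def subset_eq simp del: times_divide_eq_left intro!: tendsto_mult lim)
        have "\<bar>v\<bar> \<le> sqrt (v\<^sup>2 + e n)" for v n using e[of n] by (intro real_le_rsqrt) auto
        then have "\<bar>v / sqrt (v\<^sup>2 + e n)\<bar> \<le> 1" for v n
          using pos[of v n] by (simp add: abs_divide)
        then have "\<bar>v / sqrt (v\<^sup>2 + e n)\<bar> * \<bar>w\<bar> \<le> \<bar>w\<bar>" for v w n by (rule mult_left_le_one_le[rotated 2]) auto
        then show "AE t in lborel. norm (indicat_real {x..y} t *\<^sub>R (u t / sqrt ((u t)\<^sup>2 + e n) * g t)) \<le> indicat_real {x..y} t *\<^sub>R \<bar>g t\<bar>" for n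
          by (intro AE_I2) (auto simp: indicator_def abs_mult abs_divide)
      qed auto
    qed
    note lim_int = this
    have "(\<lambda>n. sqrt ((u y)\<^sup>2 + e n) - sqrt ((u x)\<^sup>2 + e n)) \<longlonglongrightarrow> sqrt ((u y)\<^sup>2 + 0) - sqrt ((u x)\<^sup>2 + 0)"
      by (intro tendsto_intros e0)
    from LIMSEQ_unique[OF this[unfolded ch(2) set_lebesgue_integral_def] lim_int[THEN conjunct2]]
    have "\<bar>u y\<bar> - \<bar>u x\<bar> = (LINT t:{x..y}|lborel. sgn (indicator I t * u t) * g t)"
      by (simp add: set_lebesgue_integral_def)
    with lim_int show ?thesis by (simp add: set_integrable_def)
  qed
  have "(\<lambda>x. sgn (indicat_real I x * u x) * g x) \<in> borel_measurable lborel" by measurable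
  with * show ?thesis unfolding weak_deriv_on_def by blast
qed

section \<open>H1 functions on a single edge\<close>

text \<open>Carrying the weak derivative along lets every construction name its derivative, instead
  of reasoning about the choice hidden in \<open>wderiv\<close>.\<close>

definition h1d :: "real set \<Rightarrow> (real \<Rightarrow> real) \<Rightarrow> (real \<Rightarrow> real) \<Rightarrow> bool" where
  "h1d I u g \<longleftrightarrow> continuous_on I u \<and> set_integrable lborel I (\<lambda>x. (u x)\<^sup>2) \<and>
     weak_deriv_on I u g \<and> set_integrable lborel I (\<lambda>x. (g x)\<^sup>2)"

lemma h1dD:
  assumes "h1d I u g"
  shows "continuous_on I u" "set_integrable lborel I (\<lambda>x. (u x)\<^sup>2)" "weak_deriv_on I u g"
    "set_integrable lborel I (\<lambda>x. (g x)\<^sup>2)"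
  using assms unfolding h1d_def by simp_all

lemma H1_on_h1d: "H1_on I u \<longleftrightarrow> (\<exists>g. h1d I u g)"
  unfolding H1_on_def h1d_def by blast

lemma h1d_wderiv:
  assumes "h1d I u g" shows "h1d I u (wderiv I u)"
proof -
  have "weak_deriv_on I u (wderiv I u) \<and> set_integrable lborel I (\<lambda>x. (wderiv I u x)\<^sup>2)"
    unfolding wderiv_def by (rule someI[of _ g]) (use h1dD[OF assms] in blast)
  then show ?thesis using h1dD(1,2)[OF assms] unfolding h1d_def by blast
qed

lemma h1d_unique:
  assumes "ray I" "h1d I u g1" "h1d I u g2"
  shows "(LINT x:I|lborel. (g1 x)\<^sup>2) = (LINT x:I|lborel. (g2 x)\<^sup>2)"
proof -
  have [measurable]: "I \<in> sets borel" "g1 \<in> borel_measurable borel" "g2 \<in> borel_measurable borel"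
    by (rule ray_sets[OF assms(1)], rule weak_deriv_onD(1)[OF h1dD(3)[OF assms(2)]],
        rule weak_deriv_onD(1)[OF h1dD(3)[OF assms(3)]])
  show ?thesis
  proof (rule set_lebesgue_integral_cong_AE)
    show "AE x\<in>I in lborel. (g1 x)\<^sup>2 = (g2 x)\<^sup>2"
      using weak_deriv_AE_unique[OF assms(1) h1dD(3)[OF assms(2)] h1dD(3)[OF assms(3)]]
      by eventually_elim auto
  qed measurable
qed

lemma weak_deriv_subset: "weak_deriv_on I u g \<Longrightarrow> J \<subseteq> I \<Longrightarrow> weak_deriv_on J u g"
  unfolding weak_deriv_on_def by (auto simp only: subset_iff)

lemma h1d_subset:
  assumes "h1d I u g" "J \<subseteq> I" "J \<in> sets borel"
  shows "h1d J u g"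
proof -
  note d = h1dD[OF assms(1)]
  have "set_integrable lborel J f" if "set_integrable lborel I f" for f :: "real \<Rightarrow> real"
    by (rule set_integrable_subset[OF that]) (use assms in simp_all)
  from this[OF d(2)] this[OF d(4)] continuous_on_subset[OF d(1) assms(2)] weak_deriv_subset[OF d(3) assms(2)]
  show ?thesis unfolding h1d_def by simp
qed

lemma h1d_IccI:
  assumes "continuous_on {a..b} u" "weak_deriv_on {a..b} u g" "set_integrable lborel {a..b} (\<lambda>x. (g x)\<^sup>2)"
  shows "h1d {a..b} u g"
  unfolding h1d_def using assms
  by (auto intro!: borel_integrable_atLeastAtMost' continuous_intros)

lemma h1d_integrable_mult:
  assumes "ray I" "h1d I u g"
  shows "set_integrable lborel I (\<lambda>x. u x * g x)"
  by (rule set_integrable_sq_bound[OF h1dD(2,4)[OF assms(2)] set_borel_measurable_cont_mult])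
    (use h1dD(1)[OF assms(2)] ray_sets[OF assms(1)] weak_deriv_onD(1)[OF h1dD(3)[OF assms(2)]] in simp_all)

text \<open>Expand the integral of \<open>(g x - c)\<^sup>2\<close>, where \<open>c\<close> is the
  mean value of \<open>g\<close>.\<close>

lemma Cauchy_Schwarz_Icc:
  fixes g :: "real \<Rightarrow> real"
  assumes "a \<le> b" "set_integrable lborel {a..b} g" "set_integrable lborel {a..b} (\<lambda>x. (g x)\<^sup>2)"
  shows "(LINT x:{a..b}|lborel. g x)\<^sup>2 \<le> (b - a) * (LINT x:{a..b}|lborel. (g x)\<^sup>2)"
proof (cases "a = b")
  case False
  then have ab: "a < b" using assms by simp
  define I where "I = (LINT x:{a..b}|lborel. g x)"
  define c where "c = I / (b - a)"
  have i1: "set_integrable lborel {a..b} (\<lambda>x. 2 * c * g x)" using assms by simp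
  have i2: "set_integrable lborel {a..b} (\<lambda>x. c\<^sup>2)" by (rule borel_integrable_atLeastAtMost') simp
  have "0 \<le> (LINT x:{a..b}|lborel. (g x)\<^sup>2 - 2 * c * g x + c\<^sup>2)"
  proof (rule set_integral_nonneg_real)
    show "0 \<le> (g x)\<^sup>2 - 2 * c * g x + c\<^sup>2" for x
      using zero_le_power2[of "g x - c"] by (simp add: power2_eq_square algebra_simps)
  qed
  also have "\<dots> = (LINT x:{a..b}|lborel. (g x)\<^sup>2 - 2 * c * g x) + (LINT x:{a..b}|lborel. c\<^sup>2)"
    by (rule set_integral_add(2)[OF set_integral_diff(1)[OF assms(3) i1] i2])
  also have "(LINT x:{a..b}|lborel. (g x)\<^sup>2 - 2 * c * g x) = (LINT x:{a..b}|lborel. (g x)\<^sup>2) - 2 * c * I"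
    unfolding I_def by (subst set_integral_diff(2)[OF assms(3) i1]) simp
  also have "(LINT x:{a..b}|lborel. c\<^sup>2) = (b - a) * c\<^sup>2"
    using ab by (simp add: set_integral_const)
  finally have "0 \<le> (b - a) * ((LINT x:{a..b}|lborel. (g x)\<^sup>2) - 2 * c * I + (b - a) * c\<^sup>2)"
    using ab by simp
  moreover have "I = c * (b - a)" using ab by (simp add: c_def)
  moreover note Ieq = calculation(2)
  ultimately have "0 \<le> (b - a) * ((LINT x:{a..b}|lborel. (g x)\<^sup>2) - 2 * c * (c * (b - a)) + (b - a) * c\<^sup>2)"
    by simp
  then show ?thesis unfolding I_def[symmetric] Ieq
    by (simp add: algebra_simps power2_eq_square)
qed simp

lemma h1d_Hoelder:
  assumes "ray I" "h1d I u g" "x \<in> I" "y \<in> I" "x \<le> y"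
  shows "(u y - u x)\<^sup>2 \<le> (y - x) * (LINT t:{x..y}|lborel. (g t)\<^sup>2)"
proof -
  have "u y - u x = (LINT t:{x..y}|lborel. g t)" "set_integrable lborel {x..y} g"
    by (rule weak_deriv_onD(2,3)[OF h1dD(3)[OF assms(2)] assms(3-5)])+
  moreover have "set_integrable lborel {x..y} (\<lambda>t. (g t)\<^sup>2)"
    by (rule set_integrable_subset[OF h1dD(4)[OF assms(2)]]) (use ray_Icc_subset[OF assms(1,3,4)] in auto)
  ultimately show ?thesis using Cauchy_Schwarz_Icc[OF \<open>x \<le> y\<close>, of g] by simp
qed

text \<open>The embedding of H1 into Hoelder functions of exponent 1/2. It supplies the
  equicontinuity of minimising sequences and turns a drop of fixed size into a lower bound on
  length.\<close>

lemma h1d_Hoelder_bound: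
  assumes "ray I" "h1d I u g" "x \<in> I" "y \<in> I" "(LINT t:I|lborel. (g t)\<^sup>2) \<le> K"
  shows "\<bar>u y - u x\<bar> \<le> sqrt (K * \<bar>y - x\<bar>)"
proof -
  have *: "(u y - u x)\<^sup>2 \<le> K * \<bar>y - x\<bar>" if "x \<in> I" "y \<in> I" "x \<le> y" for x y
  proof -
    have "(LINT t:{x..y}|lborel. (g t)\<^sup>2) \<le> (LINT t:I|lborel. (g t)\<^sup>2)"
      by (rule set_integral_subset_mono[OF h1dD(4)[OF assms(2)]])
        (use ray_Icc_subset[OF assms(1) that(1,2)] in auto)
    then have "(y - x) * (LINT t:{x..y}|lborel. (g t)\<^sup>2) \<le> (y - x) * K"
      using assms(5) that by (intro mult_left_mono) auto
    then show ?thesis using h1d_Hoelder[OF assms(1,2) that] that by (simp add: mult.commute)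
  qed
  have "(u y - u x)\<^sup>2 \<le> K * \<bar>y - x\<bar>"
    using *[of x y] *[of y x] assms(3,4) by (cases "x \<le> y") (auto simp: power2_commute abs_minus_commute)
  then have "sqrt ((u y - u x)\<^sup>2) \<le> sqrt (K * \<bar>y - x\<bar>)" by (rule real_sqrt_le_mono)
  then show ?thesis by simp
qed

text \<open>Taking absolute values cannot raise the Dirichlet integral, so competitors may be
  assumed nonnegative.\<close>

lemma h1d_abs:
  assumes "ray I" "h1d I u g"
  obtains g' where "h1d I (\<lambda>x. \<bar>u x\<bar>) g'" "(LINT x:I|lborel. (g' x)\<^sup>2) \<le> (LINT x:I|lborel. (g x)\<^sup>2)"
proof -
  let ?g = "\<lambda>x. sgn (indicator I x * u x) * g x"
  have [measurable]: "I \<in> sets borel" "g \<in> borel_measurable borel"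
    by (rule ray_sets[OF assms(1)], rule weak_deriv_onD(1)[OF h1dD(3)[OF assms(2)]])
  have w: "weak_deriv_on I (\<lambda>x. \<bar>u x\<bar>) ?g"
    by (rule weak_deriv_abs[OF assms(1) h1dD(1,3)[OF assms(2)]])
  have [measurable]: "?g \<in> borel_measurable borel" by (rule weak_deriv_onD(1)[OF w])
  have le: "(?g x)\<^sup>2 \<le> (g x)\<^sup>2" for x by (simp add: sgn_if power_mult_distrib)
  have i: "set_integrable lborel I (\<lambda>x. (?g x)\<^sup>2)"
  proof (rule set_integrable_bound[OF h1dD(4)[OF assms(2)]])
    show "set_borel_measurable lborel I (\<lambda>x. (?g x)\<^sup>2)"
      by (rule set_borel_measurable_lborel) measurable
    show "AE x in lborel. x \<in> I \<longrightarrow> norm ((?g x)\<^sup>2) \<le> norm ((g x)\<^sup>2)"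
    proof (intro AE_I2 impI)
      show "norm ((?g x)\<^sup>2) \<le> norm ((g x)\<^sup>2)" for x using le[of x] by simp
    qed
  qed
  show ?thesis
  proof (rule that)
    show "h1d I (\<lambda>x. \<bar>u x\<bar>) ?g"
      unfolding h1d_def using w i h1dD(1,2)[OF assms(2)] by (simp add: continuous_intros)
    show "(LINT x:I|lborel. (?g x)\<^sup>2) \<le> (LINT x:I|lborel. (g x)\<^sup>2)"
      by (rule set_integral_mono[OF i h1dD(4)[OF assms(2)] le])
  qed
qed

text \<open>The square of \<open>u\<close> has the integrable derivative \<open>2 * u * g\<close>
  and hence a limit at infinity; a positive limit would contradict the integrability of the
  square.\<close>

lemma h1d_tendsto_zero:
  assumes h: "h1d {a..} u g"
  shows "(u \<longlongrightarrow> 0) at_top"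
proof -
  note m = set_integrable_mult_right[where a = 2, OF h1d_integrable_mult[OF ray_Ici h]]
  have i: "set_integrable lborel {a..} (\<lambda>x. 2 * u x * g x)" using m by (simp add: mult.assoc)
  have ch: "(u b)\<^sup>2 = (u a)\<^sup>2 + (LINT t:{a..b}|lborel. 2 * u t * g t)" if "a \<le> b" for b
  proof -
    have "(u b)\<^sup>2 - (u a)\<^sup>2 = (LINT t:{a..b}|lborel. 2 * u t * g t)"
      by (rule weak_chain_rule(2)[OF ray_Ici h1dD(1,3)[OF h] _ _ that, where J = UNIV and \<Psi> = "\<lambda>s. s\<^sup>2" and \<psi> = "\<lambda>s. 2 * s"])
        (use that in \<open>auto intro!: derivative_eq_intros continuous_intros\<close>)
    then show ?thesis by simp
  qed
  define L where "L = (u a)\<^sup>2 + (LINT t:{a..}|lborel. 2 * u t * g t)"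
  have "((\<lambda>b. (u a)\<^sup>2 + (LINT t:{a..b}|lborel. 2 * u t * g t)) \<longlongrightarrow> L) at_top"
    unfolding L_def by (intro tendsto_intros tendsto_set_lebesgue_integral_at_top i) auto
  moreover have "\<forall>\<^sub>F b in at_top. (u a)\<^sup>2 + (LINT t:{a..b}|lborel. 2 * u t * g t) = (u b)\<^sup>2"
    using eventually_ge_at_top[of a] by eventually_elim (rule ch[symmetric])
  ultimately have lim: "((\<lambda>b. (u b)\<^sup>2) \<longlongrightarrow> L) at_top"
    by (rule Lim_transform_eventually)
  have "L \<ge> 0" by (rule tendsto_lowerbound[OF lim]) auto
  have "L = 0"
  proof (rule ccontr)
    assume "L \<noteq> 0"
    with \<open>L \<ge> 0\<close> have "L / 2 < L" by simp
    from order_tendstoD(1)[OF lim this] obtain X where X: "\<And>x. x \<ge> X \<Longrightarrow> L / 2 < (u x)\<^sup>2"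
      unfolding eventually_at_top_linorder by auto
    define Y where "Y = max X a"
    define T where "T = (LINT t:{a..}|lborel. (u t)\<^sup>2)"
    obtain n :: nat where n: "T / (L / 2) < n" using reals_Archimedean2 by blast
    have "real n * (L / 2) = (LINT t:{Y..Y + n}|lborel. L / 2)" by (simp add: set_integral_const)
    also have "\<dots> \<le> (LINT t:{Y..Y + n}|lborel. (u t)\<^sup>2)"
    proof (rule set_integral_mono)
      show "set_integrable lborel {Y..Y + n} (\<lambda>t. (u t)\<^sup>2)"
        by (rule set_integrable_subset[OF h1dD(2)[OF h]]) (auto simp: Y_def)
      show "L / 2 \<le> (u x)\<^sup>2" if "x \<in> {Y..Y + n}" for x using X[of x] that by (simp add: Y_def)
      show "set_integrable lborel {Y..Y + real n} (\<lambda>t. L / 2)"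
        by (rule borel_integrable_atLeastAtMost') simp
    qed
    also have "\<dots> \<le> T" unfolding T_def
      by (rule set_integral_subset_mono[OF h1dD(2)[OF h]]) (auto simp: Y_def)
    finally show False using n \<open>L \<ge> 0\<close> \<open>L \<noteq> 0\<close> by (simp add: field_simps)
  qed
  with lim have "((\<lambda>b. sqrt ((u b)\<^sup>2)) \<longlongrightarrow> sqrt 0) at_top" by (intro tendsto_real_sqrt) simp
  then show ?thesis by (simp add: tendsto_rabs_zero_iff)
qed

text \<open>On a half-line the decay of \<open>u\<close> confines the search to a compact interval
  as soon as some value is positive.\<close>

lemma h1d_attains_max:
  assumes "ray I" "h1d I u g" "\<And>x. x \<in> I \<Longrightarrow> 0 \<le> u x"
  obtains x0 where "x0 \<in> I" "\<And>x. x \<in> I \<Longrightarrow> u x \<le> u x0"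
proof -
  note c = h1dD(1)[OF assms(2)]
  from assms(1) consider (b) a b where "a \<le> b" "I = {a..b}" | (i) a where "I = {a..}" by (auto simp: ray_def)
  then show ?thesis
  proof cases
    case b
    then show ?thesis using continuous_attains_sup[of "{a..b}" u] c that by auto
  next
    case (i a)
    show ?thesis
    proof (cases "\<exists>x1\<in>I. u x1 > 0")
      case False
      then have "u x \<le> u a" if "x \<in> I" for x using that i assms(3)[of a] by (auto simp: not_less intro: order_trans)
      then show ?thesis using that[of a] i by simp
    next
      case True
      then obtain x1 where x1: "x1 \<in> I" "0 < u x1" by auto
      from order_tendstoD(2)[OF h1d_tendsto_zero[OF assms(2)[unfolded i]] x1(2)]
      obtain X where X: "\<And>x. x \<ge> X \<Longrightarrow> u x < u x1" unfolding eventually_at_top_linorder by auto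
      define Y where "Y = max X x1"
      have "continuous_on {a..Y} u" using c i by (auto intro: continuous_on_subset)
      moreover have "{a..Y} \<noteq> {}" using x1 i by (auto simp: Y_def)
      ultimately obtain x0 where x0: "x0 \<in> {a..Y}" "\<And>x. x \<in> {a..Y} \<Longrightarrow> u x \<le> u x0"
        using continuous_attains_sup[of "{a..Y}" u] by auto
      show ?thesis
      proof (rule that[of x0])
        show "x0 \<in> I" using x0 i by auto
        fix x assume "x \<in> I"
        show "u x \<le> u x0"
        proof (cases "x \<le> Y")
          case False
          then have "u x < u x1" using X by (auto simp: Y_def)
          also have "u x1 \<le> u x0" using x0(2)[of x1] x1 i by (auto simp: Y_def)
          finally show ?thesis by simp
        qed (use \<open>x \<in> I\<close> i x0 in auto)
      qed
    qed
  qed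
qed

lemma h1d_bounded:
  assumes "ray I" "h1d I u g"
  obtains K where "K \<ge> 0" "\<And>x. x \<in> I \<Longrightarrow> \<bar>u x\<bar> \<le> K"
proof -
  obtain g' where "h1d I (\<lambda>x. \<bar>u x\<bar>) g'" using h1d_abs[OF assms] by auto
  from h1d_attains_max[OF assms(1) this] obtain x0 where "\<And>x. x \<in> I \<Longrightarrow> \<bar>u x\<bar> \<le> \<bar>u x0\<bar>" by auto
  then show ?thesis by (rule that[rotated]) auto
qed

text \<open>Since \<open>u\<close> is bounded and \<open>p > 2\<close>, its \<open>p\<close>-th
  power is dominated by a multiple of its square.\<close>

lemma h1d_powr_integrable:
  assumes "ray I" "h1d I u g" "2 < p"
  shows "set_integrable lborel I (\<lambda>x. \<bar>u x\<bar> powr p)"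
proof -
  obtain K where K: "K \<ge> 0" "\<And>x. x \<in> I \<Longrightarrow> \<bar>u x\<bar> \<le> K" using h1d_bounded[OF assms(1,2)] by blast
  show ?thesis
  proof (rule set_integrable_bound[where f = "\<lambda>x. K powr (p - 2) * (u x)\<^sup>2"])
    have "continuous_on I (\<lambda>x. \<bar>u x\<bar> powr p)"
      by (rule continuous_on_powr'[OF continuous_on_rabs[OF h1dD(1)[OF assms(2)]] continuous_on_const])
        (use \<open>2 < p\<close> in simp)
    then show "set_borel_measurable lborel I (\<lambda>x. \<bar>u x\<bar> powr p)"
      by (rule set_borel_measurable_continuous_on[OF ray_sets[OF assms(1)]])
    have le: "\<bar>u x\<bar> powr p \<le> K powr (p - 2) * (u x)\<^sup>2" if "x \<in> I" for x
    proof -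
      have "\<bar>u x\<bar> powr p = \<bar>u x\<bar> powr (p - 2) * \<bar>u x\<bar> powr 2"
        by (subst powr_add[symmetric]) simp
      also have "\<dots> \<le> K powr (p - 2) * \<bar>u x\<bar> powr 2"
        using \<open>2 < p\<close> K(2)[OF that] by (intro mult_right_mono powr_mono2) simp_all
      also have "\<bar>u x\<bar> powr 2 = (u x)\<^sup>2" by (cases "u x = 0") (simp_all add: powr_numeral)
      finally show ?thesis .
    qed
    show "AE x in lborel. x \<in> I \<longrightarrow> norm (\<bar>u x\<bar> powr p) \<le> norm (K powr (p - 2) * (u x)\<^sup>2)"
    proof (intro AE_I2 impI)
      show "norm (\<bar>u x\<bar> powr p) \<le> norm (K powr (p - 2) * (u x)\<^sup>2)" if "x \<in> I" for x
        using le[OF that] K(1) by simp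
    qed
    show "set_integrable lborel I (\<lambda>x. K powr (p - 2) * (u x)\<^sup>2)"
      using h1dD(2)[OF assms(2)] by simp
  qed
qed

section \<open>Completeness of L2 and limits of weak derivatives\<close>

lemma Fatou_set_integral:
  fixes f :: "nat \<Rightarrow> real \<Rightarrow> real"
  assumes A: "A \<in> sets borel" and int: "\<And>k. set_integrable lborel A (f k)" and nn: "\<And>k x. 0 \<le> f k x"
    and le: "\<And>k. (LINT x:A|lborel. f k x) \<le> c" and "c \<ge> 0" and [measurable]: "F \<in> borel_measurable borel"
    and lim: "AE x in lborel. x \<in> A \<longrightarrow> (\<lambda>k. f k x) \<longlonglongrightarrow> F x"
  shows "set_integrable lborel A F" "(LINT x:A|lborel. F x) \<le> c"
proof -
  define H where "H k x = indicat_real A x * f k x" for k x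
  define H0 where "H0 x = indicat_real A x * F x" for x
  have i: "integrable lborel (H k)" for k using int[of k] by (simp add: H_def[abs_def] set_integrable_def)
  have [measurable]: "H k \<in> borel_measurable lborel" for k using i by (rule borel_measurable_integrable)
  note A [measurable]
  have [measurable]: "H0 \<in> borel_measurable borel" unfolding H0_def by measurable
  have HH: "AE x in lborel. (\<lambda>k. H k x) \<longlonglongrightarrow> H0 x"
    using lim by eventually_elim (auto simp: H_def H0_def indicator_def)
  have H0: "AE x in lborel. 0 \<le> H0 x"
    using HH by eventually_elim (rule LIMSEQ_le_const, auto simp: H_def nn)
  have "(\<integral>\<^sup>+x. ennreal (H0 x) \<partial>lborel) = (\<integral>\<^sup>+x. liminf (\<lambda>k. ennreal (H k x)) \<partial>lborel)"
  proof (rule nn_integral_cong_AE)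
    show "AE x in lborel. ennreal (H0 x) = liminf (\<lambda>k. ennreal (H k x))"
      using HH
    proof eventually_elim
      case (elim x)
      show ?case by (rule lim_imp_Liminf[symmetric]) (auto intro!: tendsto_ennrealI elim)
    qed
  qed
  also have "\<dots> \<le> liminf (\<lambda>k. \<integral>\<^sup>+x. ennreal (H k x) \<partial>lborel)"
    by (rule nn_integral_liminf) measurable
  also have "\<dots> \<le> liminf (\<lambda>k::nat. ennreal c)"
  proof (rule Liminf_mono, rule always_eventually, rule allI)
    fix k
    have "(\<integral>\<^sup>+x. ennreal (H k x) \<partial>lborel) = ennreal (\<integral>x. H k x \<partial>lborel)"
      by (rule nn_integral_eq_integral[OF i]) (simp add: H_def nn)
    also have "\<dots> \<le> ennreal c"
      using le[of k] by (intro ennreal_leI) (simp add: H_def[abs_def] set_lebesgue_integral_def)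
    finally show "(\<integral>\<^sup>+x. ennreal (H k x) \<partial>lborel) \<le> ennreal c" .
  qed
  also have "\<dots> = ennreal c" by (simp add: Liminf_const)
  finally have b: "(\<integral>\<^sup>+x. ennreal (H0 x) \<partial>lborel) \<le> ennreal c" .
  have "integrable lborel H0"
    by (rule integrableI_nonneg[OF _ H0]) (measurable, rule order_le_less_trans[OF b], simp)
  then show "set_integrable lborel A F" by (simp add: H0_def[abs_def] set_integrable_def)
  have "(\<integral>x. H0 x \<partial>lborel) \<le> c" by (rule integral_real_bounded[OF \<open>c \<ge> 0\<close> b])
  then show "(LINT x:A|lborel. F x) \<le> c" by (simp add: H0_def[abs_def] set_lebesgue_integral_def)
qed

text \<open>Even with the weights \<open>2 ^ k\<close> the squared increments have a summable
  integral. Hence almost everywhere the increments decay geometrically and the sequence converges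
  pointwise; Fatou's lemma then transfers the rate to the limit.\<close>

lemma L2_complete_fast:
  fixes h :: "nat \<Rightarrow> real \<Rightarrow> real"
  assumes A: "A \<in> sets borel" and [measurable]: "\<And>k. h k \<in> borel_measurable borel"
    and int: "\<And>k. set_integrable lborel A (\<lambda>x. (h k x)\<^sup>2)"
    and fast: "\<And>k m. k \<le> m \<Longrightarrow> (LINT x:A|lborel. (h k x - h m x)\<^sup>2) \<le> (1/4) ^ k"
  obtains g where "g \<in> borel_measurable borel" "AE x in lborel. x \<in> A \<longrightarrow> (\<lambda>k. h k x) \<longlonglongrightarrow> g x"
    "\<And>k. set_integrable lborel A (\<lambda>x. (h k x - g x)\<^sup>2)"
    "\<And>k. (LINT x:A|lborel. (h k x - g x)\<^sup>2) \<le> (1/4) ^ k"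
proof -
  note A [measurable]
  have intd: "set_integrable lborel A (\<lambda>x. (h k x - h m x)\<^sup>2)" for k m
  proof (rule set_integrable_bound[where f = "\<lambda>x. 2 * (h k x)\<^sup>2 + 2 * (h m x)\<^sup>2"])
    show "set_integrable lborel A (\<lambda>x. 2 * (h k x)\<^sup>2 + 2 * (h m x)\<^sup>2)"
      using int[of k] int[of m] by (intro set_integral_add) simp_all
    show "set_borel_measurable lborel A (\<lambda>x. (h k x - h m x)\<^sup>2)"
      by (rule set_borel_measurable_lborel[OF A]) measurable
    have "(a - b)\<^sup>2 \<le> 2 * a\<^sup>2 + 2 * b\<^sup>2" for a b :: real
      using zero_le_power2[of "a + b"] by (simp add: power2_eq_square algebra_simps)
    then show "AE x in lborel. x \<in> A \<longrightarrow> norm ((h k x - h m x)\<^sup>2) \<le> norm (2 * (h k x)\<^sup>2 + 2 * (h m x)\<^sup>2)"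
      by (intro AE_I2) simp
  qed
  define D where "D k x = indicat_real A x * (2 ^ k * (h k x - h (Suc k) x)\<^sup>2)" for k x
  have Di: "integrable lborel (D k)" for k
    using set_integrable_mult_right[where a = "2 ^ k", OF intd[of k "Suc k"]] by (simp add: D_def[abs_def] set_integrable_def)
  have D0: "0 \<le> D k x" for k x by (simp add: D_def)
  have [measurable]: "D k \<in> borel_measurable borel" for k unfolding D_def by measurable
  have "(\<integral>\<^sup>+x. (\<Sum>k. ennreal (D k x)) \<partial>lborel) = (\<Sum>k. \<integral>\<^sup>+x. ennreal (D k x) \<partial>lborel)"
    by (rule nn_integral_suminf) measurable
  also have "\<dots> \<le> (\<Sum>k. ennreal ((1/2) ^ k))"
  proof (rule suminf_le)
    fix k
    have "(\<integral>\<^sup>+x. ennreal (D k x) \<partial>lborel) = ennreal (\<integral>x. D k x \<partial>lborel)"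
      by (rule nn_integral_eq_integral[OF Di]) (simp add: D0)
    also have "(\<integral>x. D k x \<partial>lborel) = 2 ^ k * (LINT x:A|lborel. (h k x - h (Suc k) x)\<^sup>2)"
      unfolding D_def set_lebesgue_integral_def
      by (subst integral_mult_right_zero[symmetric]) (simp add: mult.left_commute)
    also have "\<dots> \<le> 2 ^ k * (1/4) ^ k" using fast[of k "Suc k"] by (intro mult_left_mono) simp_all
    also have "\<dots> = (1/2) ^ k" by (simp flip: power_mult_distrib)
    finally show "(\<integral>\<^sup>+x. ennreal (D k x) \<partial>lborel) \<le> ennreal ((1/2) ^ k)" by (simp add: ennreal_leI)
  qed simp_all
  also have "\<dots> = ennreal (\<Sum>k. (1/2) ^ k)"
    by (rule suminf_ennreal2) (simp_all add: summable_geometric)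
  finally have "(\<integral>\<^sup>+x. (\<Sum>k. ennreal (D k x)) \<partial>lborel) < \<infinity>"
    by (simp add: order_le_less_trans[OF _ ennreal_less_top])
  then have fin: "(\<integral>\<^sup>+x. (\<Sum>k. ennreal (D k x)) \<partial>lborel) \<noteq> \<infinity>" by (rule less_imp_neq)
  have "(\<lambda>x. \<Sum>k. ennreal (D k x)) \<in> borel_measurable lborel" by measurable
  from nn_integral_PInf_AE[OF this fin] have "AE x in lborel. (\<Sum>k. ennreal (D k x)) \<noteq> \<infinity>" .
  then have AEc: "AE x in lborel. x \<in> A \<longrightarrow> convergent (\<lambda>k. h k x)"
  proof eventually_elim
    case (elim x)
    show ?case
    proof
      assume x: "x \<in> A"
      have "summable (\<lambda>k. D k x)" by (rule summable_suminf_not_top) (use elim D0 in \<open>simp_all\<close>)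
      then have "(\<lambda>k. D k x) \<longlonglongrightarrow> 0" by (rule summable_LIMSEQ_zero)
      from convergent_imp_bounded[OF this] obtain S where "\<forall>k. \<bar>D k x\<bar> \<le> S" by (auto simp: bounded_iff)
      then have S: "D k x \<le> S" for k using abs_le_D1 by blast
      have dk: "\<bar>h (Suc k) x - h k x\<bar> \<le> sqrt S * (1 / sqrt 2) ^ k" for k
      proof -
        have "2 ^ k * (h k x - h (Suc k) x)\<^sup>2 \<le> S" using S[of k] x by (simp add: D_def)
        then have "(h (Suc k) x - h k x)\<^sup>2 \<le> S * (1 / 2) ^ k"
          by (simp add: power_one_over field_simps power2_commute)
        then have "sqrt ((h (Suc k) x - h k x)\<^sup>2) \<le> sqrt (S * (1 / 2) ^ k)" by (rule real_sqrt_le_mono)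
        moreover have "sqrt (S * (1 / 2) ^ k) = sqrt S * (1 / sqrt 2) ^ k"
          by (simp add: real_sqrt_mult real_sqrt_power real_sqrt_divide)
        ultimately show ?thesis unfolding real_sqrt_abs by simp
      qed
      have "summable (\<lambda>k. sqrt S * (1 / sqrt 2) ^ k)"
        by (intro summable_mult summable_geometric) simp
      then have "summable (\<lambda>k. h (Suc k) x - h k x)"
        by (rule summable_comparison_test'[where N = 0]) (use dk in simp)
      then have "convergent (\<lambda>n. \<Sum>k<n. h (Suc k) x - h k x)" by (simp add: summable_iff_convergent)
      moreover have "(\<Sum>k<n. h (Suc k) x - h k x) = h n x - h 0 x" for n
        by (rule sum_lessThan_telescope[of "\<lambda>k. h k x"])
      ultimately have "convergent (\<lambda>n. h n x - h 0 x)" by simp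
      from convergent_add[OF this convergent_const[of "h 0 x"]] show "convergent (\<lambda>k. h k x)" by simp
    qed
  qed
  define g where "g x = lim (\<lambda>k. h k x)" for x
  have [measurable]: "g \<in> borel_measurable borel" unfolding g_def by measurable
  have lim: "AE x in lborel. x \<in> A \<longrightarrow> (\<lambda>k. h k x) \<longlonglongrightarrow> g x"
    using AEc by eventually_elim (simp add: g_def convergent_LIMSEQ_iff)
  have lim2: "AE x in lborel. x \<in> A \<longrightarrow> (\<lambda>m. (h k x - h (k + m) x)\<^sup>2) \<longlonglongrightarrow> (h k x - g x)\<^sup>2" for k
    using lim
  proof eventually_elim
    case (elim x)
    show ?case
    proof
      assume "x \<in> A"
      with elim have "(\<lambda>m. h m x) \<longlonglongrightarrow> g x" by simp
      from LIMSEQ_ignore_initial_segment[OF this, of k]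
      have "(\<lambda>m. h (k + m) x) \<longlonglongrightarrow> g x" by (simp add: add.commute)
      then show "(\<lambda>m. (h k x - h (k + m) x)\<^sup>2) \<longlonglongrightarrow> (h k x - g x)\<^sup>2" by (intro tendsto_intros)
    qed
  qed
  have gm: "(\<lambda>x. (h k x - g x)\<^sup>2) \<in> borel_measurable borel" for k by measurable
  have fast': "(LINT x:A|lborel. (h k x - h (k + m) x)\<^sup>2) \<le> (1/4) ^ k" for k m by (rule fast) simp
  have F1: "set_integrable lborel A (\<lambda>x. (h k x - g x)\<^sup>2)" for k
    by (rule Fatou_set_integral(1)[OF A intd _ fast' _ gm lim2]) simp_all
  have F2: "(LINT x:A|lborel. (h k x - g x)\<^sup>2) \<le> (1/4) ^ k" for k
    by (rule Fatou_set_integral(2)[OF A intd _ fast' _ gm lim2]) simp_all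
  show ?thesis by (rule that[OF _ lim F1 F2]) measurable
qed

text \<open>Iterated midpoints of the pairs with index at least \<open>n\<close>. They replace the
  convex hull of a tail of the sequence, because midpoints are all that the parallelogram identity
  asks for; functions and derivatives are averaged in parallel.\<close>

inductive tail_hull :: "(nat \<Rightarrow> real \<Rightarrow> real) \<Rightarrow> (nat \<Rightarrow> real \<Rightarrow> real) \<Rightarrow> nat \<Rightarrow> (real \<Rightarrow> real) \<Rightarrow> (real \<Rightarrow> real) \<Rightarrow> bool"
  for us gs n where
  base: "k \<ge> n \<Longrightarrow> tail_hull us gs n (us k) (gs k)"
| mid: "tail_hull us gs n u g \<Longrightarrow> tail_hull us gs n v h \<Longrightarrow>
    tail_hull us gs n (\<lambda>x. (u x + v x) / 2) (\<lambda>x. (g x + h x) / 2)"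

lemma tail_hull_mono: "tail_hull us gs m u g \<Longrightarrow> n \<le> m \<Longrightarrow> tail_hull us gs n u g"
  by (induction rule: tail_hull.induct) (auto intro: tail_hull.intros)

text \<open>Averaging preserves closeness to a number, so elements of late hulls converge pointwise
  to the same limit as the sequence itself.\<close>

lemma tail_hull_close:
  "tail_hull us gs n u g \<Longrightarrow> (\<And>k. k \<ge> n \<Longrightarrow> \<bar>us k x - c\<bar> \<le> e) \<Longrightarrow> \<bar>u x - c\<bar> \<le> e"
  by (induction rule: tail_hull.induct) (auto simp: abs_le_iff field_simps)

lemma set_integrable_sq_comb:
  fixes g h :: "real \<Rightarrow> real"
  assumes "A \<in> sets borel" "g \<in> borel_measurable borel" "h \<in> borel_measurable borel"
    "set_integrable lborel A (\<lambda>x. (g x)\<^sup>2)" "set_integrable lborel A (\<lambda>x. (h x)\<^sup>2)"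
  shows "set_integrable lborel A (\<lambda>x. (a * g x + b * h x)\<^sup>2)"
proof (rule set_integrable_bound[where f = "\<lambda>x. 2 * a\<^sup>2 * (g x)\<^sup>2 + 2 * b\<^sup>2 * (h x)\<^sup>2"])
  note assms(2,3)[measurable]
  show "set_integrable lborel A (\<lambda>x. 2 * a\<^sup>2 * (g x)\<^sup>2 + 2 * b\<^sup>2 * (h x)\<^sup>2)"
    using assms(4,5) by (intro set_integral_add) simp_all
  show "set_borel_measurable lborel A (\<lambda>x. (a * g x + b * h x)\<^sup>2)"
    by (rule set_borel_measurable_lborel[OF assms(1)]) measurable
  have "(a * s + b * t)\<^sup>2 \<le> 2 * a\<^sup>2 * s\<^sup>2 + 2 * b\<^sup>2 * t\<^sup>2" for s t :: real
    using zero_le_power2[of "a * s - b * t"] by (simp add: power2_eq_square algebra_simps)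
  then show "AE x in lborel. x \<in> A \<longrightarrow> norm ((a * g x + b * h x)\<^sup>2) \<le> norm (2 * a\<^sup>2 * (g x)\<^sup>2 + 2 * b\<^sup>2 * (h x)\<^sup>2)"
    by (intro AE_I2) simp
qed

lemma set_integral_parallelogram:
  fixes g h :: "real \<Rightarrow> real"
  assumes "A \<in> sets borel" "g \<in> borel_measurable borel" "h \<in> borel_measurable borel"
    "set_integrable lborel A (\<lambda>x. (g x)\<^sup>2)" "set_integrable lborel A (\<lambda>x. (h x)\<^sup>2)"
  shows "(LINT x:A|lborel. (g x - h x)\<^sup>2) + 4 * (LINT x:A|lborel. ((g x + h x) / 2)\<^sup>2)
    = 2 * (LINT x:A|lborel. (g x)\<^sup>2) + 2 * (LINT x:A|lborel. (h x)\<^sup>2)"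
proof -
  have i1: "set_integrable lborel A (\<lambda>x. (g x - h x)\<^sup>2)"
    using set_integrable_sq_comb[OF assms, of 1 "-1"] by simp
  have i2: "set_integrable lborel A (\<lambda>x. 4 * ((g x + h x) / 2)\<^sup>2)"
    using set_integrable_mult_right[where a = 4, OF set_integrable_sq_comb[OF assms, of "1/2" "1/2"]]
    by (simp add: add_divide_distrib)
  have i3: "set_integrable lborel A (\<lambda>x. 2 * (g x)\<^sup>2)" "set_integrable lborel A (\<lambda>x. 2 * (h x)\<^sup>2)"
    using assms by simp_all
  have "(LINT x:A|lborel. (g x - h x)\<^sup>2) + (LINT x:A|lborel. 4 * ((g x + h x) / 2)\<^sup>2)
      = (LINT x:A|lborel. (g x - h x)\<^sup>2 + 4 * ((g x + h x) / 2)\<^sup>2)"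
    by (rule set_integral_add(2)[OF i1 i2, symmetric])
  also have "\<dots> = (LINT x:A|lborel. 2 * (g x)\<^sup>2 + 2 * (h x)\<^sup>2)"
    by (rule arg_cong[where f = "set_lebesgue_integral lborel A"]) (simp add: fun_eq_iff power2_eq_square field_simps)
  also have "\<dots> = (LINT x:A|lborel. 2 * (g x)\<^sup>2) + (LINT x:A|lborel. 2 * (h x)\<^sup>2)"
    by (rule set_integral_add(2)[OF i3])
  finally show ?thesis by simp
qed

lemma weak_deriv_mid:
  assumes "weak_deriv_on I u g" "weak_deriv_on I v h"
  shows "weak_deriv_on I (\<lambda>x. (u x + v x) / 2) (\<lambda>x. (g x + h x) / 2)"
proof -
  note [measurable] = weak_deriv_onD(1)[OF assms(1)] weak_deriv_onD(1)[OF assms(2)]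
  have "(\<lambda>x. (g x + h x) / 2) \<in> borel_measurable lborel" by measurable
  moreover have "set_integrable lborel {x..y} (\<lambda>x. (g x + h x) / 2) \<and>
      (u y + v y) / 2 - (u x + v x) / 2 = (LINT t:{x..y}|lborel. (g t + h t) / 2)"
    if "x \<in> I" "y \<in> I" "x \<le> y" for x y
  proof -
    note i = weak_deriv_onD(2)[OF assms(1) that] weak_deriv_onD(2)[OF assms(2) that]
    have "(LINT t:{x..y}|lborel. (g t + h t) / 2) = ((u y - u x) + (v y - v x)) / 2"
      unfolding weak_deriv_onD(3)[OF assms(1) that] weak_deriv_onD(3)[OF assms(2) that]
      by (subst set_integral_add(2)[OF i, symmetric]) simp
    then show ?thesis using set_integral_add(1)[OF i] by (simp add: field_simps)
  qed
  ultimately show ?thesis unfolding weak_deriv_on_def by blast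
qed

lemma sq_integrable_Icc:
  fixes f :: "real \<Rightarrow> real"
  assumes "f \<in> borel_measurable borel" "set_integrable lborel {a..b} (\<lambda>x. (f x)\<^sup>2)"
  shows "set_integrable lborel {a..b} f"
proof (rule set_integrable_bound[where f = "\<lambda>x. 1 + (f x)\<^sup>2"])
  show "set_integrable lborel {a..b} (\<lambda>x. 1 + (f x)\<^sup>2)"
    by (intro set_integral_add assms borel_integrable_atLeastAtMost') simp
  show "set_borel_measurable lborel {a..b} f"
    by (rule set_borel_measurable_lborel) (use assms in simp_all)
  have "\<bar>s\<bar> \<le> 1 + s\<^sup>2" for s :: real
    using zero_le_power2[of "\<bar>s\<bar> - 1"] by (simp add: power2_eq_square algebra_simps) 
  then show "AE x in lborel. x \<in> {a..b} \<longrightarrow> norm (f x) \<le> norm (1 + (f x)\<^sup>2)"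
    by (intro AE_I2) simp
qed

text \<open>Mazur's idea in place of weak compactness: elements of almost minimal norm in the tail
  hulls form a Cauchy sequence in L2, and their strong limit is a weak derivative of
  \<open>U\<close>, because the averaged functions still converge pointwise to
  \<open>U\<close>.\<close>

theorem weak_deriv_limit:
  assumes I: "ray I" and wd: "\<And>n. weak_deriv_on I (us n) (gs n)"
    and int: "\<And>n. set_integrable lborel I (\<lambda>x. (gs n x)\<^sup>2)"
    and le: "\<And>n. (LINT x:I|lborel. (gs n x)\<^sup>2) \<le> K"
    and lim: "\<And>x. x \<in> I \<Longrightarrow> (\<lambda>n. us n x) \<longlonglongrightarrow> U x"
  obtains g where "weak_deriv_on I U g" "set_integrable lborel I (\<lambda>x. (g x)\<^sup>2)"
    "(LINT x:I|lborel. (g x)\<^sup>2) \<le> K"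
proof -
  define T where "T = tail_hull us gs"
  define N where "N h = (LINT x:I|lborel. (h x)\<^sup>2)" for h :: "real \<Rightarrow> real"
  note Ib = ray_sets[OF I]
  have N0: "0 \<le> N h" for h unfolding N_def by (rule set_integral_nonneg_real) simp
  have K0: "0 \<le> K" using N0[of "gs 0"] le[of 0] unfolding N_def by simp
  have Tp: "weak_deriv_on I v h \<and> set_integrable lborel I (\<lambda>x. (h x)\<^sup>2)" if "T n v h" for n v h
    using that unfolding T_def
  proof (induction rule: tail_hull.induct)
    case (base k)
    show ?case using wd int by blast
  next
    case (mid u g v h)
    have "set_integrable lborel I (\<lambda>x. (1/2 * g x + 1/2 * h x)\<^sup>2)"
      by (rule set_integrable_sq_comb[OF Ib]) (use mid weak_deriv_onD(1) in blast)+
    then show ?case using mid weak_deriv_mid by (simp add: add_divide_distrib)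
  qed
  have Tm: "h \<in> borel_measurable borel" if "T n v h" for n v h
    by (rule weak_deriv_onD(1)[OF conjunct1[OF Tp[OF that]]])
  have Ti: "set_integrable lborel I (\<lambda>x. (h x)\<^sup>2)" if "T n v h" for n v h
    by (rule conjunct2[OF Tp[OF that]])
  \<comment> \<open>The infima \<open>d n\<close> of the squared norms increase with
    \<open>n\<close>, as the hulls shrink, and stay below \<open>K\<close>; their limit
    \<open>D\<close> controls the norms of all near-minimisers chosen below.\<close>
  define S where "S n = {N h | v h. T n v h}" for n
  define d where "d n = Inf (S n)" for n
  have ne: "S n \<noteq> {}" for n unfolding S_def T_def using tail_hull.base[of n n us gs] by blast
  have bb: "bdd_below (S n)" for n unfolding S_def by (rule bdd_belowI[of _ 0]) (use N0 in auto)
  have dlow: "d n \<le> N h" if "T n v h" for n v h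
    unfolding d_def by (rule cInf_lower[OF _ bb]) (use that in \<open>auto simp: S_def\<close>)
  have dK: "d n \<le> K" for n
  proof -
    have "T n (us n) (gs n)" unfolding T_def by (rule tail_hull.base) simp
    from dlow[OF this] show ?thesis using le[of n] unfolding N_def by simp
  qed
  have "incseq d"
  proof (rule incseq_SucI)
    fix n
    have "S (Suc n) \<subseteq> S n" unfolding S_def T_def using tail_hull_mono[of us gs "Suc n" _ _ n] by auto
    then show "d n \<le> d (Suc n)" unfolding d_def by (rule cInf_superset_mono[OF ne bb])
  qed
  from incseq_convergent[OF this] dK obtain D where D: "d \<longlonglongrightarrow> D" "\<And>n. d n \<le> D" by blast
  define e where "e n = inverse (real (Suc n))" for n
  have e0: "e \<longlonglongrightarrow> 0" unfolding e_def by (rule LIMSEQ_inverse_real_of_nat)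
  have epos: "e n > 0" for n by (simp add: e_def)
  have emono: "e m \<le> e n" if "n \<le> m" for n m using that by (simp add: e_def field_simps)
  \<comment> \<open>The bound by \<open>K\<close> is secured as well: a near-minimiser that violates
    it can be replaced by \<open>gs n\<close>, whose norm is then smaller.\<close>
  have "\<exists>v h. T n v h \<and> N h < d n + e n \<and> N h \<le> K" for n
  proof -
    have "Inf (S n) < d n + e n" using epos[of n] by (simp add: d_def)
    from cInf_lessD[OF ne this] obtain v h where h: "T n v h" "N h < d n + e n" unfolding S_def by blast
    show ?thesis
    proof (cases "N h \<le> K")
      case False
      have "T n (us n) (gs n)" unfolding T_def by (rule tail_hull.base) simp
      moreover have "N (gs n) \<le> K" using le[of n] unfolding N_def by simp
      ultimately show ?thesis using False h(2) by (intro exI[of _ "us n"] exI[of _ "gs n"]) simp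
    qed (use h in blast)
  qed
  then obtain V H where VH: "\<And>n. T n (V n) (H n)" "\<And>n. N (H n) < d n + e n" "\<And>n. N (H n) \<le> K"
    by metis
  \<comment> \<open>What the parallelogram identity leaves: the midpoint contributes at least
    \<open>4 * d n\<close>, while the two ends contribute at most \<open>2 * (d n + e n)\<close> and
    \<open>2 * (D + e n)\<close>.\<close>
  define r where "r n = 2 * (D - d n) + 4 * e n" for n
  have rb: "(LINT x:I|lborel. (H n x - H m x)\<^sup>2) \<le> r n" if "n \<le> m" for n m
  proof -
    have Tm': "T n (V m) (H m)" using tail_hull_mono[OF _ that] VH(1)[of m] unfolding T_def by blast
    have "T n (\<lambda>x. (V n x + V m x) / 2) (\<lambda>x. (H n x + H m x) / 2)"
      using tail_hull.mid VH(1)[of n] Tm' unfolding T_def by blast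
    from dlow[OF this] have "d n \<le> (LINT x:I|lborel. ((H n x + H m x) / 2)\<^sup>2)" unfolding N_def .
    moreover have "(LINT x:I|lborel. (H n x - H m x)\<^sup>2) + 4 * (LINT x:I|lborel. ((H n x + H m x) / 2)\<^sup>2)
        = 2 * N (H n) + 2 * N (H m)"
      unfolding N_def by (rule set_integral_parallelogram[OF Ib Tm[OF VH(1)] Tm[OF VH(1)] Ti[OF VH(1)] Ti[OF VH(1)]])
    moreover define Y where "Y = (LINT x:I|lborel. ((H n x + H m x) / 2)\<^sup>2)"
    moreover define X where "X = (LINT x:I|lborel. (H n x - H m x)\<^sup>2)"
    ultimately have "d n \<le> Y" "X + 4 * Y = 2 * N (H n) + 2 * N (H m)" by simp_all
    then have "X \<le> 2 * (D - d n) + 4 * e n"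
      using VH(2)[of n] VH(2)[of m] emono[OF that] D(2)[of m] by (simp add: algebra_simps)
    then show ?thesis unfolding r_def X_def .
  qed
  have "r \<longlonglongrightarrow> 2 * (D - D) + 4 * 0" unfolding r_def by (intro tendsto_intros D(1) e0)
  then have r0: "r \<longlonglongrightarrow> 0" by simp
  have "\<exists>s. \<forall>n\<ge>s. r n \<le> (1/4) ^ k" for k :: nat
    using order_tendstoD(2)[OF r0, of "(1/4) ^ k"] unfolding eventually_sequentially
    by (auto intro: less_imp_le)
  then obtain s where s: "\<And>k n. n \<ge> s k \<Longrightarrow> r n \<le> (1/4) ^ k" by metis
  \<comment> \<open>Partial sums make the indices monotone, and they lie above both
    \<open>s k\<close> and \<open>k\<close>.\<close>
  define t where "t k = (\<Sum>j\<le>k. s j) + k" for k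
  have ts: "s k \<le> t k" and tk: "k \<le> t k" for k unfolding t_def using member_le_sum[of k "{..k}" s] by auto
  have tmono: "t k \<le> t m" if "k \<le> m" for k m
    unfolding t_def using that sum_mono2[of "{..m}" "{..k}" s] by auto
  have fast: "(LINT x:I|lborel. (H (t k) x - H (t m) x)\<^sup>2) \<le> (1/4) ^ k" if "k \<le> m" for k m
    using rb[OF tmono[OF that]] s[OF ts[of k]] by linarith
  obtain g where g: "g \<in> borel_measurable borel" "AE x in lborel. x \<in> I \<longrightarrow> (\<lambda>k. H (t k) x) \<longlonglongrightarrow> g x"
    "\<And>k. set_integrable lborel I (\<lambda>x. (H (t k) x - g x)\<^sup>2)"
    "\<And>k. (LINT x:I|lborel. (H (t k) x - g x)\<^sup>2) \<le> (1/4) ^ k"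
    by (rule L2_complete_fast[where h = "\<lambda>k. H (t k)", OF Ib Tm[OF VH(1)] Ti[OF VH(1)] fast]) (assumption, rule that, assumption+)
  note g(1)[measurable]
  have g2m: "(\<lambda>x. (g x)\<^sup>2) \<in> borel_measurable borel" by measurable
  have lim2: "AE x in lborel. x \<in> I \<longrightarrow> (\<lambda>k. (H (t k) x)\<^sup>2) \<longlonglongrightarrow> (g x)\<^sup>2"
    using g(2) by eventually_elim (auto intro: tendsto_power)
  have le': "(LINT x:I|lborel. (H (t k) x)\<^sup>2) \<le> K" for k using VH(3) unfolding N_def .
  have F1: "set_integrable lborel I (\<lambda>x. (g x)\<^sup>2)"
    by (rule Fatou_set_integral(1)[OF Ib Ti[OF VH(1)] _ le' K0 g2m lim2]) simp
  have F2: "(LINT x:I|lborel. (g x)\<^sup>2) \<le> K"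
    by (rule Fatou_set_integral(2)[OF Ib Ti[OF VH(1)] _ le' K0 g2m lim2]) simp
  have Vlim: "(\<lambda>k. V (t k) x) \<longlonglongrightarrow> U x" if "x \<in> I" for x
  proof (rule LIMSEQ_I)
    fix \<epsilon> :: real assume "\<epsilon> > 0"
    then have "\<epsilon> / 2 > 0" by simp
    from LIMSEQ_D[OF lim[OF that] this]
    obtain n0 where n0: "\<And>n. n \<ge> n0 \<Longrightarrow> \<bar>us n x - U x\<bar> < \<epsilon> / 2" unfolding real_norm_def by blast
    have "norm (V (t k) x - U x) < \<epsilon>" if "k \<ge> n0" for k
    proof -
      have "\<bar>V (t k) x - U x\<bar> \<le> \<epsilon> / 2"
      proof (rule tail_hull_close[where us = us and gs = gs and n = "t k" and u = "V (t k)" and g = "H (t k)"])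
        show "tail_hull us gs (t k) (V (t k)) (H (t k))" using VH(1) unfolding T_def .
        show "\<bar>us j x - U x\<bar> \<le> \<epsilon> / 2" if "j \<ge> t k" for j
          using n0[of j] that \<open>k \<ge> n0\<close> tk[of k] by linarith
      qed
      then show ?thesis using \<open>\<epsilon> > 0\<close> by simp
    qed
    then show "\<exists>n0. \<forall>k\<ge>n0. norm (V (t k) x - U x) < \<epsilon>" by blast
  qed
  have inc: "set_integrable lborel {x..y} g \<and> U y - U x = (LINT z:{x..y}|lborel. g z)"
    if xy: "x \<in> I" "y \<in> I" "x \<le> y" for x y
  proof
    have sub: "set_integrable lborel {x..y} f" if "set_integrable lborel I f" for f :: "real \<Rightarrow> real"
      by (rule set_integrable_subset[OF that]) (use ray_Icc_subset[OF I xy(1,2)] in simp_all)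
    show gi: "set_integrable lborel {x..y} g"
      by (rule sq_integrable_Icc[OF g(1) sub[OF F1]])
    have Hd: "weak_deriv_on I (V (t k)) (H (t k))" for k by (rule conjunct1[OF Tp[OF VH(1)]])
    have Hi: "set_integrable lborel {x..y} (H (t k))" for k by (rule weak_deriv_onD(2)[OF Hd xy])
    have diff: "\<bar>(V (t k) y - V (t k) x) - (LINT z:{x..y}|lborel. g z)\<bar> \<le> sqrt (y - x) * (1/2) ^ k" for k
    proof -
      have "(V (t k) y - V (t k) x) - (LINT z:{x..y}|lborel. g z) = (LINT z:{x..y}|lborel. H (t k) z - g z)"
        unfolding weak_deriv_onD(3)[OF Hd xy] by (rule set_integral_diff(2)[OF Hi gi, symmetric])
      moreover have "(LINT z:{x..y}|lborel. H (t k) z - g z)\<^sup>2 \<le> (y - x) * (LINT z:{x..y}|lborel. (H (t k) z - g z)\<^sup>2)"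
        by (rule Cauchy_Schwarz_Icc[OF xy(3) set_integral_diff(1)[OF Hi gi] sub[OF g(3)]])
      moreover have "\<dots> \<le> (y - x) * (1/4) ^ k"
        by (intro mult_left_mono order_trans[OF set_integral_subset_mono[OF g(3)] g(4)])
          (use xy ray_Icc_subset[OF I xy(1,2)] in simp_all)
      ultimately have "sqrt (((V (t k) y - V (t k) x) - (LINT z:{x..y}|lborel. g z))\<^sup>2) \<le> sqrt ((y - x) * (1/4) ^ k)"
        by (intro real_sqrt_le_mono) simp
      moreover have "sqrt ((y - x) * (1/4) ^ k) = sqrt (y - x) * (1/2) ^ k"
        by (simp add: real_sqrt_mult real_sqrt_power real_sqrt_divide)
      ultimately show ?thesis unfolding real_sqrt_abs by simp
    qed
    have "(\<lambda>k. (V (t k) y - V (t k) x) - (LINT z:{x..y}|lborel. g z)) \<longlonglongrightarrow> 0"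
    proof (rule Lim_null_comparison)
      show "\<forall>\<^sub>F k in sequentially. norm ((V (t k) y - V (t k) x) - (LINT z:{x..y}|lborel. g z)) \<le> sqrt (y - x) * (1/2) ^ k"
        using diff by (intro always_eventually allI) simp
      show "(\<lambda>k. sqrt (y - x) * (1/2) ^ k) \<longlonglongrightarrow> 0"
        by (rule tendsto_mult_right_zero, rule LIMSEQ_power_zero) simp
    qed
    moreover have "(\<lambda>k. (V (t k) y - V (t k) x) - (LINT z:{x..y}|lborel. g z)) \<longlonglongrightarrow> (U y - U x) - (LINT z:{x..y}|lborel. g z)"
      by (intro tendsto_intros Vlim xy)
    ultimately have "0 = (U y - U x) - (LINT z:{x..y}|lborel. g z)" by (rule LIMSEQ_unique)
    then show "U y - U x = (LINT z:{x..y}|lborel. g z)" by linarith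
  qed
  have "weak_deriv_on I U g" unfolding weak_deriv_on_def using g(1) inc by simp
  then show ?thesis using that F1 F2 by blast
qed

section \<open>The three integrals of an edge; dilation, gluing and splitting\<close>

text \<open>Energy, action, mass and Nehari functional are linear in these three numbers, so cutting
  and gluing become subtraction and addition of triples.\<close>

definition trip :: "real \<Rightarrow> real set \<Rightarrow> (real \<Rightarrow> real) \<Rightarrow> (real \<Rightarrow> real) \<Rightarrow> real \<times> real \<times> real" where
  "trip p I u g = (LINT x:I|lborel. (g x)\<^sup>2, LINT x:I|lborel. \<bar>u x\<bar> powr p, LINT x:I|lborel. (u x)\<^sup>2)"

lemma set_integral_affine:
  fixes f :: "real \<Rightarrow> real"
  assumes "\<tau> > 0" "\<And>x. x \<in> I' \<longleftrightarrow> s + \<tau> * x \<in> I"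
  shows "(LINT x:I|lborel. f x) = \<tau> * (LINT x:I'|lborel. f (s + \<tau> * x))"
    and "set_integrable lborel I' (\<lambda>x. f (s + \<tau> * x)) \<longleftrightarrow> set_integrable lborel I f"
proof -
  have ind: "indicat_real I (s + \<tau> * x) = indicat_real I' x" for x
    using assms(2)[of x] by (simp add: indicator_def)
  show "(LINT x:I|lborel. f x) = \<tau> * (LINT x:I'|lborel. f (s + \<tau> * x))"
    unfolding set_lebesgue_integral_def
    by (subst lborel_integral_real_affine[of \<tau> _ s]) (use assms(1) in \<open>simp_all add: ind\<close>)
  show "set_integrable lborel I' (\<lambda>x. f (s + \<tau> * x)) \<longleftrightarrow> set_integrable lborel I f"
    unfolding set_integrable_def
    by (subst lborel_integrable_real_affine_iff[of \<tau> _ s, symmetric]) (use assms(1) in \<open>simp_all add: ind\<close>)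
qed

lemma h1d_affine:
  assumes h: "h1d I u g" and \<tau>: "\<tau> > 0" and I': "\<And>x. x \<in> I' \<longleftrightarrow> s + \<tau> * x \<in> I"
  shows "h1d I' (\<lambda>x. c * u (s + \<tau> * x)) (\<lambda>x. c * \<tau> * g (s + \<tau> * x))" (is ?H)
    and "trip p I' (\<lambda>x. c * u (s + \<tau> * x)) (\<lambda>x. c * \<tau> * g (s + \<tau> * x)) =
      (c\<^sup>2 * \<tau> * fst (trip p I u g), \<bar>c\<bar> powr p / \<tau> * fst (snd (trip p I u g)), c\<^sup>2 / \<tau> * snd (snd (trip p I u g)))" (is ?T)
proof -
  note d = h1dD[OF h]
  note [measurable] = weak_deriv_onD(1)[OF d(3)]
  have "continuous_on I' (\<lambda>x. c * u (s + \<tau> * x))"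
  proof (intro continuous_on_mult continuous_on_const continuous_on_compose2[OF d(1)])
    show "continuous_on I' (\<lambda>x. s + \<tau> * x)" by (intro continuous_intros)
    show "(\<lambda>x. s + \<tau> * x) ` I' \<subseteq> I" using I' by blast
  qed
  moreover have "set_integrable lborel I' (\<lambda>x. (c * u (s + \<tau> * x))\<^sup>2)"
    using set_integral_affine(2)[OF \<tau> I', of "\<lambda>x. (u x)\<^sup>2"] d(2) by (simp add: power_mult_distrib)
  moreover have "set_integrable lborel I' (\<lambda>x. (c * \<tau> * g (s + \<tau> * x))\<^sup>2)"
    using set_integral_affine(2)[OF \<tau> I', of "\<lambda>x. (g x)\<^sup>2"] d(4) by (simp add: power_mult_distrib)
  moreover have "weak_deriv_on I' (\<lambda>x. c * u (s + \<tau> * x)) (\<lambda>x. c * \<tau> * g (s + \<tau> * x))"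
    unfolding weak_deriv_on_def
  proof (intro conjI ballI impI)
    have "(\<lambda>x. c * \<tau> * g (s + \<tau> * x)) \<in> borel_measurable borel" by measurable
    then show "(\<lambda>x. c * \<tau> * g (s + \<tau> * x)) \<in> borel_measurable lborel" by simp
    fix x y assume xy: "x \<in> I'" "y \<in> I'" "x \<le> y"
    have xy': "s + \<tau> * x \<in> I" "s + \<tau> * y \<in> I" "s + \<tau> * x \<le> s + \<tau> * y" 
      using I'[of x] I'[of y] xy \<tau> by simp_all
    have e: "z \<in> {x..y} \<longleftrightarrow> s + \<tau> * z \<in> {s + \<tau> * x..s + \<tau> * y}" for z using \<tau> by simp
    show "set_integrable lborel {x..y} (\<lambda>x. c * \<tau> * g (s + \<tau> * x))"
      using set_integral_affine(2)[OF \<tau> e, of g] weak_deriv_onD(2)[OF d(3) xy'] by simp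
    have "u (s + \<tau> * y) - u (s + \<tau> * x) = \<tau> * (LINT z:{x..y}|lborel. g (s + \<tau> * z))"
      unfolding weak_deriv_onD(3)[OF d(3) xy'] by (rule set_integral_affine(1)[OF \<tau> e])
    then show "c * u (s + \<tau> * y) - c * u (s + \<tau> * x) = (LINT z:{x..y}|lborel. c * \<tau> * g (s + \<tau> * z))"
      by (simp add: right_diff_distrib[symmetric])
  qed
  ultimately show ?H unfolding h1d_def by blast
  show ?T unfolding trip_def fst_conv snd_conv
    using set_integral_affine(1)[OF \<tau> I', of "\<lambda>x. (g x)\<^sup>2"] set_integral_affine(1)[OF \<tau> I', of "\<lambda>x. (u x)\<^sup>2"]
      set_integral_affine(1)[OF \<tau> I', of "\<lambda>x. \<bar>u x\<bar> powr p"] \<tau>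
    by (simp add: power_mult_distrib abs_mult powr_mult) (simp add: power2_eq_square)
qed

lemma h1d_C1:
  assumes "ray I" and der: "\<And>x. (u has_real_derivative g x) (at x)" and cont: "continuous_on UNIV g"
    and "set_integrable lborel I (\<lambda>x. (u x)\<^sup>2)" "set_integrable lborel I (\<lambda>x. (g x)\<^sup>2)"
  shows "h1d I u g"
proof -
  have cu: "continuous_on A u" for A
    using der by (intro continuous_at_imp_continuous_on ballI) (rule DERIV_isCont)
  have "weak_deriv_on I u g" unfolding weak_deriv_on_def
  proof (intro conjI ballI impI)
    show "g \<in> borel_measurable lborel" using borel_measurable_continuous_onI[OF cont] by simp
    fix x y :: real assume xy: "x \<le> y"
    have cg: "continuous_on {x..y} g" using cont by (rule continuous_on_subset) simp
    then show "set_integrable lborel {x..y} g" by (rule borel_integrable_atLeastAtMost')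
    show "u y - u x = (LINT t:{x..y}|lborel. g t)" unfolding set_lebesgue_integral_def
    proof (rule integral_FTC_atLeastAtMost[OF xy _ cg, symmetric])
      show "(u has_vector_derivative g z) (at z within {x..y})" for z
        by (rule has_vector_derivative_at_within[OF has_real_derivative_iff_has_vector_derivative[THEN iffD1, OF der]])
    qed
  qed
  then show ?thesis unfolding h1d_def using cu assms(4,5) by blast
qed

lemma h1d_const: "a \<le> b \<Longrightarrow> h1d {a..b} (\<lambda>_. c) (\<lambda>_. 0)"
  by (rule h1d_C1) (auto intro!: borel_integrable_atLeastAtMost' derivative_eq_intros continuous_intros)

lemma trip_const: "a \<le> b \<Longrightarrow> trip p {a..b} (\<lambda>_. c) (\<lambda>_. 0) = (0, (b - a) * \<bar>c\<bar> powr p, (b - a) * c\<^sup>2)"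
  by (simp add: trip_def set_integral_const)

lemma h1d_linear: "a \<le> b \<Longrightarrow> h1d {a..b} (\<lambda>x. c + d * x) (\<lambda>_. d)"
  by (rule h1d_C1) (auto intro!: borel_integrable_atLeastAtMost' derivative_eq_intros continuous_intros)

definition glue :: "real \<Rightarrow> (real \<Rightarrow> real) \<Rightarrow> (real \<Rightarrow> real) \<Rightarrow> real \<Rightarrow> real" where
  "glue b f f' x = (if x \<le> b then f x else f' x)"

lemma set_integral_glue:
  fixes f f' F :: "real \<Rightarrow> real"
  assumes A: "A \<in> sets borel" "A \<subseteq> {..b}" and B: "B \<in> sets borel" "B \<subseteq> {b..}"
    and "set_integrable lborel A f" "set_integrable lborel B f'"
    and F: "\<And>x. x \<in> A \<Longrightarrow> F x = f x" "\<And>x. x \<in> B \<Longrightarrow> x \<noteq> b \<Longrightarrow> F x = f' x"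
  shows "set_integrable lborel (A \<union> B) F"
    and "(LINT x:A \<union> B|lborel. F x) = (LINT x:A|lborel. f x) + (LINT x:B|lborel. f' x)"
proof -
  have iA: "set_integrable lborel A F"
    by (subst set_integrable_cong[OF refl refl F(1)]) (simp_all add: assms(5))
  have BA: "set_integrable lborel (B - {b}) F"
  proof -
    have "set_integrable lborel (B - {b}) f'"
      by (rule set_integrable_subset[OF assms(6)]) (use B in auto)
    moreover have "set_integrable lborel (B - {b}) F = set_integrable lborel (B - {b}) f'"
      by (rule set_integrable_cong[OF refl refl F(2)]) simp_all
    ultimately show ?thesis by simp
  qed
  have nu: "AE x in lborel. x \<noteq> b" by (rule AE_lborel_singleton)
  have iB: "set_integrable lborel B F"
  proof -
    have "integrable lborel (\<lambda>x. indicat_real (B - {b}) x *\<^sub>R F x) = integrable lborel (\<lambda>x. indicat_real B x *\<^sub>R F x)"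
      by (rule integrable_discrete_difference[of "{b}"]) (auto simp: indicator_def)
    with BA show ?thesis unfolding set_integrable_def by simp
  qed
  show int: "set_integrable lborel (A \<union> B) F"
    by (rule set_integrable_Un[OF iA iB]) (use A B in simp_all)
  have "(LINT x:B|lborel. F x) = (LINT x:B|lborel. f' x)"
    unfolding set_lebesgue_integral_def
    by (rule integral_discrete_difference[of "{b}"]) (use F(2) in \<open>auto simp: indicator_def\<close>)
  moreover have "(LINT x:A|lborel. F x) = (LINT x:A|lborel. f x)"
    unfolding set_lebesgue_integral_def
    by (rule Bochner_Integration.integral_cong) (use F(1) in \<open>auto simp: indicator_def\<close>)
  ultimately show "(LINT x:A \<union> B|lborel. F x) = (LINT x:A|lborel. f x) + (LINT x:B|lborel. f' x)"
    using set_integral_split_at[OF int A(1) B(1) A(2) B(2)] by simp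
qed

text \<open>Only the values have to match at the seam. The derivative may jump there, since a single
  point has measure zero.\<close>

lemma h1d_glue:
  assumes ab: "a \<le> b" and h1: "h1d {a..b} u g" and J: "J = {b..} \<or> (\<exists>c\<ge>b. J = {b..c})" and h2: "h1d J v h"
    and eq: "u b = v b" and p: "2 < p"
  shows "h1d ({a..b} \<union> J) (glue b u v) (glue b g h)"
    and "trip p ({a..b} \<union> J) (glue b u v) (glue b g h) = trip p {a..b} u g + trip p J v h"
proof -
  have rJ: "ray J" using J by auto
  have bJ: "b \<in> J" "J \<subseteq> {b..}" using J by auto
  note d1 = h1dD[OF h1] and d2 = h1dD[OF h2]
  have JB: "J \<in> sets borel" by (rule ray_sets[OF rJ])
  have v: "glue b u v x = v x" if "x \<in> J" for x using that bJ eq by (auto simp: glue_def)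
  have gl: "glue b g h x = h x" if "x \<in> J" "x \<noteq> b" for x using that bJ by (auto simp: glue_def)
  have uu: "glue b u v x = u x" "glue b g h x = g x" if "x \<in> {a..b}" for x using that by (auto simp: glue_def)
  note [measurable] = weak_deriv_onD(1)[OF d1(3)] weak_deriv_onD(1)[OF d2(3)]
  have sI: "{a..b} \<in> sets borel" "{a..b} \<subseteq> {..b}" by auto
  note glI = set_integral_glue[OF sI JB bJ(2)]
  have "continuous_on ({a..b} \<union> J) (glue b u v)"
  proof (rule continuous_on_closed_Un)
    show "closed J" using J by auto
    show "continuous_on {a..b} (glue b u v)" using d1(1) by (rule continuous_on_eq) (simp add: uu)
    show "continuous_on J (glue b u v)" using d2(1) by (rule continuous_on_eq) (simp add: v)
  qed simp
  moreover have "set_integrable lborel ({a..b} \<union> J) (\<lambda>x. (glue b u v x)\<^sup>2)"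
    by (rule glI(1)[OF d1(2) d2(2)]) (simp_all add: uu v)
  moreover have "set_integrable lborel ({a..b} \<union> J) (\<lambda>x. (glue b g h x)\<^sup>2)"
    by (rule glI(1)[OF d1(4) d2(4)]) (simp_all add: uu gl)
  moreover have "weak_deriv_on ({a..b} \<union> J) (glue b u v) (glue b g h)"
    unfolding weak_deriv_on_def
  proof (intro conjI ballI impI)
    have "glue b g h \<in> borel_measurable borel" unfolding glue_def[abs_def] by measurable
    then show "glue b g h \<in> borel_measurable lborel" by simp
    fix x y assume xy: "x \<in> {a..b} \<union> J" "y \<in> {a..b} \<union> J" "x \<le> y"
    have "set_integrable lborel {x..y} (glue b g h) \<and>
       glue b u v y - glue b u v x = (LINT t:{x..y}|lborel. glue b g h t)"
    proof -
      consider "y \<le> b" | "b \<le> x" | "x < b" "b < y" by linarith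
      then show ?thesis
      proof cases
        case 1
        have y: "x \<in> {a..b}" "y \<in> {a..b}" using 1 xy ab bJ by auto
        then have "\<And>z. z \<in> {x..y} \<Longrightarrow> glue b g h z = g z" using uu by simp
        then have "set_integrable lborel {x..y} (glue b g h) = set_integrable lborel {x..y} g"
          "(LINT t:{x..y}|lborel. glue b g h t) = (LINT t:{x..y}|lborel. g t)"
          by - (rule set_integrable_cong[OF refl refl], simp, rule set_lebesgue_integral_cong, simp_all)
        then show ?thesis using weak_deriv_onD(2,3)[OF d1(3) y xy(3)] uu[OF y(1)] uu[OF y(2)] by simp
      next
        case 2
        have "x = b" if "x \<in> {a..b}" using that 2 by simp
        moreover have "y = b" if "y \<in> {a..b}" using that 2 xy by simp
        ultimately have y: "x \<in> J" "y \<in> J" using xy bJ by auto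
        have s: "{x..y} \<subseteq> J" by (rule ray_Icc_subset[OF rJ y])
        have B: "{x..y} \<subseteq> {b..}" using 2 by simp
        have F: "\<And>z. z \<in> {} \<Longrightarrow> glue b g h z = g z" "\<And>z. z \<in> {x..y} \<Longrightarrow> z \<noteq> b \<Longrightarrow> glue b g h z = h z"
          using s by (simp, intro gl) auto
        note q = set_integral_glue[OF _ _ _ B set_integrable_empty weak_deriv_onD(2)[OF d2(3) y xy(3)] F, simplified]
        have "(LINT t:{}|lborel. g t) = 0" by (simp add: set_lebesgue_integral_def)
        then show ?thesis using q weak_deriv_onD(3)[OF d2(3) y xy(3)] v[OF y(1)] v[OF y(2)] by simp
      next
        case 3
        have y: "x \<in> {a..b}" "b \<in> {a..b}" "y \<in> J" using 3 xy ab bJ by auto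
        have s: "{b..y} \<subseteq> J" by (rule ray_Icc_subset[OF rJ bJ(1) y(3)])
        have B: "{x..b} \<subseteq> {..b}" "{b..y} \<subseteq> {b..}" by auto
        have F: "glue b g h z = g z" if "z \<in> {x..b}" for z using that y(1) by (intro uu) simp
        have F': "glue b g h z = h z" if "z \<in> {b..y}" "z \<noteq> b" for z using that s by (intro gl) auto
        have xb: "x \<le> b" "b \<le> y" using 3 by simp_all
        have sb: "{x..b} \<in> sets borel" "{b..y} \<in> sets borel" by simp_all
        note gi = weak_deriv_onD(2)[OF d1(3) y(1,2) xb(1)] weak_deriv_onD(2)[OF d2(3) bJ(1) y(3) xb(2)]
        note set_integral_glue[OF sb(1) B(1) sb(2) B(2) gi F F']
        moreover have "{x..b} \<union> {b..y} = {x..y}" using 3 by auto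
        ultimately show ?thesis
          using weak_deriv_onD(3)[OF d1(3) y(1,2) xb(1)] weak_deriv_onD(3)[OF d2(3) bJ(1) y(3) xb(2)] v[OF y(3)] uu(1)[OF y(1)] eq
          by simp
      qed
    qed
    then show "set_integrable lborel {x..y} (glue b g h)"
      "glue b u v y - glue b u v x = (LINT t:{x..y}|lborel. glue b g h t)" by blast+
  qed
  ultimately show "h1d ({a..b} \<union> J) (glue b u v) (glue b g h)" unfolding h1d_def by blast
  have "(LINT x:{a..b} \<union> J|lborel. (glue b g h x)\<^sup>2) = (LINT x:{a..b}|lborel. (g x)\<^sup>2) + (LINT x:J|lborel. (h x)\<^sup>2)"
    by (rule glI(2)[OF d1(4) d2(4)]) (simp_all add: uu gl)
  moreover have "(LINT x:{a..b} \<union> J|lborel. (glue b u v x)\<^sup>2) = (LINT x:{a..b}|lborel. (u x)\<^sup>2) + (LINT x:J|lborel. (v x)\<^sup>2)"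
    by (rule glI(2)[OF d1(2) d2(2)]) (simp_all add: uu v)
  moreover have "(LINT x:{a..b} \<union> J|lborel. \<bar>glue b u v x\<bar> powr p) = (LINT x:{a..b}|lborel. \<bar>u x\<bar> powr p) + (LINT x:J|lborel. \<bar>v x\<bar> powr p)"
    by (rule glI(2)[OF h1d_powr_integrable[OF ray_Icc[OF ab] h1 p] h1d_powr_integrable[OF rJ h2 p]]) (simp_all add: uu v)
  ultimately show "trip p ({a..b} \<union> J) (glue b u v) (glue b g h) = trip p {a..b} u g + trip p J v h"
    by (simp add: trip_def)
qed

lemma trip_split_Icc:
  assumes "a \<le> b" "b \<le> c" "h1d {a..c} u g" "2 < p"
  shows "trip p {a..c} u g = trip p {a..b} u g + trip p {b..c} u g"
proof -
  have "ray {a..c}" using assms by simp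
  note i = h1dD(4)[OF assms(3)] h1d_powr_integrable[OF this assms(3,4)] h1dD(2)[OF assms(3)]
  show ?thesis unfolding trip_def add_Pair by (simp only: i[THEN set_integral_Icc_split[OF assms(1,2)]])
qed

lemma trip_split_Ici:
  assumes "a \<le> b" "h1d {a..} u g" "2 < p"
  shows "trip p {a..} u g = trip p {a..b} u g + trip p {b..} u g"
proof -
  note i = h1dD(4)[OF assms(2)] h1d_powr_integrable[OF ray_Ici assms(2,3)] h1dD(2)[OF assms(2)]
  show ?thesis unfolding trip_def add_Pair by (simp only: i[THEN set_integral_Ici_split[OF assms(1)]])
qed

text \<open>Energy plus \<open>c\<close> times mass; with \<open>c = 0\<close> it is the energy
  itself.\<close>

definition act :: "real \<Rightarrow> real \<Rightarrow> real \<times> real \<times> real \<Rightarrow> real" where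
  "act p c T = fst T / 2 - fst (snd T) / p + c * snd (snd T)"

lemma act_add: "act p c (x + y) = act p c x + act p c y"
  by (simp add: act_def algebra_simps add_divide_distrib)

lemma act_sum: "act p c (\<Sum>i\<in>A. f i) = (\<Sum>i\<in>A. act p c (f i))"
  by (induction A rule: infinite_finite_induct) (simp_all add: act_add, simp_all add: act_def)

lemma act_trip:
  assumes I: "ray I" and h: "h1d I u g" and p: "2 < p"
  shows "set_integrable lborel I (\<lambda>x. (g x)\<^sup>2 / 2 - \<bar>u x\<bar> powr p / p + c * (u x)\<^sup>2)"
    and "act p c (trip p I u g) = (LINT x:I|lborel. (g x)\<^sup>2 / 2 - \<bar>u x\<bar> powr p / p + c * (u x)\<^sup>2)"
proof -
  note d = h1dD[OF h]
  have i: "set_integrable lborel I (\<lambda>x. (g x)\<^sup>2 / 2)" "set_integrable lborel I (\<lambda>x. \<bar>u x\<bar> powr p / p)"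
    "set_integrable lborel I (\<lambda>x. c * (u x)\<^sup>2)"
    using d(2,4) h1d_powr_integrable[OF I h p] by simp_all
  note i' = set_integral_diff[OF i(1,2)]
  show "set_integrable lborel I (\<lambda>x. (g x)\<^sup>2 / 2 - \<bar>u x\<bar> powr p / p + c * (u x)\<^sup>2)"
    by (rule set_integral_add(1)[OF i'(1) i(3)])
  show "act p c (trip p I u g) = (LINT x:I|lborel. (g x)\<^sup>2 / 2 - \<bar>u x\<bar> powr p / p + c * (u x)\<^sup>2)"
    unfolding set_integral_add(2)[OF i'(1) i(3)] i'(2) by (simp add: act_def trip_def)
qed

section \<open>The soliton calibration\<close>

locale nls =
  fixes p :: real
  assumes p2: "2 < p" and p6: "p < 6"
begin

text \<open>For height one this is \<open>sqrt (2 * W s)\<close> with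
  \<open>W s = (s\<^sup>2 - s powr p) / p\<close>, the modulus of the slope of the soliton at level
  \<open>s\<close>. Its primitive \<open>\<Phi>1\<close> is the least action of a passage between
  the level 0 and the level \<open>t\<close>.\<close>

definition \<sigma> :: "real \<Rightarrow> real" where "\<sigma> s = sqrt (2 * (s\<^sup>2 - s powr p) / p)"
definition \<Phi>1 :: "real \<Rightarrow> real" where "\<Phi>1 t = integral {0..t} \<sigma>"
definition \<kappa> :: real where "\<kappa> = \<Phi>1 1"
text \<open>The multiplier for which \<open>lam M * s\<^sup>2 - s powr p / p\<close> vanishes at
  \<open>s = M\<close>, so that the corresponding soliton has height \<open>M\<close>.\<close>

definition lam :: "real \<Rightarrow> real" where "lam M = M powr (p - 2) / p"
text \<open>The crossing cost for height \<open>M\<close>, reduced by scaling to height one;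
  \<open>sg M\<close> is its derivative.\<close>

definition \<Phi> :: "real \<Rightarrow> real \<Rightarrow> real" where "\<Phi> M t = M powr (1 + p / 2) * \<Phi>1 (t / M)"
definition sg :: "real \<Rightarrow> real \<Rightarrow> real" where "sg M t = M powr (p / 2) * \<sigma> (t / M)"

lemma powr_split2: "s \<ge> 0 \<Longrightarrow> s powr p = s powr (p - 2) * s\<^sup>2"
  by (cases "s = 0") (simp_all add: powr_diff powr_numeral)

lemma w_nonneg:
  assumes "0 \<le> s" "s \<le> 1" shows "0 \<le> s\<^sup>2 - s powr p"
proof -
  have "s powr (p - 2) * s\<^sup>2 \<le> 1 * s\<^sup>2"
    using powr_mono2[of "p - 2" s 1] assms p2 by (intro mult_right_mono) simp_all
  then show ?thesis using powr_split2[OF assms(1)] by simp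
qed

lemma w_pos:
  assumes "0 < s" "s < 1" shows "0 < s\<^sup>2 - s powr p"
proof -
  have "s powr (p - 2) < 1 powr (p - 2)" by (rule powr_less_mono2) (use assms p2 in simp_all)
  then have "s powr (p - 2) * s\<^sup>2 < 1 * s\<^sup>2" using assms by (intro mult_strict_right_mono) simp_all
  then show ?thesis using powr_split2[of s] assms by simp
qed

lemma \<sigma>_cont: "continuous_on {0..t} \<sigma>"
  unfolding \<sigma>_def[abs_def]
  by (intro continuous_intros continuous_on_powr') (use p2 in auto)

lemma \<sigma>_nonneg: "0 \<le> s \<Longrightarrow> s \<le> 1 \<Longrightarrow> 0 \<le> \<sigma> s"
  unfolding \<sigma>_def using w_nonneg[of s] p2 by simp

lemma \<sigma>_pos: "0 < s \<Longrightarrow> s < 1 \<Longrightarrow> 0 < \<sigma> s"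
  unfolding \<sigma>_def using w_pos[of s] p2 by simp

lemma \<sigma>_le: "0 \<le> s \<Longrightarrow> \<sigma> s \<le> sqrt (2 / p) * s"
proof -
  assume "0 \<le> s"
  have "\<sigma> s \<le> sqrt (2 / p * s\<^sup>2)"
    unfolding \<sigma>_def using p2 by (intro real_sqrt_le_mono) (simp add: field_simps)
  also have "sqrt (2 / p * s\<^sup>2) = sqrt (2 / p) * s"
    unfolding real_sqrt_mult using \<open>0 \<le> s\<close> by simp
  finally show "\<sigma> s \<le> sqrt (2 / p) * s" .
qed

lemma \<Phi>1_deriv: "t \<in> {0..1} \<Longrightarrow> (\<Phi>1 has_real_derivative \<sigma> t) (at t within {0..1})"
  unfolding \<Phi>1_def[abs_def] by (rule integral_has_real_derivative[OF \<sigma>_cont])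

lemma \<Phi>1_0 [simp]: "\<Phi>1 0 = 0" by (simp add: \<Phi>1_def)

lemma \<Phi>1_cont: "continuous_on {0..1} \<Phi>1"
  by (rule DERIV_continuous_on[OF \<Phi>1_deriv])

lemma \<Phi>1_strict:
  assumes "0 \<le> s" "s < t" "t \<le> 1" shows "\<Phi>1 s < \<Phi>1 t"
proof (rule DERIV_pos_imp_increasing_open[OF assms(2)])
  fix x assume x: "s < x" "x < t"
  have "at x within {0..1} = at x" by (rule at_within_Icc_at) (use assms x in auto)
  then show "\<exists>y. DERIV \<Phi>1 x :> y \<and> 0 < y"
    using \<Phi>1_deriv[of x] \<sigma>_pos[of x] assms x by auto
next
  show "continuous_on {s..t} \<Phi>1" by (rule continuous_on_subset[OF \<Phi>1_cont]) (use assms in auto)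
qed

lemma \<Phi>1_le: assumes "0 \<le> t" "t \<le> 1" shows "\<Phi>1 t \<le> sqrt (2 / p) * t"
proof -
  have "\<Phi>1 t \<le> integral {0..t} (\<lambda>_. sqrt (2 / p) * t)"
    unfolding \<Phi>1_def
  proof (rule integral_le)
    show "\<sigma> integrable_on {0..t}" by (rule integrable_continuous_real[OF \<sigma>_cont])
    show "\<sigma> x \<le> sqrt (2 / p) * t" if "x \<in> {0..t}" for x
      by (rule order_trans[OF \<sigma>_le mult_left_mono]) (use that p2 in simp_all)
  qed (rule integrable_const_ivl)
  also have "\<dots> = t * (sqrt (2 / p) * t)" using assms by simp
  also have "\<dots> \<le> 1 * (sqrt (2 / p) * t)" using assms p2 by (intro mult_right_mono) simp_all
  finally show ?thesis by simp
qed

lemma \<kappa>_pos: "\<kappa> > 0" unfolding \<kappa>_def using \<Phi>1_strict[of 0 1] by simp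

lemma lam_pos: "M > 0 \<Longrightarrow> lam M > 0" unfolding lam_def using p2 by simp

lemma \<Phi>_0 [simp]: "\<Phi> M 0 = 0" by (simp add: \<Phi>_def)
lemma \<Phi>_max: "M > 0 \<Longrightarrow> \<Phi> M M = \<kappa> * M powr (1 + p / 2)" by (simp add: \<Phi>_def \<kappa>_def)

lemma \<Phi>_strict: "M > 0 \<Longrightarrow> 0 \<le> s \<Longrightarrow> s < t \<Longrightarrow> t \<le> M \<Longrightarrow> \<Phi> M s < \<Phi> M t"
  unfolding \<Phi>_def by (intro mult_strict_left_mono \<Phi>1_strict) (simp_all add: divide_strict_right_mono)

lemma \<Phi>_mono: "M > 0 \<Longrightarrow> 0 \<le> s \<Longrightarrow> s \<le> t \<Longrightarrow> t \<le> M \<Longrightarrow> \<Phi> M s \<le> \<Phi> M t"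
  using \<Phi>_strict[of M s t] by (cases "s = t") auto

lemma \<Phi>_nonneg: "M > 0 \<Longrightarrow> 0 \<le> t \<Longrightarrow> t \<le> M \<Longrightarrow> 0 \<le> \<Phi> M t"
  using \<Phi>_mono[of M 0 t] by simp

lemma \<Phi>_pos: "M > 0 \<Longrightarrow> 0 < t \<Longrightarrow> t \<le> M \<Longrightarrow> 0 < \<Phi> M t"
  using \<Phi>_strict[of M 0 t] by simp

lemma powr_1_half: "M > 0 \<Longrightarrow> M powr (1 + p / 2) = M * M powr (p / 2)"
  by (simp add: powr_add)

lemma \<Phi>_le: assumes "M > 0" "0 \<le> t" "t \<le> M" shows "\<Phi> M t \<le> M powr (p / 2) * sqrt (2 / p) * t"
proof -
  have "M powr (1 + p / 2) * \<Phi>1 (t / M) \<le> M powr (1 + p / 2) * (sqrt (2 / p) * (t / M))"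
    using assms by (intro mult_left_mono \<Phi>1_le) simp_all
  then show ?thesis using assms by (simp add: \<Phi>_def powr_1_half)
qed

lemma \<Phi>_deriv:
  assumes "M > 0" "t \<in> {0..M}"
  shows "(\<Phi> M has_real_derivative sg M t) (at t within {0..M})"
proof -
  have "((\<lambda>t. t / M) has_real_derivative 1 / M) (at t within {0..M})"
    using assms by (auto intro!: derivative_eq_intros)
  moreover have "(\<Phi>1 has_real_derivative \<sigma> (t / M)) (at (t / M) within (\<lambda>t. t / M) ` {0..M})"
    by (rule has_field_derivative_subset[OF \<Phi>1_deriv]) (use assms in auto)
  ultimately have "(\<Phi>1 \<circ> (\<lambda>t. t / M) has_real_derivative \<sigma> (t / M) * (1 / M)) (at t within {0..M})"
    by (rule DERIV_image_chain[rotated])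
  from DERIV_cmult[OF this, of "M powr (1 + p / 2)"]
  show ?thesis using assms unfolding \<Phi>_def[abs_def] sg_def o_def by (simp add: powr_1_half)
qed

lemma sg_cont: assumes "M > 0" shows "continuous_on {0..M} (sg M)"
  unfolding sg_def[abs_def]
  by (insert assms, intro continuous_on_mult continuous_on_const continuous_on_compose2[OF \<sigma>_cont[of 1]]
      continuous_on_divide continuous_on_id) auto

lemma sg_nonneg: "M > 0 \<Longrightarrow> 0 \<le> t \<Longrightarrow> t \<le> M \<Longrightarrow> 0 \<le> sg M t"
  unfolding sg_def by (intro mult_nonneg_nonneg \<sigma>_nonneg) simp_all

lemma sg_le: "M > 0 \<Longrightarrow> 0 \<le> t \<Longrightarrow> sg M t \<le> M powr (p / 2) * sqrt (2 / p) / M * t"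
  unfolding sg_def using \<sigma>_le[of "t / M"] by (simp add: field_simps)

lemma sg_sq:
  assumes "M > 0" "0 \<le> t" "t \<le> M"
  shows "(sg M t)\<^sup>2 / 2 = lam M * t\<^sup>2 - t powr p / p"
proof -
  have "(M powr (p / 2))\<^sup>2 = M powr p" using assms by (simp flip: powr_numeral powr_powr) (simp add: powr_powr powr_numeral)
  moreover have "(\<sigma> (t / M))\<^sup>2 = 2 * ((t / M)\<^sup>2 - (t / M) powr p) / p"
    unfolding \<sigma>_def using w_nonneg[of "t / M"] assms p2 by (intro real_sqrt_pow2) simp
  moreover have "M powr p * (t / M)\<^sup>2 = M powr (p - 2) * t\<^sup>2"
    using assms powr_split2[of M] by (simp add: power_divide)
  moreover have "M powr p * (t / M) powr p = t powr p" using assms by (simp add: powr_divide)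
  ultimately show ?thesis unfolding sg_def lam_def power_mult_distrib
    by (simp add: diff_divide_distrib right_diff_distrib)
qed

lemma act_integrand_nonneg:
  assumes "M > 0" "0 \<le> t" "t \<le> M"
  shows "0 \<le> g\<^sup>2 / 2 - \<bar>t\<bar> powr p / p + lam M * t\<^sup>2"
proof -
  have "0 \<le> lam M * t\<^sup>2 - t powr p / p"
    unfolding sg_sq[OF assms, symmetric] by simp
  moreover have "0 \<le> g\<^sup>2 / 2" "\<bar>t\<bar> = t" using assms by simp_all
  ultimately show ?thesis by linarith
qed

lemma act_nonneg:
  assumes "ray I" "h1d I u g" "M > 0" "\<And>x. x \<in> I \<Longrightarrow> 0 \<le> u x \<and> u x \<le> M"
  shows "0 \<le> act p (lam M) (trip p I u g)"
  unfolding act_trip(2)[OF assms(1,2) p2]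
  by (rule set_integral_nonneg_real, rule act_integrand_nonneg) (use assms in auto)

text \<open>Completing the square: \<open>(sg M t)\<^sup>2 / 2\<close> is the potential part of the
  integrand, and \<open>sg M (u z) * g z\<close> is the derivative of
  \<open>\<Phi> M (u z)\<close>.\<close>

lemma calib_eq:
  assumes xy: "x \<le> y" and h: "h1d {x..y} u g" and M: "M > 0" and u: "\<And>z. z \<in> {x..y} \<Longrightarrow> 0 \<le> u z \<and> u z \<le> M"
  shows "set_integrable lborel {x..y} (\<lambda>z. (g z - sg M (u z))\<^sup>2 / 2)"
    "act p (lam M) (trip p {x..y} u g) = \<Phi> M (u y) - \<Phi> M (u x) + (LINT z:{x..y}|lborel. (g z - sg M (u z))\<^sup>2 / 2)"
proof -
  have r: "ray {x..y}" using xy by simp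
  note d = h1dD[OF h]
  have ch: "set_integrable lborel {x..y} (\<lambda>z. sg M (u z) * g z)"
    "\<Phi> M (u y) - \<Phi> M (u x) = (LINT z:{x..y}|lborel. sg M (u z) * g z)"
    by (rule weak_chain_rule[OF r d(1,3) _ _ xy _ _ \<Phi>_deriv[OF M] sg_cont[OF M]]; use xy u in simp)+
  have e: "((g z)\<^sup>2 / 2 - \<bar>u z\<bar> powr p / p + lam M * (u z)\<^sup>2) - sg M (u z) * g z = (g z - sg M (u z))\<^sup>2 / 2"
    if "z \<in> {x..y}" for z
  proof -
    have "(sg M (u z))\<^sup>2 / 2 = lam M * (u z)\<^sup>2 - u z powr p / p" using sg_sq[OF M, of "u z"] u[OF that] by simp
    moreover have "\<bar>u z\<bar> = u z" using u[OF that] by simp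
    ultimately show ?thesis by (simp add: power2_eq_square algebra_simps)
  qed
  note a = act_trip[OF r h p2, of "lam M"]
  have i: "set_integrable lborel {x..y} (\<lambda>z. ((g z)\<^sup>2 / 2 - \<bar>u z\<bar> powr p / p + lam M * (u z)\<^sup>2) - sg M (u z) * g z)"
    by (rule set_integral_diff(1)[OF a(1) ch(1)])
  have "set_integrable lborel {x..y} (\<lambda>z. ((g z)\<^sup>2 / 2 - \<bar>u z\<bar> powr p / p + lam M * (u z)\<^sup>2) - sg M (u z) * g z)
    \<longleftrightarrow> set_integrable lborel {x..y} (\<lambda>z. (g z - sg M (u z))\<^sup>2 / 2)"
    by (rule set_integrable_cong[OF refl refl e])
  with i show "set_integrable lborel {x..y} (\<lambda>z. (g z - sg M (u z))\<^sup>2 / 2)" by blast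
  have "(LINT z:{x..y}|lborel. (g z - sg M (u z))\<^sup>2 / 2) =
     (LINT z:{x..y}|lborel. ((g z)\<^sup>2 / 2 - \<bar>u z\<bar> powr p / p + lam M * (u z)\<^sup>2) - sg M (u z) * g z)"
    by (rule set_lebesgue_integral_cong) (simp, use e in metis)
  also have "\<dots> = act p (lam M) (trip p {x..y} u g) - (\<Phi> M (u y) - \<Phi> M (u x))"
    unfolding a(2) ch(2) by (rule set_integral_diff(2)[OF a(1) ch(1)])
  finally show "act p (lam M) (trip p {x..y} u g) = \<Phi> M (u y) - \<Phi> M (u x) + (LINT z:{x..y}|lborel. (g z - sg M (u z))\<^sup>2 / 2)"
    by linarith
qed

text \<open>Upward passages are covered by \<open>calib_eq\<close>; for downward ones the square
  \<open>(g z + sg M (u z))\<^sup>2\<close> is used instead.\<close>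

lemma calib:
  assumes "x \<le> y" "h1d {x..y} u g" "M > 0" "\<And>z. z \<in> {x..y} \<Longrightarrow> 0 \<le> u z \<and> u z \<le> M"
  shows "\<bar>\<Phi> M (u y) - \<Phi> M (u x)\<bar> \<le> act p (lam M) (trip p {x..y} u g)"
proof -
  have "\<Phi> M (u y) - \<Phi> M (u x) \<le> act p (lam M) (trip p {x..y} u g)"
    using calib_eq(2)[OF assms] set_integral_nonneg_real[of "{x..y}" "\<lambda>z. (g z - sg M (u z))\<^sup>2 / 2" lborel] by simp
  moreover have "\<Phi> M (u x) - \<Phi> M (u y) \<le> act p (lam M) (trip p {x..y} u g)"
  proof -
    define u' g' where "u' z = 1 * u (0 + 1 * z)" and "g' z = 1 * 1 * g (0 + 1 * z)" for z
    have r: "ray {x..y}" using assms by simp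
    note d = h1dD[OF assms(2)]
    have ch: "set_integrable lborel {x..y} (\<lambda>z. sg M (u z) * g z)"
      "\<Phi> M (u y) - \<Phi> M (u x) = (LINT z:{x..y}|lborel. sg M (u z) * g z)"
      by (rule weak_chain_rule[OF r d(1,3) _ _ assms(1) _ _ \<Phi>_deriv[OF assms(3)] sg_cont[OF assms(3)]]; use assms in simp)+
    note a = act_trip[OF r assms(2) p2, of "lam M"]
    have "0 \<le> (LINT z:{x..y}|lborel. ((g z)\<^sup>2 / 2 - \<bar>u z\<bar> powr p / p + lam M * (u z)\<^sup>2) + sg M (u z) * g z)"
    proof (rule set_integral_nonneg_real)
      fix z assume z: "z \<in> {x..y}"
      have "(sg M (u z))\<^sup>2 / 2 = lam M * (u z)\<^sup>2 - u z powr p / p" "\<bar>u z\<bar> = u z"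
        using sg_sq[OF assms(3), of "u z"] assms(4)[OF z] by simp_all
      then show "0 \<le> ((g z)\<^sup>2 / 2 - \<bar>u z\<bar> powr p / p + lam M * (u z)\<^sup>2) + sg M (u z) * g z"
        using zero_le_power2[of "g z + sg M (u z)"] by (simp add: power2_eq_square algebra_simps)
    qed
    also have "\<dots> = act p (lam M) (trip p {x..y} u g) + (\<Phi> M (u y) - \<Phi> M (u x))"
      unfolding a(2) ch(2) by (rule set_integral_add(2)[OF a(1) ch(1)])
    finally show ?thesis by linarith
  qed
  ultimately show ?thesis by linarith
qed

text \<open>The right end of \<open>calib\<close> is sent to infinity, where \<open>u\<close> tends
  to 0 and \<open>\<Phi> M\<close> is bounded by a linear function.\<close>

lemma calib_ray:
  assumes h: "h1d {x..} u g" and M: "M > 0" and u: "\<And>z. z \<ge> x \<Longrightarrow> 0 \<le> u z \<and> u z \<le> M"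
  shows "\<Phi> M (u x) \<le> act p (lam M) (trip p {x..} u g)"
proof -
  have le: "\<Phi> M (u x) - \<Phi> M (u y) \<le> act p (lam M) (trip p {x..} u g)" if "x \<le> y" for y
  proof -
    have hy: "h1d {x..y} u g" by (rule h1d_subset[OF h]) auto
    have hy': "h1d {y..} u g" by (rule h1d_subset[OF h]) (use that in auto)
    have "\<Phi> M (u x) - \<Phi> M (u y) \<le> act p (lam M) (trip p {x..y} u g)"
      using calib[OF that hy M] u by simp
    also have "\<dots> \<le> act p (lam M) (trip p {x..y} u g) + act p (lam M) (trip p {y..} u g)"
      using act_nonneg[OF ray_Ici hy' M] u that by simp
    also have "\<dots> = act p (lam M) (trip p {x..} u g)"
      by (simp add: trip_split_Ici[OF that h p2] act_add)
    finally show ?thesis .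
  qed
  have "((\<lambda>y. \<Phi> M (u y)) \<longlongrightarrow> \<Phi> M 0) at_top"
  proof (rule tendsto_sandwich[of "\<lambda>_. 0" _ _ "\<lambda>y. M powr (p / 2) * sqrt (2 / p) * u y"])
    show "\<forall>\<^sub>F y in at_top. 0 \<le> \<Phi> M (u y)"
      using eventually_ge_at_top[of x] by eventually_elim (use u M in \<open>simp add: \<Phi>_nonneg\<close>)
    show "\<forall>\<^sub>F y in at_top. \<Phi> M (u y) \<le> M powr (p / 2) * sqrt (2 / p) * u y"
      using eventually_ge_at_top[of x] by eventually_elim (use u M in \<open>simp add: \<Phi>_le\<close>)
    show "((\<lambda>y. M powr (p / 2) * sqrt (2 / p) * u y) \<longlongrightarrow> \<Phi> M 0) at_top"
      using tendsto_mult_right_zero[OF h1d_tendsto_zero[OF h], of "M powr (p / 2) * sqrt (2 / p)"] by simp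
  qed simp
  then have lim: "((\<lambda>y. \<Phi> M (u x) - \<Phi> M (u y)) \<longlongrightarrow> \<Phi> M (u x) - 0) at_top"
    by (intro tendsto_intros) simp
  have "\<Phi> M (u x) - 0 \<le> act p (lam M) (trip p {x..} u g)"
    by (rule tendsto_upperbound[OF lim]) (use le in \<open>auto intro: eventually_mono[OF eventually_ge_at_top[of x]]\<close>)
  then show ?thesis by simp
qed

text \<open>Equality in the calibration would give \<^term>\<open>g = sg M u\<close>, a linearly bounded ODE, so a function
  starting at zero would stay there.\<close>

lemma calib_strict:
  assumes xy: "x \<le> y" and h: "h1d {x..y} u g" and M: "M > 0" and u: "\<And>z. z \<in> {x..y} \<Longrightarrow> 0 \<le> u z \<and> u z \<le> M"
    and ux: "u x = 0" and uy: "u y > 0"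
  shows "\<Phi> M (u y) < act p (lam M) (trip p {x..y} u g)"
proof (rule ccontr)
  assume "\<not> ?thesis"
  with calib_eq(2)[OF xy h M u] ux
  have "(LINT z:{x..y}|lborel. (g z - sg M (u z))\<^sup>2 / 2) \<le> 0" by simp
  then have z0: "(LINT z:{x..y}|lborel. (g z - sg M (u z))\<^sup>2 / 2) = 0"
    using set_integral_nonneg_real[of "{x..y}" "\<lambda>z. (g z - sg M (u z))\<^sup>2 / 2" lborel] by simp
  have "AE z in lborel. indicat_real {x..y} z *\<^sub>R ((g z - sg M (u z))\<^sup>2 / 2) = 0"
    using z0 calib_eq(1)[OF xy h M u] unfolding set_lebesgue_integral_def set_integrable_def
    by (subst (asm) integral_nonneg_eq_0_iff_AE) auto
  then have ae: "AE z in lborel. z \<in> {x..y} \<longrightarrow> g z = sg M (u z)"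
    by eventually_elim (auto simp: indicator_def)
  \<comment> \<open>The constant of the linear bound \<open>sg_le\<close>.\<close>
  define k where "k = M powr (p / 2) * sqrt (2 / p) / M"
  have k: "k \<ge> 0" unfolding k_def using M p2 by simp
  note d = h1dD[OF h]
  have step: "u b - u a \<le> k * m * (b - a)"
    if ab: "x \<le> a" "a \<le> b" "b \<le> y" and m: "\<And>z. a \<le> z \<Longrightarrow> z \<le> b \<Longrightarrow> u z \<le> m" for a b m
  proof -
    have I: "a \<in> {x..y}" "b \<in> {x..y}" using ab by auto
    have "u b - u a = (LINT t:{a..b}|lborel. g t)" by (rule weak_deriv_onD(3)[OF d(3) I ab(2)])
    also have "\<dots> \<le> (LINT t:{a..b}|lborel. k * m)"
    proof (rule set_integral_mono_AE)
      show "set_integrable lborel {a..b} g" by (rule weak_deriv_onD(2)[OF d(3) I ab(2)])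
      show "set_integrable lborel {a..b} (\<lambda>t. k * m)" by (rule borel_integrable_atLeastAtMost') simp
      show "AE z\<in>{a..b} in lborel. g z \<le> k * m"
        using ae
      proof eventually_elim
        case (elim z)
        show ?case
        proof
          assume z: "z \<in> {a..b}"
          then have zz: "z \<in> {x..y}" using ab by auto
          have "g z = sg M (u z)" using elim zz by blast
          also have "\<dots> \<le> k * u z" unfolding k_def by (rule sg_le[OF M]) (use u[OF zz] in simp)
          also have "\<dots> \<le> k * m" using m[of z] z k by (intro mult_left_mono) simp_all
          finally show "g z \<le> k * m" .
        qed
      qed
    qed
    also have "\<dots> = k * m * (b - a)" using ab by (simp add: set_integral_const)
    finally show ?thesis .
  qed
  \<comment> \<open>To the right of the last zero \<open>z0\<close>, on an interval of length at
    most \<open>1 / (2 * (k + 1))\<close>, the maximum of \<open>u\<close> is at most half of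
    itself. So \<open>u\<close> vanishes at \<open>b\<close> too, beyond its last zero.\<close>
  define Z where "Z = {z \<in> {x..y}. u z = 0}"
  have "closed Z"
  proof -
    have "closed ({x..y} \<inter> u -` {0})" by (rule continuous_closed_preimage[OF d(1)]) simp_all
    then show ?thesis unfolding Z_def by (simp add: Int_def vimage_def conj_commute)
  qed
  then have "compact Z" by (rule compact_eq_bounded_closed[THEN iffD2, OF conjI, rotated])
      (rule bounded_subset[OF bounded_closed_interval[of x y]], auto simp: Z_def)
  moreover have "x \<in> Z" using ux xy by (simp add: Z_def)
  ultimately obtain z0 where z0: "z0 \<in> Z" "\<And>z. z \<in> Z \<Longrightarrow> z \<le> z0"
    using compact_attains_sup[of Z] by blast
  have z0': "x \<le> z0" "z0 < y" "u z0 = 0" using z0(1) uy by (auto simp: Z_def less_le)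
  define b where "b = min y (z0 + 1 / (2 * (k + 1)))"
  have b: "z0 < b" "b \<le> y" "b - z0 \<le> 1 / (2 * (k + 1))" unfolding b_def using z0' k by auto
  have "continuous_on {z0..b} u" by (rule continuous_on_subset[OF d(1)]) (use b z0' in auto)
  then obtain s where s: "s \<in> {z0..b}" "\<And>z. z \<in> {z0..b} \<Longrightarrow> u z \<le> u s"
    using continuous_attains_sup[of "{z0..b}" u] b by auto
  have "u s - u z0 \<le> k * u s * (s - z0)" by (rule step) (use s b z0' in auto)
  also have "\<dots> \<le> k * u s * (1 / (2 * (k + 1)))"
    using s b k u[of s] z0' by (intro mult_left_mono) auto
  also have "\<dots> \<le> u s / 2" using u[of s] s b z0' k by (auto simp: field_simps intro!: mult_right_mono)
  finally have "u s \<le> 0" using z0' by simp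
  then have "u b \<le> 0" using s(2)[of b] b by simp
  then have "b \<in> Z" using u[of b] b z0' by (auto simp: Z_def)
  then show False using z0(2)[of b] b by simp
qed

end

section \<open>Competitors on the star graph, and scaling in the mass\<close>

definition gr :: "nat \<Rightarrow> real \<Rightarrow> (nat \<Rightarrow> real \<Rightarrow> real) \<Rightarrow> (nat \<Rightarrow> real \<Rightarrow> real) \<Rightarrow> bool" where
  "gr N l u g \<longleftrightarrow> (\<forall>i\<le>N. h1d (edge_dom N l i) (u i) (g i)) \<and>
     (\<forall>i\<le>N. \<forall>x\<in>edge_dom N l i. 0 \<le> u i x) \<and> (\<forall>i\<le>N. u i 0 = u 0 0)"

definition gtrip :: "real \<Rightarrow> nat \<Rightarrow> real \<Rightarrow> (nat \<Rightarrow> real \<Rightarrow> real) \<Rightarrow> (nat \<Rightarrow> real \<Rightarrow> real) \<Rightarrow> real \<times> real \<times> real" where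
  "gtrip p N l u g = (\<Sum>i\<le>N. trip p (edge_dom N l i) (u i) (g i))"

text \<open>Whether the infimum is attained depends only on this set of triples; from here on
  competitors are represented by its members.\<close>

definition TT :: "real \<Rightarrow> nat \<Rightarrow> real \<Rightarrow> (real \<times> real \<times> real) set" where
  "TT p N l = {gtrip p N l u g | u g. gr N l u g}"

lemma grI:
  assumes "\<And>i. i \<le> N \<Longrightarrow> h1d (edge_dom N l i) (u i) (g i)"
    "\<And>i x. i \<le> N \<Longrightarrow> x \<in> edge_dom N l i \<Longrightarrow> 0 \<le> u i x" "\<And>i. i \<le> N \<Longrightarrow> u i 0 = u 0 0"
  shows "gr N l u g"
  using assms unfolding gr_def by blast

lemma grD:
  assumes "gr N l u g"
  shows "i \<le> N \<Longrightarrow> h1d (edge_dom N l i) (u i) (g i)"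
    "i \<le> N \<Longrightarrow> x \<in> edge_dom N l i \<Longrightarrow> 0 \<le> u i x" "i \<le> N \<Longrightarrow> u i 0 = u 0 0"
proof -
  note * = assms[unfolded gr_def]
  show "i \<le> N \<Longrightarrow> h1d (edge_dom N l i) (u i) (g i)" by (rule *[THEN conjunct1, rule_format])
  show "i \<le> N \<Longrightarrow> x \<in> edge_dom N l i \<Longrightarrow> 0 \<le> u i x" by (rule *[THEN conjunct2, THEN conjunct1, rule_format])
  show "i \<le> N \<Longrightarrow> u i 0 = u 0 0" by (rule *[THEN conjunct2, THEN conjunct2, rule_format])
qed

lemma edge_dom_ray: "i < N \<Longrightarrow> edge_dom N l i = {0..}" and edge_dom_last: "edge_dom N l N = {0..l}"
  by (simp_all add: edge_dom_def)

lemma ray_edge: "0 \<le> l \<Longrightarrow> ray (edge_dom N l i)"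
  by (simp add: edge_dom_def)

lemma zero_edge: "0 \<le> l \<Longrightarrow> 0 \<in> edge_dom N l i"
  by (simp add: edge_dom_def)

lemma grD_ray:
  assumes "gr N l u g" "i < N"
  shows "h1d {0..} (u i) (g i)" "0 \<le> x \<Longrightarrow> 0 \<le> u i x" "u i 0 = u 0 0"
  using grD(1)[OF assms(1), of i] grD(2)[OF assms(1), of i x] grD(3)[OF assms(1), of i] assms(2)
  by (simp_all add: edge_dom_ray)

lemma grD_last:
  assumes "gr N l u g"
  shows "h1d {0..l} (u N) (g N)" "0 \<le> x \<Longrightarrow> x \<le> l \<Longrightarrow> 0 \<le> u N x" "u N 0 = u 0 0"
  using grD(1)[OF assms(1), of N] grD(2)[OF assms(1), of N x] grD(3)[OF assms(1), of N]
  by (simp_all add: edge_dom_last)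

lemma gtrip_split: "gtrip p N l u g = trip p {0..l} (u N) (g N) + (\<Sum>i<N. trip p {0..} (u i) (g i))"
proof -
  have "gtrip p N l u g = trip p (edge_dom N l N) (u N) (g N) + (\<Sum>i<N. trip p (edge_dom N l i) (u i) (g i))"
    unfolding gtrip_def by (simp flip: lessThan_Suc_atMost add: add.commute)
  then show ?thesis by (simp add: edge_dom_ray edge_dom_last)
qed

lemma fst_sum_triple: "fst (\<Sum>i\<in>A. f i) = (\<Sum>i\<in>A. fst (f i))"
  "snd (\<Sum>i\<in>A. f i) = (\<Sum>i\<in>A. snd (f i))" for f :: "_ \<Rightarrow> 'a::comm_monoid_add \<times> 'b::comm_monoid_add"
  by (induction A rule: infinite_finite_induct) simp_all

lemma energy_eq:
  assumes "0 \<le> l" "\<And>i. i \<le> N \<Longrightarrow> h1d (edge_dom N l i) (u i) (g i)"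
  shows "energy p N l u = act p 0 (gtrip p N l u g)" "mass N l u = snd (snd (gtrip p N l u g))"
proof -
  have *: "(LINT x:edge_dom N l i|lborel. (wderiv (edge_dom N l i) (u i) x)\<^sup>2) = (LINT x:edge_dom N l i|lborel. (g i x)\<^sup>2)"
    if "i \<le> N" for i
    by (rule h1d_unique[OF ray_edge[OF assms(1)] h1d_wderiv[OF assms(2)[OF that]] assms(2)[OF that]])
  show "energy p N l u = act p 0 (gtrip p N l u g)"
    unfolding energy_def act_def gtrip_def fst_sum_triple trip_def by (simp add: *)
  show "mass N l u = snd (snd (gtrip p N l u g))"
    unfolding mass_def gtrip_def fst_sum_triple trip_def by simp
qed

definition att :: "real \<Rightarrow> nat \<Rightarrow> real \<Rightarrow> real \<Rightarrow> bool" where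
  "att p N \<mu> l \<longleftrightarrow> (\<exists>T\<in>TT p N l. snd (snd T) = \<mu> \<and>
     (\<forall>T'\<in>TT p N l. snd (snd T') = \<mu> \<longrightarrow> act p 0 T \<le> act p 0 T'))"

text \<open>Absolute values keep mass and potential term, do not raise the Dirichlet integral, and
  still agree at the vertex.\<close>

lemma H1_mass_TT:
  assumes "0 \<le> l" "u \<in> H1_mass N l \<mu>"
  obtains T where "T \<in> TT p N l" "snd (snd T) = \<mu>" "act p 0 T \<le> energy p N l u"
proof -
  have G: "H1_graph N l u" and m: "mass N l u = \<mu>" using assms(2) by (auto simp: H1_mass_def)
  have "\<forall>i\<le>N. \<exists>g. h1d (edge_dom N l i) (u i) g"
    using G unfolding H1_graph_def H1_on_h1d by blast
  then obtain g where g: "\<And>i. i \<le> N \<Longrightarrow> h1d (edge_dom N l i) (u i) (g i)" by metis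
  have "\<exists>g'. h1d (edge_dom N l i) (\<lambda>x. \<bar>u i x\<bar>) g' \<and>
     (LINT x:edge_dom N l i|lborel. (g' x)\<^sup>2) \<le> (LINT x:edge_dom N l i|lborel. (g i x)\<^sup>2)" if "i \<le> N" for i
    using h1d_abs[OF ray_edge[OF assms(1)] g[OF that]] by blast
  then obtain g' where g': "\<And>i. i \<le> N \<Longrightarrow> h1d (edge_dom N l i) (\<lambda>x. \<bar>u i x\<bar>) (g' i)"
     "\<And>i. i \<le> N \<Longrightarrow> (LINT x:edge_dom N l i|lborel. (g' i x)\<^sup>2) \<le> (LINT x:edge_dom N l i|lborel. (g i x)\<^sup>2)"
    by metis
  define v where "v i x = \<bar>u i x\<bar>" for i x
  have "gr N l v g'"
  proof (rule grI)
    show "h1d (edge_dom N l i) (v i) (g' i)" if "i \<le> N" for i using g'(1)[OF that] by (simp add: v_def[abs_def])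
    show "v i 0 = v 0 0" if "i \<le> N" for i using G that unfolding H1_graph_def v_def by metis
  qed (simp add: v_def)
  then have "gtrip p N l v g' \<in> TT p N l" unfolding TT_def by blast
  moreover have "snd (snd (gtrip p N l v g')) = \<mu>"
    unfolding m[symmetric] mass_def gtrip_def fst_sum_triple trip_def by (simp add: v_def)
  moreover have "act p 0 (gtrip p N l v g') \<le> energy p N l u"
  proof -
    have "(\<Sum>i\<le>N. LINT x:edge_dom N l i|lborel. (g' i x)\<^sup>2) \<le> (\<Sum>i\<le>N. LINT x:edge_dom N l i|lborel. (g i x)\<^sup>2)"
      by (rule sum_mono) (use g'(2) in simp)
    moreover have "energy p N l u = act p 0 (gtrip p N l u g)" by (rule energy_eq(1)[OF assms(1)]) (rule g)
    ultimately show ?thesis unfolding act_def gtrip_def fst_sum_triple trip_def by (simp add: v_def)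
  qed
  ultimately show ?thesis by (rule that)
qed

lemma TT_H1_mass:
  assumes "0 \<le> l" "T \<in> TT p N l"
  obtains u where "u \<in> H1_mass N l (snd (snd T))" "energy p N l u = act p 0 T"
proof -
  obtain u g where T: "T = gtrip p N l u g" and gr: "gr N l u g" using assms(2) unfolding TT_def by blast
  have "H1_graph N l u" unfolding H1_graph_def H1_on_h1d using grD(1,3)[OF gr] by blast
  moreover note energy_eq[OF assms(1) grD(1)[OF gr], of p]
  ultimately show ?thesis using that[of u] unfolding T H1_mass_def by simp
qed

lemma attained_iff_att:
  assumes "0 \<le> l"
  shows "(\<exists>w\<in>H1_mass N l \<mu>. \<forall>v\<in>H1_mass N l \<mu>. energy p N l w \<le> energy p N l v) \<longleftrightarrow> att p N \<mu> l"
proof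
  assume "\<exists>w\<in>H1_mass N l \<mu>. \<forall>v\<in>H1_mass N l \<mu>. energy p N l w \<le> energy p N l v"
  then obtain w where w: "w \<in> H1_mass N l \<mu>" "\<And>v. v \<in> H1_mass N l \<mu> \<Longrightarrow> energy p N l w \<le> energy p N l v" by blast
  obtain T where T: "T \<in> TT p N l" "snd (snd T) = \<mu>" "act p 0 T \<le> energy p N l w"
    by (rule H1_mass_TT[OF assms w(1)])
  have "act p 0 T \<le> act p 0 T'" if T': "T' \<in> TT p N l" "snd (snd T') = \<mu>" for T'
  proof -
    obtain u where "u \<in> H1_mass N l (snd (snd T'))" "energy p N l u = act p 0 T'" by (rule TT_H1_mass[OF assms T'(1)])
    then show ?thesis using w(2)[of u] T(3) T'(2) by simp
  qed
  then show "att p N \<mu> l" unfolding att_def using T by blast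
next
  assume "att p N \<mu> l"
  then obtain T where T: "T \<in> TT p N l" "snd (snd T) = \<mu>"
    "\<And>T'. T' \<in> TT p N l \<Longrightarrow> snd (snd T') = \<mu> \<Longrightarrow> act p 0 T \<le> act p 0 T'" unfolding att_def by blast
  obtain w where w: "w \<in> H1_mass N l (snd (snd T))" "energy p N l w = act p 0 T" by (rule TT_H1_mass[OF assms T(1)])
  have "energy p N l w \<le> energy p N l v" if v: "v \<in> H1_mass N l \<mu>" for v
  proof -
    obtain T' where "T' \<in> TT p N l" "snd (snd T') = \<mu>" "act p 0 T' \<le> energy p N l v" by (rule H1_mass_TT[OF assms v])
    then show ?thesis using T(3)[of T'] w(2) by simp
  qed
  then show "\<exists>w\<in>H1_mass N l \<mu>. \<forall>v\<in>H1_mass N l \<mu>. energy p N l w \<le> energy p N l v" using w(1) T(2) by blast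
qed

lemma gr_affine:
  assumes gr: "gr N l u g" and c: "c \<ge> 0" and \<tau>: "\<tau> > 0"
  shows "gr N (l / \<tau>) (\<lambda>i x. c * u i (0 + \<tau> * x)) (\<lambda>i x. c * \<tau> * g i (0 + \<tau> * x))"
    and "gtrip p N (l / \<tau>) (\<lambda>i x. c * u i (0 + \<tau> * x)) (\<lambda>i x. c * \<tau> * g i (0 + \<tau> * x)) =
      (c\<^sup>2 * \<tau> * fst (gtrip p N l u g), c powr p / \<tau> * fst (snd (gtrip p N l u g)), c\<^sup>2 / \<tau> * snd (snd (gtrip p N l u g)))"
proof -
  have I': "x \<in> edge_dom N (l / \<tau>) i \<longleftrightarrow> 0 + \<tau> * x \<in> edge_dom N l i" for x i
    using \<tau> by (auto simp: edge_dom_def field_simps zero_le_mult_iff)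
  show "gr N (l / \<tau>) (\<lambda>i x. c * u i (0 + \<tau> * x)) (\<lambda>i x. c * \<tau> * g i (0 + \<tau> * x))"
  proof (rule grI)
    show "h1d (edge_dom N (l / \<tau>) i) (\<lambda>x. c * u i (0 + \<tau> * x)) (\<lambda>x. c * \<tau> * g i (0 + \<tau> * x))" if "i \<le> N" for i
      by (rule h1d_affine(1)[OF grD(1)[OF gr that] \<tau> I'])
    show "0 \<le> c * u i (0 + \<tau> * x)" if "i \<le> N" "x \<in> edge_dom N (l / \<tau>) i" for i x
      using grD(2)[OF gr that(1)] I'[of x i] that(2) c by simp
    show "c * u i (0 + \<tau> * 0) = c * u 0 (0 + \<tau> * 0)" if "i \<le> N" for i using grD(3)[OF gr that] by simp
  qed
  have *: "trip p (edge_dom N (l / \<tau>) i) (\<lambda>x. c * u i (0 + \<tau> * x)) (\<lambda>x. c * \<tau> * g i (0 + \<tau> * x)) =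
      (c\<^sup>2 * \<tau> * fst (trip p (edge_dom N l i) (u i) (g i)), c powr p / \<tau> * fst (snd (trip p (edge_dom N l i) (u i) (g i))),
       c\<^sup>2 / \<tau> * snd (snd (trip p (edge_dom N l i) (u i) (g i))))" if "i \<le> N" for i
    using h1d_affine(2)[where c = c and p = p, OF grD(1)[OF gr that] \<tau> I'] c by simp
  show "gtrip p N (l / \<tau>) (\<lambda>i x. c * u i (0 + \<tau> * x)) (\<lambda>i x. c * \<tau> * g i (0 + \<tau> * x)) =
      (c\<^sup>2 * \<tau> * fst (gtrip p N l u g), c powr p / \<tau> * fst (snd (gtrip p N l u g)), c\<^sup>2 / \<tau> * snd (snd (gtrip p N l u g)))"
    unfolding gtrip_def
    by (rule trans[OF sum.cong[OF refl *]]) (simp_all add: prod_eq_iff fst_sum_triple sum_distrib_left)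
qed

lemma TT_affine:
  assumes "T \<in> TT p N l" "c \<ge> 0" "\<tau> > 0"
  shows "(c\<^sup>2 * \<tau> * fst T, c powr p / \<tau> * fst (snd T), c\<^sup>2 / \<tau> * snd (snd T)) \<in> TT p N (l / \<tau>)"
proof -
  obtain u g where "T = gtrip p N l u g" "gr N l u g" using assms(1) unfolding TT_def by blast
  then show ?thesis
    using gr_affine(1)[OF _ assms(2,3), of N l u g] gr_affine(2)[where p = p, OF _ assms(2,3), of N l u g, symmetric]
    unfolding TT_def by blast
qed

text \<open>The map with amplitude \<open>\<mu> powr ((1 + \<beta>) / 2)\<close> and dilation
  \<open>\<mu> powr \<beta>\<close> multiplies the mass by \<open>\<mu>\<close> and both parts of
  the energy by the same power \<open>\<mu> powr (1 + 2 * \<beta>)\<close>; the equality of these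
  two factors is what determines \<open>\<beta>\<close>. The second mass \<open>\<nu>\<close> makes
  the statement reversible, with \<open>1 / \<mu>\<close> in place of \<open>\<mu>\<close>.\<close>

lemma att_scale1:
  assumes p: "2 < p" "p < 6" and "\<mu> > 0" "\<nu> > 0" "att p N \<nu> l"
  defines "\<beta> \<equiv> (p - 2) / (6 - p)"
  shows "att p N (\<mu> * \<nu>) (l / \<mu> powr \<beta>)"
proof -
  define sc where "sc \<mu> T = (\<mu> powr (1 + 2 * \<beta>) * fst T, \<mu> powr (1 + 2 * \<beta>) * fst (snd T), \<mu> * snd (snd T))"
    for \<mu> :: real and T :: "real \<times> real \<times> real"
  have sc: "sc \<mu> T \<in> TT p N (l / \<mu> powr \<beta>)" if "T \<in> TT p N l" "\<mu> > 0" for T \<mu> l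
  proof -
    define c where "c = \<mu> powr ((1 + \<beta>) / 2)"
    have "c\<^sup>2 = \<mu> powr ((1 + \<beta>) / 2 + (1 + \<beta>) / 2)" unfolding c_def power2_eq_square powr_add ..
    then have c2: "c\<^sup>2 = \<mu> powr (1 + \<beta>)" by (simp only: field_sum_of_halves)
    have "c\<^sup>2 * \<mu> powr \<beta> = \<mu> powr (1 + 2 * \<beta>)"
      unfolding c2 powr_add[symmetric] by (rule arg_cong[where f = "(powr) \<mu>"]) simp
    moreover have "c powr p / \<mu> powr \<beta> = \<mu> powr (1 + 2 * \<beta>)"
    proof -
      have "(1 + \<beta>) / 2 * p - \<beta> = 1 + 2 * \<beta>" unfolding \<beta>_def using p by (simp add: divide_simps) algebra
      then show ?thesis unfolding c_def powr_powr powr_diff[symmetric] by (simp only:)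
    qed
    moreover have "c\<^sup>2 / \<mu> powr \<beta> = \<mu>" unfolding c2 using that by (simp flip: powr_diff)
    ultimately show ?thesis using TT_affine[OF that(1), of c "\<mu> powr \<beta>"] that(2) by (simp add: sc_def c_def)
  qed
  have sa: "act p 0 (sc \<mu> T) = \<mu> powr (1 + 2 * \<beta>) * act p 0 T" for \<mu> T
    by (simp add: sc_def act_def algebra_simps)
  obtain T where T: "T \<in> TT p N l" "snd (snd T) = \<nu>"
    "\<And>T'. T' \<in> TT p N l \<Longrightarrow> snd (snd T') = \<nu> \<Longrightarrow> act p 0 T \<le> act p 0 T'" using assms(5) unfolding att_def by blast
  have "act p 0 (sc \<mu> T) \<le> act p 0 T'" if T': "T' \<in> TT p N (l / \<mu> powr \<beta>)" "snd (snd T') = \<mu> * \<nu>" for T'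
  proof -
    have "sc (1 / \<mu>) T' \<in> TT p N (l / \<mu> powr \<beta> / (1 / \<mu>) powr \<beta>)" using sc[OF T'(1)] \<open>\<mu> > 0\<close> by simp
    moreover have "l / \<mu> powr \<beta> / (1 / \<mu>) powr \<beta> = l" using \<open>\<mu> > 0\<close> by (simp add: powr_divide)
    moreover have "snd (snd (sc (1 / \<mu>) T')) = \<nu>" using T'(2) \<open>\<mu> > 0\<close> by (simp add: sc_def)
    ultimately have "act p 0 T \<le> act p 0 (sc (1 / \<mu>) T')" using T(3) by simp
    also have "\<dots> = act p 0 T' / \<mu> powr (1 + 2 * \<beta>)" unfolding sa using \<open>\<mu> > 0\<close> by (simp add: powr_divide)
    finally show ?thesis unfolding sa using \<open>\<mu> > 0\<close> by (simp add: field_simps)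
  qed
  moreover have "sc \<mu> T \<in> TT p N (l / \<mu> powr \<beta>)" "snd (snd (sc \<mu> T)) = \<mu> * \<nu>"
    using sc[OF T(1) \<open>\<mu> > 0\<close>] T(2) by (simp_all add: sc_def)
  ultimately show ?thesis unfolding att_def by blast
qed

lemma att_scale:
  assumes p: "2 < p" "p < 6" and "\<mu> > 0"
  shows "att p N \<mu> l \<longleftrightarrow> att p N 1 (\<mu> powr ((p - 2) / (6 - p)) * l)"
proof
  assume "att p N \<mu> l"
  from att_scale1[OF p _ \<open>\<mu> > 0\<close> this, of "1 / \<mu>"] \<open>\<mu> > 0\<close>
  show "att p N 1 (\<mu> powr ((p - 2) / (6 - p)) * l)" by (simp add: powr_divide mult.commute)
next
  assume "att p N 1 (\<mu> powr ((p - 2) / (6 - p)) * l)"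
  from att_scale1[OF p \<open>\<mu> > 0\<close> _ this] \<open>\<mu> > 0\<close>
  show "att p N \<mu> l" by simp
qed

section \<open>The soliton level and lower bounds on the graph\<close>

context nls begin

text \<open>The energy bound at unit mass for a function of height \<open>M\<close> that pays for
  two passages between the levels 0 and \<open>M\<close>.\<close>

definition f0 :: "real \<Rightarrow> real" where "f0 M = 2 * \<Phi> M M - lam M"
text \<open>Taking the infimum over heights, rather than the value at a critical height, spares any
  computation of the mass of a soliton.\<close>

definition ee :: real where "ee = (INF M\<in>{0<..}. f0 M)"

lemma f0_eq: "M > 0 \<Longrightarrow> f0 M = 2 * \<kappa> * M powr (1 + p / 2) - M powr (p - 2) / p"
  by (simp add: f0_def \<Phi>_max lam_def)

lemma powr_factor: "M > 0 \<Longrightarrow> M powr (1 + p / 2) = M powr (p - 2) * M powr ((6 - p) / 2)"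
  by (simp add: powr_add[symmetric] field_simps)

lemma half_powr: "c > 0 \<Longrightarrow> (c powr (2 / (6 - p))) powr ((6 - p) / 2) = c"
proof -
  have "2 / q * (q / 2) = 1" if "q > 0" for q :: real using that by simp
  from this[of "6 - p"] p6 have "2 / (6 - p) * ((6 - p) / 2) = 1" by linarith
  then show "c > 0 \<Longrightarrow> (c powr (2 / (6 - p))) powr ((6 - p) / 2) = c" unfolding powr_powr by (simp only: powr_one)
qed

text \<open>The exponents are ordered as \<open>p - 2 < 1 + p / 2\<close> because \<open>p < 6\<close>: the gradient term wins for tall
  functions, the potential term for flat ones.\<close>

lemma f0_bdd_gen:
  assumes c: "c > 0"
  shows "\<exists>B. \<forall>M>0. B \<le> c * M powr (1 + p / 2) - M powr (p - 2) / p"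
proof -
  \<comment> \<open>The height at which the two terms balance: below it the negative term is
    bounded, above it the positive one wins.\<close>
  define R where "R = (1 / (p * c)) powr (2 / (6 - p))"
  have "c * M powr (1 + p / 2) - M powr (p - 2) / p \<ge> - (R powr (p - 2) / p)" if M: "M > 0" for M
  proof (cases "M \<le> R")
    case True
    then have "M powr (p - 2) \<le> R powr (p - 2)" using M p2 by (intro powr_mono2) simp_all
    then have "M powr (p - 2) / p \<le> R powr (p - 2) / p" using p2 by (intro divide_right_mono) simp_all
    moreover have "0 \<le> c * M powr (1 + p / 2)" using c by simp
    ultimately show ?thesis by linarith
  next
    case False
    have "R > 0" unfolding R_def using c p2 by simp
    have "1 / (p * c) = R powr ((6 - p) / 2)" unfolding R_def by (rule half_powr[symmetric]) (use c p2 in simp)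
    also have "\<dots> \<le> M powr ((6 - p) / 2)" using False \<open>R > 0\<close> p6 by (intro powr_mono2) simp_all
    finally have "1 / p \<le> c * M powr ((6 - p) / 2)" using c p2 by (simp add: field_simps)
    then have "M powr (p - 2) * (1 / p) \<le> M powr (p - 2) * (c * M powr ((6 - p) / 2))" by (intro mult_left_mono) simp_all
    then have "M powr (p - 2) / p \<le> c * M powr (1 + p / 2)" unfolding powr_factor[OF M] by (simp add: mult_ac)
    moreover have "0 \<le> R powr (p - 2) / p" using p2 by simp
    ultimately show ?thesis by linarith
  qed
  then show ?thesis by blast
qed

lemma f0_bdd: "bdd_below (f0 ` {0<..})"
proof -
  obtain B where B: "\<forall>M>0. B \<le> 2 * \<kappa> * M powr (1 + p / 2) - M powr (p - 2) / p"
    using f0_bdd_gen[of "2 * \<kappa>"] \<kappa>_pos by auto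
  show ?thesis by (rule bdd_belowI2[of _ B]) (use B f0_eq in simp)
qed

lemma ee_le: "M > 0 \<Longrightarrow> ee \<le> f0 M"
  unfolding ee_def by (rule cINF_lower[OF f0_bdd]) simp

lemma ee_approx: assumes "\<epsilon> > 0" obtains M where "M > 0" "f0 M < ee + \<epsilon>"
proof -
  have "Inf (f0 ` {0<..}) < ee + \<epsilon>" using assms by (simp add: ee_def)
  from cInf_lessD[OF _ this] show ?thesis using that by auto
qed

lemma ee_neg: "ee < 0"
proof -
  \<comment> \<open>At the resulting height the gradient term is exactly half of the potential
    term.\<close>
  define c where "c = 1 / (4 * p * \<kappa>)"
  have c: "c > 0" unfolding c_def using p2 \<kappa>_pos by simp
  define M where "M = c powr (2 / (6 - p))"
  have M: "M > 0" unfolding M_def using c by simp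
  have "M powr ((6 - p) / 2) = c" unfolding M_def by (rule half_powr[OF c])
  then have "f0 M = M powr (p - 2) * (2 * \<kappa> * c - 1 / p)"
    unfolding f0_eq[OF M] powr_factor[OF M] by (simp add: right_diff_distrib mult_ac)
  also have "2 * \<kappa> * c - 1 / p = - 1 / (2 * p)" unfolding c_def using \<kappa>_pos p2 by (simp add: field_simps)
  also have "M powr (p - 2) * (- 1 / (2 * p)) < 0" using M p2 by (simp add: mult_pos_neg divide_neg_pos)
  finally show ?thesis using ee_le[OF M] by simp
qed

text \<open>Multiplying the nonnegative term of \<open>f0 M\<close> by \<open>m\<close> only lowers
  it. So a portion of mass \<open>m\<close> obeys the bound \<open>m * ee\<close>, which is what the
  mass escaping along the half-lines will cost.\<close>

lemma ee_mass:
  assumes "M > 0" "0 \<le> m" "m \<le> 1"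
  shows "m * ee \<le> 2 * \<Phi> M M - lam M * m"
proof -
  have "m * ee \<le> m * f0 M" by (rule mult_left_mono[OF ee_le]) (use assms in simp_all)
  also have "\<dots> = m * (2 * \<Phi> M M) - lam M * m" by (simp add: f0_def algebra_simps)
  also have "m * (2 * \<Phi> M M) \<le> 1 * (2 * \<Phi> M M)"
    using assms \<Phi>_nonneg[of M M] by (intro mult_right_mono) simp_all
  finally show ?thesis by simp
qed

lemma gr_attains_max:
  assumes l: "0 \<le> l" and gr: "gr N l u g"
  shows "\<exists>i x0. i \<le> N \<and> x0 \<in> edge_dom N l i \<and> (\<forall>j x. j \<le> N \<longrightarrow> x \<in> edge_dom N l j \<longrightarrow> u j x \<le> u i x0)"
proof -
  have "\<exists>x0. x0 \<in> edge_dom N l i \<and> (\<forall>x\<in>edge_dom N l i. u i x \<le> u i x0)" if "i \<le> N" for i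
  proof (rule h1d_attains_max[OF ray_edge[OF l] grD(1)[OF gr that]])
    show "0 \<le> u i x" if "x \<in> edge_dom N l i" for x by (rule grD(2)[OF gr \<open>i \<le> N\<close> that])
  qed blast
  then obtain X where X: "\<And>i. i \<le> N \<Longrightarrow> X i \<in> edge_dom N l i" "\<And>i x. i \<le> N \<Longrightarrow> x \<in> edge_dom N l i \<Longrightarrow> u i x \<le> u i (X i)"
    by metis
  define S where "S = (\<lambda>i. u i (X i)) ` {..N}"
  have "finite S" "S \<noteq> {}" unfolding S_def by auto
  then have "Max S \<in> S" by (rule Max_in)
  then obtain i where i: "i \<le> N" "Max S = u i (X i)" unfolding S_def by blast
  have "u j x \<le> u i (X i)" if "j \<le> N" "x \<in> edge_dom N l j" for j x
  proof -
    have "u j (X j) \<in> S" unfolding S_def using that by blast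
    then have "u j (X j) \<le> u i (X i)" using Max_ge[OF \<open>finite S\<close>] i(2) by simp
    then show ?thesis using X(2)[OF that] by linarith
  qed
  then show ?thesis using i(1) X(1)[OF i(1)] by blast
qed

lemma gr_act_split:
  "act p c (gtrip p N l u g) = act p c (trip p {0..l} (u N) (g N)) + (\<Sum>i<N. act p c (trip p {0..} (u i) (g i)))"
  by (simp add: gtrip_split act_add act_sum)

text \<open>The climb covers only the levels from \<open>u a\<close> to \<open>M\<close>, the
  descent to infinity covers all of them. If the climb starts at 0 it is strictly more expensive
  than the calibration says.\<close>

lemma ray_peak:
  assumes h: "h1d {a..} u g" and M: "M > 0" and u: "\<And>x. x \<ge> a \<Longrightarrow> 0 \<le> u x \<and> u x \<le> M" and x0: "a \<le> x0" "u x0 = M"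
  shows "2 * \<Phi> M M - \<Phi> M (u a) \<le> act p (lam M) (trip p {a..} u g)"
    and "u a = 0 \<Longrightarrow> 2 * \<Phi> M M < act p (lam M) (trip p {a..} u g)"
proof -
  have h1: "h1d {a..x0} u g" and h2: "h1d {x0..} u g" by (rule h1d_subset[OF h]; use x0 in auto)+
  have s: "act p (lam M) (trip p {a..} u g) = act p (lam M) (trip p {a..x0} u g) + act p (lam M) (trip p {x0..} u g)"
    by (simp add: trip_split_Ici[OF x0(1) h p2] act_add)
  have 2: "\<Phi> M M \<le> act p (lam M) (trip p {x0..} u g)" using calib_ray[OF h2 M] u x0 by simp
  have "\<Phi> M M - \<Phi> M (u a) \<le> act p (lam M) (trip p {a..x0} u g)" using calib[OF x0(1) h1 M] u x0 by simp
  with 2 s show "2 * \<Phi> M M - \<Phi> M (u a) \<le> act p (lam M) (trip p {a..} u g)" by linarith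
  assume "u a = 0"
  then have "\<Phi> M M < act p (lam M) (trip p {a..x0} u g)"
    using calib_strict[OF x0(1) h1 M] u x0 M by simp
  with 2 s show "2 * \<Phi> M M < act p (lam M) (trip p {a..} u g)" by linarith
qed

text \<open>The deficit \<open>\<Phi> M (u 0 0)\<close> of the half-line with the peak is more than
  repaid by at least two further half-lines descending from the vertex. If the vertex value is zero
  there is no deficit, and strictness comes from the climb.\<close>

lemma gr_ray_peak:
  assumes l: "0 \<le> l" and gr: "gr N l u g" and M: "M > 0" and N: "N \<ge> 3"
    and u: "\<And>i x. i \<le> N \<Longrightarrow> x \<in> edge_dom N l i \<Longrightarrow> u i x \<le> M"
    and i: "i < N" "0 \<le> x0" "u i x0 = M"
  shows "2 * \<Phi> M M < act p (lam M) (gtrip p N l u g)"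
proof -
  let ?a = "\<lambda>i. act p (lam M) (trip p {0..} (u i) (g i))"
  have b: "0 \<le> u j x \<and> u j x \<le> M" if "j < N" "x \<ge> 0" for j x
    using grD_ray(2)[OF gr that] u[of j x] that by (simp add: edge_dom_ray)
  have h: "0 \<le> u 0 0" "u 0 0 \<le> M" using b[of 0 0] N by simp_all
  have t: "0 \<le> act p (lam M) (trip p {0..l} (u N) (g N))"
    by (rule act_nonneg[OF _ grD_last(1)[OF gr] M]) (use l grD_last(2)[OF gr] u[of N] in \<open>simp_all add: edge_dom_last\<close>)
  have j: "\<Phi> M (u 0 0) \<le> ?a j" if "j < N" for j
    using calib_ray[OF grD_ray(1)[OF gr that] M] b[OF that] grD_ray(3)[OF gr that] by simp
  have "(real N - 1) * \<Phi> M (u 0 0) = (\<Sum>j\<in>{..<N} - {i}. \<Phi> M (u 0 0))" using i by (simp add: of_nat_diff)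
  also have "\<dots> \<le> (\<Sum>j\<in>{..<N} - {i}. ?a j)" by (rule sum_mono) (use j in auto)
  finally have r: "(real N - 1) * \<Phi> M (u 0 0) \<le> (\<Sum>j\<in>{..<N} - {i}. ?a j)" .
  have s: "(\<Sum>j<N. ?a j) = ?a i + (\<Sum>j\<in>{..<N} - {i}. ?a j)" by (rule sum.remove) (use i in simp_all)
  note pk = ray_peak[OF grD_ray(1)[OF gr i(1)] M b[OF i(1)] i(2,3), unfolded grD_ray(3)[OF gr i(1)]]
  show ?thesis
  proof (cases "u 0 0 = 0")
    case True
    then show ?thesis using pk(2) r s t unfolding gr_act_split by simp
  next
    case False
    then have "\<Phi> M (u 0 0) > 0" using \<Phi>_pos[OF M] h by simp
    moreover have "2 * \<Phi> M (u 0 0) \<le> (real N - 1) * \<Phi> M (u 0 0)"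
      using N calculation by (intro mult_right_mono) simp_all
    ultimately show ?thesis using pk(1) r s t unfolding gr_act_split by linarith
  qed
qed

text \<open>Only one climb from the vertex to \<open>M\<close> is certain on the terminal edge, but
  at least three half-lines descend from the vertex level:
  \<open>\<Phi> M M - \<Phi> M h + 3 * \<Phi> M h\<close> with \<open>h = u 0 0\<close>.\<close>

lemma gr_tip_peak:
  assumes l: "0 \<le> l" and gr: "gr N l u g" and M: "M > 0" and N: "N \<ge> 3"
    and u: "\<And>i x. i \<le> N \<Longrightarrow> x \<in> edge_dom N l i \<Longrightarrow> u i x \<le> M"
    and x0: "0 \<le> x0" "x0 \<le> l" "u N x0 = M"
  shows "\<Phi> M M + 2 * \<Phi> M (u 0 0) \<le> act p (lam M) (gtrip p N l u g)"
proof -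
  let ?a = "\<lambda>i. act p (lam M) (trip p {0..} (u i) (g i))"
  have b: "0 \<le> u j x \<and> u j x \<le> M" if "j < N" "x \<ge> 0" for j x
    using grD_ray(2)[OF gr that] u[of j x] that by (simp add: edge_dom_ray)
  have h: "0 \<le> u 0 0" "u 0 0 \<le> M" using b[of 0 0] N by simp_all
  have bN: "0 \<le> u N x \<and> u N x \<le> M" if "x \<in> {0..l}" for x
    using grD_last(2)[OF gr] u[of N x] that by (simp add: edge_dom_last)
  have h1: "h1d {0..x0} (u N) (g N)" and h2: "h1d {x0..l} (u N) (g N)"
    by (rule h1d_subset[OF grD_last(1)[OF gr]]; use x0 in auto)+
  have "\<Phi> M M - \<Phi> M (u 0 0) \<le> act p (lam M) (trip p {0..x0} (u N) (g N))"
    using calib[OF x0(1) h1 M] bN x0 grD_last(3)[OF gr] by simp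
  moreover have "0 \<le> act p (lam M) (trip p {x0..l} (u N) (g N))"
    by (rule act_nonneg[OF _ h2 M]) (use x0 bN in simp_all)
  moreover have "act p (lam M) (trip p {0..l} (u N) (g N)) = act p (lam M) (trip p {0..x0} (u N) (g N)) + act p (lam M) (trip p {x0..l} (u N) (g N))"
    by (simp add: trip_split_Icc[OF x0(1,2) grD_last(1)[OF gr] p2] act_add)
  moreover have "3 * \<Phi> M (u 0 0) \<le> (\<Sum>j<N. ?a j)"
  proof -
    have j: "\<Phi> M (u 0 0) \<le> ?a j" if "j < N" for j
      using calib_ray[OF grD_ray(1)[OF gr that] M] b[OF that] grD_ray(3)[OF gr that] by simp
    have "3 * \<Phi> M (u 0 0) \<le> real N * \<Phi> M (u 0 0)"
      using N \<Phi>_nonneg[OF M h] by (intro mult_right_mono) simp_all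
    also have "\<dots> = (\<Sum>j<N. \<Phi> M (u 0 0))" by simp
    also have "\<dots> \<le> (\<Sum>j<N. ?a j)" by (rule sum_mono) (use j in auto)
    finally show ?thesis .
  qed
  ultimately show ?thesis unfolding gr_act_split by linarith
qed

lemma act_lam: "act p c T = act p 0 T + c * snd (snd T)"
  by (simp add: act_def)

text \<open>Wherever the maximum lies, at least one full passage is paid. This is weaker than the
  soliton bound, yet it controls the height of competitors of negative energy.\<close>

lemma energy_lower:
  assumes l: "0 \<le> l" and gr: "gr N l u g" and M: "M > 0" and N: "N \<ge> 3"
    and u: "\<And>i x. i \<le> N \<Longrightarrow> x \<in> edge_dom N l i \<Longrightarrow> u i x \<le> M"
    and i: "i \<le> N" "x0 \<in> edge_dom N l i" "u i x0 = M" and m: "snd (snd (gtrip p N l u g)) = 1"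
  shows "\<Phi> M M - lam M \<le> act p 0 (gtrip p N l u g)"
proof -
  have "\<Phi> M M \<le> act p (lam M) (gtrip p N l u g)"
  proof (cases "i = N")
    case True
    have "0 \<le> u 0 0" "u 0 0 \<le> M" using grD(2)[OF gr, of 0 0] u[of 0 0] zero_edge[OF l, of N 0] by simp_all
    then have "0 \<le> \<Phi> M (u 0 0)" using \<Phi>_nonneg[OF M] by simp
    then show ?thesis using gr_tip_peak[OF l gr M N u, of x0] i True by (simp add: edge_dom_last)
  next
    case False
    then have "i < N" using i by simp
    then show ?thesis using gr_ray_peak[OF l gr M N u, of i x0] i \<Phi>_nonneg[of M M] M by (simp add: edge_dom_ray)
  qed
  then show ?thesis unfolding act_lam[of "lam M"] using m by simp
qed

text \<open>The bound is uniform in the length, which matters when the length varies in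
  \<open>att_closed\<close>.\<close>

lemma energy_bounded_below:
  "\<exists>B. \<forall>N l T. 3 \<le> N \<longrightarrow> 0 \<le> l \<longrightarrow> T \<in> TT p N l \<longrightarrow> snd (snd T) = 1 \<longrightarrow> B \<le> act p 0 T"
proof -
  obtain B where B: "\<forall>M>0. B \<le> \<kappa> * M powr (1 + p / 2) - M powr (p - 2) / p"
    using f0_bdd_gen[OF \<kappa>_pos] by blast
  show ?thesis
  proof (intro exI[of _ B] allI impI)
    fix N :: nat and l :: real and T assume N: "3 \<le> N" and l: "0 \<le> l" and T: "T \<in> TT p N l" "snd (snd T) = 1"
    obtain u g where T': "T = gtrip p N l u g" and gr: "gr N l u g" using T unfolding TT_def by blast
    obtain i x0 where i: "i \<le> N" "x0 \<in> edge_dom N l i" "\<And>j x. j \<le> N \<Longrightarrow> x \<in> edge_dom N l j \<Longrightarrow> u j x \<le> u i x0"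
      using gr_attains_max[OF l gr] by blast
    show "B \<le> act p 0 T"
    proof (cases "u i x0 > 0")
      case True
      then show ?thesis using energy_lower[OF l gr True N i(3) i(1,2) refl] T B[rule_format, OF True]
        unfolding T' \<Phi>_max[OF True] lam_def by simp
    next
      case False
      then have z: "u j x = 0" if "j \<le> N" "x \<in> edge_dom N l j" for j x
        using i(3)[OF that] grD(2)[OF gr that] by simp
      have "(LINT x:edge_dom N l j|lborel. (u j x)\<^sup>2) = 0" if "j \<le> N" for j
        unfolding set_lebesgue_integral_def by (rule integral_eq_zero_AE, rule AE_I2) (use z[OF that] in \<open>simp add: indicator_def\<close>)
      then have "snd (snd T) = 0" unfolding T' gtrip_def fst_sum_triple trip_def by simp
      then show ?thesis using T by simp
    qed
  qed
qed

end

section \<open>Restoring unit mass, and the shape of competitors of low energy\<close>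

lemma TT_intro:
  assumes N: "N \<ge> 1" and l: "0 \<le> l"
    and v: "\<And>i. i < N \<Longrightarrow> h1d {0..} (v i) (h i)" "\<And>i x. i < N \<Longrightarrow> 0 \<le> x \<Longrightarrow> 0 \<le> v i x" "\<And>i. i < N \<Longrightarrow> v i 0 = c"
    and w: "h1d {0..l} w k" "\<And>x. 0 \<le> x \<Longrightarrow> x \<le> l \<Longrightarrow> 0 \<le> w x" "w 0 = c"
  shows "trip p {0..l} w k + (\<Sum>i<N. trip p {0..} (v i) (h i)) \<in> TT p N l"
proof -
  define u g where "u i = (if i < N then v i else w)" and "g i = (if i < N then h i else k)" for i
  have "gr N l u g"
  proof (rule grI)
    fix i assume i: "i \<le> N"
    show "h1d (edge_dom N l i) (u i) (g i)" using v(1)[of i] w(1) i by (simp add: u_def g_def edge_dom_def)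
    show "0 \<le> u i x" if "x \<in> edge_dom N l i" for x
      using v(2)[of i x] w(2)[of x] that by (simp add: u_def edge_dom_def split: if_splits)
    show "u i 0 = u 0 0" using v(3)[of i] v(3)[of 0] w(3) N by (simp add: u_def)
  qed
  moreover have "gtrip p N l u g = trip p {0..l} w k + (\<Sum>i<N. trip p {0..} (v i) (h i))"
    unfolding gtrip_split by (simp add: u_def g_def)
  ultimately show ?thesis unfolding TT_def by (metis (mono_tags, lifting) mem_Collect_eq)
qed

lemma Bernoulli_powr:
  assumes "q > 0" "s \<ge> 1" shows "1 + s * (q - 1) \<le> (q::real) powr s"
proof -
  have "(q powr s) powr (1 / s) * 1 powr (1 - 1 / s) \<le> 1 / s * (q powr s) + (1 - 1 / s) * 1"
    by (rule Youngs_inequality_0) (use assms in simp_all)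
  then have "q \<le> q powr s / s + (1 - 1 / s)" using assms by (simp add: powr_powr)
  then have "s * q \<le> s * (q powr s / s + (1 - 1 / s))" using assms by (intro mult_left_mono) simp_all
  then show ?thesis using assms by (simp add: algebra_simps)
qed

context nls begin

text \<open>Twice the derivative at \<open>q = 1\<close> of the action along
  \<open>q \<mapsto> sqrt q * u\<close>: the Nehari functional of the action.\<close>

definition ne :: "real \<Rightarrow> real \<times> real \<times> real \<Rightarrow> real" where
  "ne c T = fst T - fst (snd T) + 2 * c * snd (snd T)"

lemma ne_add: "ne c (x + y) = ne c x + ne c y" by (simp add: ne_def algebra_simps)
lemma ne_sum: "ne c (\<Sum>i\<in>A. f i) = (\<Sum>i\<in>A. ne c (f i))"
  by (induction A rule: infinite_finite_induct) (simp_all add: ne_add, simp_all add: ne_def)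

text \<open>The energy is concave along \<open>q \<mapsto> sqrt q u\<close>, so rescaling the amplitude to unit mass costs at most the
  first order term, which is governed by the Nehari functional \<open>ne\<close>.\<close>

lemma TT_normalise:
  assumes "T \<in> TT p N l" "snd (snd T) > 0" "fst (snd T) \<ge> 0"
  obtains T' where "T' \<in> TT p N l" "snd (snd T') = 1"
    "act p 0 T' \<le> act p c T - c + (1 / snd (snd T) - 1) / 2 * ne c T"
proof -
  define A B C where "A = fst T" and "B = fst (snd T)" and "C = snd (snd T)"
  have C: "C > 0" and B: "B \<ge> 0" using assms by (simp_all add: B_def C_def)
  define q where "q = 1 / C"
  have q: "q > 0" using C by (simp add: q_def)
  have qC: "q * C = 1" using C by (simp add: q_def)
  have "((sqrt q)\<^sup>2 * 1 * fst T, sqrt q powr p / 1 * fst (snd T), (sqrt q)\<^sup>2 / 1 * snd (snd T)) \<in> TT p N (l / 1)"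
    by (rule TT_affine[OF assms(1)]) (use q in simp_all)
  then have "(q * A, sqrt q powr p * B, q * C) \<in> TT p N l" using q by (simp add: A_def B_def C_def)
  moreover have "sqrt q powr p = q powr (p / 2)" using q by (simp add: powr_half_sqrt[symmetric] powr_powr)
  ultimately have T': "(q * A, q powr (p / 2) * B, 1) \<in> TT p N l" using qC by simp
  have "(1 + p / 2 * (q - 1)) * B \<le> q powr (p / 2) * B"
    by (rule mult_right_mono[OF Bernoulli_powr[OF q] B]) (use p2 in simp)
  then have "(1 + p / 2 * (q - 1)) * B / p \<le> q powr (p / 2) * B / p" using p2 by (intro divide_right_mono) simp_all
  moreover have "(1 + p / 2 * (q - 1)) * B / p = B / p + (q - 1) * B / 2" using p2 by (simp add: field_simps)
  ultimately have "q * A / 2 - q powr (p / 2) * B / p \<le> q * A / 2 - (B / p + (q - 1) * B / 2)" by linarith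
  also have "\<dots> = (A / 2 - B / p + c * C) - c + (q - 1) / 2 * (A - B + 2 * c * C) - c * (q * C - 1)"
    by (simp add: field_simps)
  also have "\<dots> = (A / 2 - B / p + c * C) - c + (q - 1) / 2 * (A - B + 2 * c * C)"
    unfolding qC by simp
  also have "\<dots> = act p c T - c + (1 / snd (snd T) - 1) / 2 * ne c T"
    unfolding act_def ne_def A_def B_def C_def q_def ..
  finally show ?thesis using that[OF T'] by (simp add: act_def)
qed

lemma TT_nonneg:
  assumes "T \<in> TT p N l" shows "0 \<le> fst T" "0 \<le> fst (snd T)" "0 \<le> snd (snd T)"
proof -
  obtain u g where T: "T = gtrip p N l u g" using assms unfolding TT_def by blast
  show "0 \<le> fst T" "0 \<le> fst (snd T)" "0 \<le> snd (snd T)"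
    unfolding T gtrip_def fst_sum_triple trip_def fst_conv snd_conv
    by (intro sum_nonneg set_integral_nonneg_real; simp)+
qed

lemma powr_integral_le:
  assumes I: "ray I" and h: "h1d I u g" and M: "M > 0" and u: "\<And>x. x \<in> I \<Longrightarrow> 0 \<le> u x \<and> u x \<le> M"
  shows "(LINT x:I|lborel. \<bar>u x\<bar> powr p) \<le> M powr (p - 2) * (LINT x:I|lborel. (u x)\<^sup>2)"
proof -
  have "(LINT x:I|lborel. \<bar>u x\<bar> powr p) \<le> (LINT x:I|lborel. M powr (p - 2) * (u x)\<^sup>2)"
  proof (rule set_integral_mono[OF h1d_powr_integrable[OF I h p2]])
    show "set_integrable lborel I (\<lambda>x. M powr (p - 2) * (u x)\<^sup>2)" using h1dD(2)[OF h] by simp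
    show "\<bar>u x\<bar> powr p \<le> M powr (p - 2) * (u x)\<^sup>2" if "x \<in> I" for x
      using powr_split2[of "u x"] powr_mono2[of "p - 2" "u x" M] u[OF that] p2
      by (simp add: mult_right_mono)
  qed
  then show ?thesis by simp
qed

text \<open>From this height on \<open>\<Phi> M M \<ge> lam M\<close>, so
  \<open>energy_lower\<close> excludes negative energy.\<close>

definition M1 :: real where "M1 = (1 / (p * \<kappa>)) powr (2 / (6 - p))"
text \<open>The height at which \<open>lam\<close> equals \<open>- ee\<close>; a lower function of
  unit mass has too small a potential term to reach the level.\<close>

definition c0 :: real where "c0 = (- (ee * p)) powr (1 / (p - 2))"

lemma c0_pos: "c0 > 0" unfolding c0_def using ee_neg p2 by (simp add: mult_neg_pos)
lemma M1_pos: "M1 > 0" unfolding M1_def using \<kappa>_pos p2 by simp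

lemma lam_mono: "0 < s \<Longrightarrow> s \<le> t \<Longrightarrow> lam s \<le> lam t"
  unfolding lam_def using p2 by (intro divide_right_mono powr_mono2) simp_all

lemma c0_le: assumes "M > 0" "- ee \<le> lam M" shows "c0 \<le> M"
proof -
  have "- (ee * p) \<le> M powr (p - 2)" using assms(2) p2 unfolding lam_def by (simp add: field_simps)
  then have "c0 \<le> (M powr (p - 2)) powr (1 / (p - 2))"
    unfolding c0_def using ee_neg p2 by (intro powr_mono2) (simp_all add: mult_nonpos_nonneg less_imp_le)
  also have "\<dots> = M" unfolding powr_powr using assms(1) p2 by simp
  finally show ?thesis .
qed

lemma gr_zero_mass:
  assumes "\<And>j x. j \<le> N \<Longrightarrow> x \<in> edge_dom N l j \<Longrightarrow> u j x = 0"
  shows "snd (snd (gtrip p N l u g)) = 0"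
proof -
  have "(LINT x:edge_dom N l j|lborel. (u j x)\<^sup>2) = 0" if "j \<le> N" for j
    unfolding set_lebesgue_integral_def
    by (rule integral_eq_zero_AE, rule AE_I2) (use assms[OF that] in \<open>simp add: indicator_def\<close>)
  then show ?thesis unfolding gtrip_def fst_sum_triple trip_def by simp
qed

text \<open>A maximum on a half-line would put the energy strictly above \<open>f0 M\<close>. On the
  terminal edge, negative energy bounds the height by \<open>M1\<close>, and the estimate of the
  potential term by \<open>lam M\<close> forces the height above \<open>c0\<close> and bounds the
  Dirichlet integral.\<close>

lemma low_energy:
  assumes l: "0 \<le> l" and gr: "gr N l u g" and N: "N \<ge> 3" and m: "snd (snd (gtrip p N l u g)) = 1"
    and E: "act p 0 (gtrip p N l u g) \<le> ee"
  obtains x0 where "0 \<le> x0" "x0 \<le> l" "c0 \<le> u N x0" "u N x0 \<le> M1" "fst (gtrip p N l u g) \<le> 2 * lam M1"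
    "\<And>i x. i \<le> N \<Longrightarrow> x \<in> edge_dom N l i \<Longrightarrow> u i x \<le> u N x0" "\<And>i x. i < N \<Longrightarrow> 0 \<le> x \<Longrightarrow> u i x < u N x0"
proof -
  let ?T = "gtrip p N l u g"
  obtain i x0 where i: "i \<le> N" "x0 \<in> edge_dom N l i" "\<And>j x. j \<le> N \<Longrightarrow> x \<in> edge_dom N l j \<Longrightarrow> u j x \<le> u i x0"
    using gr_attains_max[OF l gr] by blast
  define M where "M = u i x0"
  note uM = i(3)[folded M_def]
  have M: "M > 0"
  proof (rule ccontr)
    assume "\<not> 0 < M"
    then have "u j x = 0" if "j \<le> N" "x \<in> edge_dom N l j" for j x
      using uM[OF that] grD(2)[OF gr that] by simp
    then show False using gr_zero_mass[of N l u g] m by simp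
  qed
  have ray: "u j x < M" if j: "j < N" "0 \<le> x" for j x
  proof (rule ccontr)
    assume "\<not> u j x < M"
    then have "u j x = M" using uM[of j x] j by (simp add: edge_dom_ray)
    from gr_ray_peak[OF l gr M N uM j this] have "2 * \<Phi> M M - lam M < act p 0 ?T"
      unfolding act_lam[of "lam M"] using m by simp
    then show False using ee_le[OF M] E unfolding f0_def by simp
  qed
  then have iN: "i = N" using i(1,2) ray[of i x0] unfolding M_def by (cases "i < N") (simp_all add: edge_dom_ray)
  have x0: "0 \<le> x0" "x0 \<le> l" "u N x0 = M" using i(2) unfolding iN M_def by (simp_all add: edge_dom_last)
  have lo: "\<Phi> M M - lam M \<le> act p 0 ?T"
    by (rule energy_lower[OF l gr M N uM i(1,2) M_def[symmetric] m])
  have "\<Phi> M M < lam M" using lo E ee_neg by linarith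
  then have "\<kappa> * (M powr (p - 2) * M powr ((6 - p) / 2)) < M powr (p - 2) / p"
    unfolding \<Phi>_max[OF M] lam_def powr_factor[OF M] .
  then have "M powr (p - 2) * (\<kappa> * M powr ((6 - p) / 2)) < M powr (p - 2) * (1 / p)" by (simp add: mult_ac)
  then have "\<kappa> * M powr ((6 - p) / 2) < 1 / p" using M by (subst (asm) mult_less_cancel_left_pos) simp_all
  then have a: "M powr ((6 - p) / 2) < 1 / (p * \<kappa>)" using \<kappa>_pos p2 by (simp add: field_simps)
  have M1: "M \<le> M1"
  proof (rule ccontr)
    assume "\<not> M \<le> M1"
    then have "M1 powr ((6 - p) / 2) \<le> M powr ((6 - p) / 2)" using M1_pos p6 by (intro powr_mono2) simp_all
    moreover have "M1 powr ((6 - p) / 2) = 1 / (p * \<kappa>)" unfolding M1_def by (rule half_powr) (use \<kappa>_pos p2 in simp)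
    ultimately show False using a by simp
  qed
  have "fst (snd ?T) \<le> (\<Sum>i\<le>N. M powr (p - 2) * (LINT x:edge_dom N l i|lborel. (u i x)\<^sup>2))"
    unfolding gtrip_def fst_sum_triple trip_def fst_conv snd_conv
  proof (rule sum_mono, rule powr_integral_le[OF ray_edge[OF l] grD(1)[OF gr] M])
    show "0 \<le> u i x \<and> u i x \<le> M" if "i \<in> {..N}" "x \<in> edge_dom N l i" for i x
      using grD(2)[OF gr, of i x] uM[of i x] that by simp
  qed simp
  also have "\<dots> = M powr (p - 2) * snd (snd ?T)"
    unfolding gtrip_def fst_sum_triple trip_def fst_conv snd_conv by (simp add: sum_distrib_left)
  finally have "fst (snd ?T) / p \<le> lam M" unfolding lam_def using m p2 by (simp add: divide_right_mono)
  moreover have "fst ?T / 2 - fst (snd ?T) / p \<le> ee" using E unfolding act_def by simp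
  moreover have "0 \<le> fst ?T" using TT_nonneg(1)[of ?T N l] gr unfolding TT_def by blast
  ultimately have f: "- ee \<le> lam M" "fst ?T \<le> 2 * lam M" using ee_neg by linarith+
  show ?thesis
  proof (rule that[OF x0(1,2)])
    show "c0 \<le> u N x0" using c0_le[OF M f(1)] x0 by simp
    show "u N x0 \<le> M1" using M1 x0 by simp
    show "fst ?T \<le> 2 * lam M1" using f(2) lam_mono[OF M M1] by simp
  qed (use uM ray x0 in simp_all)
qed

text \<open>Comparing \<open>gr_tip_peak\<close> with \<open>f0 M\<close> gives
  \<open>2 * \<Phi> M h \<le> \<Phi> M M\<close>, so the vertex value \<open>h\<close> lies below
  the maximum by a fixed fraction. With a bounded Dirichlet integral such a drop needs a minimal
  length.\<close>

lemma short_edge: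
  obtains L0 where "L0 > 0" "\<And>N l T. N \<ge> 3 \<Longrightarrow> 0 < l \<Longrightarrow> T \<in> TT p N l \<Longrightarrow> snd (snd T) = 1 \<Longrightarrow> act p 0 T \<le> ee \<Longrightarrow> L0 \<le> l"
proof -
  \<comment> \<open>Any fraction of \<open>\<kappa>\<close> strictly between 1/2 and 1 would serve:
    above 1/2 it dominates the value at \<open>h / M\<close>, below 1 it keeps \<open>r\<close> away
    from 1.\<close>
  obtain r where r: "0 \<le> r" "r \<le> 1" "\<Phi>1 r = 3 / 4 * \<kappa>"
    using IVT'[of \<Phi>1 0 "3 / 4 * \<kappa>" 1] \<Phi>1_cont \<kappa>_pos unfolding \<kappa>_def[symmetric] by (auto simp: \<kappa>_def)
  have r1: "r < 1" using r \<kappa>_pos by (cases "r = 1") (auto simp: \<kappa>_def)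
  define L0 where "L0 = ((1 - r) * c0)\<^sup>2 / (2 * lam M1)"
  have "L0 > 0" unfolding L0_def using r1 c0_pos lam_pos[OF M1_pos] by simp
  moreover have "L0 \<le> l" if N: "N \<ge> 3" and l: "0 < l" and T: "T \<in> TT p N l" "snd (snd T) = 1" "act p 0 T \<le> ee" for N l T
  proof -
    have l0: "0 \<le> l" using l by simp
    obtain u g where T': "T = gtrip p N l u g" and gr: "gr N l u g" using T unfolding TT_def by blast
    obtain x0 where x0: "0 \<le> x0" "x0 \<le> l" "c0 \<le> u N x0" "u N x0 \<le> M1" "fst (gtrip p N l u g) \<le> 2 * lam M1"
      "\<And>i x. i \<le> N \<Longrightarrow> x \<in> edge_dom N l i \<Longrightarrow> u i x \<le> u N x0"
      by (rule low_energy[OF l0 gr N T(2,3)[unfolded T']]) blast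
    define M h where "M = u N x0" and "h = u 0 0"
    have M: "M > 0" using x0(3) c0_pos unfolding M_def by linarith
    have h: "0 \<le> h" "h \<le> M" using grD(2)[OF gr _ zero_edge[OF l0], of 0] x0(6)[OF _ zero_edge[OF l0], of 0] unfolding h_def M_def by simp_all
    have "\<Phi> M M + 2 * \<Phi> M h \<le> act p (lam M) T"
      unfolding T' h_def by (rule gr_tip_peak[OF l0 gr M N _ x0(1,2)]) (use x0(6) in \<open>simp_all add: M_def\<close>)
    also have "\<dots> \<le> 2 * \<Phi> M M" unfolding act_lam[of "lam M"] using T ee_le[OF M] unfolding f0_def by simp
    finally have "2 * \<Phi> M h \<le> \<Phi> M M" by simp
    then have "M powr (1 + p / 2) * (2 * \<Phi>1 (h / M)) \<le> M powr (1 + p / 2) * \<kappa>"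
      unfolding \<Phi>_def \<kappa>_def using M by simp
    then have "2 * \<Phi>1 (h / M) \<le> \<kappa>" using M by (subst (asm) mult_le_cancel_left_pos) simp_all
    then have "\<Phi>1 (h / M) < \<Phi>1 r" using r \<kappa>_pos by simp
    then have "h / M < r" using \<Phi>1_strict[of r "h / M"] r h M by (cases "h / M" r rule: linorder_cases) auto
    then have "(1 - r) * M \<le> M - h" using M by (simp add: field_simps)
    moreover have "(1 - r) * c0 \<le> (1 - r) * M" using r1 x0(3) unfolding M_def by (intro mult_left_mono) simp_all
    ultimately have hM: "(1 - r) * c0 \<le> M - h" by linarith
    have hN: "u N 0 = h" using grD_last(3)[OF gr] by (simp add: h_def)
    have AN: "(LINT x:{0..l}|lborel. (g N x)\<^sup>2) \<le> 2 * lam M1"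
    proof -
      have "(LINT x:edge_dom N l N|lborel. (g N x)\<^sup>2) \<le> (\<Sum>i\<le>N. LINT x:edge_dom N l i|lborel. (g i x)\<^sup>2)"
        by (rule member_le_sum) (auto intro: set_integral_nonneg_real)
      also have "\<dots> = fst (gtrip p N l u g)" unfolding gtrip_def fst_sum_triple trip_def by simp
      finally show ?thesis using x0(5) by (simp add: edge_dom_last)
    qed
    have rl: "ray {0..l}" using l0 by simp
    have "\<bar>u N x0 - u N 0\<bar> \<le> sqrt (2 * lam M1 * \<bar>x0 - 0\<bar>)"
      by (rule h1d_Hoelder_bound[OF rl grD_last(1)[OF gr] _ _ AN]) (use x0 l0 in simp_all)
    also have "\<dots> \<le> sqrt (2 * lam M1 * l)" using x0 lam_pos[OF M1_pos] by (intro real_sqrt_le_mono mult_left_mono) simp_all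
    finally have "(1 - r) * c0 \<le> sqrt (2 * lam M1 * l)" using hM unfolding hN M_def by linarith
    then have "((1 - r) * c0)\<^sup>2 \<le> (sqrt (2 * lam M1 * l))\<^sup>2" using r1 c0_pos by (intro power_mono) simp_all
    also have "\<dots> = 2 * lam M1 * l" using lam_pos[OF M1_pos] l by simp
    finally show ?thesis unfolding L0_def using lam_pos[OF M1_pos] by (simp add: field_simps)
  qed
  ultimately show ?thesis by (rule that)
qed

end

section \<open>Explicit solitons\<close>

lemma set_integrable_exp_ray:
  assumes "c > 0" shows "set_integrable lborel {a..} (\<lambda>x::real. exp (- c * x))"
proof -
  have "((\<lambda>x. - exp (- c * x) / c) \<longlongrightarrow> 0) at_top" using assms by real_asymp
  then have "(\<integral>\<^sup>+x. ennreal (exp (- c * x)) * indicator {a..} x \<partial>lborel) = 0 - (- exp (- c * a) / c)"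
    by (intro nn_integral_FTC_atLeast) (use assms in \<open>auto intro!: derivative_eq_intros simp: field_simps\<close>)
  then have "(\<integral>\<^sup>+x. ennreal (exp (- c * x)) * indicator {a..} x \<partial>lborel) < \<infinity>" by simp
  moreover have "(\<lambda>x. ennreal (exp (- c * x)) * indicator {a..} x) = (\<lambda>x. ennreal (indicat_real {a..} x *\<^sub>R exp (- c * x)))"
    by (auto simp: fun_eq_iff indicator_def)
  ultimately have "(\<integral>\<^sup>+x. ennreal (indicat_real {a..} x *\<^sub>R exp (- c * x)) \<partial>lborel) < \<infinity>" by simp
  then show ?thesis unfolding set_integrable_def
    by (intro integrableI_nonneg) (simp_all add: indicator_def)
qed

context nls begin

text \<open>The exponential decay rate of the soliton of height \<open>M\<close>.\<close>

definition kk :: "real \<Rightarrow> real" where "kk M = sqrt (2 * lam M)"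
text \<open>The soliton of height \<open>M\<close> centred at 0, a negative power of the hyperbolic
  cosine. On each side of its centre the calibration is an equality.\<close>

definition sol :: "real \<Rightarrow> real \<Rightarrow> real" where
  "sol M x = M * cosh (kk M * (p - 2) / 2 * x) powr (- 2 / (p - 2))"
definition sol' :: "real \<Rightarrow> real \<Rightarrow> real" where
  "sol' M x = - kk M * tanh (kk M * (p - 2) / 2 * x) * sol M x"

context
  fixes M :: real assumes M: "M > 0"
begin

abbreviation "bb \<equiv> kk M * (p - 2) / 2"

lemma kk_pos: "kk M > 0" unfolding kk_def using lam_pos[OF M] by simp
lemma kk_sq: "(kk M)\<^sup>2 = 2 * lam M" unfolding kk_def using lam_pos[OF M] by simp
lemma bb_pos: "bb > 0" using kk_pos p2 by simp

lemma sol_0: "sol M 0 = M" by (simp add: sol_def)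
lemma sol_pos: "0 < sol M x" unfolding sol_def using M cosh_real_pos[of "bb * x"] by simp
lemma sol_even: "sol M (- x) = sol M x" by (simp add: sol_def)

lemma sol_le: "sol M x \<le> M"
proof -
  have "1 powr (2 / (p - 2)) \<le> cosh (bb * x) powr (2 / (p - 2))"
    using cosh_real_ge_1[of "bb * x"] p2 by (intro powr_mono2) simp_all
  then have "cosh (bb * x) powr (- 2 / (p - 2)) \<le> 1"
    using cosh_real_pos[of "bb * x"] by (simp add: powr_minus divide_simps)
  then show ?thesis unfolding sol_def using M by (simp add: mult_left_le)
qed

text \<open>The exponent of the hyperbolic cosine times \<open>p - 2\<close> is \<open>- 2\<close>,
  and the inverse square of that function is one minus the square of \<open>tanh\<close>.\<close>

lemma sol_powr: "sol M x powr p / p = lam M * (sol M x)\<^sup>2 * (1 - (tanh (bb * x))\<^sup>2)"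
proof -
  let ?c = "cosh (bb * x)"
  have c: "?c > 0" by (rule cosh_real_pos)
  have "sol M x powr (p - 2) = M powr (p - 2) * ?c powr (- 2 / (p - 2) * (p - 2))"
    unfolding sol_def using M c by (simp add: powr_mult powr_powr)
  also have "- 2 / (p - 2) * (p - 2) = - 2"
  proof -
    have "- 2 / q * q = - 2" if "q \<noteq> 0" for q :: real using that by simp
    from this[of "p - 2"] show ?thesis using p2 by simp
  qed
  also have "?c powr - 2 = 1 - (tanh (bb * x))\<^sup>2"
  proof -
    have "?c powr - 2 = 1 / ?c\<^sup>2" using c by (simp add: powr_minus_divide powr_numeral)
    also have "\<dots> = (?c\<^sup>2 - (sinh (bb * x))\<^sup>2) / ?c\<^sup>2" unfolding cosh_square_eq[of "bb * x"] by simp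
    also have "\<dots> = 1 - (tanh (bb * x))\<^sup>2"
      using c unfolding tanh_def power_divide diff_divide_distrib by simp
    finally show ?thesis .
  qed
  finally show ?thesis using powr_split2[of "sol M x"] sol_pos[of x] by (simp add: lam_def)
qed

lemma sol_ode: "(sol' M x)\<^sup>2 / 2 = lam M * (sol M x)\<^sup>2 - sol M x powr p / p"
  unfolding sol_powr unfolding sol'_def power_mult_distrib power2_minus kk_sq by (simp add: algebra_simps)

lemma sol_deriv: "(sol M has_real_derivative sol' M x) (at x)"
proof -
  have c: "cosh (bb * x) > 0" by (rule cosh_real_pos)
  have "(sol M has_real_derivative M * (- 2 / (p - 2) * cosh (bb * x) powr (- 2 / (p - 2) - 1) * (sinh (bb * x) * bb))) (at x)"
    unfolding sol_def[abs_def] using c by (auto intro!: derivative_eq_intros)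
  moreover have "M * (- 2 / (p - 2) * cosh (bb * x) powr (- 2 / (p - 2) - 1) * (sinh (bb * x) * bb)) = sol' M x"
  proof -
    have "- 2 / q * (kk M * q / 2) = - kk M" if "q \<noteq> 0" for q :: real using that by simp
    from this[of "p - 2"] have k: "- 2 / (p - 2) * bb = - kk M" using p2 by simp
    have pw: "cosh (bb * x) powr (- 2 / (p - 2) - 1) = cosh (bb * x) powr (- 2 / (p - 2)) / cosh (bb * x)"
      unfolding powr_diff using c by simp
    have "M * (D * X * (s * b)) = (D * b) * (s * (M * X))" for D X s b :: real by (simp only: mult_ac)
    note this[of "- 2 / (p - 2)" "cosh (bb * x) powr (- 2 / (p - 2) - 1)" "sinh (bb * x)" bb]
    also have "(- 2 / (p - 2) * bb) * (sinh (bb * x) * (M * cosh (bb * x) powr (- 2 / (p - 2) - 1)))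
      = - kk M * (sinh (bb * x) * (M * (cosh (bb * x) powr (- 2 / (p - 2)) / cosh (bb * x))))"
      unfolding k pw ..
    also have "\<dots> = sol' M x" unfolding sol'_def sol_def tanh_def by simp
    finally show ?thesis .
  qed
  ultimately show ?thesis by (simp only:)
qed

lemma sol'_sq_le: "(sol' M x)\<^sup>2 \<le> (kk M)\<^sup>2 * (sol M x)\<^sup>2"
proof -
  have "\<bar>tanh (bb * x)\<bar> \<le> 1" using tanh_real_bounds[of "bb * x"] by auto
  then have "(tanh (bb * x))\<^sup>2 \<le> 1" by (simp add: abs_square_le_1)
  then have "(kk M)\<^sup>2 * (sol M x)\<^sup>2 * (tanh (bb * x))\<^sup>2 \<le> (kk M)\<^sup>2 * (sol M x)\<^sup>2 * 1" by (intro mult_left_mono) simp_all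
  then show ?thesis unfolding sol'_def power_mult_distrib power2_minus by (simp add: mult_ac)
qed

lemma sol_exp: "(sol M x)\<^sup>2 \<le> M\<^sup>2 * 2 powr (4 / (p - 2)) * exp (- (2 * kk M) * x)"
proof -
  define r where "r = 4 / (p - 2)"
  have "exp (bb * x) / 2 \<le> cosh (bb * x)" by (simp add: cosh_def)
  then have "cosh (bb * x) powr (- r) \<le> (exp (bb * x) / 2) powr (- r)"
    using p2 by (intro powr_mono2') (simp_all add: r_def)
  also have "\<dots> = exp (bb * x * (- r)) / 2 powr (- r)"
    by (simp only: powr_divide exp_powr_real)
  also have "\<dots> = 2 powr r * exp (- (2 * kk M) * x)"
  proof -
    have "kk M * q / 2 * x * (- (4 / q)) = - (2 * kk M) * x" if "q \<noteq> 0" for q :: real using that by simp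
    from this[of "p - 2"] have e: "bb * x * (- r) = - (2 * kk M) * x" unfolding r_def using p2 by simp
    show ?thesis unfolding e powr_minus by (simp add: divide_inverse)
  qed
  finally have "M\<^sup>2 * cosh (bb * x) powr (- r) \<le> M\<^sup>2 * (2 powr r * exp (- (2 * kk M) * x))"
    by (intro mult_left_mono) simp_all
  moreover have "(sol M x)\<^sup>2 = M\<^sup>2 * cosh (bb * x) powr (- r)"
  proof -
    have "- r = - 2 / (p - 2) + - 2 / (p - 2)" unfolding r_def by (simp add: add_divide_distrib[symmetric])
    then show ?thesis unfolding sol_def power_mult_distrib power2_eq_square[of "_ powr _"] powr_add[symmetric] by simp
  qed
  ultimately show ?thesis unfolding r_def by (simp add: mult_ac)
qed

lemma sol_cont: "continuous_on A (sol M)"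
  using sol_deriv by (intro continuous_at_imp_continuous_on ballI) (rule DERIV_isCont)

lemma sol'_cont: "continuous_on A (sol' M)"
  unfolding sol'_def[abs_def] by (intro continuous_intros sol_cont) (use cosh_real_pos in \<open>simp add: less_imp_neq[THEN not_sym]\<close>)

lemma sol_h1d: "h1d {x..} (sol M) (sol' M)"
proof (rule h1d_C1[OF ray_Ici sol_deriv sol'_cont])
  show i: "set_integrable lborel {x..} (\<lambda>x. (sol M x)\<^sup>2)"
  proof (rule set_integrable_bound[where f = "\<lambda>x. M\<^sup>2 * 2 powr (4 / (p - 2)) * exp (- (2 * kk M) * x)"])
    show "set_integrable lborel {x..} (\<lambda>x. M\<^sup>2 * 2 powr (4 / (p - 2)) * exp (- (2 * kk M) * x))"
      by (intro set_integrable_mult_right set_integrable_exp_ray) (use kk_pos in simp)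
    show "set_borel_measurable lborel {x..} (\<lambda>x. (sol M x)\<^sup>2)"
      by (rule set_borel_measurable_continuous_on) (auto intro!: continuous_intros sol_cont)
    show "AE y in lborel. y \<in> {x..} \<longrightarrow> norm ((sol M y)\<^sup>2) \<le> norm (M\<^sup>2 * 2 powr (4 / (p - 2)) * exp (- (2 * kk M) * y))"
      using sol_exp by (intro AE_I2) (simp add: abs_mult)
  qed
  show "set_integrable lborel {x..} (\<lambda>x. (sol' M x)\<^sup>2)"
  proof (rule set_integrable_bound[where f = "\<lambda>x. (kk M)\<^sup>2 * (sol M x)\<^sup>2"])
    show "set_integrable lborel {x..} (\<lambda>x. (kk M)\<^sup>2 * (sol M x)\<^sup>2)" using i by simp
    show "set_borel_measurable lborel {x..} (\<lambda>x. (sol' M x)\<^sup>2)"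
      by (rule set_borel_measurable_continuous_on) (auto intro!: continuous_intros sol'_cont)
    show "AE y in lborel. y \<in> {x..} \<longrightarrow> norm ((sol' M y)\<^sup>2) \<le> norm ((kk M)\<^sup>2 * (sol M y)\<^sup>2)"
      using sol'_sq_le by (intro AE_I2) simp
  qed
qed

lemma sol_h1d_Icc: "h1d {x..y} (sol M) (sol' M)"
  by (rule h1d_subset[OF sol_h1d]) auto

lemma sol_lim: "(sol M \<longlongrightarrow> 0) at_top"
  by (rule h1d_tendsto_zero[OF sol_h1d])

text \<open>By \<open>sol_ode\<close> the derivative equals \<open>sg M (sol M x)\<close> up to
  sign; the sign is that of \<open>tanh\<close>, so the profile rises on the left and falls on the
  right.\<close>

lemma sol_sg:
  "0 \<le> x \<Longrightarrow> sol' M x = - sg M (sol M x)" "x \<le> 0 \<Longrightarrow> sol' M x = sg M (sol M x)"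
proof -
  have "(sol' M x)\<^sup>2 = (sg M (sol M x))\<^sup>2"
    using sol_ode[of x] sg_sq[OF M, of "sol M x"] sol_pos[of x] sol_le[of x] by simp
  then have "sol' M x = sg M (sol M x) \<or> sol' M x = - sg M (sol M x)" unfolding power2_eq_iff .
  then have e: "\<bar>sol' M x\<bar> = sg M (sol M x)"
    using sg_nonneg[OF M, of "sol M x"] sol_pos[of x] sol_le[of x] by auto
  show "sol' M x = - sg M (sol M x)" if "0 \<le> x"
  proof -
    have "0 \<le> tanh (bb * x)" using bb_pos that by simp
    then have "0 \<le> kk M * tanh (bb * x) * sol M x" using kk_pos sol_pos[of x] by simp
    then show ?thesis using e unfolding sol'_def by simp
  qed
  show "sol' M x = sg M (sol M x)" if "x \<le> 0"
  proof -
    have "tanh (bb * x) \<le> 0" using bb_pos that by (simp add: mult_nonneg_nonpos)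
    then have "kk M * tanh (bb * x) * sol M x \<le> 0" using kk_pos sol_pos[of x]
      by (simp add: mult_nonneg_nonpos mult_nonpos_nonneg)
    then show ?thesis using e unfolding sol'_def by simp
  qed
qed

lemma sol_act_Icc:
  assumes "x \<le> y"
  shows "0 \<le> x \<Longrightarrow> act p (lam M) (trip p {x..y} (sol M) (sol' M)) = \<Phi> M (sol M x) - \<Phi> M (sol M y)"
    "y \<le> 0 \<Longrightarrow> act p (lam M) (trip p {x..y} (sol M) (sol' M)) = \<Phi> M (sol M y) - \<Phi> M (sol M x)"
proof -
  have r: "ray {x..y}" using assms by simp
  have xy: "x \<in> {x..y}" "y \<in> {x..y}" using assms by simp_all
  have J: "sol M z \<in> {0..M}" for z using sol_pos[of z] sol_le[of z] by simp
  have ch: "\<Phi> M (sol M y) - \<Phi> M (sol M x) = (LINT z:{x..y}|lborel. sg M (sol M z) * sol' M z)"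
    by (rule weak_chain_rule(2)[OF r sol_cont h1dD(3)[OF sol_h1d_Icc] xy assms J is_interval_cc \<Phi>_deriv[OF M] sg_cont[OF M]])
  have a: "act p (lam M) (trip p {x..y} (sol M) (sol' M)) = (LINT z:{x..y}|lborel. (sol' M z)\<^sup>2)"
    unfolding act_trip(2)[OF r sol_h1d_Icc p2]
  proof (rule set_lebesgue_integral_cong)
    show "\<forall>z. z \<in> {x..y} \<longrightarrow> (sol' M z)\<^sup>2 / 2 - \<bar>sol M z\<bar> powr p / p + lam M * (sol M z)\<^sup>2 = (sol' M z)\<^sup>2"
    proof (intro allI impI)
      fix z
      have e: "\<bar>sol M z\<bar> = sol M z" using sol_pos[of z] by simp
      show "(sol' M z)\<^sup>2 / 2 - \<bar>sol M z\<bar> powr p / p + lam M * (sol M z)\<^sup>2 = (sol' M z)\<^sup>2"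
        unfolding e using sol_ode[of z] by linarith
    qed
  qed simp
  show "act p (lam M) (trip p {x..y} (sol M) (sol' M)) = \<Phi> M (sol M x) - \<Phi> M (sol M y)" if "0 \<le> x"
  proof -
    have "(LINT z:{x..y}|lborel. (sol' M z)\<^sup>2) = (LINT z:{x..y}|lborel. (-1) * (sg M (sol M z) * sol' M z))"
    proof (rule set_lebesgue_integral_cong)
      show "\<forall>z. z \<in> {x..y} \<longrightarrow> (sol' M z)\<^sup>2 = (-1) * (sg M (sol M z) * sol' M z)"
        using sol_sg(1) that by (auto simp: power2_eq_square)
    qed simp
    also have "\<dots> = - (LINT z:{x..y}|lborel. sg M (sol M z) * sol' M z)"
      by (subst set_integral_mult_right) simp
    finally show ?thesis unfolding a ch[symmetric] by simp
  qed
  show "act p (lam M) (trip p {x..y} (sol M) (sol' M)) = \<Phi> M (sol M y) - \<Phi> M (sol M x)" if "y \<le> 0"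
  proof -
    have "(LINT z:{x..y}|lborel. (sol' M z)\<^sup>2) = (LINT z:{x..y}|lborel. sg M (sol M z) * sol' M z)"
    proof (rule set_lebesgue_integral_cong)
      show "\<forall>z. z \<in> {x..y} \<longrightarrow> (sol' M z)\<^sup>2 = sg M (sol M z) * sol' M z"
        using sol_sg(2) that by (auto simp: power2_eq_square)
    qed simp
    then show ?thesis unfolding a ch[symmetric] .
  qed
qed

lemma act_ray_limit:
  assumes "h1d {x..} u g"
  shows "((\<lambda>y. act p c (trip p {x..y} u g)) \<longlongrightarrow> act p c (trip p {x..} u g)) at_top"
    and "((\<lambda>y. ne c (trip p {x..y} u g)) \<longlongrightarrow> ne c (trip p {x..} u g)) at_top"
proof -
  have "((\<lambda>y. set_lebesgue_integral lborel {x..y} f) \<longlongrightarrow> set_lebesgue_integral lborel {x..} f) at_top"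
    if "set_integrable lborel {x..} f" for f :: "real \<Rightarrow> real"
    by (rule tendsto_set_lebesgue_integral_at_top[OF _ that]) simp
  note L = this[OF h1dD(4)[OF assms]] this[OF h1d_powr_integrable[OF ray_Ici assms p2]] this[OF h1dD(2)[OF assms]]
  show "((\<lambda>y. act p c (trip p {x..y} u g)) \<longlongrightarrow> act p c (trip p {x..} u g)) at_top"
    unfolding act_def trip_def fst_conv snd_conv by (intro tendsto_intros L) (use p2 in simp_all)
  show "((\<lambda>y. ne c (trip p {x..y} u g)) \<longlongrightarrow> ne c (trip p {x..} u g)) at_top"
    unfolding ne_def trip_def fst_conv snd_conv by (intro tendsto_intros L)
qed

lemma sol_act_ray:
  assumes "0 \<le> x" shows "act p (lam M) (trip p {x..} (sol M) (sol' M)) \<le> \<Phi> M (sol M x)"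
proof (rule tendsto_upperbound[OF act_ray_limit(1)[OF sol_h1d]])
  show "\<forall>\<^sub>F y in at_top. act p (lam M) (trip p {x..y} (sol M) (sol' M)) \<le> \<Phi> M (sol M x)"
    using eventually_ge_at_top[of x]
  proof eventually_elim
    case (elim y)
    show ?case using sol_act_Icc(1)[OF elim assms] \<Phi>_nonneg[OF M, of "sol M y"] sol_pos[of y] sol_le[of y] by simp
  qed
qed simp

lemma sol_act_left:
  assumes "x \<le> 0" shows "act p (lam M) (trip p {x..0} (sol M) (sol' M)) \<le> \<Phi> M M"
  using sol_act_Icc(2)[OF assms] \<Phi>_nonneg[OF M, of "sol M x"] sol_pos[of x] sol_le[of x] by (simp add: sol_0)

text \<open>The second order equation of the soliton, multiplied by the soliton: the integrand of
  \<open>ne (lam M)\<close> is an exact derivative, hence \<open>ne\<close> of any piece reduces to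
  boundary terms that are small in the tails.\<close>

lemma sol_ne_deriv:
  "((\<lambda>x. sol M x * sol' M x) has_real_derivative (sol' M x)\<^sup>2 - sol M x powr p + 2 * lam M * (sol M x)\<^sup>2) (at x)"
proof -
  let ?t = "tanh (bb * x)"
  have c: "cosh (bb * x) \<noteq> 0" using cosh_real_pos[of "bb * x"] by simp
  have "((\<lambda>x. - kk M * tanh (bb * x) * sol M x) has_real_derivative
      - kk M * ((1 - ?t\<^sup>2) * bb) * sol M x + sol' M x * (- kk M * ?t)) (at x)"
  proof (rule DERIV_mult[OF DERIV_cmult sol_deriv])
    show "((\<lambda>x. tanh (bb * x)) has_real_derivative (1 - ?t\<^sup>2) * bb) (at x)"
      using c by (auto intro!: derivative_eq_intros)
  qed
  then have d: "(sol' M has_real_derivative - kk M * ((1 - ?t\<^sup>2) * bb) * sol M x + sol' M x * (- kk M * ?t)) (at x)"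
    unfolding sol'_def[abs_def] .
  have 1: "sol' M x * (- kk M * ?t) * sol M x = 2 * lam M * ?t\<^sup>2 * (sol M x)\<^sup>2"
    unfolding sol'_def kk_sq[symmetric] by (simp add: power2_eq_square)
  have 2: "- kk M * ((1 - ?t\<^sup>2) * bb) * sol M x * sol M x = - (lam M * (p - 2)) * (1 - ?t\<^sup>2) * (sol M x)\<^sup>2"
  proof -
    have "lam M = (kk M)\<^sup>2 / 2" unfolding kk_sq by simp
    then show ?thesis by (simp add: power2_eq_square)
  qed
  have 3: "sol M x powr p = p * (lam M * (sol M x)\<^sup>2 * (1 - ?t\<^sup>2))"
    unfolding sol_powr[symmetric] using p2 by simp
  have "sol' M x * sol' M x + (- kk M * ((1 - ?t\<^sup>2) * bb) * sol M x + sol' M x * (- kk M * ?t)) * sol M x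
    = sol' M x * sol' M x + (- kk M * ((1 - ?t\<^sup>2) * bb) * sol M x * sol M x + sol' M x * (- kk M * ?t) * sol M x)"
    by (simp only: distrib_right)
  also have "\<dots> = (sol' M x)\<^sup>2 - sol M x powr p + 2 * lam M * (sol M x)\<^sup>2"
    unfolding 1 2 3 by (simp add: power2_eq_square algebra_simps)
  finally show ?thesis using DERIV_mult[OF sol_deriv[of x] d] by (simp only:)
qed

lemma sol_ne_Icc:
  assumes "x \<le> y"
  shows "ne (lam M) (trip p {x..y} (sol M) (sol' M)) = sol M y * sol' M y - sol M x * sol' M x"
proof -
  have r: "ray {x..y}" using assms by simp
  note h = sol_h1d_Icc[of x y]
  have i: "set_integrable lborel {x..y} (\<lambda>z. (sol' M z)\<^sup>2)" "set_integrable lborel {x..y} (\<lambda>z. \<bar>sol M z\<bar> powr p)"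
    "set_integrable lborel {x..y} (\<lambda>z. 2 * lam M * (sol M z)\<^sup>2)"
    using h1dD(2,4)[OF h] h1d_powr_integrable[OF r h p2] by simp_all
  have "ne (lam M) (trip p {x..y} (sol M) (sol' M)) =
    (LINT z:{x..y}|lborel. (sol' M z)\<^sup>2 - \<bar>sol M z\<bar> powr p + 2 * lam M * (sol M z)\<^sup>2)"
    unfolding set_integral_add(2)[OF set_integral_diff(1)[OF i(1,2)] i(3)] set_integral_diff(2)[OF i(1,2)]
    by (simp add: ne_def trip_def)
  also have "\<dots> = sol M y * sol' M y - sol M x * sol' M x"
    unfolding set_lebesgue_integral_def
  proof (rule integral_FTC_atLeastAtMost[OF assms])
    show "((\<lambda>x. sol M x * sol' M x) has_vector_derivative (sol' M z)\<^sup>2 - \<bar>sol M z\<bar> powr p + 2 * lam M * (sol M z)\<^sup>2) (at z within {x..y})" for z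
    proof (rule has_vector_derivative_at_within)
      have "\<bar>sol M z\<bar> = sol M z" using sol_pos[of z] by simp
      then show "((\<lambda>x. sol M x * sol' M x) has_vector_derivative (sol' M z)\<^sup>2 - \<bar>sol M z\<bar> powr p + 2 * lam M * (sol M z)\<^sup>2) (at z)"
        using has_real_derivative_iff_has_vector_derivative[THEN iffD1, OF sol_ne_deriv[of z]] by (simp only:)
    qed
    show "continuous_on {x..y} (\<lambda>z. (sol' M z)\<^sup>2 - \<bar>sol M z\<bar> powr p + 2 * lam M * (sol M z)\<^sup>2)"
      by (intro continuous_intros sol_cont sol'_cont continuous_on_powr') (use p2 in auto)
  qed
  finally show ?thesis .
qed

lemma sol_prod_le: "\<bar>sol M x * sol' M x\<bar> \<le> kk M * (sol M x)\<^sup>2"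
proof -
  have "(sol' M x)\<^sup>2 \<le> (kk M * sol M x)\<^sup>2" using sol'_sq_le[of x] by (simp only: power_mult_distrib)
  then have "\<bar>sol' M x\<bar> \<le> \<bar>kk M * sol M x\<bar>" unfolding abs_le_square_iff .
  also have "\<dots> = kk M * sol M x" using kk_pos sol_pos[of x] by simp
  finally have "sol M x * \<bar>sol' M x\<bar> \<le> sol M x * (kk M * sol M x)" using sol_pos[of x] by (intro mult_left_mono) simp_all
  then show ?thesis using sol_pos[of x] by (simp add: abs_mult power2_eq_square mult_ac)
qed

lemma sol_ne_ray: "\<bar>ne (lam M) (trip p {x..} (sol M) (sol' M))\<bar> \<le> kk M * (sol M x)\<^sup>2"
proof -
  have "((\<lambda>y. kk M * (sol M y)\<^sup>2) \<longlongrightarrow> kk M * 0\<^sup>2) at_top" by (intro tendsto_intros sol_lim)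
  then have z: "((\<lambda>y. kk M * (sol M y)\<^sup>2) \<longlongrightarrow> 0) at_top" by simp
  have "((\<lambda>y. sol M y * sol' M y) \<longlongrightarrow> 0) at_top"
    by (rule Lim_null_comparison[OF _ z]) (use sol_prod_le in \<open>simp del: abs_mult\<close>)
  then have l: "((\<lambda>y. sol M y * sol' M y - sol M x * sol' M x) \<longlongrightarrow> 0 - sol M x * sol' M x) at_top"
    by (intro tendsto_intros)
  have "\<forall>\<^sub>F y in at_top. ne (lam M) (trip p {x..y} (sol M) (sol' M)) = sol M y * sol' M y - sol M x * sol' M x"
    using eventually_ge_at_top[of x] by eventually_elim (rule sol_ne_Icc)
  from Lim_transform_eventually[OF act_ray_limit(2)[OF sol_h1d] this]
  have "ne (lam M) (trip p {x..} (sol M) (sol' M)) = 0 - sol M x * sol' M x"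
    by (rule tendsto_unique[rotated, OF _ l]) simp
  then show ?thesis using sol_prod_le[of x] by simp
qed

end

end

section \<open>Competitors built from solitons: escaping along a half-line, and on a long
  edge\<close>

lemma h1d_shift:
  assumes "h1d {a..} u g"
  shows "h1d {a - s..} (\<lambda>x. u (s + x)) (\<lambda>x. g (s + x))"
    "trip p {a - s..} (\<lambda>x. u (s + x)) (\<lambda>x. g (s + x)) = trip p {a..} u g"
proof -
  have I': "x \<in> {a - s..} \<longleftrightarrow> s + 1 * x \<in> {a..}" for x by auto
  show "h1d {a - s..} (\<lambda>x. u (s + x)) (\<lambda>x. g (s + x))"
    using h1d_affine(1)[where c = 1, OF assms zero_less_one I'] by simp
  show "trip p {a - s..} (\<lambda>x. u (s + x)) (\<lambda>x. g (s + x)) = trip p {a..} u g"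
    using h1d_affine(2)[where c = 1 and p = p, OF assms zero_less_one I'] by simp
qed

lemma h1d_shift_Icc:
  assumes "h1d {a..b} u g"
  shows "h1d {a - s..b - s} (\<lambda>x. u (s + x)) (\<lambda>x. g (s + x))"
    "trip p {a - s..b - s} (\<lambda>x. u (s + x)) (\<lambda>x. g (s + x)) = trip p {a..b} u g"
proof -
  have I': "x \<in> {a - s..b - s} \<longleftrightarrow> s + 1 * x \<in> {a..b}" for x by auto
  show "h1d {a - s..b - s} (\<lambda>x. u (s + x)) (\<lambda>x. g (s + x))"
    using h1d_affine(1)[where c = 1, OF assms zero_less_one I'] by simp
  show "trip p {a - s..b - s} (\<lambda>x. u (s + x)) (\<lambda>x. g (s + x)) = trip p {a..b} u g"
    using h1d_affine(2)[where c = 1 and p = p, OF assms zero_less_one I'] by simp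
qed

lemma trip_nonneg: "0 \<le> fst (trip p I u g)" "0 \<le> fst (snd (trip p I u g))" "0 \<le> snd (snd (trip p I u g))"
  unfolding trip_def fst_conv snd_conv by (intro set_integral_nonneg_real; simp)+

context nls begin

lemma sol_mass_pos:
  assumes M: "M > 0" and "a < b" shows "0 < snd (snd (trip p {a..b} (sol M) (sol' M)))"
proof -
  have c: "continuous_on {a..b} (sol M)" by (rule sol_cont[OF M])
  obtain z where z: "z \<in> {a..b}" "\<And>x. x \<in> {a..b} \<Longrightarrow> sol M z \<le> sol M x"
    using continuous_attains_inf[OF compact_Icc _ c] assms(2) by auto
  have "0 < (b - a) * (sol M z)\<^sup>2" using assms sol_pos[OF M, of z] by simp
  also have "\<dots> = (LINT x:{a..b}|lborel. (sol M z)\<^sup>2)" using assms(2) by (simp add: set_integral_const)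
  also have "\<dots> \<le> (LINT x:{a..b}|lborel. (sol M x)\<^sup>2)"
  proof (rule set_integral_mono)
    show "set_integrable lborel {a..b} (\<lambda>x. (sol M z)\<^sup>2)" by (rule borel_integrable_atLeastAtMost') simp
    show "set_integrable lborel {a..b} (\<lambda>x. (sol M x)\<^sup>2)" by (rule h1dD(2)[OF sol_h1d_Icc[OF M]])
    show "(sol M z)\<^sup>2 \<le> (sol M x)\<^sup>2" if "x \<in> {a..b}" for x
      using z(2)[OF that] sol_pos[OF M, of z] by (intro power_mono) simp_all
  qed
  finally show ?thesis by (simp add: trip_def)
qed

lemma escaping_soliton:
  assumes M: "M > 0" and N: "N \<ge> 3" and l: "0 < l" and \<epsilon>: "\<epsilon> > 0"
  obtains T where "T \<in> TT p N l" "snd (snd T) = 1" "act p 0 T < f0 M + \<epsilon>"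
proof -
  \<comment> \<open>A lower bound for the mass that does not depend on \<open>R\<close>; it has to
    be fixed first, since \<open>K\<close> depends on it and \<open>R\<close> on
    \<open>K\<close>.\<close>
  define m0 where "m0 = snd (snd (trip p {0..1} (sol M) (sol' M)))"
  have m0: "m0 > 0" unfolding m0_def by (rule sol_mass_pos[OF M]) simp
  \<comment> \<open>The summands bound, per unit of \<open>sol M R\<close>, the action of the tails,
    the action of the constant on the terminal edge, and the cost of restoring unit mass.\<close>
  define K where "K = real N * M powr (p / 2) * sqrt (2 / p) + l * lam M * M + (real N * kk M + l * ((p + 2) * lam M)) * M * ((1 / m0 + 1) / 2)"
  have K0: "K \<ge> 0" unfolding K_def using M N l m0 lam_pos[OF M] kk_pos[OF M] p2 by (intro add_nonneg_nonneg mult_nonneg_nonneg) simp_all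
  have "((\<lambda>R. K * sol M R) \<longlongrightarrow> K * 0) at_top" by (intro tendsto_intros sol_lim[OF M])
  then have "\<forall>\<^sub>F R in at_top. K * sol M R < \<epsilon>" using \<epsilon> by (intro order_tendstoD(2)[of _ 0]) simp_all
  then have "\<forall>\<^sub>F R in at_top. K * sol M R < \<epsilon> \<and> R \<ge> 0" using eventually_ge_at_top[of 0] by (rule eventually_conj)
  then obtain R where R: "K * sol M R < \<epsilon>" "R \<ge> 0" by (auto dest: eventually_happens)
  define c where "c = sol M R"
  have c: "0 < c" "c \<le> M" unfolding c_def using sol_pos[OF M] sol_le[OF M] by simp_all
  define tr where "tr x = trip p {x..} (sol M) (sol' M)" for x
  define v where "v i = (if i = 0 then (\<lambda>x. sol M (- R + x)) else (\<lambda>x. sol M (R + x)))" for i :: nat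
  define h where "h i = (if i = 0 then (\<lambda>x. sol' M (- R + x)) else (\<lambda>x. sol' M (R + x)))" for i :: nat
  have vt: "trip p {0..} (v i) (h i) = tr (if i = 0 then - R else R)" for i
    using h1d_shift(2)[where s = "- R" and p = p, OF sol_h1d[OF M, of "- R"]] h1d_shift(2)[where s = R and p = p, OF sol_h1d[OF M, of R]]
    by (simp add: v_def h_def tr_def)
  have vh: "h1d {0..} (v i) (h i)" for i
    using h1d_shift(1)[OF sol_h1d[OF M, of "- R"], of "- R"] h1d_shift(1)[OF sol_h1d[OF M, of R], of R]
    by (simp add: v_def h_def)
  define T where "T = trip p {0..l} (\<lambda>_. c) (\<lambda>_. 0) + (\<Sum>i<N. trip p {0..} (v i) (h i))"
  have TT: "T \<in> TT p N l" unfolding T_def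
  proof (rule TT_intro)
    show "h1d {0..} (v i) (h i)" for i by (rule vh)
    show "0 \<le> v i x" for i x using sol_pos[OF M] by (simp add: v_def less_imp_le)
    show "v i 0 = c" for i by (simp add: v_def c_def sol_even[OF M])
    show "h1d {0..l} (\<lambda>_. c) (\<lambda>_. 0)" by (rule h1d_const) (use l in simp)
  qed (use N l c in simp_all)
  have sum: "(\<Sum>i<N. trip p {0..} (v i) (h i)) = tr (- R) + (\<Sum>i\<in>{..<N} - {0}. tr R)"
    using N by (subst sum.remove[of _ 0]) (auto simp: vt)
  have cp: "c powr p \<le> p * lam M * c\<^sup>2"
  proof -
    have "c powr (p - 2) \<le> M powr (p - 2)" using c p2 by (intro powr_mono2) simp_all
    then have "c powr (p - 2) * c\<^sup>2 \<le> M powr (p - 2) * c\<^sup>2" by (intro mult_right_mono) simp_all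
    then show ?thesis using powr_split2[of c] c p2 by (simp add: lam_def)
  qed
  have ct: "trip p {0..l} (\<lambda>_. c) (\<lambda>_. 0) = (0, l * c powr p, l * c\<^sup>2)" using trip_const[of 0 l p c] l c by simp
  have cc: "c\<^sup>2 \<le> M * c" using c by (simp add: power2_eq_square)
  have a1: "act p (lam M) (trip p {0..l} (\<lambda>_. c) (\<lambda>_. 0)) \<le> l * lam M * M * c"
  proof -
    have "0 \<le> l * c powr p / p" using l p2 by simp
    moreover have "lam M * (l * c\<^sup>2) \<le> lam M * (l * (M * c))" using cc l lam_pos[OF M] by (intro mult_left_mono) simp_all
    ultimately show ?thesis unfolding ct act_def by (simp add: mult_ac)
  qed
  have n1: "\<bar>ne (lam M) (trip p {0..l} (\<lambda>_. c) (\<lambda>_. 0))\<bar> \<le> l * ((p + 2) * lam M) * M * c"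
  proof -
    have "\<bar>2 * lam M * (l * c\<^sup>2) - l * c powr p\<bar> \<le> 2 * lam M * (l * c\<^sup>2) + l * c powr p"
      using l lam_pos[OF M] by (intro order_trans[OF abs_triangle_ineq4]) simp
    also have "\<dots> \<le> 2 * lam M * (l * c\<^sup>2) + l * (p * lam M * c\<^sup>2)" using cp l by (intro add_left_mono mult_left_mono) simp_all
    also have "\<dots> = l * ((p + 2) * lam M) * c\<^sup>2" by (simp add: algebra_simps)
    also have "\<dots> \<le> l * ((p + 2) * lam M) * (M * c)" using cc l lam_pos[OF M] p2 by (intro mult_left_mono) simp_all
    finally show ?thesis unfolding ct ne_def by (simp add: mult_ac)
  qed
  have trR: "tr (- R) = trip p {- R..0} (sol M) (sol' M) + tr 0"
    unfolding tr_def by (rule trip_split_Ici[OF _ sol_h1d[OF M] p2]) (use R in simp)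
  have aR: "act p (lam M) (tr (- R)) \<le> 2 * \<Phi> M M"
    using sol_act_left[OF M, of "- R"] sol_act_ray[OF M, of 0] R unfolding trR act_add by (simp add: tr_def sol_0[OF M])
  have aR': "act p (lam M) (tr R) \<le> M powr (p / 2) * sqrt (2 / p) * c"
    using sol_act_ray[OF M R(2)] \<Phi>_le[OF M, of c] c unfolding tr_def c_def by simp
  have nR: "\<bar>ne (lam M) (tr (- R))\<bar> \<le> kk M * M * c" "\<bar>ne (lam M) (tr R)\<bar> \<le> kk M * M * c"
  proof -
    have "kk M * c\<^sup>2 \<le> kk M * (M * c)" using cc kk_pos[OF M] by (intro mult_left_mono) simp_all
    then show "\<bar>ne (lam M) (tr (- R))\<bar> \<le> kk M * M * c" "\<bar>ne (lam M) (tr R)\<bar> \<le> kk M * M * c"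
      using sol_ne_ray[OF M, of "- R"] sol_ne_ray[OF M, of R] unfolding tr_def c_def[symmetric] sol_even[OF M]
      by (simp_all add: c_def mult_ac)
  qed
  have cardN: "card ({..<N} - {0}) = N - 1" using N by simp
  have a: "act p (lam M) T \<le> 2 * \<Phi> M M + (real N * M powr (p / 2) * sqrt (2 / p) + l * lam M * M) * c"
  proof -
    have "(\<Sum>i\<in>{..<N} - {0}. act p (lam M) (tr R)) \<le> (\<Sum>i\<in>{..<N} - {0}. M powr (p / 2) * sqrt (2 / p) * c)"
      by (rule sum_mono) (rule aR')
    also have "\<dots> = real (N - 1) * (M powr (p / 2) * sqrt (2 / p) * c)" by (simp add: cardN)
    also have "\<dots> \<le> real N * (M powr (p / 2) * sqrt (2 / p) * c)" using c p2 by (intro mult_right_mono) simp_all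
    finally show ?thesis unfolding T_def sum act_add act_sum using a1 aR by (simp add: algebra_simps)
  qed
  have n: "\<bar>ne (lam M) T\<bar> \<le> (real N * kk M + l * ((p + 2) * lam M)) * M * c"
  proof -
    have "\<bar>\<Sum>i\<in>{..<N} - {0}. ne (lam M) (tr R)\<bar> \<le> (\<Sum>i\<in>{..<N} - {0}. kk M * M * c)"
      by (rule order_trans[OF sum_abs sum_mono]) (rule nR)
    also have "\<dots> = (real N - 1) * (kk M * M * c)" using N by (simp add: cardN of_nat_diff)
    finally have S: "\<bar>\<Sum>i\<in>{..<N} - {0}. ne (lam M) (tr R)\<bar> \<le> (real N - 1) * (kk M * M * c)" .
    have "\<bar>ne (lam M) T\<bar> \<le> l * ((p + 2) * lam M) * M * c + (kk M * M * c + (real N - 1) * (kk M * M * c))"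
      unfolding T_def sum ne_add ne_sum using n1 nR(1) S by linarith
    also have "\<dots> = (real N * kk M + l * ((p + 2) * lam M)) * M * c" by (simp add: algebra_simps)
    finally show ?thesis .
  qed
  have C: "m0 \<le> snd (snd T)"
  proof -
    have "tr 0 = trip p {0..1} (sol M) (sol' M) + tr 1" unfolding tr_def by (rule trip_split_Ici[OF _ sol_h1d[OF M] p2]) simp
    then have "m0 \<le> snd (snd (tr 0))" unfolding m0_def tr_def using trip_nonneg(3)[of p "{1..}" "sol M" "sol' M"] by simp
    also have "\<dots> \<le> snd (snd (tr (- R)))" unfolding trR using trip_nonneg(3)[of p "{- R..0}" "sol M" "sol' M"] by simp
    also have "\<dots> \<le> snd (snd T)" unfolding T_def sum
      using trip_nonneg(3)[of p "{0..l}" "\<lambda>_. c" "\<lambda>_. 0"] sum_nonneg[of "{..<N} - {0}" "\<lambda>_. snd (snd (tr R))"] trip_nonneg(3)[of p "{R..}" "sol M" "sol' M"]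
      by (simp add: fst_sum_triple tr_def)
    finally show ?thesis .
  qed
  have C0: "snd (snd T) > 0" using C m0 by linarith
  obtain T' where T': "T' \<in> TT p N l" "snd (snd T') = 1"
    "act p 0 T' \<le> act p (lam M) T - lam M + (1 / snd (snd T) - 1) / 2 * ne (lam M) T"
    by (rule TT_normalise[OF TT C0 TT_nonneg(2)[OF TT]])
  have "(1 / snd (snd T) - 1) / 2 * ne (lam M) T \<le> \<bar>(1 / snd (snd T) - 1) / 2\<bar> * \<bar>ne (lam M) T\<bar>"
    unfolding abs_mult[symmetric] by simp
  also have "\<dots> \<le> ((1 / m0 + 1) / 2) * ((real N * kk M + l * ((p + 2) * lam M)) * M * c)"
  proof (rule mult_mono[OF _ n])
    have "1 / snd (snd T) \<le> 1 / m0" "0 < 1 / snd (snd T)" using C m0 C0 by (simp_all add: frac_le)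
    moreover have "\<bar>(a - 1) / 2\<bar> \<le> (b + 1) / 2" if "a \<le> b" "0 < a" for a b :: real
      unfolding abs_le_iff using that by (simp add: field_simps)
    ultimately show "\<bar>(1 / snd (snd T) - 1) / 2\<bar> \<le> (1 / m0 + 1) / 2" by blast
  qed (use m0 in simp_all)
  finally have b: "(1 / snd (snd T) - 1) / 2 * ne (lam M) T
    \<le> ((1 / m0 + 1) / 2) * ((real N * kk M + l * ((p + 2) * lam M)) * M * c)" .
  have "(P + Q + R * M * X) * c = (P + Q) * c + X * (R * M * c)" for P Q R X :: real
    by (simp add: algebra_simps)
  then have "K * c = (real N * M powr (p / 2) * sqrt (2 / p) + l * lam M * M) * c
    + ((1 / m0 + 1) / 2) * ((real N * kk M + l * ((p + 2) * lam M)) * M * c)"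
    unfolding K_def .
  then have "act p 0 T' \<le> 2 * \<Phi> M M - lam M + K * c" using T'(3) a b by linarith
  then have "act p 0 T' < f0 M + \<epsilon>" using R(1) unfolding f0_def c_def by simp
  then show ?thesis by (rule that[OF T'(1,2)])
qed

lemma below_level: assumes "N \<ge> 3" "0 < l" "\<epsilon> > 0"
  obtains T where "T \<in> TT p N l" "snd (snd T) = 1" "act p 0 T < ee + \<epsilon>"
proof -
  obtain M where M: "M > 0" "f0 M < ee + \<epsilon> / 2" using ee_approx[of "\<epsilon> / 2"] assms(3) by auto
  have "\<epsilon> / 2 > 0" using assms(3) by simp
  then obtain T where "T \<in> TT p N l" "snd (snd T) = 1" "act p 0 T < f0 M + \<epsilon> / 2"
    by (rule escaping_soliton[OF M(1) assms(1,2)])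
  then show ?thesis using M(2) that[of T] by simp
qed

text \<open>Half a soliton with its peak at the tip pays \<open>\<Phi> M M\<close> once instead of
  twice, and on a long edge the errors are again multiples of the small vertex value. The height
  must only be chosen so that the saving \<open>\<Phi> M M\<close> exceeds
  \<open>f0 M - ee\<close>.\<close>

lemma long_edge:
  assumes N: "N \<ge> 3"
  obtains L T where "L > 0" "T \<in> TT p N L" "snd (snd T) = 1" "act p 0 T < ee"
proof -
  \<comment> \<open>The height with \<open>lam Ms = - ee / 2\<close>. The first entry of
    \<open>\<epsilon>\<close> forces \<open>Ms \<le> M\<close>, after which the second one keeps
    \<open>f0 M - ee\<close> below \<open>\<Phi> M M\<close>.\<close>
  define Ms where "Ms = (- (ee / 2) * p) powr (1 / (p - 2))"
  have Ms: "Ms > 0" unfolding Ms_def using ee_neg p2 by (simp add: mult_neg_pos)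
  define \<epsilon> where "\<epsilon> = min (- ee / 2) (\<Phi> Ms Ms)"
  have \<epsilon>: "\<epsilon> > 0" unfolding \<epsilon>_def using ee_neg \<Phi>_pos[OF Ms Ms] by simp
  obtain M where M: "M > 0" "f0 M < ee + \<epsilon>" by (rule ee_approx[OF \<epsilon>])
  have "Ms \<le> M"
  proof (rule ccontr)
    assume n: "\<not> Ms \<le> M"
    have "- (ee / 2) < lam M" using M \<Phi>_nonneg[of M M] unfolding f0_def \<epsilon>_def by simp
    moreover have "lam M \<le> lam Ms" by (rule lam_mono[OF M(1)]) (use n in simp)
    moreover have "lam Ms = - (ee / 2)"
    proof -
      have x: "- (ee / 2) * p > 0" using p2 ee_neg by (simp add: mult_neg_pos)
      have "1 / (p - 2) * (p - 2) = 1" using p2 by simp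
      then have "Ms powr (p - 2) = - (ee / 2) * p" unfolding Ms_def powr_powr using x by (simp only: powr_one less_imp_le)
      then show ?thesis unfolding lam_def using p2 by simp
    qed
    ultimately show False by simp
  qed
  then have "\<Phi> Ms Ms \<le> \<Phi> M M" unfolding \<Phi>_max[OF Ms] \<Phi>_max[OF M(1)]
    using Ms \<kappa>_pos p2 by (intro mult_left_mono powr_mono2) simp_all
  then have gap: "0 < ee - (\<Phi> M M - lam M)" using M(2) unfolding f0_def \<epsilon>_def by simp
  note M = M(1)
  define m0 where "m0 = snd (snd (trip p {- 1..0} (sol M) (sol' M)))"
  have m0: "m0 > 0" unfolding m0_def by (rule sol_mass_pos[OF M]) simp
  define K where "K = real N * M powr (p / 2) * sqrt (2 / p) + (real N + 2) * kk M * M * ((1 / m0 + 1) / 2)"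
  have "((\<lambda>R. K * sol M R) \<longlongrightarrow> K * 0) at_top" by (intro tendsto_intros sol_lim[OF M])
  then have "\<forall>\<^sub>F R in at_top. K * sol M R < ee - (\<Phi> M M - lam M)" using gap by (intro order_tendstoD(2)[of _ 0]) simp_all
  then have "\<forall>\<^sub>F R in at_top. K * sol M R < ee - (\<Phi> M M - lam M) \<and> R \<ge> 1" using eventually_ge_at_top[of 1] by (rule eventually_conj)
  then obtain L where L: "K * sol M L < ee - (\<Phi> M M - lam M)" "L \<ge> 1" by (auto dest: eventually_happens)
  define c where "c = sol M L"
  have c: "0 < c" "c \<le> M" unfolding c_def using sol_pos[OF M] sol_le[OF M] by simp_all
  have cc: "c\<^sup>2 \<le> M * c" using c by (simp add: power2_eq_square)
  define tr where "tr x = trip p {x..} (sol M) (sol' M)" for x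
  define tl where "tl = trip p {- L..0} (sol M) (sol' M)"
  have vt: "trip p {0..} (\<lambda>x. sol M (L + x)) (\<lambda>x. sol' M (L + x)) = tr L"
    using h1d_shift(2)[where s = L and p = p, OF sol_h1d[OF M, of L]] by (simp add: tr_def)
  have wt: "trip p {0..L} (\<lambda>x. sol M (- L + x)) (\<lambda>x. sol' M (- L + x)) = tl"
    using h1d_shift_Icc(2)[where s = "- L" and p = p, OF sol_h1d_Icc[OF M, of "- L" 0]] by (simp add: tl_def)
  define T where "T = trip p {0..L} (\<lambda>x. sol M (- L + x)) (\<lambda>x. sol' M (- L + x)) + (\<Sum>i<N. trip p {0..} (\<lambda>x. sol M (L + x)) (\<lambda>x. sol' M (L + x)))"
  have TT: "T \<in> TT p N L" unfolding T_def
  proof (rule TT_intro)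
    show "h1d {0..} (\<lambda>x. sol M (L + x)) (\<lambda>x. sol' M (L + x))" using h1d_shift(1)[OF sol_h1d[OF M, of L], of L] by simp
    show "h1d {0..L} (\<lambda>x. sol M (- L + x)) (\<lambda>x. sol' M (- L + x))"
      using h1d_shift_Icc(1)[OF sol_h1d_Icc[OF M, of "- L" 0], of "- L"] by simp
    show "sol M (- L + 0) = sol M (L + 0)" by (simp add: sol_even[OF M])
  qed (use N L sol_pos[OF M] in \<open>simp_all add: less_imp_le\<close>)
  have T: "T = tl + (\<Sum>i<N. tr L)" unfolding T_def vt wt ..
  have a: "act p (lam M) T \<le> \<Phi> M M + real N * M powr (p / 2) * sqrt (2 / p) * c"
  proof -
    have "act p (lam M) (tr L) \<le> M powr (p / 2) * sqrt (2 / p) * c"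
      using sol_act_ray[OF M, of L] L \<Phi>_le[OF M, of c] c unfolding tr_def c_def by simp
    then have "(\<Sum>i<N. act p (lam M) (tr L)) \<le> (\<Sum>i<N. M powr (p / 2) * sqrt (2 / p) * c)" by (intro sum_mono)
    moreover have "act p (lam M) tl \<le> \<Phi> M M" unfolding tl_def by (rule sol_act_left[OF M]) (use L in simp)
    ultimately show ?thesis unfolding T act_add act_sum by (simp add: mult_ac)
  qed
  have n: "\<bar>ne (lam M) T\<bar> \<le> (real N + 2) * kk M * M * c"
  proof -
    have k: "kk M * c\<^sup>2 \<le> kk M * (M * c)" using cc kk_pos[OF M] by (intro mult_left_mono) simp_all
    have 1: "\<bar>ne (lam M) (tr L)\<bar> \<le> kk M * (M * c)" using sol_ne_ray[OF M, of L] k unfolding tr_def c_def[symmetric] by simp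
    have "(\<Sum>i<N. \<bar>ne (lam M) (tr L)\<bar>) \<le> (\<Sum>i<N. kk M * (M * c))" by (intro sum_mono 1)
    then have 2: "\<bar>\<Sum>i<N. ne (lam M) (tr L)\<bar> \<le> real N * (kk M * (M * c))" using sum_abs[of "\<lambda>_. ne (lam M) (tr L)" "{..<N}"] by simp
    have "- L \<le> 0" using L by simp
    from sol_ne_Icc[OF M this] have "ne (lam M) tl = - (sol M (- L) * sol' M (- L))"
      unfolding tl_def by (simp add: sol'_def)
    then have 3: "\<bar>ne (lam M) tl\<bar> \<le> kk M * (M * c)" using sol_prod_le[OF M, of "- L"] k unfolding c_def by (simp add: sol_even[OF M])
    have "0 \<le> kk M * (M * c)" using kk_pos[OF M] M c by simp
    have "\<bar>ne (lam M) T\<bar> \<le> \<bar>ne (lam M) tl\<bar> + \<bar>\<Sum>i<N. ne (lam M) (tr L)\<bar>" unfolding T ne_add ne_sum by (rule abs_triangle_ineq)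
    also have "\<dots> \<le> kk M * (M * c) + real N * (kk M * (M * c))" using 2 3 by linarith
    also have "\<dots> \<le> (real N + 2) * kk M * M * c" using \<open>0 \<le> kk M * (M * c)\<close> by (simp add: algebra_simps)
    finally show ?thesis .
  qed
  have C: "m0 \<le> snd (snd T)"
  proof -
    have "tl = trip p {- L..- 1} (sol M) (sol' M) + trip p {- 1..0} (sol M) (sol' M)"
      unfolding tl_def by (rule trip_split_Icc[OF _ _ sol_h1d_Icc[OF M] p2]) (use L in simp_all)
    then have "m0 \<le> snd (snd tl)" unfolding m0_def using trip_nonneg(3)[of p "{- L..- 1}" "sol M" "sol' M"] by simp
    also have "\<dots> \<le> snd (snd T)" unfolding T
      using sum_nonneg[of "{..<N}" "\<lambda>_. snd (snd (tr L))"] trip_nonneg(3)[of p "{L..}" "sol M" "sol' M"]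
      by (simp add: fst_sum_triple tr_def)
    finally show ?thesis .
  qed
  have C0: "snd (snd T) > 0" using C m0 by linarith
  obtain T' where T': "T' \<in> TT p N L" "snd (snd T') = 1"
    "act p 0 T' \<le> act p (lam M) T - lam M + (1 / snd (snd T) - 1) / 2 * ne (lam M) T"
    by (rule TT_normalise[OF TT C0 TT_nonneg(2)[OF TT]])
  have "(1 / snd (snd T) - 1) / 2 * ne (lam M) T \<le> \<bar>(1 / snd (snd T) - 1) / 2\<bar> * \<bar>ne (lam M) T\<bar>"
    unfolding abs_mult[symmetric] by simp
  also have "\<dots> \<le> ((1 / m0 + 1) / 2) * ((real N + 2) * kk M * M * c)"
  proof (rule mult_mono[OF _ n])
    have "1 / snd (snd T) \<le> 1 / m0" "0 < 1 / snd (snd T)" using C m0 C0 by (simp_all add: frac_le)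
    moreover have "\<bar>(a - 1) / 2\<bar> \<le> (b + 1) / 2" if "a \<le> b" "0 < a" for a b :: real
      unfolding abs_le_iff using that by (simp add: field_simps)
    ultimately show "\<bar>(1 / snd (snd T) - 1) / 2\<bar> \<le> (1 / m0 + 1) / 2" by blast
  qed (use m0 in simp_all)
  finally have b: "(1 / snd (snd T) - 1) / 2 * ne (lam M) T \<le> ((1 / m0 + 1) / 2) * ((real N + 2) * kk M * M * c)" .
  have "(P + R * k * M * X) * c = P * c + X * (R * k * M * c)" for P R k X :: real
    by (simp add: algebra_simps)
  then have "K * c = real N * M powr (p / 2) * sqrt (2 / p) * c + ((1 / m0 + 1) / 2) * ((real N + 2) * kk M * M * c)"
    unfolding K_def .
  then have "act p 0 T' \<le> \<Phi> M M - lam M + K * c" using T'(3) a b by linarith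
  then have "act p 0 T' < ee" using L(1) unfolding c_def by simp
  then show ?thesis using that[of L T'] T'(1,2) L(2) by simp
qed

end

section \<open>Compactness of minimising sequences\<close>

text \<open>A diagonal subsequence converges on a countable dense set, and the common Hoelder bound
  extends the convergence to every point. Pointwise convergence is enough, as bounded convergence
  takes care of the integrals on compact intervals.\<close>

lemma equi_Hoelder_subsequence:
  fixes u :: "nat \<Rightarrow> nat \<Rightarrow> real \<Rightarrow> real"
  assumes bd: "\<And>n i x. i \<le> N \<Longrightarrow> x \<in> D i \<Longrightarrow> \<bar>u n i x\<bar> \<le> K"
    and hl: "\<And>n i x y. i \<le> N \<Longrightarrow> x \<in> D i \<Longrightarrow> y \<in> D i \<Longrightarrow> \<bar>u n i x - u n i y\<bar> \<le> sqrt (A * \<bar>x - y\<bar>)"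
    and D: "\<And>i x e. i \<le> N \<Longrightarrow> x \<in> D i \<Longrightarrow> 0 < e \<Longrightarrow> \<exists>q\<in>Q. q \<in> D i \<and> \<bar>x - q\<bar> < e"
    and Q: "countable Q" and A: "0 \<le> A"
  shows "\<exists>r U. strict_mono (r :: nat \<Rightarrow> nat) \<and> (\<forall>i x. i \<le> N \<longrightarrow> x \<in> D i \<longrightarrow> (\<lambda>n. u (r n) i x) \<longlonglongrightarrow> U i x)"
proof -
  define S where "S = (SIGMA i:{..N}. Q \<inter> D i)"
  have "countable S" unfolding S_def by (intro countable_SIGMA) (use Q in \<open>auto intro: countable_Int1\<close>)
  moreover have "norm (u n (fst z) (snd z)) \<le> K" if "z \<in> S" for n z using bd that by (auto simp: S_def)
  ultimately obtain r where r: "strict_mono (r :: nat \<Rightarrow> nat)" "\<And>z. z \<in> S \<Longrightarrow> \<exists>l. (\<lambda>n. u (r n) (fst z) (snd z)) \<longlonglongrightarrow> l"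
    using function_convergent_subsequence[of S "\<lambda>n z. u n (fst z) (snd z)" K] by blast
  have conv: "convergent (\<lambda>n. u (r n) i x)" if i: "i \<le> N" and x: "x \<in> D i" for i x
  proof (rule Cauchy_convergent, rule CauchyI)
    fix e :: real assume e: "0 < e"
    define d where "d = (e / 3)\<^sup>2 / (A + 1)"
    have d: "d > 0" unfolding d_def using e A by simp
    obtain q where q: "q \<in> Q" "q \<in> D i" "\<bar>x - q\<bar> < d" using D[OF i x d] by blast
    have "A * \<bar>x - q\<bar> \<le> A * d" using q(3) A by (intro mult_left_mono) simp_all
    also have "\<dots> \<le> (e / 3)\<^sup>2" unfolding d_def using A e by (simp add: field_simps)
    finally have sq: "sqrt (A * \<bar>x - q\<bar>) \<le> e / 3" using e by (intro real_le_lsqrt) simp_all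
    have c: "\<bar>u n i x - u n i q\<bar> \<le> e / 3" for n using hl[OF i x q(2), of n] sq by linarith
    have "(i, q) \<in> S" using i q by (simp add: S_def)
    from r(2)[OF this] have "Cauchy (\<lambda>n. u (r n) i q)" by (auto intro: LIMSEQ_imp_Cauchy)
    then obtain M where M: "\<And>m n. m \<ge> M \<Longrightarrow> n \<ge> M \<Longrightarrow> norm (u (r m) i q - u (r n) i q) < e / 3"
      using CauchyD[of "\<lambda>n. u (r n) i q" "e / 3"] e by auto
    have "norm (u (r m) i x - u (r n) i x) < e" if "m \<ge> M" "n \<ge> M" for m n
      using M[OF that] c[of "r m"] c[of "r n"] unfolding real_norm_def by linarith
    then show "\<exists>M. \<forall>m\<ge>M. \<forall>n\<ge>M. norm (u (r m) i x - u (r n) i x) < e" by blast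
  qed
  show ?thesis
  proof (intro exI conjI allI impI)
    show "strict_mono r" by (rule r(1))
    show "(\<lambda>n. u (r n) i x) \<longlonglongrightarrow> lim (\<lambda>n. u (r n) i x)" if "i \<le> N" "x \<in> D i" for i x
      using conv[OF that] unfolding convergent_LIMSEQ_iff .
  qed
qed

lemma edge_dom_dense:
  assumes "l > 0" "x \<in> edge_dom N l i" "0 < (e::real)"
  shows "\<exists>q\<in>\<rat>. q \<in> edge_dom N l i \<and> \<bar>x - q\<bar> < e"
proof (cases "i < N")
  case True
  then have "0 \<le> x" using assms by (simp add: edge_dom_ray)
  obtain q where "q \<in> \<rat>" "x < q" "q < x + e" using Rats_dense_in_real[of x "x + e"] assms(3) by auto
  then show ?thesis using True \<open>0 \<le> x\<close> by (intro bexI[of _ q]) (auto simp: edge_dom_def)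
next
  case False
  then have x: "0 \<le> x" "x \<le> l" using assms by (auto simp: edge_dom_def)
  have "max 0 (x - e) < min l (x + e)" using x assms by auto
  then obtain q where "q \<in> \<rat>" "max 0 (x - e) < q" "q < min l (x + e)" using Rats_dense_in_real by blast
  then show ?thesis using False by (intro bexI[of _ q]) (auto simp: edge_dom_def)
qed

lemma bounded_convergence_Icc:
  fixes f :: "nat \<Rightarrow> real \<Rightarrow> real"
  assumes c: "\<And>n. continuous_on {a..b} (f n)" and b: "\<And>n x. x \<in> {a..b} \<Longrightarrow> \<bar>f n x\<bar> \<le> K"
    and l: "\<And>x. x \<in> {a..b} \<Longrightarrow> (\<lambda>n. f n x) \<longlonglongrightarrow> F x" and F: "continuous_on {a..b} F"
  shows "(\<lambda>n. LINT x:{a..b}|lborel. f n x) \<longlonglongrightarrow> (LINT x:{a..b}|lborel. F x)"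
  unfolding set_lebesgue_integral_def
proof (rule integral_dominated_convergence[where w = "\<lambda>x. indicat_real {a..b} x *\<^sub>R K"])
  show "integrable lborel (\<lambda>x. indicat_real {a..b} x *\<^sub>R K)"
    using borel_integrable_atLeastAtMost'[of a b "\<lambda>_. K"] by (simp add: set_integrable_def)
  show "(\<lambda>x. indicat_real {a..b} x *\<^sub>R F x) \<in> borel_measurable lborel"
    using set_borel_measurable_continuous_on[OF _ F] by (simp add: set_borel_measurable_def)
  show "(\<lambda>x. indicat_real {a..b} x *\<^sub>R f n x) \<in> borel_measurable lborel" for n
    using set_borel_measurable_continuous_on[OF _ c[of n]] by (simp add: set_borel_measurable_def)
  show "AE x in lborel. (\<lambda>n. indicat_real {a..b} x *\<^sub>R f n x) \<longlonglongrightarrow> indicat_real {a..b} x *\<^sub>R F x"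
    using l by (intro AE_I2) (auto simp: indicator_def)
  show "AE x in lborel. norm (indicat_real {a..b} x *\<^sub>R f n x) \<le> indicat_real {a..b} x *\<^sub>R K" for n
    using b by (intro AE_I2) (auto simp: indicator_def)
qed

text \<open>Otherwise some subsequence stays below the claimed bound, and
  \<open>weak_deriv_limit\<close> would give \<open>U\<close> a second weak derivative of smaller
  norm.\<close>

lemma Dirichlet_lsc:
  assumes ab: "a \<le> b" and h: "\<And>n. h1d {a..b} (us n) (gs n)"
    and lim: "\<And>x. x \<in> {a..b} \<Longrightarrow> (\<lambda>n. us n x) \<longlonglongrightarrow> U x" and U: "h1d {a..b} U G" and d: "0 < d"
  shows "\<forall>\<^sub>F n in sequentially. (LINT x:{a..b}|lborel. (G x)\<^sup>2) - d < (LINT x:{a..b}|lborel. (gs n x)\<^sup>2)"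
proof (rule ccontr)
  let ?K = "(LINT x:{a..b}|lborel. (G x)\<^sup>2) - d"
  assume "\<not> ?thesis"
  then have "\<exists>\<^sub>F n in sequentially. (LINT x:{a..b}|lborel. (gs n x)\<^sup>2) \<le> ?K"
    unfolding not_eventually by (simp add: not_less)
  then have "infinite {n. (LINT x:{a..b}|lborel. (gs n x)\<^sup>2) \<le> ?K}"
    unfolding cofinite_eq_sequentially[symmetric] frequently_cofinite .
  from infinite_enumerate[OF this]
  obtain r where r: "strict_mono (r :: nat \<Rightarrow> nat)" "\<And>n. (LINT x:{a..b}|lborel. (gs (r n) x)\<^sup>2) \<le> ?K"
    by blast
  have rl: "(\<lambda>n. us (r n) x) \<longlonglongrightarrow> U x" if "x \<in> {a..b}" for x
    using LIMSEQ_subseq_LIMSEQ[OF lim[OF that] r(1)] by (simp add: o_def)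
  have ra: "ray {a..b}" using ab by simp
  obtain g where g: "weak_deriv_on {a..b} U g" "set_integrable lborel {a..b} (\<lambda>x. (g x)\<^sup>2)" "(LINT x:{a..b}|lborel. (g x)\<^sup>2) \<le> ?K"
    by (rule weak_deriv_limit[OF ra h1dD(3)[OF h] h1dD(4)[OF h] r(2) rl])
  have "h1d {a..b} U g" by (rule h1d_IccI[OF h1dD(1)[OF U] g(1,2)])
  from h1d_unique[OF ra U this] g(3) d show False by simp
qed

text \<open>The Hoelder bound survives in the limit and makes \<open>U\<close> continuous. The
  truncation \<open>V\<close> provides the global measurability that Fatou's lemma requires.\<close>

lemma h1d_limit:
  assumes I: "ray I" and h: "\<And>n. h1d I (us n) (gs n)" and g: "\<And>n. (LINT x:I|lborel. (gs n x)\<^sup>2) \<le> K"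
    and m: "\<And>n. (LINT x:I|lborel. (us n x)\<^sup>2) \<le> C" and lim: "\<And>x. x \<in> I \<Longrightarrow> (\<lambda>n. us n x) \<longlonglongrightarrow> U x"
  obtains G where "h1d I U G" "(LINT x:I|lborel. (U x)\<^sup>2) \<le> C"
proof -
  obtain G where G: "weak_deriv_on I U G" "set_integrable lborel I (\<lambda>x. (G x)\<^sup>2)"
    by (rule weak_deriv_limit[OF I h1dD(3)[OF h] h1dD(4)[OF h] g lim])
  have cont: "continuous_on I U"
  proof (rule continuous_on_eq_continuous_within[THEN iffD2], rule ballI)
    fix x assume x: "x \<in> I"
    have hl: "\<bar>us n y - us n x\<bar> \<le> sqrt (K * \<bar>y - x\<bar>)" if "y \<in> I" for n y
      by (rule h1d_Hoelder_bound[OF I h x that g])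
    have le: "\<bar>U y - U x\<bar> \<le> sqrt (K * \<bar>y - x\<bar>)" if "y \<in> I" for y
    proof (rule LIMSEQ_le_const2)
      show "(\<lambda>n. \<bar>us n y - us n x\<bar>) \<longlonglongrightarrow> \<bar>U y - U x\<bar>" by (intro tendsto_intros lim x that)
    qed (use hl[OF that] in blast)
    have "((\<lambda>y. sqrt (K * \<bar>y - x\<bar>)) \<longlongrightarrow> sqrt (K * \<bar>x - x\<bar>)) (at x within I)" by (intro tendsto_intros)
    then have z: "((\<lambda>y. sqrt (K * \<bar>y - x\<bar>)) \<longlongrightarrow> 0) (at x within I)" by simp
    have "((\<lambda>y. U y - U x) \<longlongrightarrow> 0) (at x within I)"
      by (rule Lim_null_comparison[OF _ z]) (use le in \<open>auto simp: eventually_at_filter\<close>)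
    then show "continuous (at x within I) U" unfolding continuous_within by (simp add: LIM_zero_iff)
  qed
  define V where "V x = indicat_real I x * U x" for x
  note Ib = ray_sets[OF I]
  have [measurable]: "V \<in> borel_measurable borel"
    using borel_measurable_continuous_on_indicator[OF Ib cont] unfolding V_def[abs_def] real_scaleR_def .
  have V2: "(\<lambda>x. (V x)\<^sup>2) \<in> borel_measurable borel" by measurable
  have C0: "0 \<le> C" using m[of 0] set_integral_nonneg_real[of I "\<lambda>x. (us 0 x)\<^sup>2" lborel] by simp
  have lim2: "AE x in lborel. x \<in> I \<longrightarrow> (\<lambda>k. (us k x)\<^sup>2) \<longlonglongrightarrow> (V x)\<^sup>2"
    using lim by (intro AE_I2) (auto simp: V_def intro!: tendsto_power)
  have F: "set_integrable lborel I (\<lambda>x. (V x)\<^sup>2)" "(LINT x:I|lborel. (V x)\<^sup>2) \<le> C"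
    by (rule Fatou_set_integral(1)[OF Ib h1dD(2)[OF h] _ m C0 V2 lim2], simp,
        rule Fatou_set_integral(2)[OF Ib h1dD(2)[OF h] _ m C0 V2 lim2], simp)
  have e: "indicat_real I x *\<^sub>R (V x)\<^sup>2 = indicat_real I x *\<^sub>R (U x)\<^sup>2" for x by (simp add: V_def indicator_def)
  have "h1d I U G" using F(1) G cont unfolding h1d_def set_integrable_def e by blast
  moreover have "(LINT x:I|lborel. (U x)\<^sup>2) \<le> C" using F(2) unfolding set_lebesgue_integral_def e .
  ultimately show ?thesis by (rule that)
qed

context nls begin

text \<open>Applied beyond a far cut \<open>R\<close>: escaping mass costs at least
  \<open>ee\<close> per unit, up to an error proportional to the values at the cut. The half-line
  with the highest peak already pays for two passages; the others have nonnegative action.\<close>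

lemma escaping_energy:
  fixes f g :: "nat \<Rightarrow> real \<Rightarrow> real"
  assumes h: "\<And>i. i < N \<Longrightarrow> h1d {R..} (f i) (g i)" and b: "\<And>i x. i < N \<Longrightarrow> R \<le> x \<Longrightarrow> 0 \<le> f i x \<and> f i x \<le> K"
    and K: "K > 0" and \<rho>: "\<And>i. i < N \<Longrightarrow> f i R \<le> \<rho>" "\<rho> \<ge> 0"
    and m: "snd (snd (\<Sum>i<N. trip p {R..} (f i) (g i))) = m" "m \<le> 1"
  shows "m * ee - K powr (p / 2) * sqrt (2 / p) * \<rho> \<le> act p 0 (\<Sum>i<N. trip p {R..} (f i) (g i))"
proof -
  let ?T = "\<Sum>i<N. trip p {R..} (f i) (g i)"
  have m0: "0 \<le> m" unfolding m(1)[symmetric] fst_sum_triple by (intro sum_nonneg trip_nonneg)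
  have Kr: "0 \<le> K powr (p / 2) * sqrt (2 / p) * \<rho>" using p2 \<rho> by simp
  have "\<exists>x0. x0 \<ge> R \<and> (\<forall>x\<ge>R. f i x \<le> f i x0)" if "i < N" for i
  proof (rule h1d_attains_max[OF ray_Ici h[OF that]])
    show "0 \<le> f i x" if "x \<in> {R..}" for x using b[OF \<open>i < N\<close>, of x] that by simp
  qed auto
  then obtain X where X: "\<And>i. i < N \<Longrightarrow> X i \<ge> R" "\<And>i x. i < N \<Longrightarrow> x \<ge> R \<Longrightarrow> f i x \<le> f i (X i)" by metis
  show ?thesis
  proof (cases "\<exists>i<N. f i (X i) > 0")
    case False
    have z: "f i x = 0" if "i < N" "x \<in> {R..}" for i x
    proof -
      have "f i x \<le> f i (X i)" using X(2)[of i x] that by simp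
      moreover have "\<not> 0 < f i (X i)" using False that(1) by blast
      ultimately show ?thesis using b[OF that(1), of x] that(2) by simp
    qed
    have "(LINT x:{R..}|lborel. (f i x)\<^sup>2) = 0" "(LINT x:{R..}|lborel. \<bar>f i x\<bar> powr p) = 0" if "i < N" for i
      unfolding set_lebesgue_integral_def
      by (rule integral_eq_zero_AE, rule AE_I2, use z[OF that] p2 in \<open>simp add: indicator_def\<close>)+
    then have "snd (snd ?T) = 0" "fst (snd ?T) = 0" unfolding fst_sum_triple trip_def by simp_all
    moreover have "0 \<le> fst ?T" unfolding fst_sum_triple by (intro sum_nonneg trip_nonneg)
    ultimately show ?thesis using Kr m(1) unfolding act_def by simp
  next
    case True
    define S where "S = (\<lambda>i. f i (X i)) ` {..<N}"
    have S: "finite S" "S \<noteq> {}" using True unfolding S_def by auto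
    then have "Max S \<in> S" by (rule Max_in)
    then obtain j where j: "j < N" "Max S = f j (X j)" unfolding S_def by blast
    define M where "M = f j (X j)"
    have fM: "f i x \<le> M" if "i < N" "x \<ge> R" for i x
    proof -
      have "f i (X i) \<in> S" unfolding S_def using that by blast
      then have "f i (X i) \<le> M" using Max_ge[OF S(1)] j(2) unfolding M_def by simp
      then show ?thesis using X(2)[OF that] by linarith
    qed
    have M: "M > 0" using True fM X(1) by (meson less_le_trans)
    have MK: "M \<le> K" unfolding M_def using b[OF j(1) X(1)[OF j(1)]] by simp
    have fb: "0 \<le> f i x \<and> f i x \<le> M" if "i < N" "x \<ge> R" for i x using b[OF that] fM[OF that] by simp
    have "2 * \<Phi> M M - \<Phi> M (f j R) \<le> act p (lam M) (trip p {R..} (f j) (g j))"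
      by (rule ray_peak(1)[OF h[OF j(1)] M fb[OF j(1)] X(1)[OF j(1)] M_def[symmetric]])
    also have "\<dots> \<le> (\<Sum>i<N. act p (lam M) (trip p {R..} (f i) (g i)))"
      by (rule member_le_sum[of j "{..<N}" "\<lambda>i. act p (lam M) (trip p {R..} (f i) (g i))"])
        (use j act_nonneg[OF ray_Ici h M fb] in auto)
    also have "\<dots> = act p (lam M) ?T" by (rule act_sum[symmetric])
    also have "\<dots> = act p 0 ?T + lam M * m" unfolding act_lam[of "lam M"] m(1) ..
    finally have 1: "2 * \<Phi> M M - lam M * m - \<Phi> M (f j R) \<le> act p 0 ?T" by simp
    have "\<Phi> M (f j R) \<le> M powr (p / 2) * sqrt (2 / p) * f j R" using \<Phi>_le[OF M] fb[OF j(1), of R] by simp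
    also have "\<dots> \<le> K powr (p / 2) * sqrt (2 / p) * \<rho>"
      using M MK p2 \<rho>(1)[OF j(1)] fb[OF j(1), of R] by (intro mult_mono powr_mono2) simp_all
    finally show ?thesis using 1 ee_mass[OF M m0 m(2)] by linarith
  qed
qed


text \<open>On a compact piece the potential term and the mass converge, so only the Dirichlet
  integral can drop in the limit.\<close>

lemma edge_lsc:
  assumes ab: "a \<le> b" and h: "\<And>n. h1d {a..b} (us n) (gs n)"
    and bd: "\<And>n x. x \<in> {a..b} \<Longrightarrow> \<bar>us n x\<bar> \<le> K"
    and lim: "\<And>x. x \<in> {a..b} \<Longrightarrow> (\<lambda>n. us n x) \<longlonglongrightarrow> U x" and U: "h1d {a..b} U G"
  shows "0 < d \<Longrightarrow> \<forall>\<^sub>F n in sequentially. act p 0 (trip p {a..b} U G) - d < act p 0 (trip p {a..b} (us n) (gs n))"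
    and "(\<lambda>n. LINT x:{a..b}|lborel. \<bar>us n x\<bar> powr p) \<longlonglongrightarrow> (LINT x:{a..b}|lborel. \<bar>U x\<bar> powr p)"
    and "(\<lambda>n. LINT x:{a..b}|lborel. (us n x)\<^sup>2) \<longlonglongrightarrow> (LINT x:{a..b}|lborel. (U x)\<^sup>2)"
proof -
  have K0: "0 \<le> K" using bd[of a 0] ab by simp
  have cp: "continuous_on {a..b} (\<lambda>x. \<bar>f x\<bar> powr p)" if "continuous_on {a..b} f" for f :: "real \<Rightarrow> real"
    using that p2 by (intro continuous_on_powr' continuous_intros) auto
  show pw: "(\<lambda>n. LINT x:{a..b}|lborel. \<bar>us n x\<bar> powr p) \<longlonglongrightarrow> (LINT x:{a..b}|lborel. \<bar>U x\<bar> powr p)"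
  proof (rule bounded_convergence_Icc[OF cp[OF h1dD(1)[OF h]] _ _ cp[OF h1dD(1)[OF U]]])
    show "\<bar>\<bar>us n x\<bar> powr p\<bar> \<le> K powr p" if "x \<in> {a..b}" for n x
      using powr_mono2[OF _ _ bd[OF that], of p n] p2 by simp
    show "(\<lambda>n. \<bar>us n x\<bar> powr p) \<longlonglongrightarrow> \<bar>U x\<bar> powr p" if "x \<in> {a..b}" for x
      using tendsto_powr'[OF tendsto_rabs[OF lim[OF that]] tendsto_const[of p]] p2 by simp
  qed
  show "(\<lambda>n. LINT x:{a..b}|lborel. (us n x)\<^sup>2) \<longlonglongrightarrow> (LINT x:{a..b}|lborel. (U x)\<^sup>2)"
  proof (rule bounded_convergence_Icc)
    show "\<bar>(us n x)\<^sup>2\<bar> \<le> K\<^sup>2" if "x \<in> {a..b}" for n x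
      using bd[OF that, of n] K0 by (simp add: abs_le_square_iff[symmetric])
    show "(\<lambda>n. (us n x)\<^sup>2) \<longlonglongrightarrow> (U x)\<^sup>2" if "x \<in> {a..b}" for x by (intro tendsto_intros lim that)
  qed (intro continuous_intros h1dD(1)[OF h] h1dD(1)[OF U])+
  assume d: "0 < d"
  have "\<forall>\<^sub>F n in sequentially. (LINT x:{a..b}|lborel. (G x)\<^sup>2) - d < (LINT x:{a..b}|lborel. (gs n x)\<^sup>2)"
    by (rule Dirichlet_lsc[OF ab h lim U d])
  moreover have "\<forall>\<^sub>F n in sequentially. (LINT x:{a..b}|lborel. \<bar>us n x\<bar> powr p) < (LINT x:{a..b}|lborel. \<bar>U x\<bar> powr p) + d"
    by (rule order_tendstoD(2)[OF pw]) (use d in simp)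
  ultimately show "\<forall>\<^sub>F n in sequentially. act p 0 (trip p {a..b} U G) - d < act p 0 (trip p {a..b} (us n) (gs n))"
  proof eventually_elim
    case (elim n)
    have "(LINT x:{a..b}|lborel. \<bar>us n x\<bar> powr p) / p < ((LINT x:{a..b}|lborel. \<bar>U x\<bar> powr p) + d) / p"
      using elim(2) p2 by (intro divide_strict_right_mono) simp_all
    moreover have "d / p < d / 2" by (rule divide_strict_left_mono) (use d p2 in simp_all)
    ultimately show ?case using elim(1) unfolding act_def trip_def fst_conv snd_conv add_divide_distrib by linarith
  qed
qed

text \<open>By the Hoelder bound the function stays above \<open>c / 2\<close> on an interval of
  length \<open>d\<close> next to \<open>x\<close>. This keeps the limit of a minimising sequence
  from vanishing.\<close>

lemma tip_bulk:
  assumes h: "h1d {0..l} u g" and l: "0 < l" and A: "(LINT x:{0..l}|lborel. (g x)\<^sup>2) \<le> A"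
    and x: "0 \<le> x" "x \<le> l" "c \<le> u x" and c: "0 < c"
    and d: "d = min (l / 2) ((c / 2)\<^sup>2 / (A + 1))"
  shows "0 < d" "(c / 2)\<^sup>2 * d \<le> (LINT x:{0..l}|lborel. (u x)\<^sup>2)" "(c / 2) powr p * d \<le> (LINT x:{0..l}|lborel. \<bar>u x\<bar> powr p)"
proof -
  have A0: "0 \<le> A" using A set_integral_nonneg_real[of "{0..l}" "\<lambda>x. (g x)\<^sup>2" lborel] by simp
  show d0: "0 < d" unfolding d using l c A0 by simp
  have r: "ray {0..l}" using l by simp
  \<comment> \<open>The interval extends to the left or to the right of \<open>x\<close>, whichever
    side has room; \<open>d \<le> l / 2\<close> guarantees that one of them does.\<close>
  define a where "a = (if l / 2 \<le> x then x - d else x)"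
  have dl: "d \<le> l / 2" unfolding d by (rule min.cobounded1)
  have a: "0 \<le> a" "a + d \<le> l" "x \<in> {a..a + d}" unfolding a_def using x l dl d0 by auto
  have near: "c / 2 \<le> u y" if y: "y \<in> {a..a + d}" for y
  proof -
    have "\<bar>u y - u x\<bar> \<le> sqrt (A * \<bar>y - x\<bar>)"
      by (rule h1d_Hoelder_bound[OF r h _ _ A]) (use x y a in auto)
    also have "\<dots> \<le> sqrt (A * d)" using y a(3) A0 by (intro real_sqrt_le_mono mult_left_mono) (auto simp: abs_le_iff)
    also have "\<dots> \<le> c / 2"
    proof (rule real_le_lsqrt)
      have "A * d \<le> A * ((c / 2)\<^sup>2 / (A + 1))" unfolding d using A0 by (intro mult_left_mono) simp_all
      also have "\<dots> \<le> (c / 2)\<^sup>2" using A0 c by (simp add: field_simps)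
      finally show "A * d \<le> (c / 2)\<^sup>2" .
    qed (use c A0 d0 in simp_all)
    finally show ?thesis using x(3) by linarith
  qed
  have low: "k * d \<le> (LINT x:{0..l}|lborel. f x)"
    if "set_integrable lborel {0..l} f" "\<And>y. y \<in> {a..a + d} \<Longrightarrow> k \<le> f y" "\<And>y. 0 \<le> f y" for k and f :: "real \<Rightarrow> real"
  proof -
    have s: "{a..a + d} \<subseteq> {0..l}" using a by auto
    have "k * d = (LINT x:{a..a + d}|lborel. k)" using d0 by (simp add: set_integral_const)
    also have "\<dots> \<le> (LINT x:{a..a + d}|lborel. f x)"
      by (rule set_integral_mono[OF _ set_integrable_subset[OF that(1) _ s] that(2)])
        (auto intro: borel_integrable_atLeastAtMost')
    also have "\<dots> \<le> (LINT x:{0..l}|lborel. f x)" by (rule set_integral_subset_mono[OF that(1) _ s that(3)]) simp_all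
    finally show ?thesis .
  qed
  show "(c / 2)\<^sup>2 * d \<le> (LINT x:{0..l}|lborel. (u x)\<^sup>2)"
    by (rule low[OF h1dD(2)[OF h]]) (use near c in \<open>auto intro!: power_mono\<close>)
  show "(c / 2) powr p * d \<le> (LINT x:{0..l}|lborel. \<bar>u x\<bar> powr p)"
  proof (rule low[OF h1d_powr_integrable[OF r h p2]])
    show "(c / 2) powr p \<le> \<bar>u y\<bar> powr p" if "y \<in> {a..a + d}" for y
      using near[OF that] c p2 by (intro powr_mono2) simp_all
  qed simp
qed

lemma gtrip_cut:
  assumes gr: "gr N l u g" and R: "0 \<le> R"
  shows "gtrip p N l u g = (trip p {0..l} (u N) (g N) + (\<Sum>i<N. trip p {0..R} (u i) (g i))) + (\<Sum>i<N. trip p {R..} (u i) (g i))"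
proof -
  have "trip p {0..} (u i) (g i) = trip p {0..R} (u i) (g i) + trip p {R..} (u i) (g i)" if "i \<in> {..<N}" for i
    by (rule trip_split_Ici[OF R grD_ray(1)[OF gr] p2]) (use that in simp)
  then have "(\<Sum>i<N. trip p {0..} (u i) (g i)) = (\<Sum>i<N. trip p {0..R} (u i) (g i)) + (\<Sum>i<N. trip p {R..} (u i) (g i))"
    unfolding sum.distrib[symmetric] by (rule sum.cong[OF refl])
  then show ?thesis unfolding gtrip_split by (simp only: add.assoc)
qed

lemma edge_le_total:
  assumes "i \<le> N"
  shows "fst (trip p (edge_dom N l i) (u i) (g i)) \<le> fst (gtrip p N l u g)"
    "snd (snd (trip p (edge_dom N l i) (u i) (g i))) \<le> snd (snd (gtrip p N l u g))"
  unfolding gtrip_def fst_sum_triple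
  by (rule member_le_sum[of i "{..N}" "\<lambda>i. fst (trip p (edge_dom N l i) (u i) (g i))"]; use assms trip_nonneg in simp)
    (rule member_le_sum[of i "{..N}" "\<lambda>i. snd (snd (trip p (edge_dom N l i) (u i) (g i)))"]; use assms trip_nonneg in simp)

text \<open>Lower semicontinuity inside a cut and \<open>escaping_energy\<close> outside give, as
  the cut recedes, \<open>act p 0\<close> of the limit plus \<open>(1 - m) * ee\<close> at most
  \<open>J\<close>, where \<open>m\<close> is the mass of the limit. If \<open>m < 1\<close>,
  raising the limit to unit mass makes its energy per mass strictly smaller, which leads to
  \<open>ee < J\<close>. The hypothesis on the tip excludes \<open>m = 0\<close>.\<close>

theorem minimising_sequence:
  assumes N: "N \<ge> 3" and l: "0 < l" and gr: "\<And>n. gr N l (u n) (g n)"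
    and m1: "\<And>n. snd (snd (gtrip p N l (u n) (g n))) = 1" and A: "\<And>n. fst (gtrip p N l (u n) (g n)) \<le> A"
    and K: "\<And>n i x. i \<le> N \<Longrightarrow> x \<in> edge_dom N l i \<Longrightarrow> u n i x \<le> K" "K > 0"
    and tip: "\<And>n. \<exists>x. 0 \<le> x \<and> x \<le> l \<and> c \<le> u n N x" and c: "0 < c"
    and J: "J \<le> ee" "(\<lambda>n. act p 0 (gtrip p N l (u n) (g n))) \<longlonglongrightarrow> J"
    and Jmin: "\<And>T. T \<in> TT p N l \<Longrightarrow> snd (snd T) = 1 \<Longrightarrow> J \<le> act p 0 T"
  shows "\<exists>T\<in>TT p N l. snd (snd T) = 1 \<and> act p 0 T \<le> J"
proof -
  have l0: "0 \<le> l" using l by simp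
  have "gtrip p N l (u 0) (g 0) \<in> TT p N l" unfolding TT_def using gr[of 0] by blast
  from TT_nonneg(1)[OF this] A[of 0] have A0: "0 \<le> A" by linarith
  have gi: "(LINT x:edge_dom N l i|lborel. (g n i x)\<^sup>2) \<le> A" if "i \<le> N" for n i
    using edge_le_total(1)[OF that, of l "u n" "g n"] A[of n] by (simp add: trip_def)
  have mi: "(LINT x:edge_dom N l i|lborel. (u n i x)\<^sup>2) \<le> 1" if "i \<le> N" for n i
    using edge_le_total(2)[OF that, of l "u n" "g n"] m1[of n] by (simp add: trip_def)
  have bd: "\<bar>u n i x\<bar> \<le> K" if "i \<le> N" "x \<in> edge_dom N l i" for n i x
    using K(1)[OF that] grD(2)[OF gr that] by simp
  have hl: "\<bar>u n i x - u n i y\<bar> \<le> sqrt (A * \<bar>x - y\<bar>)" if "i \<le> N" "x \<in> edge_dom N l i" "y \<in> edge_dom N l i" for n i x y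
    by (rule h1d_Hoelder_bound[OF ray_edge[OF l0] grD(1)[OF gr that(1)] that(3,2) gi[OF that(1)]])
  have "\<exists>r U. strict_mono (r :: nat \<Rightarrow> nat) \<and> (\<forall>i x. i \<le> N \<longrightarrow> x \<in> edge_dom N l i \<longrightarrow> (\<lambda>n. u (r n) i x) \<longlonglongrightarrow> U i x)"
    by (rule equi_Hoelder_subsequence[where K = K and A = A and Q = "\<rat>", OF bd hl edge_dom_dense[OF l] countable_rat A0])
  then obtain r U where r: "strict_mono (r :: nat \<Rightarrow> nat)"
    and lim': "\<forall>i x. i \<le> N \<longrightarrow> x \<in> edge_dom N l i \<longrightarrow> (\<lambda>n. u (r n) i x) \<longlonglongrightarrow> U i x" by blast
  note lim = lim'[rule_format]
  define v w where "v n = u (r n)" and "w n = g (r n)" for n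
  have grv: "gr N l (v n) (w n)" for n unfolding v_def w_def by (rule gr)
  have limv: "(\<lambda>n. v n i x) \<longlonglongrightarrow> U i x" if "i \<le> N" "x \<in> edge_dom N l i" for i x
    unfolding v_def by (rule lim[OF that])
  have "\<exists>G. h1d (edge_dom N l i) (U i) G" if i: "i \<le> N" for i
  proof (rule h1d_limit[where us = "\<lambda>n. v n i" and gs = "\<lambda>n. w n i" and K = A and C = 1 and U = "U i", OF ray_edge[OF l0] grD(1)[OF grv i]])
    show "(LINT x:edge_dom N l i|lborel. (w n i x)\<^sup>2) \<le> A" for n unfolding w_def by (rule gi[OF i])
    show "(LINT x:edge_dom N l i|lborel. (v n i x)\<^sup>2) \<le> 1" for n unfolding v_def by (rule mi[OF i])
    show "(\<lambda>n. v n i x) \<longlonglongrightarrow> U i x" if "x \<in> edge_dom N l i" for x by (rule limv[OF i that])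
  qed blast
  then obtain G where G: "\<And>i. i \<le> N \<Longrightarrow> h1d (edge_dom N l i) (U i) (G i)" by metis
  have Unn: "0 \<le> U i x" if "i \<le> N" "x \<in> edge_dom N l i" for i x
    by (rule LIMSEQ_le_const[OF limv[OF that]]) (use grD(2)[OF grv that] in blast)
  have grU: "gr N l U G"
  proof (rule grI[OF G Unn])
    fix i assume i: "i \<le> N"
    have "(\<lambda>n. v n i 0) \<longlonglongrightarrow> U i 0" by (rule limv[OF i zero_edge[OF l0]])
    moreover have "(\<lambda>n. v n 0 0) \<longlonglongrightarrow> U 0 0" by (rule limv[OF _ zero_edge[OF l0]]) simp
    moreover have "v n i 0 = v n 0 0" for n by (rule grD(3)[OF grv i])
    ultimately show "U i 0 = U 0 0" using LIMSEQ_unique by simp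
  qed
  let ?TU = "gtrip p N l U G"
  define m where "m = snd (snd ?TU)"
  define inU where "inU R = trip p {0..l} (U N) (G N) + (\<Sum>i<N. trip p {0..R} (U i) (G i))" for R
  define inv where "inv n R = trip p {0..l} (v n N) (w n N) + (\<Sum>i<N. trip p {0..R} (v n i) (w n i))" for n R
  define outv where "outv n R = (\<Sum>i<N. trip p {R..} (v n i) (w n i))" for n R
  define \<rho> where "\<rho> R = (\<Sum>i<N. U i R)" for R
  define Kc where "Kc = K powr (p / 2) * sqrt (2 / p)"
  have Kc: "0 \<le> Kc" unfolding Kc_def using p2 by simp
  have hR: "h1d {0..R} (v n i) (w n i)" "h1d {0..R} (U i) (G i)" if "i < N" for n i R
    by (rule h1d_subset[OF grD_ray(1)[OF grv that]], auto, rule h1d_subset[OF grD_ray(1)[OF grU that]], auto)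
  have bdv: "\<bar>v n i x\<bar> \<le> K" if "i \<le> N" "x \<in> edge_dom N l i" for n i x unfolding v_def by (rule bd[OF that])
  have cutv: "gtrip p N l (v n) (w n) = inv n R + outv n R" if "0 \<le> R" for n R
    unfolding inv_def outv_def by (rule gtrip_cut[OF grv that])
  have Nl: "h1d {0..l} (v n N) (w n N)" for n by (rule grD_last(1)[OF grv])
  have NU: "h1d {0..l} (U N) (G N)" by (rule grD_last(1)[OF grU])
  have bN: "\<bar>v n N x\<bar> \<le> K" if "x \<in> {0..l}" for n x using bdv[of N x] that by (simp add: edge_dom_last)
  have lN: "(\<lambda>n. v n N x) \<longlonglongrightarrow> U N x" if "x \<in> {0..l}" for x using limv[of N x] that by (simp add: edge_dom_last)
  have bi: "\<bar>v n i x\<bar> \<le> K" if "i < N" "x \<in> {0..R}" for n i x R using bdv[of i x] that by (simp add: edge_dom_ray)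
  have li: "(\<lambda>n. v n i x) \<longlonglongrightarrow> U i x" if "i < N" "x \<in> {0..R}" for i x R using limv[of i x] that by (simp add: edge_dom_ray)
  have massin: "(\<lambda>n. snd (snd (inv n R))) \<longlonglongrightarrow> snd (snd (inU R))" if R: "0 \<le> R" for R
    unfolding inv_def inU_def fst_sum_triple snd_add fst_add trip_def snd_conv fst_conv
    by (intro tendsto_add tendsto_sum edge_lsc(3)[OF l0 Nl bN lN NU] edge_lsc(3)[OF R hR(1) bi[where R = R] li[where R = R] hR(2)]) simp_all
  have inle: "snd (snd (inv n R)) \<le> 1" if "0 \<le> R" for n R
  proof -
    have "snd (snd (gtrip p N l (v n) (w n))) = 1" unfolding v_def w_def by (rule m1)
    moreover have "0 \<le> snd (snd (outv n R))" unfolding outv_def fst_sum_triple by (intro sum_nonneg trip_nonneg)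
    ultimately show ?thesis unfolding cutv[OF that] by simp
  qed
  have key: "act p 0 (inU R) + (1 - snd (snd (inU R))) * ee - Kc * \<rho> R \<le> J" if R: "0 \<le> R" for R
  proof (rule field_le_epsilon)
    fix e :: real assume e: "0 < e"
    \<comment> \<open>The total weight with which the tolerance \<open>d\<close> enters: once per
      edge, once for \<open>J\<close>, and through the escaping mass and the values at the
      cut.\<close>
    define S where "S = real N + 2 - ee + Kc"
    have S: "S > 0" unfolding S_def using Kc ee_neg by simp
    define d where "d = e / S"
    have d: "d > 0" unfolding d_def using e S by simp
    have "\<forall>\<^sub>F n in sequentially. act p 0 (trip p {0..l} (U N) (G N)) - d < act p 0 (trip p {0..l} (v n N) (w n N))"
      by (rule edge_lsc(1)[OF l0 Nl bN lN NU d])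
    moreover have "\<forall>\<^sub>F n in sequentially. \<forall>i\<in>{..<N}. act p 0 (trip p {0..R} (U i) (G i)) - d < act p 0 (trip p {0..R} (v n i) (w n i))"
      by (intro eventually_ball_finite ballI edge_lsc(1)[OF R hR(1) bi[where R = R] li[where R = R] hR(2) d]) simp_all
    moreover have "\<forall>\<^sub>F n in sequentially. snd (snd (inU R)) - d < snd (snd (inv n R))"
      by (rule order_tendstoD(1)[OF massin[OF R]]) (use d in simp)
    moreover have "\<forall>\<^sub>F n in sequentially. \<forall>i\<in>{..<N}. v n i R < U i R + d"
    proof (intro eventually_ball_finite ballI)
      fix i assume "i \<in> {..<N}"
      then show "\<forall>\<^sub>F n in sequentially. v n i R < U i R + d"
        using R d by (intro order_tendstoD(2)[OF li[of i R R]]) simp_all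
    qed simp
    moreover have "\<forall>\<^sub>F n in sequentially. act p 0 (gtrip p N l (v n) (w n)) < J + d"
    proof (rule order_tendstoD(2))
      show "(\<lambda>n. act p 0 (gtrip p N l (v n) (w n))) \<longlonglongrightarrow> J"
        using LIMSEQ_subseq_LIMSEQ[OF J(2) r] by (simp add: o_def v_def w_def)
    qed (use d in simp)
    ultimately have "\<forall>\<^sub>F n in sequentially. act p 0 (inU R) + (1 - snd (snd (inU R))) * ee - Kc * \<rho> R \<le> J + e"
    proof eventually_elim
      case (elim n)
      have "(\<Sum>i<N. act p 0 (trip p {0..R} (U i) (G i)) - d) \<le> (\<Sum>i<N. act p 0 (trip p {0..R} (v n i) (w n i)))"
        using elim(2) by (intro sum_mono less_imp_le) simp
      then have a: "act p 0 (inU R) - (real N + 1) * d \<le> act p 0 (inv n R)"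
        using elim(1) unfolding inU_def inv_def act_add act_sum sum_subtractf by (simp add: distrib_right)
      have Uin: "U i R \<le> \<rho> R" if "i < N" for i unfolding \<rho>_def
        by (rule member_le_sum[of i "{..<N}" "\<lambda>i. U i R"]) (use that Unn R in \<open>auto simp: edge_dom_ray\<close>)
      have \<rho>0: "0 \<le> \<rho> R" unfolding \<rho>_def by (rule sum_nonneg) (use Unn R in \<open>simp add: edge_dom_ray\<close>)
      define mo where "mo = snd (snd (outv n R))"
      have mo: "mo = 1 - snd (snd (inv n R))"
        using cutv[OF R, of n] m1[of "r n"] unfolding mo_def v_def w_def by simp
      have "0 \<le> snd (snd (inv n R))" unfolding inv_def fst_sum_triple snd_add by (intro add_nonneg_nonneg sum_nonneg trip_nonneg)
      then have mo1: "mo \<le> 1" using mo by simp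
      have "mo * ee - K powr (p / 2) * sqrt (2 / p) * (\<rho> R + d) \<le> act p 0 (outv n R)"
        unfolding outv_def
      proof (rule escaping_energy)
        show "h1d {R..} (v n i) (w n i)" if "i < N" for i
          by (rule h1d_subset[OF grD_ray(1)[OF grv that]]) (use R in auto)
        show "0 \<le> v n i x \<and> v n i x \<le> K" if "i < N" "R \<le> x" for i x
          using grD_ray(2)[OF grv that(1), of x] bi[OF that(1), of x x n] R that(2) by simp
        show "v n i R \<le> \<rho> R + d" if "i < N" for i
        proof -
          have "v n i R < U i R + d" using elim(4) that by simp
          then show ?thesis using Uin[OF that] by linarith
        qed
        show "snd (snd (\<Sum>i<N. trip p {R..} (v n i) (w n i))) = mo" unfolding mo_def outv_def ..
      qed (use K \<rho>0 d mo1 in simp_all)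
      then have b: "mo * ee - Kc * \<rho> R - Kc * d \<le> act p 0 (outv n R)" unfolding Kc_def by (simp add: distrib_left)
      have "mo \<le> 1 - snd (snd (inU R)) + d" using mo elim(3) by simp
      then have "(1 - snd (snd (inU R)) + d) * ee \<le> mo * ee" using ee_neg by (intro mult_right_mono_neg) simp_all
      then have "act p 0 (inU R) + (1 - snd (snd (inU R))) * ee - Kc * \<rho> R - (real N + 1) * d - Kc * d + d * ee \<le> J + d"
        using a b elim(5) unfolding cutv[OF R] act_add by (simp add: distrib_right)
      moreover have "S * d = e" unfolding d_def using S by simp
      ultimately show ?case unfolding S_def by (simp add: algebra_simps)
    qed
    then show "act p 0 (inU R) + (1 - snd (snd (inU R))) * ee - Kc * \<rho> R \<le> J + e"
      by (auto dest: eventually_happens)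
  qed
  have actlim: "((\<lambda>R. act p q (inU R)) \<longlongrightarrow> act p q ?TU) at_top" for q
    unfolding inU_def gtrip_split act_add act_sum
    by (intro tendsto_add tendsto_const tendsto_sum act_ray_limit(1)[OF zero_less_one] grD_ray(1)[OF grU]) simp
  have masslim: "((\<lambda>R. snd (snd (inU R))) \<longlongrightarrow> m) at_top"
  proof -
    \<comment> \<open>The mass is a difference of two actions, so the limit of the actions yields
      the limit of the masses.\<close>
    have e: "snd (snd T) = act p 1 T - act p 0 T" for T by (simp add: act_def)
    show ?thesis unfolding m_def e by (intro tendsto_diff actlim)
  qed
  have \<rho>lim: "((\<lambda>R. \<rho> R) \<longlongrightarrow> 0) at_top"
  proof -
    have "((\<lambda>R. \<Sum>i<N. U i R) \<longlongrightarrow> (\<Sum>i<N. 0)) at_top"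
      by (intro tendsto_sum h1d_tendsto_zero[OF grD_ray(1)[OF grU]]) simp
    then show ?thesis unfolding \<rho>_def by simp
  qed
  have "act p 0 ?TU + (1 - m) * ee - Kc * 0 \<le> J"
  proof (rule tendsto_upperbound)
    show "((\<lambda>R. act p 0 (inU R) + (1 - snd (snd (inU R))) * ee - Kc * \<rho> R) \<longlongrightarrow> act p 0 ?TU + (1 - m) * ee - Kc * 0) at_top"
      by (intro tendsto_intros actlim masslim \<rho>lim)
    show "\<forall>\<^sub>F R in at_top. act p 0 (inU R) + (1 - snd (snd (inU R))) * ee - Kc * \<rho> R \<le> J"
      using eventually_ge_at_top[of 0] by eventually_elim (rule key)
  qed simp
  then have E: "act p 0 ?TU + (1 - m) * ee \<le> J" by simp
  have m_le: "m \<le> 1"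
  proof (rule tendsto_upperbound[OF masslim])
    show "\<forall>\<^sub>F R in at_top. snd (snd (inU R)) \<le> 1"
      using eventually_ge_at_top[of 0]
    proof eventually_elim
      case (elim R)
      show ?case by (rule LIMSEQ_le_const2[OF massin[OF elim]]) (use inle[OF elim] in blast)
    qed
  qed simp
  define dd where "dd = min (l / 2) ((c / 2)\<^sup>2 / (A + 1))"
  have bulk: "0 < dd" "(c / 2)\<^sup>2 * dd \<le> (LINT x:{0..l}|lborel. (v n N x)\<^sup>2)" "(c / 2) powr p * dd \<le> (LINT x:{0..l}|lborel. \<bar>v n N x\<bar> powr p)" for n
  proof -
    have a: "(LINT x:{0..l}|lborel. (w n N x)\<^sup>2) \<le> A" using gi[of N "r n"] by (simp add: w_def edge_dom_last)
    obtain x where x: "0 \<le> x" "x \<le> l" "c \<le> v n N x" using tip[of "r n"] unfolding v_def by blast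
    note tip_bulk[OF Nl l a x c dd_def]
    then show "0 < dd" "(c / 2)\<^sup>2 * dd \<le> (LINT x:{0..l}|lborel. (v n N x)\<^sup>2)" "(c / 2) powr p * dd \<le> (LINT x:{0..l}|lborel. \<bar>v n N x\<bar> powr p)" by blast+
  qed
  have "(c / 2)\<^sup>2 * dd \<le> (LINT x:{0..l}|lborel. (U N x)\<^sup>2)"
    by (rule LIMSEQ_le_const[OF edge_lsc(3)[OF l0 Nl bN lN NU]]) (assumption, assumption, intro exI[of _ 0] allI impI bulk(2))
  also have "\<dots> \<le> m" unfolding m_def using edge_le_total(2)[of N N l U G] by (simp add: trip_def edge_dom_last)
  finally have m_pos: "0 < m" by (rule less_le_trans[OF mult_pos_pos[OF zero_less_power bulk(1)], rotated]) (use c in simp)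
  have "(c / 2) powr p * dd \<le> (LINT x:{0..l}|lborel. \<bar>U N x\<bar> powr p)"
    by (rule LIMSEQ_le_const[OF edge_lsc(2)[OF l0 Nl bN lN NU]]) (assumption, assumption, intro exI[of _ 0] allI impI bulk(3))
  also have "\<dots> \<le> fst (snd ?TU)"
    unfolding gtrip_split fst_sum_triple snd_add fst_add
    using sum_nonneg[of "{..<N}" "\<lambda>i. fst (snd (trip p {0..} (U i) (G i)))"] trip_nonneg(2) by (simp add: trip_def)
  finally have B_pos: "0 < fst (snd ?TU)" by (rule less_le_trans[OF mult_pos_pos[OF _ bulk(1)], rotated]) (use c in simp)
  have TU: "?TU \<in> TT p N l" using grU unfolding TT_def by blast
  show ?thesis
  proof (cases "m = 1")
    case True
    then show ?thesis using E TU unfolding m_def by (intro bexI[of _ ?TU]) simp_all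
  next
    case False
    then have m1: "m < 1" using m_le by simp
    \<comment> \<open>Since \<open>p > 2\<close>, the potential term grows by more than the factor
      \<open>q > 1\<close> that the Dirichlet integral receives; it is positive by
      \<open>tip_bulk\<close>, so the comparison with \<open>J\<close> is strict.\<close>
    define q where "q = 1 / m"
    have q: "1 < q" "q * m = 1" "0 < q" unfolding q_def using m_pos m1 by simp_all
    have "((sqrt q)\<^sup>2 * 1 * fst ?TU, sqrt q powr p / 1 * fst (snd ?TU), (sqrt q)\<^sup>2 / 1 * snd (snd ?TU)) \<in> TT p N (l / 1)"
      by (rule TT_affine[OF TU]) (use q in simp_all)
    moreover have "sqrt q powr p = q powr (p / 2)" using q by (simp add: powr_half_sqrt[symmetric] powr_powr)
    ultimately have "(q * fst ?TU, q powr (p / 2) * fst (snd ?TU), 1) \<in> TT p N l" using q by (simp flip: m_def)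
    from Jmin[OF this] have "J \<le> q * fst ?TU / 2 - q powr (p / 2) * fst (snd ?TU) / p" by (simp add: act_def)
    also have "\<dots> < q * fst ?TU / 2 - q * fst (snd ?TU) / p"
    proof -
      have "q powr 1 < q powr (p / 2)" using q p2 by (intro powr_less_mono) simp_all
      then have "q * fst (snd ?TU) < q powr (p / 2) * fst (snd ?TU)" using q B_pos by (intro mult_strict_right_mono) simp_all
      then show ?thesis using p2 by (simp add: divide_strict_right_mono)
    qed
    also have "\<dots> = q * act p 0 ?TU" by (simp add: act_def right_diff_distrib)
    finally have "m * J < m * (q * act p 0 ?TU)" using m_pos by (rule mult_strict_left_mono)
    also have "m * (q * act p 0 ?TU) = act p 0 ?TU" using q by (simp add: mult_ac)
    finally have "m * J + (1 - m) * ee < J" using E by linarith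
    then have "(1 - m) * ee < (1 - m) * J" by (simp add: algebra_simps)
    then have "ee < J" using m1 by simp
    then show ?thesis using J(1) by simp
  qed
qed

end

section \<open>Local surgery on competitors\<close>

text \<open>Makes the Dirichlet integral of a removed piece as small as desired, and with it the
  Nehari functional of that piece.\<close>

lemma small_integral:
  fixes f :: "real \<Rightarrow> real"
  assumes S: "S \<in> sets borel" and f: "set_integrable lborel S f" and e: "0 < e"
  shows "\<exists>d>0. (LINT x:S \<inter> {x0 - d..x0 + d}|lborel. f x) < e"
proof -
  define D where "D n = S \<inter> {x0 - inverse (real (Suc n))..x0 + inverse (real (Suc n))}" for n
  have "decseq D" unfolding D_def decseq_def
  proof (intro allI impI)
    fix m n :: nat assume "m \<le> n"
    then have "inverse (real (Suc n)) \<le> inverse (real (Suc m))" by (simp add: field_simps)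
    then show "S \<inter> {x0 - inverse (real (Suc n))..x0 + inverse (real (Suc n))}
       \<subseteq> S \<inter> {x0 - inverse (real (Suc m))..x0 + inverse (real (Suc m))}" by (intro Int_mono order_refl atLeastatMost_subset_iff[THEN iffD2] disjI2 conjI) linarith+
  qed
  moreover have "D n \<in> sets lborel" for n unfolding D_def using S by simp
  moreover have "set_integrable lborel (D 0) f" by (rule set_integrable_subset[OF f]) (use S in \<open>auto simp: D_def\<close>)
  ultimately have "(\<lambda>n. LINT x:D n|lborel. f x) \<longlonglongrightarrow> (LINT x:(\<Inter>n. D n)|lborel. f x)"
    by (intro set_integral_cont_down)
  moreover have "(LINT x:(\<Inter>n. D n)|lborel. f x) = 0"
  proof -
    have "x = x0" if "x \<in> (\<Inter>n. D n)" for x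
    proof (rule ccontr)
      assume "x \<noteq> x0"
      then obtain n where "inverse (real (Suc n)) < \<bar>x - x0\<bar>" using reals_Archimedean[of "\<bar>x - x0\<bar>"] by auto
      moreover have "x \<in> D n" using that by blast
      ultimately show False unfolding D_def by auto
    qed
    then have "AE x in lborel. indicat_real (\<Inter>n. D n) x *\<^sub>R f x = 0"
      using AE_lborel_singleton[of x0] by (auto simp: indicator_def elim!: eventually_mono)
    then show ?thesis unfolding set_lebesgue_integral_def by (rule integral_eq_zero_AE)
  qed
  ultimately have "(\<lambda>n. LINT x:D n|lborel. f x) \<longlonglongrightarrow> 0" by simp
  from order_tendstoD(2)[OF this e] obtain n where "(LINT x:D n|lborel. f x) < e"
    by (auto simp: eventually_sequentially)
  then show ?thesis unfolding D_def by (intro exI[of _ "inverse (real (Suc n))"]) simp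
qed

lemma trip_shift_Ici:
  assumes "h1d {a..} u g"
  shows "h1d {b..} (\<lambda>x. u (a - b + x)) (\<lambda>x. g (a - b + x))" "trip p {b..} (\<lambda>x. u (a - b + x)) (\<lambda>x. g (a - b + x)) = trip p {a..} u g"
  using h1d_shift(1)[OF assms, of "a - b"] h1d_shift(2)[where p = p and s = "a - b", OF assms] by simp_all

lemma trip_shift_Icc:
  assumes "h1d {a..a'} u g"
  shows "h1d {b..b + (a' - a)} (\<lambda>x. u (a - b + x)) (\<lambda>x. g (a - b + x))"
    "trip p {b..b + (a' - a)} (\<lambda>x. u (a - b + x)) (\<lambda>x. g (a - b + x)) = trip p {a..a'} u g"
proof -
  have e: "a - (a - b) = b" "a' - (a - b) = b + (a' - a)" by simp_all
  show "h1d {b..b + (a' - a)} (\<lambda>x. u (a - b + x)) (\<lambda>x. g (a - b + x))"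
    using h1d_shift_Icc(1)[OF assms, of "a - b"] unfolding e .
  show "trip p {b..b + (a' - a)} (\<lambda>x. u (a - b + x)) (\<lambda>x. g (a - b + x)) = trip p {a..a'} u g"
    using h1d_shift_Icc(2)[where p = p and s = "a - b", OF assms] unfolding e .
qed

context nls begin

text \<open>The values at both ends of the removed piece agree, so the rest of the half-line can be
  shifted back to close the gap.\<close>

lemma cut_ray:
  assumes N: "N \<ge> 1" and l: "0 \<le> l" and gr: "gr N l u g" and i: "i < N" and ab: "0 \<le> a" "a \<le> b" "u i a = u i b"
  shows "gtrip p N l u g - trip p {a..b} (u i) (g i) \<in> TT p N l"
proof -
  have h: "h1d {0..} (u i) (g i)" by (rule grD_ray(1)[OF gr i])
  have h1: "h1d {0..a} (u i) (g i)" by (rule h1d_subset[OF h]) auto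
  have h2: "h1d {b..} (u i) (g i)" by (rule h1d_subset[OF h]) (use ab in auto)
  have h3: "h1d {a..} (u i) (g i)" by (rule h1d_subset[OF h]) (use ab in auto)
  let ?s = "\<lambda>x. u i (b - a + x)" and ?t = "\<lambda>x. g i (b - a + x)"
  note sh = trip_shift_Ici(1)[where b = a, OF h2] trip_shift_Ici(2)[where b = a and p = p, OF h2]
  have un: "{0..a} \<union> {a..} = {0..}" using ab by auto
  have gl: "h1d {0..} (glue a (u i) ?s) (glue a (g i) ?t)"
    "trip p {0..} (glue a (u i) ?s) (glue a (g i) ?t) = trip p {0..a} (u i) (g i) + trip p {a..} ?s ?t"
    using h1d_glue[OF ab(1) h1 _ sh(1) _ p2] ab(3) un by simp_all
  define v h' where "v j = (if j = i then glue a (u i) ?s else u j)" and "h' j = (if j = i then glue a (g i) ?t else g j)" for j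
  have "trip p {0..l} (u N) (g N) + (\<Sum>j<N. trip p {0..} (v j) (h' j)) \<in> TT p N l"
  proof (rule TT_intro[OF N l])
    show "h1d {0..} (v j) (h' j)" if "j < N" for j using gl(1) grD_ray(1)[OF gr that] by (simp add: v_def h'_def)
    show "0 \<le> v j x" if "j < N" "0 \<le> x" for j x
      using grD_ray(2)[OF gr that] grD_ray(2)[OF gr i, of "b - a + x"] grD_ray(2)[OF gr i, of x] that ab by (simp add: v_def glue_def)
    show "v j 0 = u 0 0" if "j < N" for j using grD_ray(3)[OF gr that] grD_ray(3)[OF gr i] ab by (simp add: v_def glue_def)
  qed (use grD_last[OF gr] in simp_all)
  moreover have "trip p {0..l} (u N) (g N) + (\<Sum>j<N. trip p {0..} (v j) (h' j)) = gtrip p N l u g - trip p {a..b} (u i) (g i)"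
  proof -
    have "(\<Sum>j<N. trip p {0..} (v j) (h' j)) = trip p {0..} (v i) (h' i) + (\<Sum>j\<in>{..<N} - {i}. trip p {0..} (v j) (h' j))"
      by (rule sum.remove) (use i in simp_all)
    also have "(\<Sum>j\<in>{..<N} - {i}. trip p {0..} (v j) (h' j)) = (\<Sum>j\<in>{..<N} - {i}. trip p {0..} (u j) (g j))"
      by (rule sum.cong) (simp_all add: v_def h'_def)
    also have "trip p {0..} (v i) (h' i) = trip p {0..} (u i) (g i) - trip p {a..b} (u i) (g i)"
      using gl(2) sh(2) trip_split_Ici[OF ab(1) h p2] trip_split_Ici[OF ab(2) h3 p2] by (simp add: v_def h'_def)
    also have "trip p {0..} (u i) (g i) - trip p {a..b} (u i) (g i) + (\<Sum>j\<in>{..<N} - {i}. trip p {0..} (u j) (g j))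
        = (\<Sum>j<N. trip p {0..} (u j) (g j)) - trip p {a..b} (u i) (g i)"
      using sum.remove[of "{..<N}" i "\<lambda>j. trip p {0..} (u j) (g j)"] i by simp
    finally show ?thesis unfolding gtrip_split by simp
  qed
  ultimately show ?thesis by simp
qed

text \<open>The edge is opened at \<open>x0\<close> and a constant piece inserted; having no
  gradient, it adds only to the potential term and the mass.\<close>

lemma insert_plateau:
  assumes N: "N \<ge> 1" and gr: "gr N l u g" and x0: "0 \<le> x0" "x0 \<le> l" and d: "0 \<le> d"
  shows "gtrip p N l u g + (0, d * (u N x0) powr p, d * (u N x0)\<^sup>2) \<in> TT p N (l + d)"
proof -
  let ?M = "u N x0"
  have M: "0 \<le> ?M" using grD_last(2)[OF gr x0] .
  have h: "h1d {0..l} (u N) (g N)" by (rule grD_last(1)[OF gr])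
  have h1: "h1d {0..x0} (u N) (g N)" and h2: "h1d {x0..l} (u N) (g N)" by (rule h1d_subset[OF h]; use x0 in auto)+
  let ?s = "\<lambda>x. u N (x0 - (x0 + d) + x)" and ?t = "\<lambda>x. g N (x0 - (x0 + d) + x)"
  note sh = trip_shift_Icc(1)[where b = "x0 + d", OF h2] trip_shift_Icc(2)[where b = "x0 + d" and p = p, OF h2]
  have e: "x0 + d + (l - x0) = l + d" by simp
  note sh = sh[unfolded e]
  have un: "{x0..x0 + d} \<union> {x0 + d..l + d} = {x0..l + d}" "{0..x0} \<union> {x0..l + d} = {0..l + d}" using x0 d by auto
  have hc: "h1d {x0..x0 + d} (\<lambda>_. ?M) (\<lambda>_. 0)" by (rule h1d_const) (use d in simp)
  have xd: "x0 \<le> x0 + d" using d by simp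
  have J1: "{x0 + d..l + d} = {x0 + d..} \<or> (\<exists>c\<ge>x0 + d. {x0 + d..l + d} = {x0 + d..c})" using x0 by auto
  have J2: "{x0..l + d} = {x0..} \<or> (\<exists>c\<ge>x0. {x0..l + d} = {x0..c})" using x0 d by auto
  have eq1: "?M = ?s (x0 + d)" by simp
  note g1 = h1d_glue[OF xd hc J1 sh(1) eq1 p2, unfolded un(1)]
  have eq2: "u N x0 = glue (x0 + d) (\<lambda>_. ?M) ?s x0" using d by (simp add: glue_def)
  note g2 = h1d_glue[OF x0(1) h1 J2 g1(1) eq2 p2, unfolded un(2)]
  have "trip p {0..l + d} (glue x0 (u N) (glue (x0 + d) (\<lambda>_. ?M) ?s)) (glue x0 (g N) (glue (x0 + d) (\<lambda>_. 0) ?t))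
     + (\<Sum>j<N. trip p {0..} (u j) (g j)) \<in> TT p N (l + d)"
  proof (rule TT_intro[OF N _ _ _ _ g2(1)])
    show "0 \<le> glue x0 (u N) (glue (x0 + d) (\<lambda>_. ?M) ?s) x" if "0 \<le> x" "x \<le> l + d" for x
      using grD_last(2)[OF gr, of x] grD_last(2)[OF gr, of "x - d"] M that x0 by (simp add: glue_def)
    show "glue x0 (u N) (glue (x0 + d) (\<lambda>_. ?M) ?s) 0 = u 0 0" using x0 grD_last(3)[OF gr] by (simp add: glue_def)
    show "0 \<le> l + d" using x0 d by simp
    show "h1d {0..} (u j) (g j)" if "j < N" for j by (rule grD_ray(1)[OF gr that])
    show "0 \<le> u j x" if "j < N" "0 \<le> x" for j x by (rule grD_ray(2)[OF gr that])
    show "u j 0 = u 0 0" if "j < N" for j by (rule grD_ray(3)[OF gr that])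
  qed
  moreover have "trip p {0..l + d} (glue x0 (u N) (glue (x0 + d) (\<lambda>_. ?M) ?s)) (glue x0 (g N) (glue (x0 + d) (\<lambda>_. 0) ?t))
     + (\<Sum>j<N. trip p {0..} (u j) (g j)) = gtrip p N l u g + (0, d * ?M powr p, d * ?M\<^sup>2)"
    unfolding g2(2) g1(2) sh(2) gtrip_split trip_split_Icc[OF x0 h p2] trip_const[OF xd] using M by simp
  ultimately show ?thesis by simp
qed

text \<open>The vertex is lowered to the level \<open>y\<close>: every half-line loses its initial
  piece up to a point with value \<open>y\<close>, and the terminal edge starts with a linear ramp
  from \<open>y\<close> back to the old vertex value.\<close>

lemma ramp_vertex:
  assumes N: "N \<ge> 1" and l: "0 \<le> l" and gr: "gr N l u g" and d: "0 < d" and y: "0 \<le> y"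
    and \<epsilon>: "\<And>i. i < N \<Longrightarrow> 0 \<le> \<epsilon> i \<and> u i (\<epsilon> i) = y" and yh: "y \<le> u 0 0"
  shows "gtrip p N l u g + (trip p {0..d} (\<lambda>x. y + (u 0 0 - y) / d * x) (\<lambda>_. (u 0 0 - y) / d)
     - (\<Sum>i<N. trip p {0..\<epsilon> i} (u i) (g i))) \<in> TT p N (l + d)"
proof -
  let ?r = "\<lambda>x. y + (u 0 0 - y) / d * x" and ?r' = "\<lambda>x::real. (u 0 0 - y) / d"
  have h: "h1d {0..l} (u N) (g N)" by (rule grD_last(1)[OF gr])
  let ?s = "\<lambda>x. u N (0 - d + x)" and ?t = "\<lambda>x. g N (0 - d + x)"
  note sh = trip_shift_Icc(1)[where b = d, OF h] trip_shift_Icc(2)[where b = d and p = p, OF h]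
  have e: "d + (l - 0) = l + d" by simp
  note sh = sh[unfolded e]
  have un: "{0..d} \<union> {d..l + d} = {0..l + d}" using l d by auto
  have d0: "0 \<le> d" using d by simp
  have hl: "h1d {0..d} ?r ?r'" by (rule h1d_linear[OF d0])
  have J: "{d..l + d} = {d..} \<or> (\<exists>c\<ge>d. {d..l + d} = {d..c})" using l by auto
  have eq: "?r d = ?s d" using d grD_last(3)[OF gr] by simp
  note g1 = h1d_glue[OF d0 hl J sh(1) eq p2, unfolded un]
  have hi: "h1d {\<epsilon> i..} (u i) (g i)" if "i < N" for i
    by (rule h1d_subset[OF grD_ray(1)[OF gr that]]) (use \<epsilon>[OF that] in auto)
  define v h' where "v j x = u j (\<epsilon> j - 0 + x)" and "h' j x = g j (\<epsilon> j - 0 + x)" for j x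
  have vh: "h1d {0..} (v j) (h' j)" "trip p {0..} (v j) (h' j) = trip p {\<epsilon> j..} (u j) (g j)" if "j < N" for j
    using trip_shift_Ici(1)[where b = 0, OF hi[OF that]] trip_shift_Ici(2)[where b = 0 and p = p, OF hi[OF that]] unfolding v_def[abs_def] h'_def[abs_def] by simp_all
  have "trip p {0..l + d} (glue d ?r ?s) (glue d ?r' ?t) + (\<Sum>j<N. trip p {0..} (v j) (h' j)) \<in> TT p N (l + d)"
  proof (rule TT_intro[OF N _ _ _ _ g1(1)])
    show "0 \<le> glue d ?r ?s x" if "0 \<le> x" "x \<le> l + d" for x
      using grD_last(2)[OF gr, of "x - d"] that y yh d by (simp add: glue_def)
    show "v j 0 = y" if "j < N" for j using \<epsilon>[OF that] by (simp add: v_def)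
    show "0 \<le> v j x" if "j < N" "0 \<le> x" for j x using grD_ray(2)[OF gr that(1), of "\<epsilon> j + x"] \<epsilon>[OF that(1)] that(2) by (simp add: v_def)
    show "glue d ?r ?s 0 = y" using d by (simp add: glue_def)
    show "0 \<le> l + d" using l d by simp
  qed (use vh in simp)
  moreover have "(\<Sum>j<N. trip p {0..} (v j) (h' j)) = (\<Sum>j<N. trip p {0..} (u j) (g j)) - (\<Sum>i<N. trip p {0..\<epsilon> i} (u i) (g i))"
    unfolding sum_subtractf[symmetric]
  proof (rule sum.cong[OF refl])
    fix j assume "j \<in> {..<N}"
    then have j: "j < N" by simp
    show "trip p {0..} (v j) (h' j) = trip p {0..} (u j) (g j) - trip p {0..\<epsilon> j} (u j) (g j)"
      unfolding vh(2)[OF j] using trip_split_Ici[OF _ grD_ray(1)[OF gr j] p2, of "\<epsilon> j"] \<epsilon>[OF j] by simp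
  qed
  ultimately show ?thesis unfolding g1(2) sh(2) gtrip_split by (simp add: algebra_simps)
qed

text \<open>The new mass is at least 1/2, so the factor that \<open>TT_normalise\<close> puts in
  front of \<open>ne\<close> is at most the change of mass. As \<open>ne c T = 0\<close>, the price
  is a product of two changes, that is, of second order.\<close>

lemma perturb:
  assumes T: "snd (snd T) = 1" "ne c T = 0" and T': "T + \<Delta> \<in> TT p N l'"
    and C: "\<bar>snd (snd \<Delta>)\<bar> \<le> 1 / 2"
  obtains T'' where "T'' \<in> TT p N l'" "snd (snd T'') = 1" "act p 0 T'' \<le> act p 0 T + (act p c \<Delta> + \<bar>snd (snd \<Delta>)\<bar> * \<bar>ne c \<Delta>\<bar>)"
proof -
  define C' where "C' = snd (snd (T + \<Delta>))"
  have C': "C' = 1 + snd (snd \<Delta>)" "1 / 2 \<le> C'" unfolding C'_def using T(1) C by (simp_all add: abs_le_iff)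
 have C'p: "0 < snd (snd (T + \<Delta>))" using C'(2) unfolding C'_def by linarith
  obtain T'' where T'': "T'' \<in> TT p N l'" "snd (snd T'') = 1" "act p 0 T'' \<le> act p c (T + \<Delta>) - c + (1 / C' - 1) / 2 * ne c (T + \<Delta>)"
    unfolding C'_def by (rule TT_normalise[OF T' C'p TT_nonneg(2)[OF T']]) blast
  have "\<bar>(1 / C' - 1) / 2\<bar> \<le> \<bar>snd (snd \<Delta>)\<bar>"
  proof -
    have "(1 / C' - 1) / 2 = - snd (snd \<Delta>) / (2 * C')" using C' by (simp add: field_simps)
    then have "\<bar>(1 / C' - 1) / 2\<bar> = \<bar>snd (snd \<Delta>)\<bar> / (2 * C')" using C'(2) by (simp add: abs_divide)
    also have "\<dots> \<le> \<bar>snd (snd \<Delta>)\<bar> / 1" using C'(2) by (intro divide_left_mono) simp_all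
    finally show ?thesis by simp
  qed
  then have "\<bar>(1 / C' - 1) / 2\<bar> * \<bar>ne c \<Delta>\<bar> \<le> \<bar>snd (snd \<Delta>)\<bar> * \<bar>ne c \<Delta>\<bar>" by (rule mult_right_mono) simp
  then have "(1 / C' - 1) / 2 * ne c \<Delta> \<le> \<bar>snd (snd \<Delta>)\<bar> * \<bar>ne c \<Delta>\<bar>"
    unfolding abs_mult[symmetric] using abs_ge_self order_trans by blast
  moreover have e1: "act p c (T + \<Delta>) - c = act p 0 T + act p c \<Delta>" unfolding act_add act_lam[of c T] using T(1) by simp
  moreover have e2: "ne c (T + \<Delta>) = ne c \<Delta>" unfolding ne_add using T(2) by simp
  ultimately have "act p 0 T'' \<le> act p 0 T + (act p c \<Delta> + \<bar>snd (snd \<Delta>)\<bar> * \<bar>ne c \<Delta>\<bar>)" using T''(3) unfolding e2 by linarith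
  then show ?thesis by (rule that[OF T''(1,2)])
qed

lemma trip_small:
  assumes ab: "a \<le> b" and h: "h1d {a..b} u g" and u: "\<And>x. x \<in> {a..b} \<Longrightarrow> 0 \<le> u x \<and> u x \<le> H" and c: "0 \<le> c"
  shows "snd (snd (trip p {a..b} u g)) \<le> H\<^sup>2 * (b - a)"
    "\<bar>ne c (trip p {a..b} u g)\<bar> \<le> (LINT x:{a..b}|lborel. (g x)\<^sup>2) + (H powr p + 2 * c * H\<^sup>2) * (b - a)"
proof -
  have r: "ray {a..b}" using ab by simp
  have up: "(LINT x:{a..b}|lborel. f x) \<le> k * (b - a)"
    if "set_integrable lborel {a..b} f" "\<And>x. x \<in> {a..b} \<Longrightarrow> f x \<le> k" for k and f :: "real \<Rightarrow> real"
  proof -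
    have "(LINT x:{a..b}|lborel. f x) \<le> (LINT x:{a..b}|lborel. k)"
      by (rule set_integral_mono[OF that(1) _ that(2)]) (auto intro: borel_integrable_atLeastAtMost')
    then show ?thesis using ab by (simp add: set_integral_const mult.commute)
  qed
  have C: "(LINT x:{a..b}|lborel. (u x)\<^sup>2) \<le> H\<^sup>2 * (b - a)"
    by (rule up[OF h1dD(2)[OF h]]) (use u in \<open>auto intro!: power_mono\<close>)
  have B: "(LINT x:{a..b}|lborel. \<bar>u x\<bar> powr p) \<le> H powr p * (b - a)"
    by (rule up[OF h1d_powr_integrable[OF r h p2]]) (use u p2 in \<open>auto intro!: powr_mono2\<close>)
  have nn: "0 \<le> (LINT x:{a..b}|lborel. (g x)\<^sup>2)" "0 \<le> (LINT x:{a..b}|lborel. \<bar>u x\<bar> powr p)" "0 \<le> (LINT x:{a..b}|lborel. (u x)\<^sup>2)"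
    by (intro set_integral_nonneg_real; simp)+
  show "snd (snd (trip p {a..b} u g)) \<le> H\<^sup>2 * (b - a)" using C by (simp add: trip_def)
  have C2: "2 * c * (LINT x:{a..b}|lborel. (u x)\<^sup>2) \<le> 2 * c * (H\<^sup>2 * (b - a))" using C c by (intro mult_left_mono) simp_all
  have C3: "0 \<le> 2 * c * (LINT x:{a..b}|lborel. (u x)\<^sup>2)" using nn(3) c by simp
  have "\<bar>ne c (trip p {a..b} u g)\<bar> \<le> (LINT x:{a..b}|lborel. (g x)\<^sup>2) + H powr p * (b - a) + 2 * c * (H\<^sup>2 * (b - a))"
    unfolding ne_def trip_def fst_conv snd_conv using B C2 C3 nn by linarith
  then show "\<bar>ne c (trip p {a..b} u g)\<bar> \<le> (LINT x:{a..b}|lborel. (g x)\<^sup>2) + (H powr p + 2 * c * H\<^sup>2) * (b - a)"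
    by (simp add: algebra_simps)
qed

text \<open>Pointwise \<open>(g x)\<^sup>2 / 2 \<ge> - t * g x - t\<^sup>2 / 2\<close>, and the
  integral of \<open>g\<close> is \<open>u b - u a\<close>. The slope \<open>t\<close> is free, to
  be matched to the expected descent.\<close>

lemma act_lower:
  assumes ab: "a \<le> b" and h: "h1d {a..b} u g" and u: "\<And>x. x \<in> {a..b} \<Longrightarrow> 0 \<le> u x"
    and k: "\<And>x. x \<in> {a..b} \<Longrightarrow> k \<le> c * (u x)\<^sup>2 - u x powr p / p"
  shows "t * (u a - u b) + (k - t\<^sup>2 / 2) * (b - a) \<le> act p c (trip p {a..b} u g)"
proof -
  have r: "ray {a..b}" using ab by simp
  have gi1: "set_integrable lborel {a..b} g" by (rule weak_deriv_onD(2)[OF h1dD(3)[OF h]]) (use ab in simp_all)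
  have gi: "set_integrable lborel {a..b} (\<lambda>x. (- t) * g x)" "u b - u a = (LINT x:{a..b}|lborel. g x)"
    by (rule set_integrable_mult_right[OF gi1], rule weak_deriv_onD(3)[OF h1dD(3)[OF h]]) (use ab in simp_all)
  have ki: "set_integrable lborel {a..b} (\<lambda>x. k - t\<^sup>2 / 2)" by (rule borel_integrable_atLeastAtMost') simp
  have "t * (u a - u b) + (k - t\<^sup>2 / 2) * (b - a) = (LINT x:{a..b}|lborel. (- t) * g x) + (LINT x:{a..b}|lborel. k - t\<^sup>2 / 2)"
    unfolding set_integral_mult_right gi(2)[symmetric] using ab by (simp add: set_integral_const algebra_simps)
  also have "\<dots> = (LINT x:{a..b}|lborel. (- t) * g x + (k - t\<^sup>2 / 2))" by (rule set_integral_add(2)[OF gi(1) ki, symmetric])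
  also have "\<dots> \<le> act p c (trip p {a..b} u g)"
    unfolding act_trip(2)[OF r h p2]
  proof (rule set_integral_mono[OF set_integral_add(1)[OF gi(1) ki] act_trip(1)[OF r h p2]])
    fix x assume x: "x \<in> {a..b}"
    have "\<bar>u x\<bar> = u x" using u[OF x] by simp
    then show "- t * g x + (k - t\<^sup>2 / 2) \<le> (g x)\<^sup>2 / 2 - \<bar>u x\<bar> powr p / p + c * (u x)\<^sup>2"
      using k[OF x] zero_le_power2[of "g x + t"] by (simp add: power2_eq_square algebra_simps)
  qed
  finally show ?thesis .
qed


section \<open>Attainment in terms of the level, and closedness in the length\<close>

text \<open>Members of a minimising sequence with energy at most \<open>ee\<close> satisfy
  \<open>low_energy\<close>, which supplies the bounds and the high point on the terminal edge that
  \<open>minimising_sequence\<close> asks for.\<close>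

lemma att_below:
  assumes N: "N \<ge> 3" and l: "0 < l" and T0: "T0 \<in> TT p N l" "snd (snd T0) = 1" "act p 0 T0 < ee"
  shows "att p N 1 l"
proof -
  have l0: "0 \<le> l" using l by simp
  define S where "S = {act p 0 T | T. T \<in> TT p N l \<and> snd (snd T) = 1}"
  obtain B where B: "\<forall>N l T. 3 \<le> N \<longrightarrow> 0 \<le> l \<longrightarrow> T \<in> TT p N l \<longrightarrow> snd (snd T) = 1 \<longrightarrow> B \<le> act p 0 T"
    using energy_bounded_below by blast
  have bb: "bdd_below S" by (rule bdd_belowI[of _ B]) (use B N l0 in \<open>auto simp: S_def\<close>)
  have T0S: "act p 0 T0 \<in> S" unfolding S_def using T0 by blast
  define J where "J = Inf S"
  have Jle: "J \<le> act p 0 T" if "T \<in> TT p N l" "snd (snd T) = 1" for T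
    unfolding J_def by (rule cInf_lower[OF _ bb]) (use that in \<open>unfold S_def, blast\<close>)
  have Jee: "J < ee" using Jle[OF T0(1,2)] T0(3) by simp
  \<comment> \<open>Tolerances not exceeding \<open>ee - J\<close> keep the whole sequence at or
    below the level.\<close>
  define e where "e n = inverse (real (Suc n)) * (ee - J)" for n
  have e: "0 < e n" "e n \<le> ee - J" for n
  proof -
    have "0 < inverse (real (Suc n))" "inverse (real (Suc n)) \<le> 1" by (simp_all add: divide_simps)
    then show "0 < e n" "e n \<le> ee - J" unfolding e_def using Jee mult_right_mono[of "inverse (real (Suc n))" 1 "ee - J"] by simp_all
  qed
  have "\<exists>u g. gr N l u g \<and> snd (snd (gtrip p N l u g)) = 1 \<and> act p 0 (gtrip p N l u g) < J + e n" for n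
  proof -
    have "Inf S < J + e n" using e(1)[of n] by (simp add: J_def)
    from cInf_lessD[OF _ this] obtain s where "s \<in> S" "s < J + e n" using T0S by blast
    then show ?thesis unfolding S_def TT_def by blast
  qed
  then obtain u g where ug: "\<And>n. gr N l (u n) (g n)" "\<And>n. snd (snd (gtrip p N l (u n) (g n))) = 1"
    "\<And>n. act p 0 (gtrip p N l (u n) (g n)) < J + e n" by metis
  have le: "act p 0 (gtrip p N l (u n) (g n)) \<le> ee" for n using ug(3)[of n] e(2)[of n] by linarith
  have low: "\<exists>x0. 0 \<le> x0 \<and> x0 \<le> l \<and> c0 \<le> u n N x0 \<and> u n N x0 \<le> M1 \<and> fst (gtrip p N l (u n) (g n)) \<le> 2 * lam M1
     \<and> (\<forall>i x. i \<le> N \<longrightarrow> x \<in> edge_dom N l i \<longrightarrow> u n i x \<le> u n N x0)" for n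
    by (rule low_energy[OF l0 ug(1) N ug(2) le]) blast
  have "\<exists>T\<in>TT p N l. snd (snd T) = 1 \<and> act p 0 T \<le> J"
  proof (rule minimising_sequence[OF N l ug(1,2)])
    show "fst (gtrip p N l (u n) (g n)) \<le> 2 * lam M1" for n using low[of n] by blast
    show "u n i x \<le> M1" if "i \<le> N" "x \<in> edge_dom N l i" for n i x
      using low[of n] that by (meson order_trans)
    show "\<exists>x. 0 \<le> x \<and> x \<le> l \<and> c0 \<le> u n N x" for n using low[of n] by blast
    show "J \<le> ee" using Jee by simp
    show "(\<lambda>n. act p 0 (gtrip p N l (u n) (g n))) \<longlonglongrightarrow> J"
    proof (rule tendsto_sandwich)
      show "\<forall>\<^sub>F n in sequentially. J \<le> act p 0 (gtrip p N l (u n) (g n))"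
        by (intro always_eventually allI Jle ug(2)) (use ug(1) in \<open>auto simp: TT_def\<close>)
      show "\<forall>\<^sub>F n in sequentially. act p 0 (gtrip p N l (u n) (g n)) \<le> J + e n"
        using ug(3) by (intro always_eventually allI less_imp_le)
      have "e \<longlonglongrightarrow> 0 * (ee - J)" unfolding e_def by (intro tendsto_intros LIMSEQ_inverse_real_of_nat)
      then show "(\<lambda>n. J + e n) \<longlonglongrightarrow> J" using tendsto_add[OF tendsto_const[of J], of e 0] by simp
    qed simp
  qed (use M1_pos c0_pos Jle in simp_all)
  then obtain T where "T \<in> TT p N l" "snd (snd T) = 1" "act p 0 T \<le> J" by blast
  then show ?thesis unfolding att_def using Jle order_trans by blast
qed

text \<open>Escaping solitons bring the infimum down to \<open>ee\<close>, so a minimiser cannot lie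
  above it. Conversely, either some competitor lies strictly below the level, or the given one is
  itself minimal.\<close>

lemma att_iff_low:
  assumes N: "N \<ge> 3" and l: "0 < l"
  shows "att p N 1 l \<longleftrightarrow> (\<exists>T\<in>TT p N l. snd (snd T) = 1 \<and> act p 0 T \<le> ee)"
proof
  assume "att p N 1 l"
  then obtain T where T: "T \<in> TT p N l" "snd (snd T) = 1"
    "\<And>T'. T' \<in> TT p N l \<Longrightarrow> snd (snd T') = 1 \<Longrightarrow> act p 0 T \<le> act p 0 T'" unfolding att_def by blast
  have "act p 0 T \<le> ee"
  proof (rule field_le_epsilon)
    fix e :: real assume "0 < e"
    then obtain T' where "T' \<in> TT p N l" "snd (snd T') = 1" "act p 0 T' < ee + e" by (rule below_level[OF N l])
    then show "act p 0 T \<le> ee + e" using T(3)[of T'] by simp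
  qed
  then show "\<exists>T\<in>TT p N l. snd (snd T) = 1 \<and> act p 0 T \<le> ee" using T by blast
next
  assume "\<exists>T\<in>TT p N l. snd (snd T) = 1 \<and> act p 0 T \<le> ee"
  then obtain T where T: "T \<in> TT p N l" "snd (snd T) = 1" "act p 0 T \<le> ee" by blast
  show "att p N 1 l"
  proof (cases "\<exists>T'\<in>TT p N l. snd (snd T') = 1 \<and> act p 0 T' < ee")
    case True
    then show ?thesis using att_below[OF N l] by blast
  next
    case False
    then have "act p 0 T \<le> act p 0 T'" if "T' \<in> TT p N l" "snd (snd T') = 1" for T'
      using T(3) that by (meson le_less_linear order_trans)
    then show ?thesis unfolding att_def using T by blast
  qed
qed

text \<open>If no competitor for the length \<open>l\<close> lies below \<open>ee\<close>, then
  competitors of energy at most \<open>ee\<close> for the lengths \<open>L n\<close>, dilated to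
  length \<open>l\<close>, form a minimising sequence at the level \<open>ee\<close>, to which
  \<open>minimising_sequence\<close> still applies.\<close>

lemma att_closed:
  assumes N: "N \<ge> 3" and l: "0 < l" and L: "\<And>n. 0 < L n" "L \<longlonglongrightarrow> l" and att: "\<And>n. att p N 1 (L n)"
  shows "att p N 1 l"
proof (cases "\<exists>T\<in>TT p N l. snd (snd T) = 1 \<and> act p 0 T < ee")
  case True
  then show ?thesis using att_below[OF N l] by blast
next
  case False
  then have Jmin: "ee \<le> act p 0 T" if "T \<in> TT p N l" "snd (snd T) = 1" for T using that by (meson not_less)
  have "(\<lambda>n. L n / l) \<longlonglongrightarrow> l / l" by (intro tendsto_intros L) (use l in simp)
  then have \<tau>l: "(\<lambda>n. L n / l) \<longlonglongrightarrow> 1" using l by simp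
  have "\<forall>\<^sub>F n in sequentially. 1 / 4 < L n / l \<and> L n / l < 4"
    by (intro eventually_conj order_tendstoD[OF \<tau>l]) simp_all
  then obtain n0 where n0: "\<And>n. n \<ge> n0 \<Longrightarrow> 1 / 4 < L n / l \<and> L n / l < 4" unfolding eventually_sequentially by blast
  \<comment> \<open>Dropping the first \<open>n0\<close> terms leaves ratios between 1/4 and 4, so
    that the amplitudes \<open>sqrt (\<tau> n)\<close> lie between 1/2 and 2.\<close>
  define \<tau> where "\<tau> n = L (n + n0) / l" for n
  have \<tau>: "1 / 4 < \<tau> n" "\<tau> n < 4" "0 < \<tau> n" for n
    using n0[of "n + n0"] divide_pos_pos[OF L(1) l, of "n + n0"] unfolding \<tau>_def by simp_all
  have \<tau>1: "\<tau> \<longlonglongrightarrow> 1" unfolding \<tau>_def[abs_def] by (rule LIMSEQ_ignore_initial_segment[OF \<tau>l])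
  have \<tau>L: "L (n + n0) / \<tau> n = l" for n unfolding \<tau>_def using L(1)[of "n + n0"] l by simp
  have "\<exists>u g. gr N (L (n + n0)) u g \<and> snd (snd (gtrip p N (L (n + n0)) u g)) = 1 \<and> act p 0 (gtrip p N (L (n + n0)) u g) \<le> ee" for n
    using att[of "n + n0"] unfolding att_iff_low[OF N L(1)] TT_def by blast
  then obtain u g where ug: "\<And>n. gr N (L (n + n0)) (u n) (g n)" "\<And>n. snd (snd (gtrip p N (L (n + n0)) (u n) (g n))) = 1"
    "\<And>n. act p 0 (gtrip p N (L (n + n0)) (u n) (g n)) \<le> ee" by metis
  define T where "T n = gtrip p N (L (n + n0)) (u n) (g n)" for n
  have L0: "0 \<le> L n" for n using L(1)[of n] by simp
  have low: "\<exists>x0. 0 \<le> x0 \<and> x0 \<le> L (n + n0) \<and> c0 \<le> u n N x0 \<and> u n N x0 \<le> M1 \<and> fst (T n) \<le> 2 * lam M1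
     \<and> (\<forall>i x. i \<le> N \<longrightarrow> x \<in> edge_dom N (L (n + n0)) i \<longrightarrow> u n i x \<le> u n N x0)" for n
    unfolding T_def by (rule low_energy[OF L0 ug(1) N ug(2,3)]) blast
  obtain B where B: "\<forall>N l T. 3 \<le> N \<longrightarrow> 0 \<le> l \<longrightarrow> T \<in> TT p N l \<longrightarrow> snd (snd T) = 1 \<longrightarrow> B \<le> act p 0 T"
    using energy_bounded_below by blast
  have TTn: "T n \<in> TT p N (L (n + n0))" for n unfolding T_def TT_def using ug(1) by blast
  have An: "0 \<le> fst (T n)" "fst (T n) \<le> 2 * lam M1" for n using TT_nonneg(1)[OF TTn] low[of n] by blast+
  have Bn: "0 \<le> fst (snd (T n)) / p" "fst (snd (T n)) / p \<le> lam M1 + \<bar>B\<bar>" for n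
  proof -
    show "0 \<le> fst (snd (T n)) / p" using TT_nonneg(2)[OF TTn, of n] p2 by simp
    have "B \<le> act p 0 (T n)" using B N L0 TTn ug(2) unfolding T_def by blast
    then show "fst (snd (T n)) / p \<le> lam M1 + \<bar>B\<bar>" using An(2)[of n] unfolding act_def by simp
  qed
  \<comment> \<open>Dilation by \<open>\<tau> n\<close> divides the mass by that factor, and the
    amplitude \<open>sqrt (\<tau> n)\<close> restores it to one.\<close>
  define v w where "v n = (\<lambda>i x. sqrt (\<tau> n) * u n i (0 + \<tau> n * x))" and "w n = (\<lambda>i x. sqrt (\<tau> n) * \<tau> n * g n i (0 + \<tau> n * x))" for n
  have c: "0 \<le> sqrt (\<tau> n)" for n using \<tau>(3)[of n] by simp
  have grv: "gr N l (v n) (w n)" for n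
    using gr_affine(1)[OF ug(1) c \<tau>(3), of n n n] unfolding \<tau>L v_def w_def .
  have tv: "gtrip p N l (v n) (w n) = (\<tau> n * \<tau> n * fst (T n), sqrt (\<tau> n) powr p / \<tau> n * fst (snd (T n)), 1)" for n
    using gr_affine(2)[where p = p, OF ug(1) c \<tau>(3), of n n n] \<tau>(3)[of n] ug(2)[of n] unfolding \<tau>L v_def w_def T_def by simp
  have s2: "1 / 2 \<le> sqrt (\<tau> n)" "sqrt (\<tau> n) \<le> 2" for n
    using \<tau>[of n] by (intro real_le_rsqrt, simp add: power2_eq_square, intro real_le_lsqrt, simp_all)
  have actv: "act p 0 (gtrip p N l (v n) (w n)) \<le> ee + (\<bar>\<tau> n * \<tau> n - 1\<bar> * lam M1 + \<bar>sqrt (\<tau> n) powr p / \<tau> n - 1\<bar> * (lam M1 + \<bar>B\<bar>))" for n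
  proof -
    have alg: "X * A / 2 - Y * B' / p + 0 * 1 = A / 2 - B' / p + 0 * C + (X - 1) * (A / 2) - (Y - 1) * (B' / p)"
      for X Y A B' C :: real by (simp add: left_diff_distrib diff_divide_distrib)
    define a b where "a = \<tau> n * \<tau> n - 1" and "b = sqrt (\<tau> n) powr p / \<tau> n - 1"
    have "act p 0 (gtrip p N l (v n) (w n)) = act p 0 (T n) + a * (fst (T n) / 2) - b * (fst (snd (T n)) / p)"
      unfolding tv a_def b_def act_def fst_conv snd_conv by (rule alg)
    moreover have "a * (fst (T n) / 2) \<le> \<bar>a\<bar> * lam M1"
      using An[of n] by (intro mult_mono) simp_all
    moreover have "- (b * (fst (snd (T n)) / p)) \<le> \<bar>b\<bar> * (lam M1 + \<bar>B\<bar>)"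
      unfolding mult_minus_left[symmetric] using Bn[of n] by (intro mult_mono) simp_all
    moreover have "act p 0 (T n) \<le> ee" unfolding T_def by (rule ug(3))
    ultimately show ?thesis unfolding a_def b_def by linarith
  qed
  have TTv: "gtrip p N l (v n) (w n) \<in> TT p N l" for n unfolding TT_def using grv by blast
  have "\<exists>T\<in>TT p N l. snd (snd T) = 1 \<and> act p 0 T \<le> ee"
  proof (rule minimising_sequence[OF N l grv])
    show "snd (snd (gtrip p N l (v n) (w n))) = 1" for n by (simp add: tv)
    show "fst (gtrip p N l (v n) (w n)) \<le> 16 * (2 * lam M1)" for n
    proof -
      have "\<tau> n * \<tau> n \<le> 4 * 4" using \<tau>[of n] by (intro mult_mono) simp_all
      then show ?thesis unfolding tv fst_conv using An[of n] by (intro mult_mono) simp_all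
    qed
    have dom: "0 + \<tau> n * x \<in> edge_dom N (L (n + n0)) i" if "x \<in> edge_dom N l i" for n i x
    proof -
      have "L (n + n0) = l * \<tau> n" using \<tau>L[of n] \<tau>(3)[of n] by (simp add: field_simps)
      then show ?thesis using that \<tau>(3)[of n] by (auto simp: edge_dom_def mult.commute split: if_splits)
    qed
    show "v n i x \<le> 2 * M1" if "i \<le> N" "x \<in> edge_dom N l i" for n i x
    proof -
      have "u n i (0 + \<tau> n * x) \<le> M1" using low[of n] that(1) dom[OF that(2)] by (meson order_trans)
      moreover have "0 \<le> u n i (0 + \<tau> n * x)" by (rule grD(2)[OF ug(1) that(1) dom[OF that(2)]])
      ultimately show ?thesis unfolding v_def using s2[of n] by (intro mult_mono) simp_all
    qed
    show "\<exists>x. 0 \<le> x \<and> x \<le> l \<and> c0 / 2 \<le> v n N x" for n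
    proof -
      obtain x0 where x0: "0 \<le> x0" "x0 \<le> L (n + n0)" "c0 \<le> u n N x0" using low[of n] by blast
      have "x0 / \<tau> n \<le> L (n + n0) / \<tau> n" using x0(2) \<tau>(3)[of n] by (intro divide_right_mono) simp_all
      moreover have "1 / 2 * c0 \<le> sqrt (\<tau> n) * u n N x0" using s2[of n] x0(3) c0_pos \<tau>(3)[of n] by (intro mult_mono) simp_all
      ultimately show ?thesis using x0(1) \<tau>(3)[of n] unfolding \<tau>L v_def by (intro exI[of _ "x0 / \<tau> n"]) simp
    qed
    show "(\<lambda>n. act p 0 (gtrip p N l (v n) (w n))) \<longlonglongrightarrow> ee"
    proof (rule tendsto_sandwich)
      show "\<forall>\<^sub>F n in sequentially. ee \<le> act p 0 (gtrip p N l (v n) (w n))"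
        by (intro always_eventually allI Jmin TTv) (simp add: tv)
      show "\<forall>\<^sub>F n in sequentially. act p 0 (gtrip p N l (v n) (w n)) \<le> ee + (\<bar>\<tau> n * \<tau> n - 1\<bar> * lam M1 + \<bar>sqrt (\<tau> n) powr p / \<tau> n - 1\<bar> * (lam M1 + \<bar>B\<bar>))"
        by (intro always_eventually allI actv)
      have "(\<lambda>n. ee + (\<bar>\<tau> n * \<tau> n - 1\<bar> * lam M1 + \<bar>sqrt (\<tau> n) powr p / \<tau> n - 1\<bar> * (lam M1 + \<bar>B\<bar>))) \<longlonglongrightarrow>
        ee + (\<bar>1 * 1 - 1\<bar> * lam M1 + \<bar>sqrt 1 powr p / 1 - 1\<bar> * (lam M1 + \<bar>B\<bar>))"
        by (intro tendsto_intros \<tau>1) simp_all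
      then show "(\<lambda>n. ee + (\<bar>\<tau> n * \<tau> n - 1\<bar> * lam M1 + \<bar>sqrt (\<tau> n) powr p / \<tau> n - 1\<bar> * (lam M1 + \<bar>B\<bar>))) \<longlonglongrightarrow> ee" by simp
    qed simp
  qed (use M1_pos c0_pos Jmin in simp_all)
  then show ?thesis unfolding att_iff_low[OF N l] .
qed


text \<open>With \<open>\<Delta>\<close> the change of the three integrals under a local modification, the first order part
  \<open>act p c \<Delta>\<close> decides, where \<open>2 c\<close> is the Lagrange multiplier of the minimiser.\<close>

lemma minimiser_below_on_rays:
  assumes N: "N \<ge> 3" and l: "0 < l" and gr: "gr N l u g" and m: "snd (snd (gtrip p N l u g)) = 1"
    and c: "0 < c" and ne0: "ne c (gtrip p N l u g) = 0"
    and min: "\<And>T. T \<in> TT p N l \<Longrightarrow> snd (snd T) = 1 \<Longrightarrow> act p 0 (gtrip p N l u g) \<le> act p 0 T"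
    and M: "M powr (p - 2) \<le> p * c" and ray: "\<And>i x. i < N \<Longrightarrow> 0 \<le> x \<Longrightarrow> u i x < M"
    and h: "0 < u 0 0" and i: "i < N" and x: "0 < x"
  shows "u i x < u 0 0"
proof (rule ccontr)
  assume "\<not> u i x < u 0 0"
  then have ux: "u 0 0 \<le> u i x" by simp
  have hi: "h1d {0..} (u i) (g i)" by (rule grD_ray(1)[OF gr i])
  have nn: "0 \<le> u i y" if "0 \<le> y" for y by (rule grD_ray(2)[OF gr i that])
  \<comment> \<open>If the maximum sits at the vertex, then \<open>x\<close> is a maximum as well,
    because its value is at least that of the vertex. So an interior maximum exists, and a piece
    around it can be removed.\<close>
  have "\<exists>x0. 0 < x0 \<and> (\<forall>y\<ge>0. u i y \<le> u i x0)"
  proof -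
    have "\<exists>z. 0 \<le> z \<and> (\<forall>y\<ge>0. u i y \<le> u i z)"
      by (rule h1d_attains_max[OF ray_Ici hi]) (use nn in auto)
    then obtain z where z: "0 \<le> z" "\<And>y. 0 \<le> y \<Longrightarrow> u i y \<le> u i z" by blast
    show ?thesis
    proof (cases "z = 0")
      case True
      then have "u i z \<le> u i x" using ux grD_ray(3)[OF gr i] by simp
      then show ?thesis using z(2) x order_trans by blast
    next
      case False
      then show ?thesis using z by (intro exI[of _ z]) auto
    qed
  qed
  then obtain x0 where x0: "0 < x0" "\<And>y. 0 \<le> y \<Longrightarrow> u i y \<le> u i x0" by blast
  define K where "K = u i x0"
  have K: "0 < K" "K < M" using x0(2)[of x] x h ux ray[OF i, of x0] x0(1) unfolding K_def by simp_all
  \<comment> \<open>With \<open>W s = c * s\<^sup>2 - s powr p / p\<close> this is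
    \<open>W K / K\<^sup>2\<close>, positive because \<open>K < M\<close>. As
    \<open>W s / s\<^sup>2\<close> decreases in \<open>s\<close>, the constant
    \<open>\<kappa>'\<close> bounds \<open>W\<close> from below between \<open>K / 2\<close> and
    \<open>K\<close>.\<close>
  define k where "k = c - K powr (p - 2) / p"
  have k: "0 < k"
  proof -
    have "K powr (p - 2) < M powr (p - 2)" using K p2 by (intro powr_less_mono2) simp_all
    then have "K powr (p - 2) < p * c" using M by linarith
    then show ?thesis unfolding k_def using p2 by (simp add: field_simps)
  qed
  define \<kappa>' where "\<kappa>' = k * (K / 2)\<^sup>2"
  have \<kappa>': "0 < \<kappa>'" unfolding \<kappa>'_def using k K by simp
  have W: "\<kappa>' \<le> c * s\<^sup>2 - s powr p / p" if s: "K / 2 \<le> s" "s \<le> K" for s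
  proof -
    have s0: "0 < s" using s K by linarith
    have "s powr (p - 2) \<le> K powr (p - 2)" using s s0 p2 by (intro powr_mono2) simp_all
    then have "k \<le> c - s powr (p - 2) / p" unfolding k_def using p2 by (simp add: divide_right_mono)
    then have "k * (K / 2)\<^sup>2 \<le> (c - s powr (p - 2) / p) * s\<^sup>2"
      using k K s by (intro mult_mono power_mono) simp_all
    then show ?thesis unfolding \<kappa>'_def using powr_split2[of s] s0 by (simp add: algebra_simps)
  qed
  define Z where "Z = K powr p + 2 * c * K\<^sup>2"
  have Z: "0 \<le> Z" unfolding Z_def using c by simp
  \<comment> \<open>Balanced so that \<open>K\<^sup>2 * (2 * e) = \<kappa>'\<close>: the second
    order term stays below the first order gain.\<close>
  define e where "e = \<kappa>' / (2 * K\<^sup>2)"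
  have e: "0 < e" unfolding e_def using \<kappa>' K by simp
  obtain d1 where d1: "0 < d1" "(LINT y:{0..} \<inter> {x0 - d1..x0 + d1}|lborel. (g i y)\<^sup>2) < e"
    using small_integral[OF _ h1dD(4)[OF hi] e, of x0] by auto
  have "isCont (u i) x0"
    by (rule continuous_on_interior[OF continuous_on_subset[OF h1dD(1)[OF hi], of "{0<..}"]])
      (use x0 in \<open>auto simp: interior_open\<close>)
  moreover have "K / 2 < u i x0" using K K_def by linarith
  ultimately have "\<forall>\<^sub>F y in at x0. K / 2 < u i y"
    unfolding isCont_def by (rule order_tendstoD(1))
  then obtain d2 where d2: "0 < d2" "\<And>y. y \<noteq> x0 \<Longrightarrow> \<bar>y - x0\<bar> < d2 \<Longrightarrow> K / 2 < u i y"
    unfolding eventually_at dist_real_def by auto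
  \<comment> \<open>The entries ensure a Dirichlet integral below \<open>e\<close>, values above
    \<open>K / 2\<close>, a window inside the half-line, the remaining part of \<open>ne\<close> at
    most \<open>e\<close>, and a change of mass of at most 1/2.\<close>
  define d where "d = min (min d1 (d2 / 2)) (min x0 (min (e / (2 * (Z + 1))) (1 / (4 * K\<^sup>2))))"
  have "0 < e / (2 * (Z + 1))" "0 < 1 / (4 * K\<^sup>2)" using e Z K by simp_all
  then have d0: "0 < d" unfolding d_def min_less_iff_conj using d1(1) d2(1) x0(1) by simp
  have "d \<le> d2 / 2" unfolding d_def min_le_iff_disj by blast
  then have "d < d2" using d2(1) by linarith
  moreover have "d \<le> d1" "d \<le> x0" "d \<le> e / (2 * (Z + 1))" "d \<le> 1 / (4 * K\<^sup>2)"
    unfolding d_def min_le_iff_disj by blast+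
  ultimately have d: "0 < d" "d \<le> d1" "d < d2" "d \<le> x0" "d \<le> e / (2 * (Z + 1))" "d \<le> 1 / (4 * K\<^sup>2)"
    using d0 by blast+
  \<comment> \<open>Of the two values at the ends of the window the larger one is attained again on
    the other side of the maximum.\<close>
  have "\<exists>a b. x0 - d \<le> a \<and> a < b \<and> b \<le> x0 + d \<and> u i a = u i b"
  proof -
    have cl: "continuous_on {x0 - d..x0} (u i)" and cr: "continuous_on {x0..x0 + d} (u i)"
      using d x0 by (auto intro!: continuous_on_subset[OF h1dD(1)[OF hi]])
    have le: "u i (x0 - d) \<le> u i x0" "u i (x0 + d) \<le> u i x0" using x0(2)[of "x0 - d"] x0(2)[of "x0 + d"] d x0 by simp_all
    show ?thesis
    proof (cases "u i (x0 - d) \<le> u i (x0 + d)")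
      case True
      obtain a where "x0 - d \<le> a" "a \<le> x0" "u i a = u i (x0 + d)"
        using IVT'[of "u i" "x0 - d" "u i (x0 + d)" x0] True le cl d by auto
      then show ?thesis using d by (intro exI[of _ a] exI[of _ "x0 + d"]) simp
    next
      case False
      obtain b where "x0 \<le> b" "b \<le> x0 + d" "u i b = u i (x0 - d)"
        using IVT2'[of "u i" "x0 + d" "u i (x0 - d)" x0] False le cr d by auto
      then show ?thesis using d by (intro exI[of _ "x0 - d"] exI[of _ b]) simp
    qed
  qed
  then obtain a b where ab: "x0 - d \<le> a" "a < b" "b \<le> x0 + d" "u i a = u i b" by blast
  have a0: "0 \<le> a" using ab d by simp
  have hab: "h1d {a..b} (u i) (g i)" by (rule h1d_subset[OF hi]) (use a0 in auto)
  have uab: "K / 2 \<le> u i y \<and> u i y \<le> K" if y: "y \<in> {a..b}" for y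
  proof -
    have "0 \<le> y" "\<bar>y - x0\<bar> < d2" using y ab a0 d by auto
    then show ?thesis using d2(2)[of y] x0(2)[of y] K unfolding K_def by (cases "y = x0") auto
  qed
  let ?t = "trip p {a..b} (u i) (g i)"
  have uab': "0 \<le> u i y \<and> u i y \<le> K" if "y \<in> {a..b}" for y using uab[OF that] K by simp
  have ab': "a \<le> b" using ab by simp
  have low: "\<kappa>' * (b - a) \<le> act p c ?t"
    using act_lower[where t = 0 and k = \<kappa>' and c = c, OF ab' hab] uab uab' W by simp
  have sm: "snd (snd ?t) \<le> K\<^sup>2 * (b - a)" "\<bar>ne c ?t\<bar> \<le> (LINT y:{a..b}|lborel. (g i y)\<^sup>2) + Z * (b - a)"
    unfolding Z_def by (rule trip_small(1)[OF ab' hab _ less_imp_le[OF c]], erule uab')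
      (rule trip_small(2)[OF ab' hab _ less_imp_le[OF c]], erule uab')
  have C0: "0 \<le> snd (snd ?t)" by (rule trip_nonneg)
  have small: "\<bar>ne c ?t\<bar> < 2 * e"
  proof -
    have "(LINT y:{a..b}|lborel. (g i y)\<^sup>2) \<le> (LINT y:{0..} \<inter> {x0 - d1..x0 + d1}|lborel. (g i y)\<^sup>2)"
    proof (rule set_integral_subset_mono)
      show "set_integrable lborel ({0..} \<inter> {x0 - d1..x0 + d1}) (\<lambda>y. (g i y)\<^sup>2)"
        by (rule set_integrable_subset[OF h1dD(4)[OF hi]]) auto
    qed (use ab a0 d in auto)
    moreover have "Z * (b - a) \<le> (Z + 1) * (2 * d)" using Z ab by (intro mult_mono) simp_all
    moreover have "(Z + 1) * (2 * d) \<le> (Z + 1) * (2 * (e / (2 * (Z + 1))))" using Z d by (intro mult_left_mono) simp_all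
    moreover have "(Z + 1) * (2 * (e / (2 * (Z + 1)))) = e" using Z by (simp add: field_simps)
    ultimately show ?thesis using sm(2) d1(2) by linarith
  qed
  have Ch: "\<bar>snd (snd (- ?t))\<bar> \<le> 1 / 2"
  proof -
    have "K\<^sup>2 * (b - a) \<le> K\<^sup>2 * (2 * (1 / (4 * K\<^sup>2)))" using ab d by (intro mult_left_mono) simp_all
    also have "\<dots> = 1 / 2" using K by simp
    finally show ?thesis using sm(1) C0 by simp
  qed
  have "gtrip p N l u g - ?t \<in> TT p N l"
    by (rule cut_ray[OF _ _ gr i a0 ab' ab(4)]) (use N l in simp_all)
  then have "gtrip p N l u g + - ?t \<in> TT p N l" by simp
  from perturb[OF m ne0 this Ch]
  obtain T where T: "T \<in> TT p N l" "snd (snd T) = 1"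
    "act p 0 T \<le> act p 0 (gtrip p N l u g) + (act p c (- ?t) + \<bar>snd (snd (- ?t))\<bar> * \<bar>ne c (- ?t)\<bar>)" by blast
  have "act p c (- ?t) = - act p c ?t" "ne c (- ?t) = - ne c ?t" by (simp_all add: act_def ne_def)
  moreover have "snd (snd ?t) * \<bar>ne c ?t\<bar> < \<kappa>' * (b - a)"
  proof -
    have "snd (snd ?t) * \<bar>ne c ?t\<bar> \<le> (K\<^sup>2 * (b - a)) * \<bar>ne c ?t\<bar>" using sm(1) by (intro mult_right_mono) simp_all
    also have "\<dots> < (K\<^sup>2 * (b - a)) * (2 * e)" using small K ab by (intro mult_strict_left_mono) simp_all
    also have "\<dots> = \<kappa>' * (b - a)" unfolding e_def using K by simp
    finally show ?thesis .
  qed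
  ultimately have "act p 0 T < act p 0 (gtrip p N l u g)" using T(3) low C0 by simp
  then show False using min[OF T(1,2)] by simp
qed

end

section \<open>Persistence under a slight lengthening of the edge\<close>

lemma act_diff: "act p c (x - y) = act p c x - act p c y"
  by (simp add: act_def algebra_simps diff_divide_distrib)

context nls begin

lemma ne_diff: "ne c (x - y) = ne c x - ne c y"
  by (simp add: ne_def algebra_simps)

lemma att_perturb:
  assumes N: "N \<ge> 3" and l': "0 < l'" and T: "snd (snd T) = 1" "ne c T = 0" "act p 0 T \<le> ee"
    and \<Delta>: "T + \<Delta> \<in> TT p N l'" "\<bar>snd (snd \<Delta>)\<bar> \<le> 1 / 2"
    "act p c \<Delta> + \<bar>snd (snd \<Delta>)\<bar> * \<bar>ne c \<Delta>\<bar> \<le> 0"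
  shows "att p N 1 l'"
proof -
  from perturb[OF T(1,2) \<Delta>(1,2)] obtain T'' where T'': "T'' \<in> TT p N l'" "snd (snd T'') = 1"
    "act p 0 T'' \<le> act p 0 T + (act p c \<Delta> + \<bar>snd (snd \<Delta>)\<bar> * \<bar>ne c \<Delta>\<bar>)" by blast
  have "act p 0 T'' \<le> ee" using T''(3) T(3) \<Delta>(3) by linarith
  then show ?thesis unfolding att_iff_low[OF N l'] using T''(1,2) by blast
qed

text \<open>A ramp of slope \<open>\<sigma>\<close> and length \<open>\<delta>\<close> costs about
  \<open>2 * w0 * \<delta>\<close>. Each of the \<open>N\<close> removed pieces descends by the same
  height \<open>\<sigma> * \<delta>\<close> and saves, by \<open>act_lower\<close>, at least about
  as much; with three pieces the balance is negative. The factors 9/10 and 11/10 absorb the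
  variation of \<open>W\<close> near \<open>h\<close>.\<close>

lemma ramp_gain:
  assumes N: "N \<ge> 3" and l: "0 < l" and gr: "gr N l u g" and T: "snd (snd (gtrip p N l u g)) = 1"
    "ne c (gtrip p N l u g) = 0" "act p 0 (gtrip p N l u g) \<le> ee"
    and c: "0 < c" and h: "0 < h" "u 0 0 = h" and w0: "0 < w0" "w0 = c * h\<^sup>2 - h powr p / p"
    and below: "\<And>i x. i < N \<Longrightarrow> 0 < x \<Longrightarrow> u i x < h"
  shows "\<exists>\<epsilon>>0. \<forall>\<delta>. 0 < \<delta> \<and> \<delta> < \<epsilon> \<longrightarrow> att p N 1 (l + \<delta>)"
proof -
  define W where "W s = c * s\<^sup>2 - s powr p / p" for s
  \<comment> \<open>The slope at which gradient and potential part of the ramp are equal, the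
    cheapest one per unit of height.\<close>
  define \<sigma> where "\<sigma> = sqrt (2 * w0)"
  have \<sigma>: "0 < \<sigma>" "\<sigma> * \<sigma> = 2 * w0" "\<sigma>\<^sup>2 = 2 * w0" unfolding \<sigma>_def using w0(1) by simp_all
  have "isCont W h" unfolding W_def[abs_def] using h p2 by (intro continuous_intros) simp_all
  then have lim: "(W \<longlongrightarrow> w0) (at h)" unfolding isCont_def W_def w0(2) .
  have "\<forall>\<^sub>F s in at h. 9 / 10 * w0 < W s \<and> W s < 11 / 10 * w0"
    by (intro eventually_conj order_tendstoD(1)[OF lim] order_tendstoD(2)[OF lim]) (use w0(1) in linarith)+
  then obtain d where d: "0 < d" "\<And>s. s \<noteq> h \<Longrightarrow> \<bar>s - h\<bar> < d \<Longrightarrow> 9 / 10 * w0 < W s \<and> W s < 11 / 10 * w0"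
    unfolding eventually_at dist_real_def by blast
  \<comment> \<open>On the levels from \<open>h1\<close> to \<open>h\<close> the potential
    \<open>W\<close> is within ten per cent of \<open>w0\<close>; the minimum with \<open>h\<close>
    keeps the levels nonnegative.\<close>
  define h1 where "h1 = h - min (d / 2) h"
  have "h - d < h1" unfolding h1_def using d(1) by (simp add: min_def)
  moreover have "h1 < h" "0 \<le> h1" unfolding h1_def using d(1) h(1) by (simp_all add: min_def)
  ultimately have h1: "h1 < h" "0 \<le> h1" "h - d < h1" by blast+
  have Wb: "9 / 10 * w0 \<le> W s \<and> W s \<le> 11 / 10 * w0" if "h1 \<le> s" "s \<le> h" for s
  proof (cases "s = h")
    case True
    then have "W s = w0" unfolding W_def w0(2) by simp
    then show ?thesis using w0(1) by simp
  next
    case False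
    have "\<bar>s - h\<bar> < d" using that h1(3) by simp
    from d(2)[OF False this] show ?thesis by simp
  qed
  define Z where "Z = h powr p + 2 * c * h\<^sup>2"
  have Z: "0 \<le> Z" unfolding Z_def using c by simp
  \<comment> \<open>The admissible change of \<open>ne\<close>: multiplied by the mass change, at
    most \<open>h\<^sup>2 * D\<close>, it just matches the gain
    \<open>9 / 100 * w0 * D\<close>.\<close>
  define \<rho> where "\<rho> = 9 / 100 * w0 / h\<^sup>2"
  have \<rho>: "0 < \<rho>" "h\<^sup>2 * \<rho> = 9 / 100 * w0" unfolding \<rho>_def using w0(1) h(1) by simp_all
  define \<theta> where "\<theta> = \<rho> / (2 * real N)"
  have \<theta>: "0 < \<theta>" "real N * \<theta> = \<rho> / 2" unfolding \<theta>_def using \<rho>(1) N by simp_all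
  \<comment> \<open>One half of \<open>\<rho>\<close> is spent on the Dirichlet integrals of the
    removed pieces, \<open>\<theta>\<close> for each; the other half covers all terms proportional
    to lengths, which \<open>S\<close> collects. The bound \<open>b\<close> applies both to
    \<open>\<delta>\<close> and to every removed length.\<close>
  define S where "S = 2 * w0 + Z + real N * Z"
  have S: "0 < S" unfolding S_def using w0(1) Z by (intro add_pos_nonneg) simp_all
  define b where "b = min (\<rho> / (2 * S)) (1 / (2 * h\<^sup>2 * (real N + 1)))"
  have "0 < 1 / (2 * h\<^sup>2 * (real N + 1))" using h(1) by (intro divide_pos_pos mult_pos_pos) simp_all
  then have b0: "0 < b" unfolding b_def min_less_iff_conj using \<rho>(1) S by simp
  have bS: "S * b \<le> \<rho> / 2"
  proof -
    have "S * b \<le> S * (\<rho> / (2 * S))" unfolding b_def using S by (intro mult_left_mono) simp_all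
    then show ?thesis using S by simp
  qed
  have bh: "h\<^sup>2 * ((real N + 1) * b) \<le> 1 / 2"
  proof -
    have "h\<^sup>2 * ((real N + 1) * b) \<le> h\<^sup>2 * ((real N + 1) * (1 / (2 * h\<^sup>2 * (real N + 1))))"
      unfolding b_def by (intro mult_left_mono) simp_all
    also have "\<dots> = 1 / 2" using h(1) by (simp add: divide_simps)
    finally show ?thesis .
  qed
  have "\<exists>e. 0 < e \<and> e \<le> b \<and> (\<forall>x\<in>{0..e}. h1 \<le> u i x) \<and> (LINT x:{0..e}|lborel. (g i x)\<^sup>2) \<le> \<theta>" if i: "i \<in> {..<N}" for i
  proof -
    have hi: "h1d {0..} (u i) (g i)" by (rule grD_ray(1)[OF gr]) (use i in simp)
    have ui0: "u i 0 = h" using grD_ray(3)[OF gr, of i] i h(2) by simp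
    have m: "{0::real..} \<in> sets borel" by simp
    from small_integral[OF m h1dD(4)[OF hi] \<theta>(1), of 0] obtain d1
      where d1: "0 < d1" "(LINT x:{0..} \<inter> {0 - d1..0 + d1}|lborel. (g i x)\<^sup>2) < \<theta>" by blast
    have "\<exists>d>0. \<forall>x\<in>{0..}. dist x 0 < d \<longrightarrow> dist (u i x) (u i 0) < h - h1"
      by (rule h1dD(1)[OF hi, unfolded continuous_on_iff, THEN bspec, THEN spec, THEN mp]) (use h1 in simp_all)
    then obtain d2 where d2: "0 < d2" "\<forall>x\<in>{0..}. dist x 0 < d2 \<longrightarrow> dist (u i x) (u i 0) < h - h1" by blast
    define e where "e = min b (min d1 (d2 / 2))"
    have e: "0 < e" "e \<le> b" "e \<le> d1" "e \<le> d2 / 2"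
      unfolding e_def min_less_iff_conj min_le_iff_disj using b0 d1(1) d2(1) by simp_all
    have "h1 \<le> u i x" if x: "x \<in> {0..e}" for x
    proof -
      have "dist x 0 < d2" using x e(4) d2(1) by (simp add: dist_real_def)
      then have "\<bar>u i x - h\<bar> < h - h1" using d2(2) x unfolding ui0 dist_real_def by simp
      then show ?thesis by linarith
    qed
    moreover have "(LINT x:{0..e}|lborel. (g i x)\<^sup>2) \<le> (LINT x:{0..} \<inter> {0 - d1..0 + d1}|lborel. (g i x)\<^sup>2)"
    proof (rule set_integral_subset_mono)
      show "set_integrable lborel ({0..} \<inter> {0 - d1..0 + d1}) (\<lambda>x. (g i x)\<^sup>2)"
        by (rule set_integrable_subset[OF h1dD(4)[OF hi]]) auto
    qed (use e in auto)
    ultimately show ?thesis using e d1(2) by (intro exI[of _ e]) simp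
  qed
  then have "\<forall>i\<in>{..<N}. \<exists>e. 0 < e \<and> e \<le> b \<and> (\<forall>x\<in>{0..e}. h1 \<le> u i x) \<and> (LINT x:{0..e}|lborel. (g i x)\<^sup>2) \<le> \<theta>" by blast
  from bchoice[OF this] obtain e where "\<forall>i\<in>{..<N}. 0 < e i \<and> e i \<le> b \<and> (\<forall>x\<in>{0..e i}. h1 \<le> u i x) \<and> (LINT x:{0..e i}|lborel. (g i x)\<^sup>2) \<le> \<theta>"
    by blast
  then have e: "0 < e i" "e i \<le> b" "\<forall>x\<in>{0..e i}. h1 \<le> u i x" "(LINT x:{0..e i}|lborel. (g i x)\<^sup>2) \<le> \<theta>" if "i < N" for i
    using that by simp_all
  \<comment> \<open>The drop below \<open>h\<close> that all half-lines reach at their points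
    \<open>e i\<close>, positive because they stay below \<open>h\<close> off the vertex. Any
    smaller drop is attained before these points by the intermediate value theorem.\<close>
  define \<eta>0 where "\<eta>0 = Min ((\<lambda>i. h - u i (e i)) ` {..<N})"
  have ne: "(\<lambda>i. h - u i (e i)) ` {..<N} \<noteq> {}" using N by (auto simp: lessThan_empty_iff)
  have "\<eta>0 \<in> (\<lambda>i. h - u i (e i)) ` {..<N}" unfolding \<eta>0_def by (rule Min_in[OF _ ne]) simp
  then obtain j where "j < N" "\<eta>0 = h - u j (e j)" by blast
  then have \<eta>0: "0 < \<eta>0" using below[of j "e j"] e(1)[of j] by simp
  have \<eta>le: "\<eta>0 \<le> h - u i (e i)" if "i < N" for i unfolding \<eta>0_def by (rule Min_le) (use that in auto)
  define E where "E = min b (min ((h - h1) / \<sigma>) (\<eta>0 / \<sigma>))"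
  have E: "0 < E" unfolding E_def min_less_iff_conj using b0 h1 \<sigma>(1) \<eta>0 by simp
  have "att p N 1 (l + \<delta>)" if \<delta>: "0 < \<delta>" "\<delta> < E" for \<delta>
  proof -
    have \<delta>b: "\<delta> \<le> b" using \<delta>(2) unfolding E_def min_less_iff_conj by simp
    have "\<delta> < (h - h1) / \<sigma>" "\<delta> < \<eta>0 / \<sigma>" using \<delta>(2) unfolding E_def min_less_iff_conj by simp_all
    then have \<sigma>\<delta>: "\<sigma> * \<delta> < h - h1" "\<sigma> * \<delta> < \<eta>0" using \<sigma>(1) by (simp_all add: pos_less_divide_eq mult.commute)
    have \<sigma>\<delta>0: "0 < \<sigma> * \<delta>" using \<sigma>(1) \<delta>(1) by simp
    define y where "y = h - \<sigma> * \<delta>"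
    have y: "h1 \<le> y" "0 \<le> y" "y \<le> h" unfolding y_def using \<sigma>\<delta>(1) \<sigma>\<delta>0 h1(2) by linarith+
    have "\<exists>z. 0 \<le> z \<and> z \<le> e i \<and> u i z = y" if i: "i \<in> {..<N}" for i
    proof -
      have iN: "i < N" using i by simp
      have cont: "continuous_on {0..e i} (u i)" by (rule continuous_on_subset[OF h1dD(1)[OF grD_ray(1)[OF gr iN]]]) auto
      have lo: "u i (e i) \<le> y" using \<eta>le[OF iN] \<sigma>\<delta>(2) unfolding y_def by linarith
      have hi: "y \<le> u i 0" using grD_ray(3)[OF gr iN] h(2) y(3) by simp
      show ?thesis using IVT2'[OF lo hi less_imp_le[OF e(1)[OF iN]] cont] by blast
    qed
    then have "\<forall>i\<in>{..<N}. \<exists>z. 0 \<le> z \<and> z \<le> e i \<and> u i z = y" by blast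
    from bchoice[OF this] obtain z where "\<forall>i\<in>{..<N}. 0 \<le> z i \<and> z i \<le> e i \<and> u i (z i) = y" by blast
    then have z: "0 \<le> z i" "z i \<le> e i" "u i (z i) = y" if "i < N" for i using that by simp_all
    let ?r = "\<lambda>x. y + \<sigma> * x"
    define R where "R = trip p {0..\<delta>} ?r (\<lambda>_. \<sigma>)"
    define V where "V i = trip p {0..z i} (u i) (g i)" for i
    have sl: "(u 0 0 - y) / \<delta> = \<sigma>" unfolding h(2) y_def using \<delta>(1) by simp
    have mem: "gtrip p N l u g + (R - (\<Sum>i<N. V i)) \<in> TT p N (l + \<delta>)"
      unfolding R_def V_def
    proof (rule ramp_vertex[OF _ _ gr \<delta>(1) y(2), unfolded sl])
      show "0 \<le> z i \<and> u i (z i) = y" if "i < N" for i using z[OF that] by blast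
      show "y \<le> u 0 0" using y(3) h(2) by simp
    qed (use N l in simp_all)
    have \<delta>0: "0 \<le> \<delta>" using \<delta>(1) by simp
    have hr: "h1d {0..\<delta>} ?r (\<lambda>_. \<sigma>)" by (rule h1d_linear[OF \<delta>0])
    have rb: "y \<le> ?r x" "?r x \<le> h" if "x \<in> {0..\<delta>}" for x
    proof -
      have "0 \<le> \<sigma> * x" "\<sigma> * x \<le> \<sigma> * \<delta>" using that \<sigma>(1) by simp_all
      then show "y \<le> ?r x" "?r x \<le> h" unfolding y_def by linarith+
    qed
    have actR: "act p c R \<le> 21 / 10 * w0 * \<delta>"
    proof -
      have ry: "ray {0..\<delta>}" using \<delta>0 by simp
      have "act p c R \<le> (LINT x:{0..\<delta>}|lborel. 21 / 10 * w0)"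
        unfolding R_def act_trip(2)[OF ry hr p2]
      proof (rule set_integral_mono[OF act_trip(1)[OF ry hr p2]])
        show "set_integrable lborel {0..\<delta>} (\<lambda>x. 21 / 10 * w0)" by (rule borel_integrable_atLeastAtMost') simp
        fix x assume x: "x \<in> {0..\<delta>}"
        have "W (?r x) \<le> 11 / 10 * w0" using Wb[of "?r x"] rb[OF x] y(1) by simp
        moreover have "\<bar>?r x\<bar> = ?r x" using rb(1)[OF x] y(2) by simp
        ultimately show "\<sigma>\<^sup>2 / 2 - \<bar>?r x\<bar> powr p / p + c * (?r x)\<^sup>2 \<le> 21 / 10 * w0"
          unfolding \<sigma>(3) W_def by linarith
      qed
      then show ?thesis using \<delta>0 by (simp add: set_integral_const mult_ac)
    qed
    have Vh: "h1d {0..z i} (u i) (g i)" if "i < N" for i by (rule h1d_subset[OF grD_ray(1)[OF gr that]]) (use z[OF that] in auto)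
    have Vu: "0 \<le> u i x \<and> u i x \<le> h \<and> h1 \<le> u i x" if "i < N" "x \<in> {0..z i}" for i x
    proof (intro conjI)
      show "0 \<le> u i x" by (rule grD_ray(2)[OF gr that(1)]) (use that in simp)
      show "u i x \<le> h" using below[OF that(1), of x] grD_ray(3)[OF gr that(1)] h(2) that(2) by (cases "x = 0") simp_all
      show "h1 \<le> u i x" using e(3)[OF that(1)] z(2)[OF that(1)] that(2) by simp
    qed
    have actV: "18 / 10 * w0 * \<delta> + 9 / 100 * w0 * z i \<le> act p c (V i)" if i: "i < N" for i
    proof -
      \<comment> \<open>The slope is taken slightly smaller than \<open>\<sigma>\<close>, leaving
        the surplus \<open>9 / 100 * w0 * z i\<close>. It is needed because a removed piece may be
        much longer than \<open>\<delta>\<close> when the half-line leaves the vertex almost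
        flat.\<close>
      have low: "9 / 10 * \<sigma> * (u i 0 - u i (z i)) + (9 / 10 * w0 - (9 / 10 * \<sigma>)\<^sup>2 / 2) * (z i - 0) \<le> act p c (V i)"
        unfolding V_def
      proof (rule act_lower[OF z(1)[OF i] Vh[OF i]])
        fix x assume x: "x \<in> {0..z i}"
        show "0 \<le> u i x" using Vu[OF i x] by blast
        show "9 / 10 * w0 \<le> c * (u i x)\<^sup>2 - u i x powr p / p" using Wb[of "u i x"] Vu[OF i x] unfolding W_def by blast
      qed
      have r1: "u i 0 - u i (z i) = \<sigma> * \<delta>" using grD_ray(3)[OF gr i] z(3)[OF i] h(2) unfolding y_def by simp
      have r2: "9 / 10 * \<sigma> * (\<sigma> * \<delta>) = 18 / 10 * w0 * \<delta>"
      proof -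
        have "9 / 10 * \<sigma> * (\<sigma> * \<delta>) = 9 / 10 * (\<sigma> * \<sigma>) * \<delta>" by simp
        then show ?thesis unfolding \<sigma>(2) by simp
      qed
      have r3: "(9 / 10 * \<sigma>)\<^sup>2 = 81 / 100 * (2 * w0)" unfolding power_mult_distrib \<sigma>(3) by (simp add: power2_eq_square)
      have r4: "(9 / 10 * w0 - 81 / 100 * (2 * w0) / 2) * (z i - 0) = 9 / 100 * w0 * z i" by (simp add: field_simps)
      show ?thesis using low unfolding r1 r2 r3 r4 .
    qed
    define Y where "Y = (\<Sum>i<N. z i)"
    define D where "D = \<delta> + Y"
    have Y0: "0 \<le> Y" unfolding Y_def by (rule sum_nonneg) (use z(1) in simp)
    have "z i \<le> b" if "i < N" for i using z(2)[OF that] e(2)[OF that] by simp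
    then have "Y \<le> (\<Sum>i<N. b)" unfolding Y_def by (intro sum_mono) simp
    then have Yb: "Y \<le> real N * b" by simp
    have "(\<Sum>i<N. 18 / 10 * w0 * \<delta> + 9 / 100 * w0 * z i) \<le> (\<Sum>i<N. act p c (V i))"
      by (rule sum_mono) (use actV in simp)
    moreover have "(\<Sum>i<N. 18 / 10 * w0 * \<delta> + 9 / 100 * w0 * z i) = real N * (18 / 10 * w0 * \<delta>) + 9 / 100 * w0 * Y"
      unfolding Y_def sum.distrib sum_distrib_left by simp
    moreover have "3 * (18 / 10 * w0 * \<delta>) \<le> real N * (18 / 10 * w0 * \<delta>)"
      using N w0(1) \<delta>0 by (intro mult_right_mono) simp_all
    moreover have "0 \<le> w0 * \<delta>" using w0(1) \<delta>0 by simp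
    ultimately have actD: "act p c (R - (\<Sum>i<N. V i)) \<le> - (9 / 100 * w0 * D)"
      using actR unfolding act_diff act_sum D_def distrib_left by linarith
    have rh: "0 \<le> ?r x \<and> ?r x \<le> h" if "x \<in> {0..\<delta>}" for x using rb[OF that] y(2) by linarith
    have R: "snd (snd R) \<le> h\<^sup>2 * \<delta>" "\<bar>ne c R\<bar> \<le> 2 * w0 * \<delta> + Z * \<delta>"
    proof -
      have "snd (snd R) \<le> h\<^sup>2 * (\<delta> - 0)" unfolding R_def
        by (rule trip_small(1)[OF \<delta>0 hr _ less_imp_le[OF c]], erule rh)
      then show "snd (snd R) \<le> h\<^sup>2 * \<delta>" by simp
      have "\<bar>ne c R\<bar> \<le> (LINT x:{0..\<delta>}|lborel. \<sigma>\<^sup>2) + Z * (\<delta> - 0)" unfolding R_def Z_def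
        by (rule trip_small(2)[OF \<delta>0 hr _ less_imp_le[OF c]], erule rh)
      then show "\<bar>ne c R\<bar> \<le> 2 * w0 * \<delta> + Z * \<delta>" using \<delta>0 unfolding \<sigma>(3) by (simp add: set_integral_const mult_ac)
    qed
    have V: "snd (snd (V i)) \<le> h\<^sup>2 * z i" "\<bar>ne c (V i)\<bar> \<le> \<theta> + Z * b" if i: "i < N" for i
    proof -
      have vb: "0 \<le> u i x \<and> u i x \<le> h" if "x \<in> {0..z i}" for x using Vu[OF i that] by blast
      have "snd (snd (V i)) \<le> h\<^sup>2 * (z i - 0)" unfolding V_def
        by (rule trip_small(1)[OF z(1)[OF i] Vh[OF i] _ less_imp_le[OF c]], erule vb)
      then show "snd (snd (V i)) \<le> h\<^sup>2 * z i" by simp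
      have "\<bar>ne c (V i)\<bar> \<le> (LINT x:{0..z i}|lborel. (g i x)\<^sup>2) + Z * (z i - 0)" unfolding V_def Z_def
        by (rule trip_small(2)[OF z(1)[OF i] Vh[OF i] _ less_imp_le[OF c]], erule vb)
      moreover have "(LINT x:{0..z i}|lborel. (g i x)\<^sup>2) \<le> (LINT x:{0..e i}|lborel. (g i x)\<^sup>2)"
      proof (rule set_integral_subset_mono)
        show "set_integrable lborel {0..e i} (\<lambda>x. (g i x)\<^sup>2)"
          by (rule set_integrable_subset[OF h1dD(4)[OF grD_ray(1)[OF gr i]]]) auto
      qed (use z(2)[OF i] in auto)
      moreover have "Z * (z i - 0) \<le> Z * b" using Z z(2)[OF i] e(2)[OF i] by (intro mult_left_mono) simp_all
      ultimately show "\<bar>ne c (V i)\<bar> \<le> \<theta> + Z * b" using e(4)[OF i] by linarith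
    qed
    have CD: "\<bar>snd (snd (R - (\<Sum>i<N. V i)))\<bar> \<le> h\<^sup>2 * D"
    proof -
      have s: "snd (snd (R - (\<Sum>i<N. V i))) = snd (snd R) - (\<Sum>i<N. snd (snd (V i)))" by (simp add: fst_sum_triple)
      have "(\<Sum>i<N. snd (snd (V i))) \<le> (\<Sum>i<N. h\<^sup>2 * z i)" by (rule sum_mono) (use V(1) in simp)
      also have "\<dots> = h\<^sup>2 * Y" unfolding Y_def by (rule sum_distrib_left[symmetric])
      finally have "(\<Sum>i<N. snd (snd (V i))) \<le> h\<^sup>2 * Y" .
      moreover have "0 \<le> (\<Sum>i<N. snd (snd (V i)))" unfolding V_def by (intro sum_nonneg trip_nonneg)
      moreover have "0 \<le> snd (snd R)" unfolding R_def by (rule trip_nonneg)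
      moreover have "0 \<le> h\<^sup>2 * \<delta>" "0 \<le> h\<^sup>2 * Y" using \<delta>0 Y0 by simp_all
      ultimately show ?thesis using R(1) unfolding s D_def distrib_left by linarith
    qed
    have neD: "\<bar>ne c (R - (\<Sum>i<N. V i))\<bar> \<le> \<rho>"
    proof -
      have "\<bar>\<Sum>i<N. ne c (V i)\<bar> \<le> (\<Sum>i<N. \<bar>ne c (V i)\<bar>)" by (rule sum_abs)
      also have "\<dots> \<le> (\<Sum>i<N. \<theta> + Z * b)" by (rule sum_mono) (use V(2) in simp)
      also have "\<dots> = \<rho> / 2 + real N * Z * b" using \<theta>(2) by (simp add: distrib_left)
      finally have "\<bar>\<Sum>i<N. ne c (V i)\<bar> \<le> \<rho> / 2 + real N * Z * b" .
      moreover have "2 * w0 * \<delta> \<le> 2 * w0 * b" "Z * \<delta> \<le> Z * b" using \<delta>b w0(1) Z by (intro mult_left_mono; simp)+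
      moreover have "2 * w0 * b + Z * b + real N * Z * b \<le> \<rho> / 2" using bS unfolding S_def distrib_right .
      ultimately show ?thesis using R(2) unfolding ne_diff ne_sum by linarith
    qed
    show ?thesis
    proof (rule att_perturb[OF N _ T mem])
      show "0 < l + \<delta>" using l \<delta>(1) by simp
      have "h\<^sup>2 * D \<le> h\<^sup>2 * ((real N + 1) * b)"
        using Yb \<delta>b unfolding D_def by (intro mult_left_mono) (simp_all add: distrib_right)
      then show "\<bar>snd (snd (R - (\<Sum>i<N. V i)))\<bar> \<le> 1 / 2" using CD bh by linarith
      have "\<bar>snd (snd (R - (\<Sum>i<N. V i)))\<bar> * \<bar>ne c (R - (\<Sum>i<N. V i))\<bar> \<le> h\<^sup>2 * D * \<rho>"
        using CD neD \<rho>(1) by (intro mult_mono) (simp_all add: order_trans[OF abs_ge_zero CD])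
      also have "\<dots> = h\<^sup>2 * \<rho> * D" by simp
      also have "\<dots> = 9 / 100 * w0 * D" unfolding \<rho>(2) ..
      finally show "act p c (R - (\<Sum>i<N. V i)) + \<bar>snd (snd (R - (\<Sum>i<N. V i)))\<bar> * \<bar>ne c (R - (\<Sum>i<N. V i))\<bar> \<le> 0"
        using actD by linarith
    qed
  qed
  then show ?thesis using E by blast
qed

text \<open>Let \<open>W s = c * s\<^sup>2 - s powr p / p\<close> at a minimiser with maximum
  \<open>M\<close> and vertex value \<open>h\<close>. If \<open>h = 0\<close>, a piece of value zero
  is inserted at the vertex for free. If \<open>W M < 0\<close>, a plateau at the maximum gains.
  Otherwise \<open>W h > 0\<close>, since \<open>s powr (p - 2)\<close> increases and
  \<open>h < M\<close>, and the ramp applies.\<close>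

lemma right_open:
  assumes N: "N \<ge> 3" and l: "0 < l" and att: "att p N 1 l"
  shows "\<exists>\<epsilon>>0. \<forall>\<delta>. 0 < \<delta> \<and> \<delta> < \<epsilon> \<longrightarrow> att p N 1 (l + \<delta>)"
proof -
  have l0: "0 \<le> l" and N1: "N \<ge> 1" using l N by simp_all
  obtain T where T: "T \<in> TT p N l" "snd (snd T) = 1" "\<forall>T'\<in>TT p N l. snd (snd T') = 1 \<longrightarrow> act p 0 T \<le> act p 0 T'"
    using att unfolding att_def by blast
  obtain T2 where "T2 \<in> TT p N l" "snd (snd T2) = 1" "act p 0 T2 \<le> ee" using att unfolding att_iff_low[OF N l] by blast
  then have Te: "act p 0 T \<le> ee" using T(3) order_trans by blast
  obtain u g where gr: "gr N l u g" and Teq: "T = gtrip p N l u g" using T(1) unfolding TT_def by blast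
  note m = T(2)[unfolded Teq] and E = Te[unfolded Teq]
  \<comment> \<open>Solves \<open>ne c T = 0\<close> at unit mass; it is positive because the energy
    is negative and \<open>p > 2\<close>.\<close>
  define c where "c = (fst (snd T) - fst T) / 2"
  have ne0: "ne c T = 0" unfolding ne_def c_def T(2) by (simp add: field_simps)
  have c: "0 < c"
  proof -
    have "fst (snd T) / p \<le> fst (snd T) / 2"
      by (rule divide_left_mono) (use TT_nonneg(2)[OF T(1)] p2 in simp_all)
    moreover have "fst T / 2 - fst (snd T) / p < 0" using Te ee_neg unfolding act_def by simp
    ultimately show ?thesis unfolding c_def by simp
  qed
  have "\<exists>x0. 0 \<le> x0 \<and> x0 \<le> l \<and> c0 \<le> u N x0 \<and> (\<forall>i x. i < N \<longrightarrow> 0 \<le> x \<longrightarrow> u i x < u N x0)"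
    by (rule low_energy[OF l0 gr N m E]) blast
  then obtain x0 where x0: "0 \<le> x0" "x0 \<le> l" "c0 \<le> u N x0" "\<forall>i x. i < N \<longrightarrow> 0 \<le> x \<longrightarrow> u i x < u N x0" by blast
  define M where "M = u N x0"
  have M: "0 < M" unfolding M_def using x0(3) c0_pos by linarith
  define h where "h = u 0 0"
  have h0: "0 \<le> h" unfolding h_def using grD_ray(2)[OF gr, of 0 0] N by simp
  have hM: "h < M" unfolding h_def M_def using x0(4) N by simp
  consider "h = 0" | "c * M\<^sup>2 - M powr p / p < 0" | "0 < h" "0 \<le> c * M\<^sup>2 - M powr p / p" using h0 by linarith
  then show ?thesis
  proof cases
    case 1
    have z: "(0::real) \<le> 0" by simp
    have "att p N 1 (l + \<delta>)" if \<delta>: "0 < \<delta>" for \<delta>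
    proof (rule att_perturb[OF N _ T(2) ne0 Te])
      have "u N 0 = 0" using grD_last(3)[OF gr] 1 unfolding h_def by simp
      then show "T + (0, 0, 0) \<in> TT p N (l + \<delta>)"
        using insert_plateau[OF N1 gr z l0 less_imp_le[OF \<delta>]] unfolding Teq by simp
    qed (use l \<delta> in \<open>simp_all add: act_def\<close>)
    then show ?thesis by (intro exI[of _ 1]) simp
  next
    case 2
    define w where "w = c * M\<^sup>2 - M powr p / p"
    define q where "q = 2 * c * M\<^sup>2 - M powr p"
    \<comment> \<open>The first bound keeps the change of mass below 1/2; the second lets the first
      order gain \<open>\<delta> * w\<close> dominate the product of the changes of mass and
      \<open>ne\<close>, with \<open>+ 1\<close> guarding against a zero denominator.\<close>
    define \<epsilon> where "\<epsilon> = min (1 / (2 * M\<^sup>2)) (- w / (M\<^sup>2 * \<bar>q\<bar> + 1))"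
    have q1: "0 < M\<^sup>2 * \<bar>q\<bar> + 1" by (intro add_nonneg_pos) simp_all
    have w: "w < 0" using 2 unfolding w_def .
    have "0 < - w / (M\<^sup>2 * \<bar>q\<bar> + 1)" by (rule divide_pos_pos[OF _ q1]) (use w in simp)
    moreover have "0 < 1 / (2 * M\<^sup>2)" using M by simp
    ultimately have \<epsilon>: "0 < \<epsilon>" unfolding \<epsilon>_def min_less_iff_conj by blast
    have "att p N 1 (l + \<delta>)" if \<delta>: "0 < \<delta>" "\<delta> < \<epsilon>" for \<delta>
    proof (rule att_perturb[OF N _ T(2) ne0 Te])
      have \<delta>': "\<delta> < 1 / (2 * M\<^sup>2)" "\<delta> < - w / (M\<^sup>2 * \<bar>q\<bar> + 1)" using \<delta>(2) unfolding \<epsilon>_def min_less_iff_conj by blast+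
      show "T + (0, \<delta> * M powr p, \<delta> * M\<^sup>2) \<in> TT p N (l + \<delta>)"
        using insert_plateau[OF N1 gr x0(1,2) less_imp_le[OF \<delta>(1)]] unfolding Teq M_def .
      have "\<delta> * M\<^sup>2 \<le> 1 / (2 * M\<^sup>2) * M\<^sup>2" using \<delta>'(1) by (intro mult_right_mono) simp_all
      then have "\<delta> * M\<^sup>2 \<le> 1 / 2" using M by simp
      then show "\<bar>snd (snd (0 :: real, \<delta> * M powr p, \<delta> * M\<^sup>2))\<bar> \<le> 1 / 2" using \<delta>(1) by simp
      have a: "act p c (0, \<delta> * M powr p, \<delta> * M\<^sup>2) = \<delta> * w" unfolding act_def w_def by (simp add: algebra_simps)
      have n: "ne c (0, \<delta> * M powr p, \<delta> * M\<^sup>2) = \<delta> * q" unfolding ne_def q_def by (simp add: algebra_simps)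
      have "\<delta> * (M\<^sup>2 * \<bar>q\<bar> + 1) < - w" using \<delta>'(2) unfolding pos_less_divide_eq[OF q1] .
      then have "\<delta> * (\<delta> * (M\<^sup>2 * \<bar>q\<bar> + 1)) \<le> \<delta> * (- w)" using \<delta>(1) by (intro mult_left_mono) simp_all
      moreover have "\<delta> * (\<delta> * (M\<^sup>2 * \<bar>q\<bar> + 1)) = (\<delta> * M\<^sup>2) * (\<delta> * \<bar>q\<bar>) + \<delta> * \<delta>" by (simp add: algebra_simps)
      moreover have "0 \<le> \<delta> * \<delta>" "\<delta> * (- w) = - (\<delta> * w)" by simp_all
      moreover have ab: "\<bar>\<delta> * M\<^sup>2\<bar> = \<delta> * M\<^sup>2" "\<bar>\<delta> * q\<bar> = \<delta> * \<bar>q\<bar>" using \<delta>(1) by (simp_all add: abs_mult)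
      ultimately show "act p c (0, \<delta> * M powr p, \<delta> * M\<^sup>2) + \<bar>snd (snd (0 :: real, \<delta> * M powr p, \<delta> * M\<^sup>2))\<bar>
          * \<bar>ne c (0, \<delta> * M powr p, \<delta> * M\<^sup>2)\<bar> \<le> 0"
        unfolding a n snd_conv ab by linarith
    qed (use l \<delta> in simp)
    then show ?thesis using \<epsilon> by blast
  next
    case 3
    have "M powr (p - 2) * M\<^sup>2 \<le> (p * c) * M\<^sup>2"
      using 3(2) powr_split2[of M] M p2 by (simp add: field_simps)
    then have Mp: "M powr (p - 2) \<le> p * c" using M by (simp only: mult_le_cancel_right) simp
    have "h powr (p - 2) < M powr (p - 2)" by (rule powr_less_mono2) (use p2 3(1) hM in simp_all)
    then have "h powr (p - 2) * h\<^sup>2 < (p * c) * h\<^sup>2" using Mp 3(1) by (intro mult_strict_right_mono) simp_all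
    then have w0: "0 < c * h\<^sup>2 - h powr p / p" using powr_split2[of h] 3(1) p2 by (simp add: field_simps)
    have bel: "u i x < h" if "i < N" "0 < x" for i x
      unfolding h_def
    proof (rule minimiser_below_on_rays[OF N l gr m c ne0[unfolded Teq] _ Mp _ _ that])
      show "act p 0 (gtrip p N l u g) \<le> act p 0 T'" if "T' \<in> TT p N l" "snd (snd T') = 1" for T'
        using T(3) that unfolding Teq by blast
      show "u j y < M" if "j < N" "0 \<le> y" for j y unfolding M_def using x0(4) that by blast
      show "0 < u 0 0" using 3(1) unfolding h_def .
    qed
    show ?thesis by (rule ramp_gain[OF N l gr m ne0[unfolded Teq] E c 3(1) h_def[symmetric] w0 refl bel])
  qed
qed


section \<open>The threshold length\<close>

text \<open>The good lengths are closed under positive limits and each is followed by further good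
  ones, hence they form an up-set. \<open>short_edge\<close> keeps their infimum positive,
  \<open>long_edge\<close> makes the set nonempty, and closedness puts the infimum into it.\<close>

lemma threshold:
  assumes N: "N \<ge> 3"
  shows "\<exists>C>0. \<forall>l>0. att p N 1 l \<longleftrightarrow> C \<le> l"
proof -
  have "\<exists>L0>0. \<forall>l. 0 < l \<longrightarrow> att p N 1 l \<longrightarrow> L0 \<le> l"
  proof (rule short_edge)
    fix L0 :: real
    assume L0: "L0 > 0" "\<And>N l T. N \<ge> 3 \<Longrightarrow> 0 < l \<Longrightarrow> T \<in> TT p N l \<Longrightarrow> snd (snd T) = 1 \<Longrightarrow> act p 0 T \<le> ee \<Longrightarrow> L0 \<le> l"
    show ?thesis
    proof (intro exI[of _ L0] conjI allI impI L0(1))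
      fix l :: real assume l: "0 < l" "att p N 1 l"
      then obtain T where "T \<in> TT p N l" "snd (snd T) = 1" "act p 0 T \<le> ee" using att_iff_low[OF N l(1)] by blast
      then show "L0 \<le> l" by (rule L0(2)[OF N l(1)])
    qed
  qed
  then obtain L0 where L0: "0 < L0" "\<forall>l. 0 < l \<longrightarrow> att p N 1 l \<longrightarrow> L0 \<le> l" by blast
  \<comment> \<open>Let \<open>z\<close> be the infimum of the bad lengths beyond \<open>x\<close>.
    Attainment holds before \<open>z\<close>, at \<open>z\<close> by closedness, and slightly beyond
    \<open>z\<close> by \<open>right_open\<close>, which contradicts the choice of
    \<open>z\<close>.\<close>
  have up: "att p N 1 y" if xy: "0 < x" "att p N 1 x" "x \<le> y" for x y
  proof (rule ccontr)
    assume "\<not> att p N 1 y"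
    define S where "S = {s. x \<le> s \<and> \<not> att p N 1 s}"
    have yS: "y \<in> S" unfolding S_def using xy(3) \<open>\<not> att p N 1 y\<close> by simp
    then have S: "S \<noteq> {}" by blast
    have bb: "bdd_below S" by (rule bdd_belowI[of _ x]) (simp add: S_def)
    define z where "z = Inf S"
    have xz: "x \<le> z" unfolding z_def by (rule cInf_greatest[OF S]) (simp add: S_def)
    have z0: "0 < z" using xz xy(1) by simp
    have before: "att p N 1 s" if "x \<le> s" "s < z" for s
    proof (rule ccontr)
      assume "\<not> att p N 1 s"
      then have "s \<in> S" using that(1) unfolding S_def by simp
      then have "z \<le> s" unfolding z_def by (rule cInf_lower[OF _ bb])
      then show False using that(2) by simp
    qed
    have Pz: "att p N 1 z"
    proof (cases "x = z")
      case True
      then show ?thesis using xy(2) by simp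
    next
      case False
      then have xz': "x < z" using xz by simp
      define L where "L n = z - (z - x) * inverse (real (Suc n))" for n
      have L: "x \<le> L n" "L n < z" for n
      proof -
        have i: "0 < inverse (real (Suc n))" "inverse (real (Suc n)) \<le> 1" by (simp_all add: divide_simps)
        have "(z - x) * inverse (real (Suc n)) \<le> (z - x) * 1" using xz' i(2) by (intro mult_left_mono) simp_all
        then show "x \<le> L n" unfolding L_def by simp
        have "0 < (z - x) * inverse (real (Suc n))" using xz' i(1) by (intro mult_pos_pos) simp_all
        then show "L n < z" unfolding L_def by simp
      qed
      have "L \<longlonglongrightarrow> z - (z - x) * 0" unfolding L_def[abs_def] by (intro tendsto_intros LIMSEQ_inverse_real_of_nat)
      then have lim: "L \<longlonglongrightarrow> z" by simp
      have "0 < L n" for n using L(1)[of n] xy(1) by simp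
      then show ?thesis by (rule att_closed[OF N z0 _ lim before[OF L]])
    qed
    obtain \<epsilon> where \<epsilon>: "0 < \<epsilon>" "\<forall>\<delta>. 0 < \<delta> \<and> \<delta> < \<epsilon> \<longrightarrow> att p N 1 (z + \<delta>)" using right_open[OF N z0 Pz] by blast
    have "Inf S < z + \<epsilon>" using \<epsilon>(1) unfolding z_def by simp
    from cInf_lessD[OF S this] obtain s where s: "s \<in> S" "s < z + \<epsilon>" by blast
    have "z \<le> s" unfolding z_def by (rule cInf_lower[OF s(1) bb])
    moreover have ns: "\<not> att p N 1 s" using s(1) unfolding S_def by simp
    ultimately have "z < s" using Pz by (cases "z = s") simp_all
    then have "att p N 1 (z + (s - z))" using \<epsilon>(2) s(2) by (intro \<epsilon>(2)[rule_format]) simp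
    then show False using ns by simp
  qed
  obtain L T where LT: "L > 0" "T \<in> TT p N L" "snd (snd T) = 1" "act p 0 T < ee" by (rule long_edge[OF N])
  define S where "S = {l. 0 < l \<and> att p N 1 l}"
  have "L \<in> S" unfolding S_def using att_below[OF N LT] LT(1) by simp
  then have S: "S \<noteq> {}" by blast
  have SL0: "L0 \<le> s" if "s \<in> S" for s using that L0(2) unfolding S_def by simp
  have bb: "bdd_below S" by (rule bdd_belowI[OF SL0])
  define C where "C = Inf S"
  have C: "0 < C" using cInf_greatest[OF S SL0] L0(1) unfolding C_def by linarith
  have "att p N 1 C"
  proof (rule att_closed[OF N C _ LIMSEQ_inverse_real_of_nat_add])
    fix n
    have i: "0 < inverse (real (Suc n))" by simp
    then show "0 < C + inverse (real (Suc n))" using C by (rule add_pos_pos[rotated])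
    have "Inf S < C + inverse (real (Suc n))" using i unfolding C_def by linarith
    from cInf_lessD[OF S this] obtain s where s: "s \<in> S" "s < C + inverse (real (Suc n))" by blast
    from s(1) have "0 < s" "att p N 1 s" unfolding S_def by blast+
    then show "att p N 1 (C + inverse (real (Suc n)))" by (rule up[OF _ _ less_imp_le[OF s(2)]])
  qed
  note PC = this
  have "att p N 1 l \<longleftrightarrow> C \<le> l" if l: "0 < l" for l
  proof
    assume "att p N 1 l"
    then have "l \<in> S" using l unfolding S_def by simp
    then show "C \<le> l" unfolding C_def by (rule cInf_lower[OF _ bb])
  qed (rule up[OF C PC])
  then show ?thesis using C by blast
qed

end

theorem theorem4p4:
  fixes p :: real and N :: nat
  assumes "2 < p" and "p < 6" and "N \<ge> 3"
  shows "\<exists>C>0. \<forall>\<mu>>0. \<forall>l>0.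
    (\<exists>w\<in>H1_mass N l \<mu>. \<forall>v\<in>H1_mass N l \<mu>. energy p N l w \<le> energy p N l v)
      \<longleftrightarrow> \<mu> powr ((p - 2) / (6 - p)) * l \<ge> C"
proof -
  interpret nls p by unfold_locales (fact assms)+
  from threshold[OF assms(3)] obtain C where C: "0 < C" "\<forall>l>0. att p N 1 l \<longleftrightarrow> C \<le> l" by (elim exE conjE) (rule that)
  show ?thesis
  proof (intro exI[of _ C] conjI allI impI C(1))
    fix \<mu> l :: real assume \<mu>: "0 < \<mu>" and l: "0 < l"
    have l0: "0 \<le> l" using l by simp
    have pos: "0 < \<mu> powr ((p - 2) / (6 - p)) * l" by (rule mult_pos_pos) (use \<mu> l in simp_all)
    have "(\<exists>w\<in>H1_mass N l \<mu>. \<forall>v\<in>H1_mass N l \<mu>. energy p N l w \<le> energy p N l v) \<longleftrightarrow> att p N \<mu> l"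
      by (rule attained_iff_att[OF l0])
    also have "\<dots> \<longleftrightarrow> att p N 1 (\<mu> powr ((p - 2) / (6 - p)) * l)"
      by (rule att_scale[OF assms(1,2) \<mu>])
    also have "\<dots> \<longleftrightarrow> C \<le> \<mu> powr ((p - 2) / (6 - p)) * l"
      by (rule C(2)[THEN spec, THEN mp, OF pos])
    finally show "(\<exists>w\<in>H1_mass N l \<mu>. \<forall>v\<in>H1_mass N l \<mu>. energy p N l w \<le> energy p N l v)
      \<longleftrightarrow> \<mu> powr ((p - 2) / (6 - p)) * l \<ge> C" .
  qed
qed

end
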